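(* Let $d\in\mathbb{N}$ and let $(T_i)_{i\in\mathbb{N}}\in GL_d(\mathbb{R})^{\mathbb{N}}$ be such that $\sup_{i\in\mathbb{N}}\|T_i\|<\tfrac12$ and the singular value function $\varphi^s$ is quasi-multiplicative for all $0\le s\le d$. Let $\Phi=(\phi_i)_{i\in\mathbb{N}}\colon\Sigma\to\mathbb{R}^{\mathbb{N}}$ have summable variations and let $\alpha=(\alpha_i)_{i\in\mathbb{N}}\in\overline{\mathbb{R}}^{\mathbb{N}}$. Then $$\dim_{\mathrm H}(J^{\mathbf a}_\Phi(\alpha))=\min\Bigl\{d,\lim_{n\to\infty}\lim_{k\to\infty}\sup\Bigl\{D_k(\mu):\mu\in\mathcal{M}^*_{\sigma^k}(\Sigma)\text{ with }\int A_k\phi_i\,d\mu\in B_n(\alpha_i)\text{ for all }i\in\{1,\ldots,n\}\Bigr\}\Bigr\}$$ for $\mathcal{L}_{\mathbf A}$-almost all $\mathbf a\in\mathbf A$.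
   Context: $\mathbb{N}=\{1,2,\ldots\}$; $\Sigma=\mathbb{N}^{\mathbb{N}}$ with the product topology of discrete $\mathbb{N}$; $\sigma$ is the left shift; $\Sigma_n=\mathbb{N}^n$, $\Sigma_*=\bigcup_{n\in\mathbb{N}}\Sigma_n$; $[\omega]=\{\omega\tau:\tau\in\Sigma\}$ for $\omega\in\Sigma_*$; $\omega|_n$ is the word of the first $n$ letters of $\omega$; juxtaposition denotes concatenation. $\overline{\mathbb{R}}=\mathbb{R}\cup\{-\infty,+\infty\}$. A potential $\varphi\colon\Sigma_*\to(0,\infty)$ is sub-multiplicative if $\varphi(\omega\tau)\le\varphi(\omega)\varphi(\tau)$ for all $\omega,\tau\in\Sigma_*$; a sub-multiplicative potential is quasi-multiplicative if there exist $c\ge1$ and a finite set $\Gamma\subset\Sigma_*$ such that for all $\omega,\tau\in\Sigma_*$ there is $\kappa\in\Gamma$ with $\varphi(\omega)\varphi(\tau)\le c\,\varphi(\omega\kappa\tau)$. For $T\in GL_d(\mathbb{R})$ let $\gamma_1(T)\ge\cdots\ge\gamma_d(T)>0$ be its singular values. For $0<s\le d$ write $s=m+\delta$ with $m\in\mathbb{Z}$, $0<\delta\le1$, and put $\varphi^s(T)=\gamma_1(T)\cdots\gamma_m(T)\gamma_{m+1}(T)^\delta$; put $\varphi^0(T)=1$ and $\varphi^s(T)=|\det T|^{s/d}$ for $s\ge d$. For $\omega=\omega_1\cdots\omega_n\in\Sigma_n$ let $T_\omega=T_{\omega_1}\cdots T_{\omega_n}$ and $\varphi^s(\omega)=\varphi^s(T_\omega)$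 (the singular value function). $\mathbf A=([0,1]^d)^{\mathbb{N}}$ carries the product probability measure $\mathcal{L}_{\mathbf A}=(\mathcal{L}^d|_{[0,1]^d})^{\mathbb{N}}$, $\mathcal{L}^d$ being Lebesgue measure. For $\mathbf a=(a_i)_{i\in\mathbb{N}}\in\mathbf A$, $\pi_{\mathbf a}\colon\Sigma\to\mathbb{R}^d$ is $\pi_{\mathbf a}(\omega)=\sum_{j=1}^\infty T_{\omega|_{j-1}}a_{\omega_j}$ (with $T_{\omega|_0}$ the identity). For $\phi\colon\Sigma\to\mathbb{R}$, $\mathrm{var}_n\phi=\sup\{|\phi(\omega)-\phi(\tau)|:\omega|_n=\tau|_n\}$; $\phi$ has summable variations if $\sum_{n=1}^\infty\mathrm{var}_n\phi<\infty$, and $\Phi=(\phi_i)_{i\in\mathbb{N}}$ has summable variations if each $\phi_i$ does. $A_n\Phi=\frac1n\sum_{j=0}^{n-1}\Phi\circ\sigma^j$, and similarly $A_n\phi$. With coordinatewise convergence, $E_\Phi(\alpha)=\{\omega\in\Sigma:\lim_{n\to\infty}A_n\Phi(\omega)=\alpha\}$ and $J^{\mathbf a}_\Phi(\alpha)=\pi_{\mathbf a}(E_\Phi(\alpha))$. $\mathcal{M}^*_{\sigma^k}(\Sigma)$ is the set of compactly supported $\sigma^k$-invariant Borel probability measures on $\Sigma$. For $\mu\in\mathcal{M}^*_{\sigma^k}(\Sigma)$, $D_k(\mu)$ is the unique $s\ge0$ with $\sum_{\omega\in\Sigma_k}\mu([\omega])\log\frac{\varphi^s(\omega)}{\mu([\omega])}=0$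 (terms with $\mu([\omega])=0$ are $0$). For $\alpha\in\overline{\mathbb{R}}$ and $n\in\mathbb{N}$: $B_n(\alpha)=(\alpha-\frac1n,\alpha+\frac1n)$ if $\alpha\in\mathbb{R}$, $B_n(-\infty)=(-\infty,-n)$, $B_n(\infty)=(n,\infty)$. Conventions: $\sup\emptyset=0$, $\dim_{\mathrm H}\emptyset=0$. *)

theory Defs
  imports "HOL-Probability.Probability"
begin

text \<open>
  Alphabet, potentials and coordinates are indexed from 0: the letters are the elements of
  the type \<^typ>\<open>nat\<close>, an infinite word is a function \<^typ>\<open>nat \<Rightarrow> nat\<close> carrying the product
  topology of the discrete topology, and finite words are non-empty lists.  The linear maps act
  on \<^typ>\<open>real ^ 'n\<close>, so that the dimension is \<^term>\<open>CARD('n)\<close>.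
\<close>

subsection \<open>Symbolic space\<close>

definition shift :: "(nat \<Rightarrow> nat) \<Rightarrow> nat \<Rightarrow> nat" where
  "shift \<omega> = (\<lambda>j. \<omega> (Suc j))"

definition prefix_word :: "(nat \<Rightarrow> nat) \<Rightarrow> nat \<Rightarrow> nat list" where
  "prefix_word \<omega> n = map \<omega> [0..<n]"

definition cylinder :: "nat list \<Rightarrow> (nat \<Rightarrow> nat) set" where
  "cylinder w = {\<omega>. prefix_word \<omega> (length w) = w}"

definition submultiplicative :: "(nat list \<Rightarrow> real) \<Rightarrow> bool" where
  "submultiplicative \<phi> \<longleftrightarrow>
     (\<forall>u. u \<noteq> [] \<longrightarrow> 0 < \<phi> u) \<and>
     (\<forall>u v. u \<noteq> [] \<longrightarrow> v \<noteq> [] \<longrightarrow> \<phi> (u @ v) \<le> \<phi> u * \<phi> v)"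

definition quasi_multiplicative :: "(nat list \<Rightarrow> real) \<Rightarrow> bool" where
  "quasi_multiplicative \<phi> \<longleftrightarrow>
     submultiplicative \<phi> \<and>
     (\<exists>c\<ge>1. \<exists>\<Gamma>. finite \<Gamma> \<and> [] \<notin> \<Gamma> \<and>
        (\<forall>u v. u \<noteq> [] \<longrightarrow> v \<noteq> [] \<longrightarrow> (\<exists>w\<in>\<Gamma>. \<phi> u * \<phi> v \<le> c * \<phi> (u @ w @ v))))"

subsection \<open>Singular value function\<close>

text \<open>
  The singular values are the non-negative square roots of the eigenvalues of the symmetric
  matrix \<open>T\<^sup>t T\<close>, counted with multiplicity and listed in non-increasing order.  The
  multiplicity of an eigenvalue of a symmetric matrix is the dimension of its eigenspace; by the
  spectral theorem these add up to the dimension of the space, which is then the length of the list.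
\<close>

definition singular_values :: "real ^ 'n ^ 'n \<Rightarrow> real list" where
  "singular_values T =
     (THE xs. sorted_wrt (\<ge>) xs \<and>
        (\<forall>\<gamma>. count_list xs \<gamma> =
           (if \<gamma> \<ge> 0 then dim {v. (transpose T ** T) *v v = \<gamma>\<^sup>2 *\<^sub>R v} else 0)))"

text \<open>For \<open>0 < s \<le> d\<close> the decomposition \<open>s = m + \<delta>\<close> has \<open>\<delta> \<in> (0, 1]\<close>, whence \<open>m = \<lceil>s\<rceil> - 1\<close>.\<close>

definition singular_value_function :: "real \<Rightarrow> real ^ 'n ^ 'n \<Rightarrow> real" where
  "singular_value_function s T =
     (if s \<le> 0 then 1
      else if s \<le> real CARD('n) then
        (let m = nat (\<lceil>s\<rceil> - 1)
         in (\<Prod>i<m. singular_values T ! i) * (singular_values T ! m) powr (s - real m))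
      else \<bar>det T\<bar> powr (s / real CARD('n)))"

definition word_matrix :: "(nat \<Rightarrow> real ^ 'n ^ 'n) \<Rightarrow> nat list \<Rightarrow> real ^ 'n ^ 'n" where
  "word_matrix T w = foldr (\<lambda>i M. T i ** M) w (mat 1)"

definition word_svf :: "(nat \<Rightarrow> real ^ 'n ^ 'n) \<Rightarrow> real \<Rightarrow> nat list \<Rightarrow> real" where
  "word_svf T s w = singular_value_function s (word_matrix T w)"

subsection \<open>Translations and projection\<close>

definition translation_measure :: "(nat \<Rightarrow> real ^ 'n) measure" where
  "translation_measure = (\<Pi>\<^sub>M i\<in>UNIV. restrict_space lborel (cbox 0 1))"

definition projection ::
  "(nat \<Rightarrow> real ^ 'n ^ 'n) \<Rightarrow> (nat \<Rightarrow> real ^ 'n) \<Rightarrow> (nat \<Rightarrow> nat) \<Rightarrow> real ^ 'n" where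
  "projection T a \<omega> = (\<Sum>j. word_matrix T (prefix_word \<omega> j) *v a (\<omega> j))"

subsection \<open>Birkhoff averages\<close>

definition variation :: "nat \<Rightarrow> ((nat \<Rightarrow> nat) \<Rightarrow> real) \<Rightarrow> ennreal" where
  "variation n \<phi> =
     (SUP (\<omega>, \<tau>) \<in> {(\<omega>, \<tau>). prefix_word \<omega> n = prefix_word \<tau> n}. ennreal \<bar>\<phi> \<omega> - \<phi> \<tau>\<bar>)"

definition summable_variations :: "((nat \<Rightarrow> nat) \<Rightarrow> real) \<Rightarrow> bool" where
  "summable_variations \<phi> \<longleftrightarrow> (\<Sum>n. variation (Suc n) \<phi>) < \<infinity>"

definition birkhoff_average :: "nat \<Rightarrow> ((nat \<Rightarrow> nat) \<Rightarrow> real) \<Rightarrow> (nat \<Rightarrow> nat) \<Rightarrow> real" where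
  "birkhoff_average n \<phi> \<omega> = (\<Sum>j<n. \<phi> ((shift ^^ j) \<omega>)) / real n"

definition level_set ::
  "(nat \<Rightarrow> (nat \<Rightarrow> nat) \<Rightarrow> real) \<Rightarrow> (nat \<Rightarrow> ereal) \<Rightarrow> (nat \<Rightarrow> nat) set" where
  "level_set \<Phi> \<alpha> =
     {\<omega>. \<forall>i. (\<lambda>n. ereal (birkhoff_average n (\<Phi> i) \<omega>)) \<longlonglongrightarrow> \<alpha> i}"

definition projected_level_set ::
  "(nat \<Rightarrow> real ^ 'n ^ 'n) \<Rightarrow> (nat \<Rightarrow> (nat \<Rightarrow> nat) \<Rightarrow> real) \<Rightarrow> (nat \<Rightarrow> ereal) \<Rightarrow>
     (nat \<Rightarrow> real ^ 'n) \<Rightarrow> (real ^ 'n) set" where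
  "projected_level_set T \<Phi> \<alpha> a = projection T a ` level_set \<Phi> \<alpha>"

subsection \<open>Invariant measures and dimension\<close>

text \<open>
  As the symbolic space is second countable, the support of a Borel probability measure is compact
  iff the measure vanishes off some compact set.
\<close>

definition compact_invariant_measures :: "nat \<Rightarrow> (nat \<Rightarrow> nat) measure set" where
  "compact_invariant_measures k =
     {\<mu>. prob_space \<mu> \<and> sets \<mu> = sets borel \<and> distr \<mu> \<mu> (shift ^^ k) = \<mu> \<and>
          (\<exists>K. compact K \<and> emeasure \<mu> (- K) = 0)}"

text \<open>Summands with \<open>\<mu>[w] = 0\<close> vanish, whatever the value of the logarithm.\<close>

definition symbolic_dimension ::
  "(nat \<Rightarrow> real ^ 'n ^ 'n) \<Rightarrow> nat \<Rightarrow> (nat \<Rightarrow> nat) measure \<Rightarrow> real" where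
  "symbolic_dimension T k \<mu> =
     (THE s. 0 \<le> s \<and>
        (\<Sum>\<^sub>\<infinity>w\<in>{w. length w = k}.
           measure \<mu> (cylinder w) * ln (word_svf T s w / measure \<mu> (cylinder w))) = 0)"

definition target_nhd :: "nat \<Rightarrow> ereal \<Rightarrow> real set" where
  "target_nhd n \<beta> =
     (case \<beta> of ereal r \<Rightarrow> {r - 1 / real n <..< r + 1 / real n}
              | PInfty \<Rightarrow> {real n <..}
              | MInfty \<Rightarrow> {..< - real n})"

text \<open>
  The supremum is taken in \<^typ>\<open>ennreal\<close>: it may be infinite, and over the empty set it is 0.
\<close>

definition dimension_sup ::
  "(nat \<Rightarrow> real ^ 'n ^ 'n) \<Rightarrow> (nat \<Rightarrow> (nat \<Rightarrow> nat) \<Rightarrow> real) \<Rightarrow> (nat \<Rightarrow> ereal) \<Rightarrow>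
     nat \<Rightarrow> nat \<Rightarrow> ennreal" where
  "dimension_sup T \<Phi> \<alpha> n k =
     (SUP \<mu> \<in> {\<mu> \<in> compact_invariant_measures k.
                 \<forall>i<n. (\<integral>\<omega>. birkhoff_average k (\<Phi> i) \<omega> \<partial>\<mu>) \<in> target_nhd n (\<alpha> i)}.
        ennreal (symbolic_dimension T k \<mu>))"

subsection \<open>Hausdorff dimension\<close>

text \<open>
  The value at \<open>s = 0\<close> is set separately because \<^term>\<open>0 powr 0 = (0::real)\<close>; so the
  0-dimensional measure counts points.
\<close>

definition hausdorff_gauge :: "real \<Rightarrow> 'a::metric_space set \<Rightarrow> ennreal" where
  "hausdorff_gauge s U =
     (if U = {} then 0 else if s = 0 then 1 else ennreal (diameter U powr s))"

text \<open>Boundedness is required since \<^const>\<open>diameter\<close> is unspecified on unbounded sets.\<close>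

definition hausdorff_premeasure :: "real \<Rightarrow> real \<Rightarrow> 'a::metric_space set \<Rightarrow> ennreal" where
  "hausdorff_premeasure s \<delta> A =
     (INF U \<in> {U :: nat \<Rightarrow> 'a set. A \<subseteq> (\<Union>n. U n) \<and> (\<forall>n. bounded (U n) \<and> diameter (U n) \<le> \<delta>)}.
        \<Sum>n. hausdorff_gauge s (U n))"

definition hausdorff_measure :: "real \<Rightarrow> 'a::metric_space set \<Rightarrow> ennreal" where
  "hausdorff_measure s A = (SUP \<delta> \<in> {0<..}. hausdorff_premeasure s \<delta> A)"

definition hausdorff_dim :: "'a::metric_space set \<Rightarrow> ennreal" where
  "hausdorff_dim A = (INF s \<in> {s. 0 \<le> s \<and> hausdorff_measure s A = 0}. ennreal s)"

end

theory Submission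
  imports Defs
begin

text \<open>Let \<open>L\<^sub>n\<close> be the upper limit of \<open>dimension_sup\<close> at level \<open>n\<close> as \<open>k \<rightarrow> \<infinity>\<close>. Everything rests on a passage
  between measures and finite sets of words. If \<open>W\<close> is a finite set of words of equal length \<open>q\<close> whose
  cylinders have Birkhoff averages in the neighbourhoods of level \<open>n\<close> and over which \<open>\<phi>\<^sup>s\<close> has a sum of at
  least 1, then the Bernoulli measure of the Gibbs vector \<open>\<phi>\<^sup>s / Z\<close> on \<open>W\<close> is an admissible \<open>\<sigma>\<^sup>q\<close>-invariant
  measure of dimension at least \<open>s\<close> (\<open>gibbs_measure_feasible\<close>). Conversely, if admissible measures of
  dimension at least \<open>s' > s\<close> exist for infinitely many \<open>k\<close>, then in every large length \<open>q\<close> there are such sets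
  \<open>W\<close>, with sums as large as one likes (\<open>growing_words\<close>): the typical sequences of a marginal are glued
  together by the connecting words of quasi-multiplicativity. The price per block is independent of the block
  length \<open>k\<close>, whereas the pressure at \<open>s\<close> is at least \<open>k (s' - s) ln 2\<close>. Together, the two directions show
  that the upper limit over \<open>k\<close> is a limit; as \<open>L\<^sub>n\<close> decreases in \<open>n\<close>, it converges to its infimum \<open>L\<close>.

  Upper bound, for every choice of the translations in the cube. Let \<open>L\<^sub>n < s < t\<close>. A point of the level set
  has, in every large length \<open>q\<close>, a prefix whose averages are close to the targets. The sum of \<open>\<phi>\<^sup>s\<close> over these
  prefixes is less than 1, since otherwise their Gibbs vector would witness that the dimension at level \<open>n\<close> is
  at least \<open>s\<close>. The projection of the cylinder of \<open>v\<close> lies in an ellipsoid with the singular values of \<open>T\<^sub>v\<close>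
  as semi-axes up to a constant, and is covered by sets whose diameters to the power \<open>t\<close> add up to a multiple
  of \<open>\<phi>\<^sup>t(v)\<close>, which is exponentially smaller than \<open>\<phi>\<^sup>s(v)\<close> (\<open>cylinder_cover\<close>,
  \<open>hausdorff_dim_projection_le_above_limit\<close>).

  Lower bound, for almost all translations. Let \<open>t < s1 < s < L\<close> with \<open>s1\<close> at most the dimension of the space.
  Random blocks, drawn from the Gibbs vectors on sets of words of slowly increasing level, are glued to an
  infinite word. This word lies in the level set (\<open>glued_level_set\<close>), and its distribution gives the cylinder
  of \<open>w\<close> at most the mass \<open>K r\<^sup>m \<phi>\<^sup>s\<^sup>1(w)\<close> with \<open>m\<close> the length of \<open>w\<close> and \<open>r < 1\<close> (\<open>frostman_measure\<close>). If
  \<open>\<omega>\<close> and \<open>\<tau>\<close> have exactly the prefix \<open>w\<close> in common, then the expectation of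
  \<open>|\<pi>\<^sub>a \<omega> - \<pi>\<^sub>a \<tau>|\<^sup>-\<^sup>t\<close> over the translations is of order \<open>1 / \<phi>\<^sup>s\<^sup>1(w)\<close> (\<open>transversality\<close>; this
  is where the bound \<open>1/2\<close> on the norms is needed). The product of the two is summable over \<open>m\<close>, so the
  projected measure has finite \<open>t\<close>-energy for almost all translations (\<open>frostman_energy_finite\<close>), which bounds
  the Hausdorff dimension from below (\<open>hausdorff_dim_ge_of_energy\<close>).\<close>

section \<open>Singular values\<close>

text \<open>A maximiser \<open>v\<close> of \<open>y \<bullet> f y\<close> on the unit sphere of \<open>S\<close> is an eigenvector: since the value cannot grow
  to first order when \<open>v\<close> is moved in a direction orthogonal to it, \<open>f v\<close> is orthogonal to all these
  directions.\<close>
lemma symmetric_operator_has_eigenvector: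
  fixes f :: "'a::euclidean_space \<Rightarrow> 'a"
  assumes f: "linear f" and sym: "\<And>x y. f x \<bullet> y = x \<bullet> f y"
    and S: "subspace S" "f ` S \<subseteq> S" "S \<noteq> {0}"
  shows "\<exists>v\<in>S. norm v = 1 \<and> (\<exists>l. f v = l *\<^sub>R v)"
proof -
  let ?K = "S \<inter> sphere 0 1"
  obtain w where w: "w \<in> S" "w \<noteq> 0" using S subspace_0 by blast
  have "w /\<^sub>R norm w \<in> ?K" using w S(1) by (simp add: subspace_scale)
  hence ne: "?K \<noteq> {}" by blast
  have comp: "compact ?K" using closed_subspace[OF S(1)] by (simp add: closed_Int_compact)
  have "continuous_on ?K (\<lambda>x. x \<bullet> f x)"
    by (intro continuous_intros linear_continuous_on linear_conv_bounded_linear[THEN iffD1] f)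
  then obtain v where v: "v \<in> ?K" and max: "\<And>y. y \<in> ?K \<Longrightarrow> y \<bullet> f y \<le> v \<bullet> f v"
    using continuous_attains_sup[OF comp ne] by blast
  define l where "l = v \<bullet> f v"
  have vS: "v \<in> S" and vn: "norm v = 1" using v by auto
  have vv: "v \<bullet> v = 1" using vn by (simp add: dot_square_norm)
  have quad: "y \<bullet> f y \<le> l * (y \<bullet> y)" if "y \<in> S" for y
  proof (cases "y = 0")
    case False
    let ?u = "y /\<^sub>R norm y"
    have "?u \<in> ?K" using False that S(1) by (simp add: subspace_scale)
    from max[OF this] have "?u \<bullet> f ?u \<le> l" by (simp add: l_def)
    hence "(y \<bullet> f y) / (norm y)\<^sup>2 \<le> l"
      by (simp add: linear_scale[OF f] power2_eq_square field_simps)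
    thus ?thesis using False by (simp add: field_simps dot_square_norm)
  qed (simp add: linear_0[OF f])
  have orth: "f v \<bullet> w = 0" if "w \<in> S" "w \<bullet> v = 0" for w
  proof -
    let ?c = "f v \<bullet> w" and ?k = "l * (w \<bullet> w) - w \<bullet> f w"
    have q: "2 * t * ?c \<le> t\<^sup>2 * ?k" for t :: real
    proof -
      have "v + t *\<^sub>R w \<in> S" using vS that S(1) by (simp add: subspace_add subspace_scale)
      from quad[OF this] have
        "(v + t *\<^sub>R w) \<bullet> f (v + t *\<^sub>R w) \<le> l * ((v + t *\<^sub>R w) \<bullet> (v + t *\<^sub>R w))" .
      moreover have "(v + t *\<^sub>R w) \<bullet> f (v + t *\<^sub>R w) = l + 2 * t * ?c + t\<^sup>2 * (w \<bullet> f w)"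
        using sym[of v w] by (simp add: linear_add[OF f] linear_scale[OF f] inner_simps l_def
            power2_eq_square inner_commute algebra_simps)
      moreover have "(v + t *\<^sub>R w) \<bullet> (v + t *\<^sub>R w) = 1 + t\<^sup>2 * (w \<bullet> w)"
        using that vv by (simp add: inner_simps inner_commute power2_eq_square)
      ultimately have "l + 2 * t * ?c + t\<^sup>2 * (w \<bullet> f w) \<le> l * (1 + t\<^sup>2 * (w \<bullet> w))" by metis
      thus ?thesis by (simp add: algebra_simps)
    qed
    show ?thesis
    proof (rule ccontr)
      assume c: "?c \<noteq> 0"
      define M where "M = \<bar>?k\<bar> + 1"
      have M: "M > 0" "?k \<le> M" by (auto simp: M_def)
      \<comment> \<open>A step so small that its first order term beats the second order one.\<close>
      have "2 * (?c / M) * ?c \<le> (?c / M)\<^sup>2 * ?k" by (rule q)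
      also have "\<dots> \<le> (?c / M)\<^sup>2 * M" using M by (intro mult_left_mono) auto
      also have "\<dots> = ?c\<^sup>2 / M" using M by (simp add: power2_eq_square)
      finally have "?c\<^sup>2 / M \<le> 0" by (simp add: power2_eq_square)
      thus False using M c by (simp add: divide_le_0_iff)
    qed
  qed
  define w where "w = f v - l *\<^sub>R v"
  have wS: "w \<in> S" using vS S by (auto simp: w_def intro!: subspace_diff subspace_scale)
  have wv: "w \<bullet> v = 0" by (simp add: w_def inner_simps vv l_def inner_commute)
  have "(f v - l *\<^sub>R v) \<bullet> w = f v \<bullet> w - l * (v \<bullet> w)"
    by (simp only: inner_diff_left inner_scaleR_left)
  hence "w \<bullet> w = f v \<bullet> w - l * (v \<bullet> w)" by (simp only: w_def[symmetric])
  hence "w \<bullet> w = 0" using orth[OF wS wv] wv by (simp add: inner_commute)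
  thus ?thesis using vS vn by (auto simp: w_def)
qed

text \<open>Split off one eigenvector at a time: the part of \<open>S\<close> orthogonal to an eigenvector is again invariant,
  by symmetry.\<close>
lemma symmetric_operator_eigenbasis:
  fixes f :: "'a::euclidean_space \<Rightarrow> 'a"
  assumes f: "linear f" and sym: "\<And>x y. f x \<bullet> y = x \<bullet> f y"
  shows "subspace S \<Longrightarrow> f ` S \<subseteq> S \<Longrightarrow> dim S = n \<Longrightarrow>
    \<exists>B. finite B \<and> card B = n \<and> B \<subseteq> S \<and> pairwise orthogonal B \<and>
      (\<forall>b\<in>B. norm b = 1 \<and> (\<exists>l. f b = l *\<^sub>R b))"
proof (induction n arbitrary: S)
  case 0
  show ?case by (rule exI[of _ "{}"]) auto
next
  case (Suc n)
  have "S \<noteq> {0}" using Suc.prems(3) by auto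
  then obtain v l where v: "v \<in> S" "norm v = 1" "f v = l *\<^sub>R v"
    using symmetric_operator_has_eigenvector[OF f sym Suc.prems(1,2)] by blast
  let ?S = "{y \<in> S. orthogonal v y}"
  have sub: "subspace ?S"
    using Suc.prems(1) by (auto simp: subspace_def orthogonal_def inner_simps)
  have inv: "f ` ?S \<subseteq> ?S"
  proof
    fix z assume "z \<in> f ` ?S"
    then obtain y where y: "z = f y" "y \<in> S" "v \<bullet> y = 0" by (auto simp: orthogonal_def)
    have "v \<bullet> f y = f v \<bullet> y" by (simp add: sym)
    thus "z \<in> ?S" using y v Suc.prems(2) by (auto simp: orthogonal_def)
  qed
  have "{y \<in> S. \<forall>x\<in>span {v}. orthogonal x y} = ?S"
    by (auto simp: span_singleton orthogonal_def)
  moreover have "span {v} \<subseteq> S" using v Suc.prems(1) by (simp add: span_minimal)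
  ultimately have "dim ?S + dim (span {v}) = dim S"
    using dim_subspace_orthogonal_to_vectors[OF subspace_span Suc.prems(1)] by metis
  moreover have "dim {v} = 1" using v(2) by (metis dim_singleton norm_zero zero_neq_one)
  ultimately have "dim ?S = n" using Suc.prems(3) by simp
  from Suc.IH[OF sub inv this] obtain B where B: "finite B" "card B = n" "B \<subseteq> ?S"
    "pairwise orthogonal B" "\<forall>b\<in>B. norm b = 1 \<and> (\<exists>l. f b = l *\<^sub>R b)" by blast
  have "v \<notin> B" using B(3) v(2) by (auto simp: orthogonal_def dot_square_norm)
  thus ?case using B v
    by (intro exI[of _ "insert v B"]) (auto simp: pairwise_insert orthogonal_commute)
qed

text \<open>Both lists arise by sorting the same multiset.\<close>
lemma decreasing_list_unique:
  fixes xs ys :: "real list"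
  assumes "sorted_wrt (\<ge>) xs" "sorted_wrt (\<ge>) ys" "\<And>a. count_list xs a = count_list ys a"
  shows "xs = ys"
proof -
  have "mset xs = mset ys" using assms(3) by (intro multiset_eqI) (simp add: count_mset)
  hence "mset (rev xs) = mset (rev ys)" by simp
  moreover have "sorted (rev xs)" "sorted (rev ys)" using assms(1,2) by (simp_all add: sorted_wrt_rev)
  ultimately have "rev xs = rev ys" by (metis properties_for_sort sorted_sort_id)
  thus ?thesis by simp
qed

text \<open>The right singular vectors \<open>v\<close> in the order of the singular values \<open>g\<close>. Values at indices from
  \<open>CARD('n)\<close> on carry no information.\<close>
definition singular_system :: "real ^ 'n ^ 'n \<Rightarrow> (nat \<Rightarrow> real) \<Rightarrow> (nat \<Rightarrow> real ^ 'n) \<Rightarrow> bool" where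
  "singular_system T g v \<longleftrightarrow>
     (\<forall>i<CARD('n). 0 \<le> g i \<and> (transpose T ** T) *v v i = (g i)\<^sup>2 *\<^sub>R v i) \<and>
     (\<forall>i<CARD('n). \<forall>j<CARD('n). v i \<bullet> v j = (if i = j then 1 else 0)) \<and>
     (\<forall>i j. i \<le> j \<longrightarrow> j < CARD('n) \<longrightarrow> g j \<le> g i)"

lemma orthonormal_expansion:
  fixes v :: "nat \<Rightarrow> real ^ 'n"
  assumes on: "\<And>i j. i < CARD('n) \<Longrightarrow> j < CARD('n) \<Longrightarrow> v i \<bullet> v j = (if i = j then 1 else 0)"
  shows "x = (\<Sum>i<CARD('n). (x \<bullet> v i) *\<^sub>R v i)"
proof -
  have inj: "inj_on v {..<CARD('n)}"
    by (rule inj_onI) (metis lessThan_iff on zero_neq_one)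
  let ?B = "v ` {..<CARD('n)}"
  have card: "card ?B = CARD('n)" using inj by (simp add: card_image)
  have "pairwise orthogonal ?B"
    using on by (auto simp: pairwise_def orthogonal_def)
  moreover have "0 \<notin> ?B" using on by fastforce
  ultimately have "independent ?B" by (simp add: pairwise_orthogonal_independent)
  hence "dim ?B = DIM(real ^ 'n)" using card by (simp add: dim_eq_card_independent)
  hence "span ?B = UNIV" by (simp only: dim_eq_full)
  moreover have "orthogonal (x - (\<Sum>i<CARD('n). (x \<bullet> v i) *\<^sub>R v i)) y" if y: "y \<in> ?B" for y
  proof -
    obtain j where j: "j < CARD('n)" "y = v j" using y by auto
    have "(\<Sum>i<CARD('n). (x \<bullet> v i) *\<^sub>R v i) \<bullet> v j = (\<Sum>i<CARD('n). (x \<bullet> v i) * (v i \<bullet> v j))"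
      by (simp add: inner_sum_left)
    also have "\<dots> = (\<Sum>i<CARD('n). if i = j then x \<bullet> v i else 0)"
      using j by (intro sum.cong refl) (simp add: on)
    also have "\<dots> = x \<bullet> v j" using j by simp
    finally show ?thesis by (simp add: j orthogonal_def inner_simps)
  qed
  ultimately have "orthogonal (x - (\<Sum>i<CARD('n). (x \<bullet> v i) *\<^sub>R v i)) (x - (\<Sum>i<CARD('n). (x \<bullet> v i) *\<^sub>R v i))"
    using orthogonal_to_span[of "x - (\<Sum>i<CARD('n). (x \<bullet> v i) *\<^sub>R v i)" ?B
        "x - (\<Sum>i<CARD('n). (x \<bullet> v i) *\<^sub>R v i)"] by simp
  thus ?thesis by (simp add: orthogonal_self)
qed

lemma orthonormal_inner:
  fixes v :: "nat \<Rightarrow> real ^ 'n"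
  assumes on: "\<And>i j. i < CARD('n) \<Longrightarrow> j < CARD('n) \<Longrightarrow> v i \<bullet> v j = (if i = j then 1 else 0)"
  shows "x \<bullet> y = (\<Sum>i<CARD('n). (x \<bullet> v i) * (y \<bullet> v i))"
proof -
  have "x \<bullet> y = (\<Sum>i<CARD('n). (x \<bullet> v i) *\<^sub>R v i) \<bullet> y"
    using orthonormal_expansion[of v x, OF on] by simp
  also have "\<dots> = (\<Sum>i<CARD('n). (x \<bullet> v i) * (y \<bullet> v i))"
    by (simp only: inner_sum_left inner_scaleR_left inner_commute[of "v _" y])
  finally show ?thesis .
qed

lemma inner_gram: "((transpose T ** T) *v x) \<bullet> y = (T *v x) \<bullet> (T *v (y :: real ^ 'n))"
proof -
  have "((transpose T ** T) *v x) \<bullet> y = y \<bullet> (transpose T *v (T *v x))"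
    by (simp add: matrix_vector_mul_assoc inner_commute)
  also have "\<dots> = (y v* transpose T) \<bullet> (T *v x)" by (simp only: dot_lmul_matrix)
  also have "y v* transpose T = T *v y" by (simp only: vector_transpose_matrix)
  finally show ?thesis by (simp add: inner_commute)
qed

text \<open>An orthonormal eigenbasis of \<open>T\<^sup>t T\<close>, sorted by the norms \<open>|T v|\<close>, exhibits the list that the definition
  of the singular values describes: eigenvectors to different eigenvalues being orthogonal, the eigenspace
  of \<open>c\<^sup>2\<close> is spanned by those basis vectors with \<open>|T v| = c\<close>.\<close>
lemma singular_values_system:
  fixes T :: "real ^ 'n ^ 'n"
  shows "\<exists>v. length (singular_values T) = CARD('n) \<and> singular_system T (\<lambda>i. singular_values T ! i) v"
proof -
  let ?f = "\<lambda>x. (transpose T ** T) *v x"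
  have lin: "linear ?f" by simp
  have sym: "?f x \<bullet> y = x \<bullet> ?f y" for x y by (metis inner_commute inner_gram)
  obtain B where B: "finite B" "card B = CARD('n)" "pairwise orthogonal B"
      "\<And>b. b \<in> B \<Longrightarrow> norm b = 1" "\<And>b. b \<in> B \<Longrightarrow> \<exists>l. ?f b = l *\<^sub>R b"
    using symmetric_operator_eigenbasis[OF lin sym subspace_UNIV, of "CARD('n)"] by auto
  define g where "g b = norm (T *v b)" for b
  have eig: "?f b = (g b)\<^sup>2 *\<^sub>R b" if b: "b \<in> B" for b
  proof -
    obtain l where l: "?f b = l *\<^sub>R b" using B(5)[OF b] by blast
    have "?f b \<bullet> b = (g b)\<^sup>2" by (simp add: inner_gram g_def dot_square_norm)
    moreover have "?f b \<bullet> b = l" using B(4)[OF b] by (simp add: l dot_square_norm)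
    ultimately show ?thesis using l by simp
  qed
  obtain bs0 where bs0: "set bs0 = B" "distinct bs0" using finite_distinct_list[OF B(1)] by blast
  define bs where "bs = sort_key (\<lambda>b. - g b) bs0"
  have bs: "set bs = B" "distinct bs" by (auto simp: bs_def bs0)
  have len: "length bs = CARD('n)" using bs B(2) distinct_card by fastforce
  have "sorted (map (\<lambda>b. - g b) bs)" by (simp add: bs_def)
  hence srt: "sorted_wrt (\<ge>) (map g bs)" by (simp add: sorted_wrt_map)
  define v where "v i = bs ! i" for i
  have on: "v i \<bullet> v j = (if i = j then 1 else 0)" if "i < CARD('n)" "j < CARD('n)" for i j
  proof (cases "i = j")
    case True
    have "v j \<in> B" using that bs len by (auto simp: v_def)
    thus ?thesis using True B(4)[of "v j"] by (simp add: dot_square_norm)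
  next
    case False
    hence "v i \<noteq> v j" "v i \<in> B" "v j \<in> B" using that bs len by (auto simp: v_def nth_eq_iff_index_eq)
    thus ?thesis using B(3) False by (auto simp: pairwise_def orthogonal_def)
  qed
  have cnt: "count_list (map g bs) c = (if c \<ge> 0 then dim {x. ?f x = c\<^sup>2 *\<^sub>R x} else 0)" for c
  proof -
    let ?Bc = "{b \<in> B. g b = c}"
    have cl: "count_list (map g bs) c = card ?Bc"
    proof -
      have "count_list (map g bs) c = length (filter (\<lambda>b. g b = c) bs)" by (induction bs) auto
      also have "\<dots> = card (set (filter (\<lambda>b. g b = c) bs))"
        using bs(2) by (intro distinct_card[symmetric]) simp
      finally show ?thesis using bs(1) by simp
    qed
    show ?thesis
    proof (cases "c \<ge> 0")
      case True
      have "{x. ?f x = c\<^sup>2 *\<^sub>R x} = span ?Bc"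
      proof
        show "span ?Bc \<subseteq> {x. ?f x = c\<^sup>2 *\<^sub>R x}"
        proof (rule span_minimal)
          show "?Bc \<subseteq> {x. ?f x = c\<^sup>2 *\<^sub>R x}" using eig by auto
          show "subspace {x. ?f x = c\<^sup>2 *\<^sub>R x}"
            by (auto simp: subspace_def matrix_vector_right_distrib scaleR_right_distrib matrix_vector_mult_scaleR)
        qed
        show "{x. ?f x = c\<^sup>2 *\<^sub>R x} \<subseteq> span ?Bc"
        proof
          fix x assume "x \<in> {x. ?f x = c\<^sup>2 *\<^sub>R x}"
          hence x: "?f x = c\<^sup>2 *\<^sub>R x" by simp
          have "(x \<bullet> v i) *\<^sub>R v i \<in> span ?Bc" if i: "i < CARD('n)" for i
          proof (cases "x \<bullet> v i = 0")
            case False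
            have vB: "v i \<in> B" using i bs len by (auto simp: v_def)
            have "c\<^sup>2 * (x \<bullet> v i) = ?f x \<bullet> v i" by (simp add: x)
            also have "\<dots> = x \<bullet> ?f (v i)" by (rule sym)
            also have "\<dots> = (g (v i))\<^sup>2 * (x \<bullet> v i)" by (simp add: eig[OF vB])
            finally have "(g (v i))\<^sup>2 = c\<^sup>2" using False by simp
            hence "g (v i) = c" using True by (simp add: g_def)
            thus ?thesis using vB by (intro span_scale span_base) simp
          qed (simp add: span_zero)
          hence "(\<Sum>i<CARD('n). (x \<bullet> v i) *\<^sub>R v i) \<in> span ?Bc" by (intro span_sum) simp
          thus "x \<in> span ?Bc" using orthonormal_expansion[of v x, OF on] by simp
        qed
      qed
      moreover have "independent ?Bc"
        using B(3) B(4)[of 0] by (intro pairwise_orthogonal_independent) (auto simp: pairwise_def)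
      ultimately show ?thesis using True cl by (simp add: dim_eq_card_independent)
    next
      case False
      hence "?Bc = {}" by (auto simp: g_def)
      hence "card ?Bc = 0" by (simp only: card.empty)
      thus ?thesis using False cl by simp
    qed
  qed
  have sv: "singular_values T = map g bs"
    unfolding singular_values_def
  proof (rule the_equality)
    show "sorted_wrt (\<ge>) (map g bs) \<and> (\<forall>\<gamma>. count_list (map g bs) \<gamma> =
           (if \<gamma> \<ge> 0 then dim {v. (transpose T ** T) *v v = \<gamma>\<^sup>2 *\<^sub>R v} else 0))"
      using srt cnt by simp
  qed (use srt cnt decreasing_list_unique in auto)
  have "singular_system T (\<lambda>i. singular_values T ! i) v"
    unfolding singular_system_def sv
  proof (intro conjI allI impI)
    fix i assume i: "i < CARD('n)"
    hence vi: "map g bs ! i = g (v i)" "v i \<in> B" using len bs by (auto simp: v_def)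
    show "0 \<le> map g bs ! i" using vi by (simp add: g_def)
    show "(transpose T ** T) *v v i = (map g bs ! i)\<^sup>2 *\<^sub>R v i" using eig vi by simp
  next
    fix i j assume "i \<le> j" "j < CARD('n)"
    thus "map g bs ! j \<le> map g bs ! i"
      using srt len sorted_wrt_nth_less[of "(\<ge>)" "map g bs" i j] by (cases "i = j") auto
  qed (use on in auto)
  thus ?thesis using sv len by auto
qed

lemma singular_systemD:
  assumes "singular_system (T :: real ^ 'n ^ 'n) g v"
  shows "i < CARD('n) \<Longrightarrow> 0 \<le> g i"
    and "i < CARD('n) \<Longrightarrow> (transpose T ** T) *v v i = (g i)\<^sup>2 *\<^sub>R v i"
    and "i < CARD('n) \<Longrightarrow> j < CARD('n) \<Longrightarrow> v i \<bullet> v j = (if i = j then 1 else 0)"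
    and "i \<le> j \<Longrightarrow> j < CARD('n) \<Longrightarrow> g j \<le> g i"
  using assms by (auto simp: singular_system_def)

lemma singular_system_norm_sq:
  assumes S: "singular_system (T :: real ^ 'n ^ 'n) g v"
  shows "(norm (T *v x))\<^sup>2 = (\<Sum>i<CARD('n). (g i)\<^sup>2 * (x \<bullet> v i)\<^sup>2)"
proof -
  have "(norm (T *v x))\<^sup>2 = ((transpose T ** T) *v x) \<bullet> x"
    by (simp add: inner_gram dot_square_norm)
  also have "\<dots> = (\<Sum>i<CARD('n). (((transpose T ** T) *v x) \<bullet> v i) * (x \<bullet> v i))"
    by (rule orthonormal_inner) (rule singular_systemD(3)[OF S])
  also have "\<dots> = (\<Sum>i<CARD('n). (g i)\<^sup>2 * (x \<bullet> v i)\<^sup>2)"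
  proof (rule sum.cong[OF refl])
    fix i assume i: "i \<in> {..<CARD('n)}"
    have "((transpose T ** T) *v x) \<bullet> v i = ((transpose T ** T) *v v i) \<bullet> x"
      unfolding inner_gram by (rule inner_commute)
    also have "\<dots> = (g i)\<^sup>2 * (x \<bullet> v i)"
      using singular_systemD(2)[OF S, of i] i by (simp add: inner_commute)
    finally show "((transpose T ** T) *v x) \<bullet> v i * (x \<bullet> v i) = (g i)\<^sup>2 * (x \<bullet> v i)\<^sup>2"
      by (simp add: power2_eq_square)
  qed
  finally show ?thesis .
qed

lemma singular_system_norm_vector:
  assumes S: "singular_system (T :: real ^ 'n ^ 'n) g v" and i: "i < CARD('n)"
  shows "norm (v i) = 1" "norm (T *v v i) = g i"
proof -
  have "v i \<bullet> v i = 1" using singular_systemD(3)[OF S i i] by simp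
  thus "norm (v i) = 1" by (simp add: norm_eq_sqrt_inner)
  have "(norm (T *v v i))\<^sup>2 = (\<Sum>j<CARD('n). if j = i then (g i)\<^sup>2 else 0)"
    unfolding singular_system_norm_sq[OF S]
    using i by (intro sum.cong) (auto simp: singular_systemD(3)[OF S])
  hence "(norm (T *v v i))\<^sup>2 = (g i)\<^sup>2" using i by simp
  thus "norm (T *v v i) = g i" using singular_systemD(1)[OF S i] by simp
qed

lemma singular_system_pos:
  assumes S: "singular_system (T :: real ^ 'n ^ 'n) g v" and i: "i < CARD('n)" and T: "invertible T"
  shows "0 < g i"
proof -
  have "v i \<noteq> 0" using singular_system_norm_vector(1)[OF S i] by auto
  hence "T *v v i \<noteq> 0" using T by (metis inj_matrix_vector_mult injD matrix_vector_mult_0_right)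
  thus ?thesis using singular_system_norm_vector(2)[OF S i] by (metis zero_less_norm_iff)
qed

lemma singular_system_component_le:
  assumes S: "singular_system (T :: real ^ 'n ^ 'n) g v" and i: "i < CARD('n)"
  shows "g i * \<bar>x \<bullet> v i\<bar> \<le> norm (T *v x)"
proof -
  have "(g i * \<bar>x \<bullet> v i\<bar>)\<^sup>2 \<le> (norm (T *v x))\<^sup>2"
    unfolding singular_system_norm_sq[OF S] power_mult_distrib power2_abs
    using i by (intro member_le_sum[of i "{..<CARD('n)}" "\<lambda>i. (g i)\<^sup>2 * (x \<bullet> v i)\<^sup>2"]) auto
  thus ?thesis by (rule power2_le_imp_le) simp
qed

text \<open>In the basis \<open>v\<close> the matrix \<open>T\<^sup>t T\<close> is diagonal with entries \<open>g\<^sub>i\<^sup>2\<close>, and \<open>(det V)\<^sup>2 = 1\<close> for the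
  matrix \<open>V\<close> of the basis.\<close>
lemma singular_system_abs_det:
  assumes S: "singular_system (T :: real ^ 'n ^ 'n) g v"
  shows "\<bar>det T\<bar> = (\<Prod>i<CARD('n). g i)"
proof -
  obtain h :: "'n \<Rightarrow> nat" where h: "bij_betw h UNIV {0..<CARD('n)}"
    using ex_bij_betw_finite_nat[of "UNIV :: 'n set"] by auto
  have hl: "h i < CARD('n)" for i using h by (auto simp: bij_betw_def)
  have hi: "h i = h j \<longleftrightarrow> i = j" for i j using h by (auto simp: bij_betw_def inj_eq)
  let ?G = "transpose T ** T"
  define V :: "real ^ 'n ^ 'n" where "V = (\<chi> i j. v (h j) $ i)"
  have ent: "(transpose V ** M ** V) $ i $ j = v (h i) \<bullet> (M *v v (h j))" for M i j
  proof -
    have "(transpose V ** M ** V) $ i $ j = (transpose V ** (M ** V)) $ i $ j"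
      by (simp add: matrix_mul_assoc)
    also have "\<dots> = (\<Sum>k\<in>UNIV. v (h i) $ k * (\<Sum>l\<in>UNIV. M $ k $ l * v (h j) $ l))"
      by (simp add: matrix_matrix_mult_def transpose_def V_def)
    also have "\<dots> = v (h i) \<bullet> (M *v v (h j))"
      by (simp add: inner_vec_def matrix_vector_mult_def)
    finally show ?thesis .
  qed
  have "transpose V ** mat 1 ** V = mat 1"
    using ent[of "mat 1"] by (simp add: vec_eq_iff) (simp add: singular_systemD(3)[OF S] hl hi mat_def)
  hence VV: "det V * det V = 1" by (metis det_I det_mul det_transpose matrix_mul_rid)
  have D: "(transpose V ** ?G ** V) $ i $ j = (if i = j then (g (h i))\<^sup>2 else 0)" for i j
    unfolding ent using singular_systemD(2,3)[OF S] hl hi by auto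
  have "det (transpose V ** ?G ** V) = (\<Prod>i\<in>UNIV. (transpose V ** ?G ** V) $ i $ i)"
    by (rule det_diagonal) (simp add: D)
  also have "\<dots> = (\<Prod>i\<in>UNIV. g (h i))\<^sup>2" by (simp add: D prod_power_distrib)
  also have "(\<Prod>i\<in>UNIV. g (h i)) = (\<Prod>i<CARD('n). g i)"
    using prod.reindex_bij_betw[OF h, of g] by (simp add: atLeast0LessThan)
  finally have "det (transpose V ** ?G ** V) = (\<Prod>i<CARD('n). g i)\<^sup>2" .
  moreover have "det (transpose V ** ?G ** V) = (det T)\<^sup>2"
    using VV by (simp add: det_mul det_transpose power2_eq_square)
  ultimately have "(det T)\<^sup>2 = (\<Prod>i<CARD('n). g i)\<^sup>2" by simp
  moreover have "0 \<le> (\<Prod>i<CARD('n). g i)" by (intro prod_nonneg) (auto intro: singular_systemD(1)[OF S])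
  ultimately show ?thesis by (metis abs_of_nonneg power2_eq_iff abs_minus_cancel)
qed

lemma singular_system_dim_span:
  assumes S: "singular_system (T :: real ^ 'n ^ 'n) g v" and I: "I \<subseteq> {..<CARD('n)}"
  shows "dim (span (v ` I)) = card I"
    and "x \<in> span (v ` I) \<Longrightarrow> j < CARD('n) \<Longrightarrow> j \<notin> I \<Longrightarrow> x \<bullet> v j = 0"
proof -
  have inj: "inj_on v {..<CARD('n)}"
    by (rule inj_onI) (metis lessThan_iff singular_systemD(3)[OF S] zero_neq_one)
  have "pairwise orthogonal (v ` I)"
    using I by (auto simp: pairwise_def orthogonal_def) (metis lessThan_iff subsetD singular_systemD(3)[OF S])
  moreover have "0 \<notin> v ` I"
  proof
    assume "0 \<in> v ` I"
    then obtain i where "i \<in> I" "v i = 0" by auto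
    thus False using singular_system_norm_vector(1)[OF S, of i] I by auto
  qed
  ultimately have "independent (v ` I)" by (simp add: pairwise_orthogonal_independent)
  thus "dim (span (v ` I)) = card I"
    using inj I by (simp add: dim_eq_card_independent card_image inj_on_subset)
  assume x: "x \<in> span (v ` I)" and j: "j < CARD('n)" "j \<notin> I"
  have "orthogonal (v j) y" if "y \<in> v ` I" for y
    using that j I singular_systemD(3)[OF S, of j] by (auto simp: orthogonal_def)
  from orthogonal_to_span[OF x, of "v j"] this show "x \<bullet> v j = 0"
    by (auto simp: orthogonal_def inner_commute)
qed

text \<open>This is the Courant-Fischer argument: the first \<open>i + 1\<close> singular directions of \<open>A\<close> and the
  image under \<open>B\<close> of the last \<open>d - i\<close> singular directions of \<open>AB\<close> have a common non-zero vector.\<close>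
lemma singular_value_mult_ge:
  fixes A B :: "real ^ 'n ^ 'n"
  assumes S: "singular_system A g v" and S': "singular_system (A ** B) g' v'"
    and b: "0 < b" "\<And>x. b * norm x \<le> norm (B *v x)" and i: "i < CARD('n)"
  shows "g i * b \<le> g' i"
proof -
  let ?U = "span (v ` {..i})" and ?W = "span (v' ` {i..<CARD('n)})"
  have inj: "inj ((*v) B)"
  proof (rule injI)
    fix x y assume "B *v x = B *v y"
    hence "B *v (x - y) = 0" by (simp add: matrix_vector_mult_diff_distrib)
    hence "b * norm (x - y) \<le> 0" using b(2)[of "x - y"] by simp
    thus "x = y" using b(1) by (simp add: mult_le_0_iff)
  qed
  let ?W' = "(*v) B ` ?W"
  have sI: "{..i} \<subseteq> {..<CARD('n)}" "{i..<CARD('n)} \<subseteq> {..<CARD('n)}" using i by auto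
  from singular_system_dim_span(1)[OF S sI(1)] singular_system_dim_span(1)[OF S' sI(2)]
  have dU: "dim ?U = Suc i" and dW: "dim ?W = CARD('n) - i" by simp_all
  have dW': "dim ?W' = CARD('n) - i" using dim_image_eq[of "(*v) B" ?W] inj dW
    by (simp add: inj_on_subset)
  have sub: "subspace ?U" "subspace ?W'" by (auto intro: linear_subspace_image)
  have "dim {x + y |x y. x \<in> ?U \<and> y \<in> ?W'} \<le> CARD('n)"
    using dim_subset_UNIV[of "{x + y |x y. x \<in> ?U \<and> y \<in> ?W'}"] by simp
  hence "dim (?U \<inter> ?W') > 0" using dim_sums_Int[OF sub] dU dW' i by linarith
  hence "\<not> ?U \<inter> ?W' \<subseteq> {0}" by (metis dim_eq_0 less_irrefl)
  then obtain y where y: "y \<in> ?U" "y \<in> ?W'" "y \<noteq> 0" by blast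
  then obtain x where x: "x \<in> ?W" "y = B *v x" by auto
  have "(g i)\<^sup>2 * (norm y)\<^sup>2 = (\<Sum>j<CARD('n). (g i)\<^sup>2 * (y \<bullet> v j)\<^sup>2)"
    using orthonormal_inner[of v y y] singular_systemD(3)[OF S]
    by (simp add: dot_square_norm sum_distrib_left power2_eq_square)
  also have "\<dots> \<le> (\<Sum>j<CARD('n). (g j)\<^sup>2 * (y \<bullet> v j)\<^sup>2)"
  proof (rule sum_mono)
    fix j assume j: "j \<in> {..<CARD('n)}"
    show "(g i)\<^sup>2 * (y \<bullet> v j)\<^sup>2 \<le> (g j)\<^sup>2 * (y \<bullet> v j)\<^sup>2"
    proof (cases "j \<le> i")
      case True
      thus ?thesis using singular_systemD(1,4)[OF S] i by (intro mult_right_mono power_mono) auto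
    next
      case False
      thus ?thesis using singular_system_dim_span(2)[OF S sI(1) y(1), of j] i j by auto
    qed
  qed
  also have "\<dots> = (norm (A *v y))\<^sup>2" by (simp add: singular_system_norm_sq[OF S])
  finally have "(g i * norm y)\<^sup>2 \<le> (norm (A *v y))\<^sup>2" by (simp only: power_mult_distrib)
  hence 1: "g i * norm y \<le> norm (A *v y)" by (rule power2_le_imp_le) simp
  have "(norm ((A ** B) *v x))\<^sup>2 = (\<Sum>j<CARD('n). (g' j)\<^sup>2 * (x \<bullet> v' j)\<^sup>2)"
    by (simp add: singular_system_norm_sq[OF S'])
  also have "\<dots> \<le> (\<Sum>j<CARD('n). (g' i)\<^sup>2 * (x \<bullet> v' j)\<^sup>2)"
  proof (rule sum_mono)
    fix j assume j: "j \<in> {..<CARD('n)}"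
    show "(g' j)\<^sup>2 * (x \<bullet> v' j)\<^sup>2 \<le> (g' i)\<^sup>2 * (x \<bullet> v' j)\<^sup>2"
    proof (cases "i \<le> j")
      case True
      thus ?thesis using singular_systemD(1,4)[OF S'] j by (intro mult_right_mono power_mono) auto
    next
      case False
      thus ?thesis using singular_system_dim_span(2)[OF S' sI(2) x(1), of j] i j by auto
    qed
  qed
  also have "\<dots> = (g' i)\<^sup>2 * (norm x)\<^sup>2"
    using orthonormal_inner[of v' x x] singular_systemD(3)[OF S']
    by (simp add: dot_square_norm sum_distrib_left power2_eq_square)
  finally have "(norm ((A ** B) *v x))\<^sup>2 \<le> (g' i * norm x)\<^sup>2" by (simp only: power_mult_distrib)
  hence 2: "norm ((A ** B) *v x) \<le> g' i * norm x"
    by (rule power2_le_imp_le) (simp add: singular_systemD(1)[OF S' i])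
  have "g i * (b * norm x) \<le> g i * norm y"
    using b(2)[of x] x(2) singular_systemD(1)[OF S i] by (intro mult_left_mono) auto
  also have "\<dots> \<le> g' i * norm x" using 1 2 x(2) by (simp add: matrix_vector_mul_assoc)
  finally have "(g i * b) * norm x \<le> g' i * norm x" by (simp add: mult.assoc)
  moreover have "x \<noteq> 0" using x y by auto
  ultimately show ?thesis by simp
qed

section \<open>The singular value function\<close>

text \<open>The singular value function is the product of the \<open>\<gamma>\<^sub>i\<close> to these powers. The exponents are
  non-negative, non-decreasing in \<open>s\<close> and add up to \<open>s\<close>, for small and for large \<open>s\<close> alike, so that
  the two cases of the definition need not be told apart any more.\<close>
definition sv_exponent :: "nat \<Rightarrow> real \<Rightarrow> nat \<Rightarrow> real" where
  "sv_exponent d s i = (if s \<le> real d then min 1 (max 0 (s - real i)) else s / real d)"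

lemma sv_exponent_nonneg: "0 \<le> s \<Longrightarrow> 0 \<le> sv_exponent d s i"
  by (auto simp: sv_exponent_def)

lemma sv_exponent_le_1: "s \<le> real d \<Longrightarrow> sv_exponent d s i \<le> 1"
  by (auto simp: sv_exponent_def)

lemma sv_exponent_mono: "i < d \<Longrightarrow> s \<le> t \<Longrightarrow> sv_exponent d s i \<le> sv_exponent d t i"
proof -
  assume i: "i < d" and st: "s \<le> t"
  show ?thesis
  proof (cases "s \<le> real d \<and> real d < t")
    case True
    hence "sv_exponent d s i \<le> 1" "1 \<le> t / real d" using i by (auto simp: sv_exponent_def)
    thus ?thesis using True by (simp add: sv_exponent_def)
  qed (use st in \<open>auto simp: sv_exponent_def divide_right_mono\<close>)
qed

lemma prod_split_at:
  fixes f :: "nat \<Rightarrow> 'a::comm_monoid_mult"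
  assumes "m < d" "\<And>i. m < i \<Longrightarrow> i < d \<Longrightarrow> f i = 1"
  shows "(\<Prod>i<d. f i) = (\<Prod>i<m. f i) * f m"
proof -
  have "(\<Prod>i<d. f i) = (\<Prod>i<Suc m. f i)"
    using assms by (intro prod.mono_neutral_right) auto
  thus ?thesis by simp
qed

lemma sum_split_at:
  fixes f :: "nat \<Rightarrow> 'a::comm_monoid_add"
  assumes "m < d" "\<And>i. m < i \<Longrightarrow> i < d \<Longrightarrow> f i = 0"
  shows "(\<Sum>i<d. f i) = (\<Sum>i<m. f i) + f m"
proof -
  have "(\<Sum>i<d. f i) = (\<Sum>i<Suc m. f i)"
    using assms by (intro sum.mono_neutral_right) auto
  thus ?thesis by simp
qed

lemma sv_exponent_cases:
  assumes "0 < s" "s \<le> real d" and m: "m = nat (\<lceil>s\<rceil> - 1)"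
  shows "m < d" "i < m \<Longrightarrow> sv_exponent d s i = 1" "sv_exponent d s m = s - real m"
    "m < i \<Longrightarrow> sv_exponent d s i = 0" "real m < s" "s \<le> real m + 1"
proof -
  have c: "real m = of_int \<lceil>s\<rceil> - 1" using assms by (simp add: m)
  have 1: "real m < s" "s \<le> real m + 1" unfolding c by linarith+
  show "real m < s" "s \<le> real m + 1" by fact+
  have "real m < real d" using 1 assms by linarith
  thus "m < d" by simp
  show "sv_exponent d s i = 1" if "i < m"
  proof -
    have "real i + 1 \<le> real m" using that by linarith
    thus ?thesis using 1 assms(2) by (simp add: sv_exponent_def)
  qed
  show "sv_exponent d s m = s - real m" using 1 assms by (simp add: sv_exponent_def)
  show "sv_exponent d s i = 0" if "m < i"
  proof -
    have "real m + 1 \<le> real i" using that by linarith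
    thus ?thesis using 1 assms(2) by (simp add: sv_exponent_def)
  qed
qed

lemma sum_sv_exponent:
  assumes "0 \<le> s" "0 < d"
  shows "(\<Sum>i<d. sv_exponent d s i) = s"
proof -
  consider "s = 0" | "0 < s" "s \<le> real d" | "s > real d" using assms by linarith
  thus ?thesis
  proof cases
    case 1
    thus ?thesis by (simp add: sv_exponent_def)
  next
    case 2
    define m where "m = nat (\<lceil>s\<rceil> - 1)"
    note e = sv_exponent_cases[OF 2 m_def]
    have "(\<Sum>i<d. sv_exponent d s i) = (\<Sum>i<m. sv_exponent d s i) + sv_exponent d s m"
      using e by (intro sum_split_at) auto
    also have "(\<Sum>i<m. sv_exponent d s i) = (\<Sum>i<m. 1)" by (intro sum.cong) (auto simp: e)
    finally show ?thesis by (simp add: e)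
  next
    case 3
    thus ?thesis using assms by (simp add: sv_exponent_def)
  qed
qed

lemma singular_value_function_eq:
  fixes T :: "real ^ 'n ^ 'n"
  assumes S: "singular_system T (\<lambda>i. singular_values T ! i) v" and T: "invertible T" and s: "0 \<le> s"
  shows "singular_value_function s T = (\<Prod>i<CARD('n). (singular_values T ! i) powr sv_exponent CARD('n) s i)"
proof -
  let ?g = "\<lambda>i. singular_values T ! i" and ?d = "CARD('n)"
  have pos: "0 < ?g i" if "i < ?d" for i by (rule singular_system_pos[OF S that T])
  have nz: "?g i \<noteq> 0" if "i < ?d" for i using pos[OF that] by simp
  consider "s = 0" | "0 < s" "s \<le> real ?d" | "s > real ?d" using s by linarith
  thus ?thesis
  proof cases
    case 1
    have "?g i powr sv_exponent ?d s i = 1" if "i < ?d" for i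
      using pos[OF that] by (simp add: 1 sv_exponent_def)
    thus ?thesis by (simp add: 1 singular_value_function_def)
  next
    case 2
    define m where "m = nat (\<lceil>s\<rceil> - 1)"
    note e = sv_exponent_cases[OF 2 m_def]
    have "(\<Prod>i<?d. ?g i powr sv_exponent ?d s i) = (\<Prod>i<m. ?g i powr sv_exponent ?d s i) * ?g m powr (s - real m)"
      using e(1) by (subst prod_split_at[of m]) (auto simp: e nz)
    also have "(\<Prod>i<m. ?g i powr sv_exponent ?d s i) = (\<Prod>i<m. ?g i)"
    proof (rule prod.cong[OF refl])
      fix i assume "i \<in> {..<m}"
      hence "i < m" "0 < ?g i" using e(1) pos by auto
      thus "?g i powr sv_exponent ?d s i = ?g i" by (simp add: e(2))
    qed
    finally show ?thesis using 2 by (simp add: singular_value_function_def m_def Let_def)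
  next
    case 3
    have "singular_value_function s T = (\<Prod>i<?d. ?g i) powr (s / ?d)"
      using 3 by (simp add: singular_value_function_def singular_system_abs_det[OF S])
    also have "\<dots> = (\<Prod>i<?d. ?g i powr (s / ?d))"
      by (rule prod_powr_distrib)
    finally show ?thesis using 3 by (simp add: sv_exponent_def)
  qed
qed

lemma singular_value_function_pos:
  fixes T :: "real ^ 'n ^ 'n"
  assumes T: "invertible T" and s: "0 \<le> s"
  shows "0 < singular_value_function s T"
proof -
  obtain v where S: "singular_system T (\<lambda>i. singular_values T ! i) v"
    using singular_values_system by blast
  show ?thesis unfolding singular_value_function_eq[OF S T s]
    using singular_system_pos[OF S _ T] by (intro prod_pos) (simp add: less_imp_neq[THEN not_sym])
qed

text \<open>Raising \<open>s\<close> by \<open>h\<close> distributes additional exponents of total weight \<open>h\<close> over the singular values,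
  which lie between \<open>b\<close> and \<open>r\<close>.\<close>
lemma singular_value_function_add_bounds:
  fixes T :: "real ^ 'n ^ 'n"
  assumes T: "invertible T" and s: "0 \<le> s" "0 \<le> h"
  shows "0 < r \<Longrightarrow> (\<And>x. norm (T *v x) \<le> r * norm x) \<Longrightarrow>
           singular_value_function (s + h) T \<le> singular_value_function s T * r powr h"
    and "0 < b \<Longrightarrow> (\<And>x. b * norm x \<le> norm (T *v x)) \<Longrightarrow>
           singular_value_function s T * b powr h \<le> singular_value_function (s + h) T"
proof -
  obtain v where S: "singular_system T (\<lambda>i. singular_values T ! i) v"
    using singular_values_system by blast
  let ?d = "CARD('n)" and ?g = "\<lambda>i. singular_values T ! i"
  define D where "D i = sv_exponent ?d (s + h) i - sv_exponent ?d s i" for i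
  have pos: "0 < ?g i" if "i < ?d" for i by (rule singular_system_pos[OF S that T])
  have D: "0 \<le> D i" if "i < ?d" for i using sv_exponent_mono[OF that, of s "s + h"] s by (simp add: D_def)
  have sD: "(\<Sum>i<?d. D i) = h" using s by (simp add: D_def sum_subtractf sum_sv_exponent)
  have eq: "singular_value_function (s + h) T = singular_value_function s T * (\<Prod>i<?d. ?g i powr D i)"
    using s by (simp add: singular_value_function_eq[OF S T] D_def prod.distrib[symmetric] powr_add[symmetric])
  have P: "0 < singular_value_function s T" by (rule singular_value_function_pos[OF T s(1)])
  { assume r: "0 < r" "\<And>x. norm (T *v x) \<le> r * norm x"
    have "?g i \<le> r" if "i < ?d" for i
      using r(2)[of "v i"] singular_system_norm_vector[OF S that] by simp
    hence "(\<Prod>i<?d. ?g i powr D i) \<le> (\<Prod>i<?d. r powr D i)"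
      using D pos by (intro prod_mono) (auto intro!: powr_mono2 simp: less_imp_le)
    also have "\<dots> = r powr h" using r(1) by (simp add: powr_sum[symmetric] sD)
    finally show "singular_value_function (s + h) T \<le> singular_value_function s T * r powr h"
      unfolding eq using P by (intro mult_left_mono) auto }
  { assume b: "0 < b" "\<And>x. b * norm x \<le> norm (T *v x)"
    have g: "b \<le> ?g i" if "i < ?d" for i
      using b(2)[of "v i"] singular_system_norm_vector[OF S that] by simp
    have "b powr h = (\<Prod>i<?d. b powr D i)" using b(1) by (simp add: powr_sum[symmetric] sD)
    also have "\<dots> \<le> (\<Prod>i<?d. ?g i powr D i)"
      using D g b(1) by (intro prod_mono) (auto intro!: powr_mono2)
    finally show "singular_value_function s T * b powr h \<le> singular_value_function (s + h) T"
      unfolding eq using P by (intro mult_left_mono) auto }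
qed

text \<open>Every single singular value decreases at most by the factor \<open>b\<close>, and the exponents add up to \<open>s\<close>.\<close>
lemma singular_value_function_mult_ge:
  fixes A B :: "real ^ 'n ^ 'n"
  assumes A: "invertible A" and B: "invertible B" and s: "0 \<le> s"
    and b: "0 < b" "\<And>x. b * norm x \<le> norm (B *v x)"
  shows "singular_value_function s A * b powr s \<le> singular_value_function s (A ** B)"
proof -
  obtain v where S: "singular_system A (\<lambda>i. singular_values A ! i) v"
    using singular_values_system by blast
  obtain v' where S': "singular_system (A ** B) (\<lambda>i. singular_values (A ** B) ! i) v'"
    using singular_values_system by blast
  let ?d = "CARD('n)" and ?g = "\<lambda>i. singular_values A ! i" and ?e = "sv_exponent CARD('n) s"
  have AB: "invertible (A ** B)" using A B by (rule invertible_mult)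
  have "b powr s = (\<Prod>i<?d. b powr ?e i)" using b(1) s by (simp add: powr_sum[symmetric] sum_sv_exponent)
  hence "singular_value_function s A * b powr s = (\<Prod>i<?d. (?g i * b) powr ?e i)"
    using singular_systemD(1)[OF S] b(1)
    by (simp add: singular_value_function_eq[OF S A s] prod.distrib[symmetric] powr_mult)
  also have "\<dots> \<le> (\<Prod>i<?d. (singular_values (A ** B) ! i) powr ?e i)"
    using singular_value_mult_ge[OF S S' b] singular_systemD(1)[OF S] b(1) sv_exponent_nonneg[OF s]
    by (intro prod_mono) (auto intro!: powr_mono2)
  finally show ?thesis by (simp add: singular_value_function_eq[OF S' AB s])
qed

section \<open>Coverings and volumes by grid cells\<close>

text \<open>The index of the cell of \<open>x\<close>. Lists of integers form a countable type, which serves to index covers.\<close>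
definition grid_cell :: "(nat \<Rightarrow> real ^ 'n) \<Rightarrow> (nat \<Rightarrow> real) \<Rightarrow> real ^ 'n \<Rightarrow> int list" where
  "grid_cell v h x = map (\<lambda>i. \<lfloor>(x \<bullet> v i) / h i\<rfloor>) [0..<CARD('n)]"

lemma grid_cell_close:
  assumes "grid_cell v h x = grid_cell v h y" "i < CARD('n)" "0 < h i"
  shows "\<bar>(x - y) \<bullet> (v i :: real ^ 'n)\<bar> \<le> h i"
proof -
  have "grid_cell v h x ! i = grid_cell v h y ! i" using assms(1) by simp
  hence "\<lfloor>(x \<bullet> v i) / h i\<rfloor> = \<lfloor>(y \<bullet> v i) / h i\<rfloor>" using assms(2) by (simp add: grid_cell_def)
  hence "\<bar>(x \<bullet> v i) / h i - (y \<bullet> v i) / h i\<bar> \<le> 1" by linarith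
  hence "\<bar>((x - y) \<bullet> v i) / h i\<bar> \<le> 1" by (simp add: inner_diff_left diff_divide_distrib)
  thus ?thesis using assms(3) by (simp add: abs_divide)
qed

text \<open>The coordinates \<open>\<lfloor>(x \<bullet> v\<^sub>i) / h\<^sub>i\<rfloor>\<close> range independently over intervals of integers.\<close>
lemma grid_cell_count:
  fixes v :: "nat \<Rightarrow> real ^ 'n"
  assumes h: "\<And>i. i < CARD('n) \<Longrightarrow> 0 < h i" and q: "\<And>i. i < CARD('n) \<Longrightarrow> 0 \<le> q i"
    and X: "\<And>x i. x \<in> X \<Longrightarrow> i < CARD('n) \<Longrightarrow> \<bar>x \<bullet> v i\<bar> \<le> q i"
  shows "finite (grid_cell v h ` X)"
    and "real (card (grid_cell v h ` X)) \<le> (\<Prod>i<CARD('n). 2 * q i / h i + 2)"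
proof -
  define I where "I i = {\<lfloor>- (q i / h i)\<rfloor>..\<lfloor>q i / h i\<rfloor>}" for i
  let ?P = "PiE {..<CARD('n)} I"
  have fin: "finite ?P" by (intro finite_PiE) (auto simp: I_def)
  have sub: "grid_cell v h ` X \<subseteq> (\<lambda>f. map f [0..<CARD('n)]) ` ?P"
  proof
    fix z assume "z \<in> grid_cell v h ` X"
    then obtain x where x: "x \<in> X" "z = grid_cell v h x" by auto
    let ?f = "restrict (\<lambda>i. \<lfloor>(x \<bullet> v i) / h i\<rfloor>) {..<CARD('n)}"
    have "\<lfloor>(x \<bullet> v i) / h i\<rfloor> \<in> I i" if "i < CARD('n)" for i
    proof -
      have "\<bar>(x \<bullet> v i) / h i\<bar> \<le> q i / h i"
        using X[OF x(1) that] h[OF that] by (simp add: abs_divide divide_right_mono)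
      thus ?thesis unfolding I_def atLeastAtMost_iff by (intro conjI floor_mono) linarith+
    qed
    hence "?f \<in> ?P" by auto
    moreover have "z = map ?f [0..<CARD('n)]" by (auto simp: x grid_cell_def)
    ultimately show "z \<in> (\<lambda>f. map f [0..<CARD('n)]) ` ?P" by blast
  qed
  show "finite (grid_cell v h ` X)" using sub fin by (meson finite_imageI finite_subset)
  have "card (grid_cell v h ` X) \<le> card ?P"
    using sub fin by (meson card_image_le card_mono finite_imageI le_trans)
  also have "card ?P = (\<Prod>i<CARD('n). card (I i))" by (simp add: card_PiE)
  finally have "real (card (grid_cell v h ` X)) \<le> (\<Prod>i<CARD('n). real (card (I i)))"
    by (metis of_nat_mono of_nat_prod)
  also have "\<dots> \<le> (\<Prod>i<CARD('n). 2 * q i / h i + 2)"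
  proof (rule prod_mono, intro conjI)
    fix i assume "i \<in> {..<CARD('n)}"
    hence "0 \<le> q i / h i" using h[of i] q[of i] by (simp add: less_imp_le)
    thus "real (card (I i)) \<le> 2 * q i / h i + 2" unfolding I_def card_atLeastAtMost_int by linarith
  qed simp
  finally show "real (card (grid_cell v h ` X)) \<le> (\<Prod>i<CARD('n). 2 * q i / h i + 2)" .
qed

text \<open>The image under \<open>T\<close> of a ball is covered by \<open>\<Prod>i. \<gamma>\<^sub>i / r\<close> sets of diameter \<open>r\<close>, up to a
  constant and with the factors that are less than one replaced by one; for \<open>r = \<gamma>\<^sub>m\<close> with
  \<open>m < s \<le> m + 1\<close> this number is \<open>\<phi>\<^sup>s(T) r\<^sup>-\<^sup>s\<close>.\<close>
lemma singular_value_function_cover: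
  fixes T :: "real ^ 'n ^ 'n"
  assumes T: "invertible T" and s: "0 < s" "s \<le> real CARD('n)" and R: "0 \<le> R"
    and M: "\<And>x. norm (T *v x) \<le> M * norm x"
  shows "\<exists>(c :: real ^ 'n \<Rightarrow> int list) r. 0 < r \<and> r \<le> M \<and> finite (c ` cball 0 R) \<and>
    (\<forall>x y. c x = c y \<longrightarrow> norm (T *v x - T *v y) \<le> sqrt (real CARD('n)) * r) \<and>
    real (card (c ` cball 0 R)) * r powr s \<le> (2 * R + 2) ^ CARD('n) * singular_value_function s T"
proof -
  obtain v where S: "singular_system T (\<lambda>i. singular_values T ! i) v"
    using singular_values_system by blast
  let ?d = "CARD('n)" and ?g = "\<lambda>i. singular_values T ! i"
  define m where "m = nat (\<lceil>s\<rceil> - 1)"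
  note e = sv_exponent_cases[OF s m_def]
  have pos: "0 < ?g i" if "i < ?d" for i by (rule singular_system_pos[OF S that T])
  define r where "r = ?g m"
  have r: "0 < r" using pos e(1) by (simp add: r_def)
  have rM: "r \<le> M" using M[of "v m"] singular_system_norm_vector[OF S e(1)] by (simp add: r_def)
  \<comment> \<open>Cells of width \<open>r / \<gamma>\<^sub>i\<close> in direction \<open>v\<^sub>i\<close> become cubes of width \<open>r\<close> under \<open>T\<close>.\<close>
  define h where "h i = r / ?g i" for i
  have h: "0 < h i" if "i < ?d" for i using pos[OF that] r by (simp add: h_def)
  define c where "c = grid_cell v h"
  have X: "\<bar>x \<bullet> v i\<bar> \<le> R" if "x \<in> cball 0 R" "i < ?d" for x i
    using Cauchy_Schwarz_ineq2[of x "v i"] singular_system_norm_vector(1)[OF S that(2)] that by simp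
  note cnt = grid_cell_count[of h "\<lambda>i. R" "cball 0 R" v, OF h R X, simplified]
  have close: "norm (T *v x - T *v y) \<le> sqrt (real ?d) * r" if "c x = c y" for x y
  proof -
    have "(norm (T *v (x - y)))\<^sup>2 = (\<Sum>i<?d. (?g i)\<^sup>2 * ((x - y) \<bullet> v i)\<^sup>2)"
      by (rule singular_system_norm_sq[OF S])
    also have "\<dots> \<le> (\<Sum>i<?d. r\<^sup>2)"
    proof (rule sum_mono)
      fix i assume i: "i \<in> {..<?d}"
      have "?g i * \<bar>(x - y) \<bullet> v i\<bar> \<le> ?g i * h i"
        using grid_cell_close[of v h x y i] that h[of i] pos[of i] i by (intro mult_left_mono) (auto simp: c_def)
      also have "?g i * h i = r" using pos[of i] i by (simp add: h_def less_imp_neq[THEN not_sym])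
      finally have "(?g i * \<bar>(x - y) \<bullet> v i\<bar>)\<^sup>2 \<le> r\<^sup>2"
        using pos[of i] i by (intro power_mono) auto
      thus "(?g i)\<^sup>2 * ((x - y) \<bullet> v i)\<^sup>2 \<le> r\<^sup>2" by (simp add: power_mult_distrib)
    qed
    also have "\<dots> = (sqrt (real ?d) * r)\<^sup>2" by (simp add: power_mult_distrib)
    finally have "norm (T *v (x - y)) \<le> sqrt (real ?d) * r"
      by (rule power2_le_imp_le) (use r in auto)
    thus ?thesis by (simp add: matrix_vector_mult_diff_distrib)
  qed
  have "real (card (c ` cball 0 R)) \<le> (\<Prod>i<?d. 2 * R / h i + 2)" using cnt(2) by (simp add: c_def)
  also have "\<dots> \<le> (\<Prod>i<?d. (2 * R + 2) * (if i < m then ?g i / r else 1))"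
  proof (rule prod_mono, intro conjI)
    fix i assume i: "i \<in> {..<?d}"
    show "0 \<le> 2 * R / h i + 2" using h[of i] i R by (simp add: less_imp_le)
    show "2 * R / h i + 2 \<le> (2 * R + 2) * (if i < m then ?g i / r else 1)"
    proof (cases "i < m")
      case True
      have "r \<le> ?g i" using singular_systemD(4)[OF S, of i m] True e(1) by (simp add: r_def)
      hence "1 \<le> ?g i / r" using r by simp
      moreover have "2 * R / h i = 2 * R * (?g i / r)" by (simp add: h_def)
      moreover have "(2 * R + 2) * (?g i / r) = 2 * R * (?g i / r) + 2 * (?g i / r)"
        by (simp only: distrib_right)
      ultimately show ?thesis using True by simp
    next
      case False
      have "?g i \<le> r" using singular_systemD(4)[OF S, of m i] False i by (simp add: r_def)
      hence "?g i / r \<le> 1" using r by simp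
      hence "2 * R * (?g i / r) \<le> 2 * R * 1" using R by (intro mult_left_mono) auto
      thus ?thesis using False by (simp add: h_def)
    qed
  qed
  also have "\<dots> = (2 * R + 2) ^ ?d * (\<Prod>i<?d. if i < m then ?g i / r else 1)"
    by (simp add: prod.distrib)
  also have "(\<Prod>i<?d. if i < m then ?g i / r else 1) = (\<Prod>i<m. ?g i / r)"
    using e(1) by (subst prod_split_at[of m]) auto
  also have "\<dots> = (\<Prod>i<m. ?g i) / r ^ m" by (simp add: prod_dividef)
  finally have "real (card (c ` cball 0 R)) * r powr s \<le> (2 * R + 2) ^ ?d * ((\<Prod>i<m. ?g i) / r ^ m) * r powr s"
    by (intro mult_right_mono) auto
  also have "\<dots> = (2 * R + 2) ^ ?d * ((\<Prod>i<m. ?g i) * (r powr s / r powr m))"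
    using r by (simp add: powr_realpow)
  also have "(\<Prod>i<m. ?g i) * (r powr s / r powr m) = singular_value_function s T"
    using s by (simp add: singular_value_function_def m_def[symmetric] Let_def r_def powr_diff)
  finally show ?thesis using r rM cnt(1) close by (auto simp: c_def)
qed

lemma bounded_set_cover:
  assumes R: "0 \<le> R" and r: "0 < r" "r \<le> 1"
  shows "\<exists>c :: real ^ 'n \<Rightarrow> int list. finite (c ` cball 0 R) \<and>
    (\<forall>x y. c x = c y \<longrightarrow> norm (x - y) \<le> sqrt (real CARD('n)) * r) \<and>
    real (card (c ` cball 0 R)) \<le> ((2 * R + 2) / r) ^ CARD('n)"
proof -
  let ?d = "CARD('n)"
  obtain v where S: "singular_system (mat 1 :: real ^ 'n ^ 'n) (\<lambda>i. singular_values (mat 1 :: real ^ 'n ^ 'n) ! i) v"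
    using singular_values_system by blast
  define c where "c = grid_cell v (\<lambda>i. r)"
  have X: "\<bar>x \<bullet> v i\<bar> \<le> R" if "x \<in> cball 0 R" "i < ?d" for x i
    using Cauchy_Schwarz_ineq2[of x "v i"] singular_system_norm_vector(1)[OF S that(2)] that by simp
  note cnt = grid_cell_count[of "\<lambda>i. r" "\<lambda>i. R" "cball 0 R" v, OF r(1) R X, simplified]
  have "2 \<le> 2 / r" using r by (simp add: field_simps)
  hence "(2 * R / r + 2) ^ ?d \<le> ((2 * R + 2) / r) ^ ?d"
    using r R by (intro power_mono) (auto simp: add_divide_distrib)
  hence "real (card (c ` cball 0 R)) \<le> ((2 * R + 2) / r) ^ ?d" using cnt(2) by (simp add: c_def)
  moreover have "norm (x - y) \<le> sqrt (real ?d) * r" if "c x = c y" for x y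
  proof -
    have "(norm (x - y))\<^sup>2 = (\<Sum>i<?d. ((x - y) \<bullet> v i)\<^sup>2)"
      using orthonormal_inner[of v "x - y" "x - y"] singular_systemD(3)[OF S]
      by (simp add: dot_square_norm power2_eq_square)
    also have "\<dots> \<le> (\<Sum>i<?d. r\<^sup>2)"
      using grid_cell_close[of v "\<lambda>i. r" x y] that r by (intro sum_mono) (simp add: c_def abs_le_square_iff[symmetric])
    also have "\<dots> = (sqrt (real ?d) * r)\<^sup>2" by (simp add: power_mult_distrib)
    finally show ?thesis by (rule power2_le_imp_le) (use r in auto)
  qed
  ultimately show ?thesis using cnt(1) by (auto simp: c_def)
qed

text \<open>A volume estimate by counting grid cells: in direction \<open>v\<^sub>i\<close> the image \<open>f X\<close> lies in an interval of
  length of order \<open>min 1 (\<rho> / \<gamma>\<^sub>i)\<close>, which is at most \<open>\<rho> / \<gamma>\<^sub>i\<close> to any power between 0 and 1; the powers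
  chosen are the exponents of the singular value function. As \<open>f\<close> need not be smooth, the volume is
  compared by covering: the preimage of a small cell is contained in a cube of comparable size.\<close>
lemma sublevel_volume:
  fixes T :: "real ^ 'n ^ 'n" and f :: "real ^ 'n \<Rightarrow> real ^ 'n"
  assumes T: "invertible T" and s: "0 \<le> s" "s \<le> real CARD('n)" and R: "1 \<le> R" and rho: "0 < \<rho>"
    and k: "0 < k" "\<And>x y. norm (f x - f y) \<ge> k * norm (x - y)"
    and X: "X \<in> sets borel" "\<And>x. x \<in> X \<Longrightarrow> norm (f x) \<le> R \<and> norm (T *v f x) \<le> \<rho>"
  shows "emeasure lborel X \<le> ennreal ((8 * real CARD('n) * R / k) ^ CARD('n) * (\<rho> powr s / singular_value_function s T))"
proof -
  obtain v where S: "singular_system T (\<lambda>i. singular_values T ! i) v"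
    using singular_values_system by blast
  let ?d = "CARD('n)" and ?g = "\<lambda>i. singular_values T ! i" and ?e = "sv_exponent CARD('n) s"
  have pos: "0 < ?g i" if "i < ?d" for i by (rule singular_system_pos[OF S that T])
  define q where "q i = min R (\<rho> / ?g i)" for i
  have q: "0 < q i" if "i < ?d" for i using pos[OF that] R rho by (simp add: q_def)
  obtain h where h: "0 < h" "\<And>i. i < ?d \<Longrightarrow> h \<le> q i"
  proof
    let ?A = "insert 1 (q ` {..<?d})"
    show "0 < Min ?A" using q by (subst Min_gr_iff) auto
    show "Min ?A \<le> q i" if "i < ?d" for i using that by (intro Min_le) auto
  qed
  define c where "c = grid_cell v (\<lambda>i. h)"
  have Q: "\<bar>y \<bullet> v i\<bar> \<le> q i" if "y \<in> f ` X" "i < ?d" for y i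
  proof -
    have y: "norm y \<le> R" "norm (T *v y) \<le> \<rho>" using X(2) that(1) by auto
    have "\<bar>y \<bullet> v i\<bar> \<le> R"
      using Cauchy_Schwarz_ineq2[of y "v i"] singular_system_norm_vector(1)[OF S that(2)] y by simp
    moreover have "\<bar>y \<bullet> v i\<bar> \<le> \<rho> / ?g i"
      using singular_system_component_le[OF S that(2), of y] y(2) pos[OF that(2)] by (simp add: field_simps)
    ultimately show ?thesis by (simp add: q_def)
  qed
  note cnt = grid_cell_count[of "\<lambda>i. h" q "f ` X" v, OF h(1) less_imp_le[OF q] Q]
  define w where "w = 2 * real ?d * h / k"
  have w: "0 \<le> w" using h k by (simp add: w_def)
  have ex: "\<exists>B. B \<in> sets lborel \<and> emeasure lborel B \<le> ennreal (w ^ ?d) \<and> {x \<in> X. c (f x) = z} \<subseteq> B" for z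
  proof (cases "{x \<in> X. c (f x) = z} = {}")
    case True
    thus ?thesis by (intro exI[of _ "{}"]) simp
  next
    case False
    then obtain x0 where x0: "x0 \<in> X" "c (f x0) = z" by auto
    let ?u = "(w / 2) *\<^sub>R (1 :: real ^ 'n)"
    have "x \<in> cbox (x0 - ?u) (x0 + ?u)" if x: "x \<in> X" "c (f x) = z" for x
    proof -
      have "norm (f x - f x0) \<le> (\<Sum>i<?d. \<bar>(f x - f x0) \<bullet> v i\<bar>)"
      proof -
        have "f x - f x0 = (\<Sum>i<?d. ((f x - f x0) \<bullet> v i) *\<^sub>R v i)"
          by (rule orthonormal_expansion) (rule singular_systemD(3)[OF S])
        hence "norm (f x - f x0) \<le> (\<Sum>i<?d. norm (((f x - f x0) \<bullet> v i) *\<^sub>R v i))"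
          by (metis norm_sum)
        thus ?thesis using singular_system_norm_vector(1)[OF S] by simp
      qed
      also have "\<dots> \<le> (\<Sum>i<?d. h)"
        using grid_cell_close[of v "\<lambda>i. h" "f x" "f x0"] x x0 h(1) by (intro sum_mono) (simp add: c_def)
      finally have "k * norm (x - x0) \<le> real ?d * h" using k(2)[of x x0] by simp
      hence n: "norm (x - x0) \<le> w / 2" using k(1) by (simp add: w_def field_simps)
      have "\<bar>x $ i - x0 $ i\<bar> \<le> w / 2" for i
        using component_le_norm_cart[of "x - x0" i] n by simp
      hence "x0 $ i - w / 2 \<le> x $ i \<and> x $ i \<le> x0 $ i + w / 2" for i
        by (smt (verit))
      thus ?thesis by (simp add: mem_box_cart)
    qed
    moreover have "emeasure lborel (cbox (x0 - ?u) (x0 + ?u)) = ennreal (w ^ ?d)"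
    proof -
      have "(x0 + ?u - (x0 - ?u)) \<bullet> b = w" if "b \<in> Basis" for b
        using that by (auto simp: Basis_vec_def inner_axis)
      moreover have "\<And>b. b \<in> Basis \<Longrightarrow> (x0 - ?u) \<bullet> b \<le> (x0 + ?u) \<bullet> b"
        using w by (auto simp: Basis_vec_def inner_axis)
      ultimately have "emeasure lborel (cbox (x0 - ?u) (x0 + ?u)) =
          ennreal (\<Prod>b\<in>(Basis :: (real ^ 'n) set). w)"
        by (subst emeasure_lborel_cbox) (simp_all only: cong: prod.cong)
      thus ?thesis by simp
    qed
    ultimately show ?thesis by (intro exI[of _ "cbox (x0 - ?u) (x0 + ?u)"]) auto
  qed
  have ex': "\<forall>z. \<exists>B. B \<in> sets lborel \<and> emeasure lborel B \<le> ennreal (w ^ ?d) \<and> {x \<in> X. c (f x) = z} \<subseteq> B"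
    by (rule allI) (rule ex)
  from choice[OF ex'] obtain B where B': "\<forall>z. B z \<in> sets lborel \<and> emeasure lborel (B z) \<le> ennreal (w ^ ?d) \<and>
      {x \<in> X. c (f x) = z} \<subseteq> B z" ..
  have B: "B z \<in> sets lborel" "emeasure lborel (B z) \<le> ennreal (w ^ ?d)"
    "{x \<in> X. c (f x) = z} \<subseteq> B z" for z using B' by (simp_all only: simp_thms)
  let ?Z = "c ` f ` X"
  have "X \<subseteq> (\<Union>z\<in>?Z. B z)" using B(3) by blast
  hence "emeasure lborel X \<le> emeasure lborel (\<Union>z\<in>?Z. B z)"
    using B(1) cnt(1) by (intro emeasure_mono sets.finite_UN) (auto simp: c_def)
  also have "\<dots> \<le> (\<Sum>z\<in>?Z. emeasure lborel (B z))"
    using B(1) cnt(1) by (intro emeasure_subadditive_finite) (auto simp: c_def)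
  also have "\<dots> \<le> (\<Sum>z\<in>?Z. ennreal (w ^ ?d))" by (intro sum_mono B)
  also have "\<dots> = ennreal (real (card ?Z) * w ^ ?d)" using w by (simp add: ennreal_mult ennreal_of_nat_eq_real_of_nat)
  also have "\<dots> \<le> ennreal ((\<Prod>i<?d. 4 * R / h * (\<rho> / ?g i) powr ?e i) * w ^ ?d)"
  proof (intro ennreal_leI mult_right_mono)
    have "real (card ?Z) \<le> (\<Prod>i<?d. 2 * q i / h + 2)" using cnt(2) by (simp add: c_def)
    also have "\<dots> \<le> (\<Prod>i<?d. 4 * R / h * (\<rho> / ?g i) powr ?e i)"
    proof (rule prod_mono, intro conjI)
      fix i assume "i \<in> {..<?d}"
      hence i: "i < ?d" by simp
      show "0 \<le> 2 * q i / h + 2" using q[OF i] h(1) by simp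
      have "1 \<le> q i / h" using h(1) h(2)[OF i] by simp
      hence "2 * q i / h + 2 \<le> 2 * q i / h + 2 * (q i / h)" by linarith
      also have "\<dots> = 4 / h * q i" by simp
      also have "q i \<le> R * (\<rho> / ?g i) powr ?e i"
      proof (cases "\<rho> / ?g i \<le> 1")
        case True
        have p: "0 < \<rho> / ?g i" using rho pos[OF i] by simp
        have "q i \<le> (\<rho> / ?g i) powr 1" using rho pos[OF i] by (simp add: q_def)
        also have "\<dots> \<le> (\<rho> / ?g i) powr ?e i" using p True sv_exponent_le_1[OF s(2)]
          by (intro powr_mono') auto
        also have "\<dots> \<le> R * (\<rho> / ?g i) powr ?e i"
          using mult_right_mono[OF R, of "(\<rho> / ?g i) powr ?e i"] by simp
        finally show ?thesis .
      next
        case False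
        hence "1 \<le> (\<rho> / ?g i) powr ?e i" using sv_exponent_nonneg[OF s(1)] by (intro ge_one_powr_ge_zero) auto
        hence "R * 1 \<le> R * (\<rho> / ?g i) powr ?e i" using R by (intro mult_left_mono) auto
        moreover have "q i \<le> R" by (simp add: q_def)
        ultimately show ?thesis by linarith
      qed
      finally show "2 * q i / h + 2 \<le> 4 * R / h * (\<rho> / ?g i) powr ?e i"
        using h(1) by (simp add: mult_left_mono divide_right_mono field_simps)
    qed
    finally show "real (card ?Z) \<le> (\<Prod>i<?d. 4 * R / h * (\<rho> / ?g i) powr ?e i)" .
  qed (use w in simp)
  also have "(\<Prod>i<?d. 4 * R / h * (\<rho> / ?g i) powr ?e i) * w ^ ?d =
      (4 * R / h * w) ^ ?d * (\<Prod>i<?d. (\<rho> / ?g i) powr ?e i)"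
    by (simp add: prod.distrib prod_dividef power_mult_distrib power_divide)
  also have "4 * R / h * w = 8 * real ?d * R / k" using h(1) by (simp add: w_def)
  also have "(\<Prod>i<?d. (\<rho> / ?g i) powr ?e i) = \<rho> powr s / singular_value_function s T"
  proof -
    have "(\<Prod>i<?d. (\<rho> / ?g i) powr ?e i) = (\<Prod>i<?d. \<rho> powr ?e i / ?g i powr ?e i)"
      using pos rho by (intro prod.cong) (auto simp: powr_divide less_imp_le)
    thus ?thesis using rho s
      by (simp add: prod_dividef singular_value_function_eq[OF S T s(1)] powr_sum[symmetric] sum_sv_exponent)
  qed
  finally show ?thesis .
qed

section \<open>Riesz kernels\<close>

definition riesz :: "real \<Rightarrow> 'a::real_normed_vector \<Rightarrow> ennreal" where
  "riesz t z = (if z = 0 then \<infinity> else ennreal (norm z powr - t))"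

lemma riesz_measurable [measurable]: "riesz t \<in> borel_measurable (borel :: 'a::{real_normed_vector,second_countable_topology} measure)"
  unfolding riesz_def by measurable

lemma emeasure_unit_cube: "emeasure lborel (cbox 0 (1 :: real ^ 'n)) = 1"
proof -
  have "(1 :: real ^ 'n) \<bullet> b = 1" if "b \<in> Basis" for b
    using that by (auto simp: Basis_vec_def inner_axis)
  hence "(\<Prod>b\<in>Basis. (1 - 0 :: real ^ 'n) \<bullet> b) = 1" by (intro prod.neutral) auto
  moreover have "\<And>b. b \<in> Basis \<Longrightarrow> (0 :: real ^ 'n) \<bullet> b \<le> 1 \<bullet> b"
    by (auto simp: Basis_vec_def inner_axis)
  ultimately show ?thesis by (subst emeasure_lborel_cbox) (simp_all only: ennreal_1)
qed

lemma term_le_suminf_ennreal: "f j \<le> suminf f" for f :: "nat \<Rightarrow> ennreal"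
  using sum_le_suminf[of f "{j}"] by simp

text \<open>If \<open>2\<^sup>-\<^sup>j\<^sup>-\<^sup>1 < |z| \<le> 2\<^sup>-\<^sup>j\<close>, then the \<open>j\<close>-th term alone is at least \<open>|z|\<^sup>-\<^sup>t\<close>.\<close>
lemma riesz_le_dyadic_sum:
  assumes t: "0 \<le> t"
  shows "riesz t z \<le> 1 + (\<Sum>j. ennreal (2 powr (t * real (Suc j))) * indicator {z. norm z \<le> (1/2) ^ j} z)"
proof (cases "norm z > 1 \<or> z = 0")
  case True
  thus ?thesis
  proof
    assume "norm z > 1"
    hence "norm z powr - t \<le> 1" using t by (simp add: powr_minus ge_one_powr_ge_zero inverse_le_1_iff)
    moreover have "z \<noteq> 0" using \<open>norm z > 1\<close> by auto
    ultimately have "riesz t z \<le> 1" by (simp add: riesz_def ennreal_leI flip: ennreal_1)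
    thus ?thesis by (simp add: add_increasing2)
  next
    assume z: "z = 0"
    have "ennreal (2 powr (t * real (Suc j))) * indicator {z. norm z \<le> (1/2) ^ j} z \<ge> ennreal 1" for j
      using t unfolding z by (simp add: ge_one_powr_ge_zero ennreal_leI del: ennreal_1)
    hence "(\<Sum>j. ennreal 1) \<le> (\<Sum>j. ennreal (2 powr (t * real (Suc j))) * indicator {z. norm z \<le> (1/2) ^ j} z)"
      by (intro suminf_le) auto
    moreover have "(\<Sum>j::nat. ennreal 1) = \<infinity>"
      by (simp flip: nn_integral_count_space_nat)
    ultimately show ?thesis by (simp add: top_unique)
  qed
next
  case False
  hence z: "0 < norm z" "norm z \<le> 1" by auto
  define j where "j = (LEAST j. (1/2) ^ Suc j < norm z)"
  obtain k where k: "(1/2 :: real) ^ k < norm z" using real_arch_pow_inv[of "norm z" "1/2"] z by auto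
  have "(1/2 :: real) ^ Suc k < norm z"
    using k z(1) zero_less_power[of "1/2::real" k] unfolding power_Suc by linarith
  hence j: "(1/2) ^ Suc j < norm z" unfolding j_def by (rule LeastI)
  have j': "norm z \<le> (1/2) ^ j"
  proof (cases j)
    case (Suc i)
    hence "\<not> (1/2) ^ Suc i < norm z" using not_less_Least[of i "\<lambda>j. (1/2) ^ Suc j < norm z"] by (simp add: j_def)
    thus ?thesis using Suc by simp
  qed (use z in simp)
  have "norm z powr - t \<le> ((1/2) ^ Suc j) powr - t"
    using j t by (intro powr_mono2') auto
  also have "\<dots> = 2 powr (t * real (Suc j))"
  proof -
    have "(1/2 :: real) ^ Suc j = 2 powr (- real (Suc j))"
      by (simp only: powr_minus powr_realpow zero_less_numeral power_one_over inverse_eq_divide)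
    thus ?thesis by (simp only: powr_powr minus_mult_minus mult.commute)
  qed
  finally have "riesz t z \<le> ennreal (2 powr (t * real (Suc j))) * indicator {z. norm z \<le> (1/2) ^ j} z"
    using z j' by (simp add: riesz_def ennreal_leI)
  also have "\<dots> \<le> (\<Sum>j. ennreal (2 powr (t * real (Suc j))) * indicator {z. norm z \<le> (1/2) ^ j} z)"
    by (rule term_le_suminf_ennreal)
  finally show ?thesis by (simp add: add_increasing)
qed

text \<open>Integrate the dyadic decomposition of the kernel against the volume estimate: the \<open>j\<close>-th term
  contributes at most a constant times \<open>2\<^sup>(\<^sup>t\<^sup>-\<^sup>s\<^sup>)\<^sup>j / \<phi>\<^sup>s(T)\<close>. The constant depends neither on \<open>T\<close> nor on \<open>f\<close>.\<close>
lemma riesz_integral_le: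
  assumes t: "0 < t" "t < s" "s \<le> real CARD('n)" and R: "1 \<le> R" and k: "0 < k"
  shows "\<exists>C\<ge>0. \<forall>(T :: real ^ 'n ^ 'n) (f :: real ^ 'n \<Rightarrow> real ^ 'n). invertible T \<longrightarrow> singular_value_function s T \<le> 1 \<longrightarrow>
     f \<in> borel_measurable borel \<longrightarrow> (\<forall>x y. norm (f x - f y) \<ge> k * norm (x - y)) \<longrightarrow>
     (\<forall>x\<in>cbox 0 1. norm (f x) \<le> R) \<longrightarrow>
     (\<integral>\<^sup>+x\<in>cbox 0 1. riesz t (T *v f x) \<partial>lborel) \<le> ennreal (C / singular_value_function s T)"
proof -
  define K where "K = (8 * real CARD('n) * R / k) ^ CARD('n)"
  have K: "0 \<le> K" using R k by (simp add: K_def)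
  define q where "q = (2::real) powr (t - s)"
  have q: "0 < q" "q < 1" using t by (auto simp: q_def powr_less_one)
  define C where "C = 1 + K * 2 powr t * (1 / (1 - q))"
  have C: "0 \<le> C" using K q by (simp add: C_def)
  have "(\<integral>\<^sup>+x\<in>cbox 0 1. riesz t (T *v f x) \<partial>lborel) \<le> ennreal (C / singular_value_function s T)"
    if T: "invertible T" "singular_value_function s T \<le> 1" and f [measurable]: "f \<in> borel_measurable borel"
      and fk: "\<And>x y. norm (f x - f y) \<ge> k * norm (x - y)" and fR: "\<And>x. x \<in> cbox 0 1 \<Longrightarrow> norm (f x) \<le> R"
    for T :: "real ^ 'n ^ 'n" and f :: "real ^ 'n \<Rightarrow> real ^ 'n"
  proof -
    let ?\<phi> = "singular_value_function s T" and ?X = "cbox 0 (1 :: real ^ 'n)"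
    have pos: "0 < ?\<phi>" using T t by (intro singular_value_function_pos) auto
    have [measurable]: "(\<lambda>x. T *v f x) \<in> borel_measurable borel"
      using borel_measurable_continuous_onI[of "(*v) T"] by (auto intro!: measurable_compose[OF f] linear_continuous_on)
    define A where "A j = {x \<in> ?X. norm (T *v f x) \<le> (1/2) ^ j}" for j
    have A [measurable]: "A j \<in> sets borel" for j unfolding A_def by measurable
    have "(\<integral>\<^sup>+x\<in>?X. riesz t (T *v f x) \<partial>lborel) \<le>
        (\<integral>\<^sup>+x. indicator ?X x + (\<Sum>j. ennreal (2 powr (t * real (Suc j))) * indicator (A j) x) \<partial>lborel)"
    proof (rule nn_integral_mono)
      fix x :: "real ^ 'n"
      show "riesz t (T *v f x) * indicator ?X x \<le>
          indicator ?X x + (\<Sum>j. ennreal (2 powr (t * real (Suc j))) * indicator (A j) x)"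
        using riesz_le_dyadic_sum[of t "T *v f x"] t by (cases "x \<in> ?X") (auto simp: A_def indicator_def)
    qed
    also have "\<dots> = emeasure lborel ?X + (\<Sum>j. ennreal (2 powr (t * real (Suc j))) * emeasure lborel (A j))"
      by (simp add: nn_integral_add nn_integral_suminf nn_integral_cmult)
    also have "\<dots> \<le> ennreal (1 / ?\<phi>) + (\<Sum>j. ennreal (K * 2 powr t / ?\<phi> * q ^ j))"
    proof (intro add_mono suminf_le)
      have "emeasure lborel ?X = 1" by (rule emeasure_unit_cube)
      also have "1 \<le> ennreal (1 / ?\<phi>)" using T pos by (simp flip: ennreal_1 add: ennreal_leI)
      finally show "emeasure lborel ?X \<le> ennreal (1 / ?\<phi>)" .
      fix j
      have "emeasure lborel (A j) \<le> ennreal (K * (((1/2) ^ j) powr s / ?\<phi>))"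
        unfolding K_def
      proof (rule sublevel_volume[OF T(1) _ t(3) R _ k fk])
        show "A j \<in> sets borel" by measurable
        show "norm (f x) \<le> R \<and> norm (T *v f x) \<le> (1/2) ^ j" if "x \<in> A j" for x
          using that fR by (auto simp: A_def)
      qed (use t in auto)
      hence "ennreal (2 powr (t * real (Suc j))) * emeasure lborel (A j) \<le>
          ennreal (2 powr (t * real (Suc j))) * ennreal (K * (((1/2) ^ j) powr s / ?\<phi>))"
        by (rule mult_left_mono) simp
      also have "\<dots> = ennreal (2 powr (t * real (Suc j)) * (K * (((1/2) ^ j) powr s / ?\<phi>)))"
        using K pos by (subst ennreal_mult) auto
      also have "2 powr (t * real (Suc j)) * (K * (((1/2) ^ j) powr s / ?\<phi>)) = K * 2 powr t / ?\<phi> * q ^ j"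
      proof -
        have "((1/2::real) ^ j) powr s = 2 powr (- s * real j)"
          by (simp add: powr_realpow[symmetric] powr_powr powr_minus_divide powr_divide mult.commute)
        moreover have "q ^ j = 2 powr ((t - s) * real j)"
          by (simp add: q_def powr_powr flip: powr_realpow)
        moreover have "2 powr (t * real (Suc j)) * 2 powr (- s * real j) = 2 powr t * 2 powr ((t - s) * real j)"
          by (simp add: powr_add[symmetric] algebra_simps)
        ultimately show ?thesis by (metis (no_types, opaque_lifting) mult.assoc mult.left_commute times_divide_eq_right times_divide_eq_left)
      qed
      finally show "ennreal (2 powr (t * real (Suc j))) * emeasure lborel (A j) \<le> ennreal (K * 2 powr t / ?\<phi> * q ^ j)" .
    qed auto
    also have "(\<Sum>j. ennreal (K * 2 powr t / ?\<phi> * q ^ j)) = ennreal (K * 2 powr t / ?\<phi> * (1 / (1 - q)))"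
    proof -
      have "(\<lambda>j. K * 2 powr t / ?\<phi> * q ^ j) sums (K * 2 powr t / ?\<phi> * (1 / (1 - q)))"
        using q by (intro sums_mult geometric_sums) auto
      thus ?thesis using K pos q by (intro suminf_ennreal_eq) auto
    qed
    also have "ennreal (1 / ?\<phi>) + \<dots> = ennreal (C / ?\<phi>)"
      using K pos q by (subst ennreal_plus[symmetric]) (auto simp: C_def add_divide_distrib)
    finally show ?thesis .
  qed
  note bound = this
  show ?thesis
  proof (intro exI[of _ C] conjI allI impI C)
    fix T :: "real ^ 'n ^ 'n" and f :: "real ^ 'n \<Rightarrow> real ^ 'n"
    assume "invertible T" "singular_value_function s T \<le> 1" "f \<in> borel_measurable borel"
      "\<forall>x y. k * norm (x - y) \<le> norm (f x - f y)" "\<forall>x\<in>cbox 0 1. norm (f x) \<le> R"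
    thus "(\<integral>\<^sup>+x\<in>cbox 0 1. riesz t (T *v f x) \<partial>lborel) \<le> ennreal (C / singular_value_function s T)"
      by (intro bound) auto
  qed
qed

section \<open>Products of matrices along words\<close>

lemma word_matrix_append: "word_matrix T (u @ v) = word_matrix T u ** word_matrix T v"
  by (induction u) (simp_all add: word_matrix_def matrix_mul_assoc)

lemma word_matrix_simps [simp]: "word_matrix T [] = mat 1" "word_matrix T (i # w) = T i ** word_matrix T w"
  by (simp_all add: word_matrix_def)

lemma invertible_mat_1: "invertible (mat 1 :: real ^ 'n ^ 'n)"
  unfolding invertible_def by (intro exI[of _ "mat 1"]) simp

lemma singular_value_function_mat_1:
  "0 \<le> s \<Longrightarrow> singular_value_function s (mat 1 :: real ^ 'n ^ 'n) = 1"
proof -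
  assume s: "0 \<le> s"
  obtain v where S: "singular_system (mat 1 :: real ^ 'n ^ 'n) (\<lambda>i. singular_values (mat 1 :: real ^ 'n ^ 'n) ! i) v"
    using singular_values_system by blast
  have "singular_values (mat 1 :: real ^ 'n ^ 'n) ! i = 1" if "i < CARD('n)" for i
    using singular_system_norm_vector[OF S that] by simp
  thus ?thesis by (simp add: singular_value_function_eq[OF S _ s] invertible_mat_1)
qed

locale affine_family =
  fixes T :: "nat \<Rightarrow> real ^ 'n ^ 'n" and \<rho> :: real
  assumes inv: "invertible (T i)"
    and rho: "0 < \<rho>" "\<rho> < 1 / 2"
    and contr: "norm (T i *v x) \<le> \<rho> * norm x"
    and qm: "0 \<le> s \<Longrightarrow> s \<le> real CARD('n) \<Longrightarrow> quasi_multiplicative (word_svf T s)"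
begin

abbreviation "\<phi> \<equiv> word_svf T"
abbreviation "M \<equiv> word_matrix T"

lemma word_matrix_invertible: "invertible (M w)"
  by (induction w) (auto intro: invertible_mult inv simp: invertible_mat_1)

lemma word_matrix_contr: "norm (M w *v x) \<le> \<rho> ^ length w * norm x"
proof (induction w)
  case (Cons i w)
  have "norm (M (i # w) *v x) \<le> \<rho> * norm (M w *v x)"
    using contr[of i "M w *v x"] by (simp add: matrix_vector_mul_assoc)
  also have "\<dots> \<le> \<rho> * (\<rho> ^ length w * norm x)" using Cons rho by (intro mult_left_mono) auto
  finally show ?case by (simp add: mult.assoc)
qed simp

lemma word_svf_pos: "0 \<le> s \<Longrightarrow> 0 < \<phi> s w"
  unfolding word_svf_def by (intro singular_value_function_pos word_matrix_invertible)

lemma word_svf_Nil: "0 \<le> s \<Longrightarrow> \<phi> s [] = 1"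
  by (simp add: word_svf_def singular_value_function_mat_1)

lemma word_svf_0: "\<phi> 0 w = 1"
  by (simp add: word_svf_def singular_value_function_def)

lemma word_svf_add_le:
  assumes "0 \<le> s" "0 \<le> h"
  shows "\<phi> (s + h) w \<le> \<phi> s w * (1/2) powr (h * real (length w))"
proof -
  have "\<phi> (s + h) w \<le> \<phi> s w * (\<rho> ^ length w) powr h"
    unfolding word_svf_def using assms rho word_matrix_contr
    by (intro singular_value_function_add_bounds(1) word_matrix_invertible) auto
  also have "\<dots> \<le> \<phi> s w * ((1/2) ^ length w) powr h"
    using assms rho word_svf_pos[of s w] by (intro mult_left_mono powr_mono2 power_mono) auto
  also have "((1/2::real) ^ length w) powr h = (1/2) powr (h * real (length w))"
    by (simp add: powr_powr mult.commute flip: powr_realpow)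
  finally show ?thesis .
qed

lemma word_svf_le_1: "0 \<le> s \<Longrightarrow> \<phi> s w \<le> 1"
proof -
  assume s: "0 \<le> s"
  have "\<phi> (0 + s) w \<le> \<phi> 0 w * (1/2) powr (s * real (length w))" by (rule word_svf_add_le) (use s in auto)
  also have "\<dots> \<le> 1" using s by (simp add: word_svf_0 powr_le1)
  finally show ?thesis by simp
qed

lemma word_matrix_expansion:
  assumes "finite A"
  shows "\<exists>b. 0 < b \<and> b \<le> 1 \<and> (\<forall>w x. set w \<subseteq> A \<longrightarrow> b ^ length w * norm x \<le> norm (M w *v x))"
proof -
  have "\<exists>b>0. \<forall>x. b * norm x \<le> norm (T i *v x)" for i
  proof -
    obtain B where "B > 0" "\<And>x. B * norm x \<le> norm (T i *v x)"
      using linear_inj_bounded_below_pos[of "(*v) (T i)"] inj_matrix_vector_mult[OF inv[of i]] by auto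
    thus ?thesis by blast
  qed
  then obtain b where b: "\<And>i. 0 < b i" "\<And>i x. b i * norm x \<le> norm (T i *v x)" by metis
  define c where "c = Min (insert 1 (b ` A))"
  have c: "0 < c" "c \<le> 1" "\<And>i. i \<in> A \<Longrightarrow> c \<le> b i"
    unfolding c_def using assms b(1) by (auto simp: Min_gr_iff)
  have "c ^ length w * norm x \<le> norm (M w *v x)" if "set w \<subseteq> A" for w x
    using that
  proof (induction w)
    case (Cons i w)
    have "c ^ length (i # w) * norm x = c * (c ^ length w * norm x)" by simp
    also have "\<dots> \<le> c * norm (M w *v x)" using Cons c by (intro mult_left_mono) auto
    also have "\<dots> \<le> b i * norm (M w *v x)" using Cons c by (intro mult_right_mono) auto
    also have "\<dots> \<le> norm (M (i # w) *v x)" using b(2)[of i "M w *v x"] by (simp add: matrix_vector_mul_assoc)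
    finally show ?case .
  qed simp
  thus ?thesis using c by blast
qed

text \<open>The price of appending letters from a finite set: at most a constant factor per letter. This bounds
  the loss caused by connecting words, by padding and by truncation.\<close>
lemma word_svf_append_ge:
  assumes A: "finite A" and s: "0 \<le> s"
  shows "\<exists>b. 0 < b \<and> b \<le> 1 \<and> (\<forall>u v. set v \<subseteq> A \<longrightarrow> \<phi> s u * b ^ length v \<le> \<phi> s (u @ v))"
proof -
  obtain b where b: "0 < b" "b \<le> 1" "\<And>w x. set w \<subseteq> A \<Longrightarrow> b ^ length w * norm x \<le> norm (M w *v x)"
    using word_matrix_expansion[OF A] by blast
  have "\<phi> s u * (b powr s) ^ length v \<le> \<phi> s (u @ v)" if "set v \<subseteq> A" for u v
  proof -
    have "\<phi> s u * (b ^ length v) powr s \<le> \<phi> s (u @ v)"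
      unfolding word_svf_def word_matrix_append
      using b that s by (intro singular_value_function_mult_ge word_matrix_invertible) auto
    moreover have "(b ^ length v) powr s = (b powr s) ^ length v"
      using b(1) by (simp add: powr_powr mult.commute flip: powr_realpow)
    ultimately show ?thesis by simp
  qed
  moreover have "0 < b powr s" "b powr s \<le> 1" using b s by (auto simp: powr_le1)
  ultimately show ?thesis by blast
qed

lemma word_svf_add_ge: "\<exists>b. 0 < b \<and> (\<forall>s h. 0 \<le> s \<longrightarrow> 0 \<le> h \<longrightarrow> \<phi> s w * b powr h \<le> \<phi> (s + h) w)"
proof -
  obtain b where b: "0 < b" "\<And>u x. set u \<subseteq> set w \<Longrightarrow> b ^ length u * norm x \<le> norm (M u *v x)"
    using word_matrix_expansion[of "set w"] by blast
  have "\<phi> s w * (b ^ length w) powr h \<le> \<phi> (s + h) w" if "0 \<le> s" "0 \<le> h" for s h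
    unfolding word_svf_def using that b by (intro singular_value_function_add_bounds(2) word_matrix_invertible) auto
  thus ?thesis using b(1) by (intro exI[of _ "b ^ length w"]) auto
qed

text \<open>Above the dimension, \<open>\<phi>\<^sup>s\<close> is a power of \<open>|det|\<close> and therefore multiplicative: the empty word connects.\<close>
lemma word_svf_quasi_multiplicative:
  assumes s: "0 \<le> s"
  shows "\<exists>c \<Gamma>. 1 \<le> c \<and> finite \<Gamma> \<and> \<Gamma> \<noteq> {} \<and> (\<forall>u v. u \<noteq> [] \<longrightarrow> v \<noteq> [] \<longrightarrow> (\<exists>w\<in>\<Gamma>. \<phi> s u * \<phi> s v \<le> c * \<phi> s (u @ w @ v)))"
proof (cases "s \<le> real CARD('n)")
  case True
  obtain c \<Gamma> where "1 \<le> c" "finite \<Gamma>" "\<And>u v. u \<noteq> [] \<Longrightarrow> v \<noteq> [] \<Longrightarrow> (\<exists>w\<in>\<Gamma>. \<phi> s u * \<phi> s v \<le> c * \<phi> s (u @ w @ v))"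
    using qm[OF s True] unfolding quasi_multiplicative_def by blast
  moreover from this(3)[of "[0]" "[0]"] have "\<Gamma> \<noteq> {}" by auto
  ultimately show ?thesis by blast
next
  case False
  have "\<phi> s (u @ v) = \<phi> s u * \<phi> s v" for u v
    using False s by (simp add: word_svf_def singular_value_function_def word_matrix_append det_mul abs_mult powr_mult)
  thus ?thesis by (intro exI[of _ 1] exI[of _ "{[]}"]) auto
qed

end

section \<open>Birkhoff sums\<close>

lemma shift_funpow: "(shift ^^ j) \<omega> = (\<lambda>i. \<omega> (i + j))"
  by (induction j arbitrary: \<omega>) (simp_all add: shift_def fun_eq_iff)

lemma prefix_word_eq_iff: "prefix_word \<omega> n = prefix_word \<tau> n \<longleftrightarrow> (\<forall>i<n. \<omega> i = \<tau> i)"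
  by (auto simp: prefix_word_def)

lemma length_prefix_word [simp]: "length (prefix_word \<omega> n) = n"
  by (simp add: prefix_word_def)

lemma prefix_word_nth [simp]: "i < n \<Longrightarrow> prefix_word \<omega> n ! i = \<omega> i"
  by (simp add: prefix_word_def)

lemma prefix_word_add: "prefix_word \<omega> (m + n) = prefix_word \<omega> m @ prefix_word ((shift ^^ m) \<omega>) n"
  by (rule nth_equalityI) (auto simp: nth_append shift_funpow)

lemma cylinder_iff: "\<omega> \<in> cylinder w \<longleftrightarrow> (\<forall>i<length w. \<omega> i = w ! i)"
  by (auto simp: cylinder_def list_eq_iff_nth_eq)

lemma prefix_word_in_cylinder: "\<omega> \<in> cylinder (prefix_word \<omega> n)"
  by (simp add: cylinder_def)

definition birkhoff_sum :: "((nat \<Rightarrow> nat) \<Rightarrow> real) \<Rightarrow> nat \<Rightarrow> (nat \<Rightarrow> nat) \<Rightarrow> real" where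
  "birkhoff_sum f n \<omega> = (\<Sum>j<n. f ((shift ^^ j) \<omega>))"

lemma birkhoff_average_eq: "birkhoff_average n f \<omega> = birkhoff_sum f n \<omega> / real n"
  by (simp add: birkhoff_average_def birkhoff_sum_def)

lemma birkhoff_sum_add: "birkhoff_sum f (m + n) \<omega> = birkhoff_sum f m \<omega> + birkhoff_sum f n ((shift ^^ m) \<omega>)"
proof -
  have "birkhoff_sum f (m + n) \<omega> = birkhoff_sum f m \<omega> + (\<Sum>j\<in>{m..<m+n}. f ((shift ^^ j) \<omega>))"
    unfolding birkhoff_sum_def by (subst sum.union_disjoint[symmetric]) (auto intro!: sum.cong)
  also have "(\<Sum>j\<in>{m..<m+n}. f ((shift ^^ j) \<omega>)) = (\<Sum>j<n. f ((shift ^^ (j + m)) \<omega>))"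
    by (rule sum.reindex_bij_witness[of _ "\<lambda>j. j + m" "\<lambda>j. j - m"]) auto
  finally show ?thesis by (simp add: birkhoff_sum_def funpow_add)
qed

text \<open>The two orbits agree in \<open>n - j\<close> letters at time \<open>j\<close>, so the difference is at most the sum of all
  variations, whatever \<open>n\<close> is.\<close>
lemma summable_variations_distortion:
  assumes "summable_variations f"
  shows "\<exists>V\<ge>0. \<forall>n \<omega> \<tau>. (\<forall>i<n. \<omega> i = \<tau> i) \<longrightarrow> \<bar>birkhoff_sum f n \<omega> - birkhoff_sum f n \<tau>\<bar> \<le> V"
proof -
  define S where "S = (\<Sum>n. variation (Suc n) f)"
  have fin: "S < \<infinity>" using assms by (simp add: summable_variations_def S_def)
  have "\<bar>birkhoff_sum f n \<omega> - birkhoff_sum f n \<tau>\<bar> \<le> enn2real S" if eq: "\<And>i. i < n \<Longrightarrow> \<omega> i = \<tau> i" for n \<omega> \<tau>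
  proof -
    have 1: "ennreal \<bar>f ((shift ^^ j) \<omega>) - f ((shift ^^ j) \<tau>)\<bar> \<le> variation (Suc (n - Suc j)) f" if "j < n" for j
    proof -
      have "prefix_word ((shift ^^ j) \<omega>) (Suc (n - Suc j)) = prefix_word ((shift ^^ j) \<tau>) (Suc (n - Suc j))"
        using eq that by (auto simp: prefix_word_eq_iff shift_funpow)
      thus ?thesis unfolding variation_def
        by (intro SUP_upper2[of "((shift ^^ j) \<omega>, (shift ^^ j) \<tau>)"]) auto
    qed
    have "ennreal \<bar>birkhoff_sum f n \<omega> - birkhoff_sum f n \<tau>\<bar> \<le> ennreal (\<Sum>j<n. \<bar>f ((shift ^^ j) \<omega>) - f ((shift ^^ j) \<tau>)\<bar>)"
      unfolding birkhoff_sum_def by (intro ennreal_leI) (simp flip: sum_subtractf)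
    also have "\<dots> = (\<Sum>j<n. ennreal \<bar>f ((shift ^^ j) \<omega>) - f ((shift ^^ j) \<tau>)\<bar>)" by simp
    also have "\<dots> \<le> (\<Sum>j<n. variation (Suc (n - Suc j)) f)" using 1 by (intro sum_mono) auto
    also have "\<dots> = (\<Sum>j<n. variation (Suc j) f)" by (rule sum.nat_diff_reindex)
    also have "\<dots> \<le> S" unfolding S_def by (rule sum_le_suminf) auto
    also have "S = ennreal (enn2real S)" using fin by (simp add: less_top)
    finally show ?thesis by simp
  qed
  thus ?thesis by (intro exI[of _ "enn2real S"]) auto
qed

lemma open_cylinder: "open (cylinder w)"
proof -
  have "cylinder w = (\<Inter>i\<in>{..<length w}. (\<lambda>\<omega>. \<omega> i) -` {w ! i})" by (auto simp: cylinder_iff)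
  moreover have "open ((\<lambda>\<omega>::nat \<Rightarrow> nat. \<omega> i) -` {w ! i})" for i
    by (intro open_vimage discrete_topology_class.open_discrete continuous_on_product_coordinates)
  ultimately show ?thesis by (simp add: open_INT)
qed

lemma cylinder_measurable [measurable]: "cylinder w \<in> sets borel"
  using open_cylinder by simp

lemma coordinate_measurable [measurable]: "(\<lambda>\<omega>::nat \<Rightarrow> nat. \<omega> i) \<in> borel \<rightarrow>\<^sub>M count_space UNIV"
proof -
  have "(\<lambda>\<omega>::nat \<Rightarrow> nat. \<omega> i) -` A \<in> sets borel" for A :: "nat set"
    by (intro borel_open open_vimage discrete_topology_class.open_discrete continuous_on_product_coordinates)
  thus ?thesis by (simp add: measurable_def)
qed

lemma shift_funpow_measurable [measurable]: "(shift ^^ j) \<in> borel \<rightarrow>\<^sub>M borel"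
proof (rule borel_measurable_continuous_onI, rule continuous_on_coordinatewise_then_product)
  fix i
  have "continuous_on UNIV (\<lambda>\<omega>::nat \<Rightarrow> nat. \<omega> (i + j))" by (rule continuous_on_product_coordinates)
  thus "continuous_on UNIV (\<lambda>\<omega>. (shift ^^ j) \<omega> i)" by (simp only: shift_funpow)
qed

lemma prefix_word_measurable [measurable]: "(\<lambda>\<omega>. prefix_word \<omega> k) \<in> borel \<rightarrow>\<^sub>M count_space UNIV"
proof (rule measurableI)
  fix A :: "nat list set"
  have "(\<lambda>\<omega>. prefix_word \<omega> k) -` A \<inter> space borel = (\<Union>w\<in>{w\<in>A. length w = k}. cylinder w)"
    by (auto simp: cylinder_def)
  also have "\<dots> \<in> sets borel" by (rule sets.countable_UN'') (rule countableI_type, rule cylinder_measurable)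
  finally show "(\<lambda>\<omega>. prefix_word \<omega> k) -` A \<inter> space borel \<in> sets borel" .
qed simp

text \<open>The variations tend to zero, so the function is continuous.\<close>
lemma summable_variations_measurable:
  assumes "summable_variations f"
  shows "f \<in> borel_measurable borel"
proof -
  define v where "v n = enn2real (variation (Suc n) f)" for n
  have fin: "(\<Sum>n. variation (Suc n) f) < \<infinity>" using assms by (simp add: summable_variations_def)
  have v: "variation (Suc n) f = ennreal (v n)" for n
    using le_less_trans[OF term_le_suminf_ennreal fin, of n] by (simp add: v_def less_top)
  have "summable v" using fin
    by (intro summable_suminf_not_top) (simp_all add: v[symmetric] less_top, simp add: v_def)
  hence "v \<longlonglongrightarrow> 0" by (rule summable_LIMSEQ_zero)
  hence small: "\<exists>n. variation n f < ennreal e" if e: "0 < e" for e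
  proof -
    obtain n where "v n < e"
      using order_tendstoD(2)[OF \<open>v \<longlonglongrightarrow> 0\<close> e] by (auto simp: eventually_sequentially)
    hence "variation (Suc n) f < ennreal e" unfolding v using e by (intro ennreal_lessI)
    thus ?thesis by blast
  qed
  have "open (f -` B)" if B: "open B" for B
  proof (rule topological_space_class.openI)
    fix \<omega> assume "\<omega> \<in> f -` B"
    then obtain e where e: "0 < e" "\<And>y. dist y (f \<omega>) < e \<Longrightarrow> y \<in> B" using B by (auto simp: open_dist)
    obtain n where n: "variation n f < ennreal e" using small[OF e(1)] by blast
    have "cylinder (prefix_word \<omega> n) \<subseteq> f -` B"
    proof
      fix \<tau> assume "\<tau> \<in> cylinder (prefix_word \<omega> n)"
      hence "prefix_word \<tau> n = prefix_word \<omega> n" by (simp add: cylinder_def)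
      hence "ennreal \<bar>f \<tau> - f \<omega>\<bar> \<le> variation n f" unfolding variation_def
        by (intro SUP_upper2[of "(\<tau>, \<omega>)"]) auto
      also note n
      finally have "\<bar>f \<tau> - f \<omega>\<bar> < e" by (simp add: ennreal_less_iff)
      thus "\<tau> \<in> f -` B" using e(2) by (simp add: dist_real_def)
    qed
    thus "\<exists>T. open T \<and> \<omega> \<in> T \<and> T \<subseteq> f -` B"
      using open_cylinder prefix_word_in_cylinder by blast
  qed
  hence "continuous_on UNIV f" by (simp add: continuous_on_open_vimage)
  thus ?thesis by (rule borel_measurable_continuous_onI)
qed

lemma birkhoff_sum_measurable:
  "f \<in> borel_measurable borel \<Longrightarrow> birkhoff_sum f n \<in> borel_measurable borel"
  unfolding birkhoff_sum_def[abs_def]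
  by (intro borel_measurable_sum measurable_compose[OF shift_funpow_measurable])

section \<open>Marginals of measures on the symbolic space\<close>

lemma compact_imp_closed_words:
  fixes K :: "(nat \<Rightarrow> nat) set"
  assumes K: "compact K"
  shows "closed K"
  unfolding closed_def
proof (rule topological_space_class.openI)
  fix x assume x: "x \<in> - K"
  have op: "open ((\<lambda>\<omega>::nat \<Rightarrow> nat. \<omega> j) -` (- {x j}))" for j
    by (intro open_vimage discrete_topology_class.open_discrete continuous_on_product_coordinates)
  have cov: "K \<subseteq> (\<Union>j\<in>UNIV. (\<lambda>\<omega>. \<omega> j) -` (- {x j}))"
  proof
    fix y assume "y \<in> K"
    hence "y \<noteq> x" using x by auto
    thus "y \<in> (\<Union>j\<in>UNIV. (\<lambda>\<omega>. \<omega> j) -` (- {x j}))" by (auto simp: fun_eq_iff)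
  qed
  obtain J where J: "finite J" "K \<subseteq> (\<Union>j\<in>J. (\<lambda>\<omega>. \<omega> j) -` (- {x j}))"
    by (rule compactE_image[OF K op cov])
  obtain n where n: "\<And>j. j \<in> J \<Longrightarrow> j < n" using J(1) by (auto simp: finite_nat_set_iff_bounded)
  have "y \<notin> K" if y: "y \<in> cylinder (prefix_word x n)" for y
  proof
    assume "y \<in> K"
    then obtain j where "j \<in> J" "y j \<noteq> x j" using J(2) by auto
    thus False using n[of j] y by (simp add: cylinder_iff)
  qed
  hence "cylinder (prefix_word x n) \<subseteq> - K" by auto
  thus "\<exists>T. open T \<and> x \<in> T \<and> T \<subseteq> - K" using open_cylinder prefix_word_in_cylinder by blast
qed

text \<open>Continuous images of a compact set in a discrete space are finite: this reduces everything to finite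
  alphabets.\<close>
lemma compact_letters:
  fixes \<mu> :: "(nat \<Rightarrow> nat) measure"
  assumes "prob_space \<mu>" "sets \<mu> = sets borel" "compact K" "emeasure \<mu> (- K) = 0"
  shows "\<exists>A. finite A \<and> (AE \<omega> in \<mu>. \<forall>j<k. \<omega> j \<in> (A :: nat set))"
proof -
  have "finite ((\<lambda>\<omega>. \<omega> j) ` K)" for j
  proof -
    have "compact ((\<lambda>\<omega>. \<omega> j) ` K)"
      by (rule compact_continuous_image[OF continuous_on_subset[OF continuous_on_product_coordinates subset_UNIV] assms(3)])
    then obtain D where D: "D \<subseteq> range (\<lambda>x. {x})" "finite D" "(\<lambda>\<omega>. \<omega> j) ` K \<subseteq> \<Union>D"
      by (rule compactE[of _ "range (\<lambda>x. {x})"]) (auto intro: discrete_topology_class.open_discrete)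
    have "finite (\<Union>D)" using D(2)
    proof (rule finite_Union)
      fix B assume "B \<in> D"
      thus "finite B" using D(1) by auto
    qed
    with D(3) show ?thesis by (rule finite_subset)
  qed
  hence "finite (\<Union>j<k. (\<lambda>\<omega>. \<omega> j) ` K)" by (rule finite_UN_I[OF finite_lessThan])
  moreover have "- K \<in> null_sets \<mu>"
    using borel_open[OF open_Compl[OF compact_imp_closed_words[OF assms(3)]]] assms(2,4)
    by (intro null_setsI) simp_all
  hence "AE \<omega> in \<mu>. \<omega> \<notin> - K" by (rule AE_not_in)
  hence "AE \<omega> in \<mu>. \<forall>j<k. \<omega> j \<in> (\<Union>j<k. (\<lambda>\<omega>. \<omega> j) ` K)"
    by eventually_elim auto
  ultimately show ?thesis by (intro exI[of _ "\<Union>j<k. (\<lambda>\<omega>. \<omega> j) ` K"] conjI)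
qed

lemma finite_words: "finite A \<Longrightarrow> finite {w. length w = k \<and> set w \<subseteq> (A :: nat set)}"
  using finite_lists_length_eq[of A k] by (simp add: conj_commute)

text \<open>Only the finitely many words over \<open>A\<close> carry mass, so that integrals become finite sums, exactly for
  functions of the first \<open>k\<close> letters and up to \<open>V\<close> for functions close to these.\<close>
lemma marginal_integral:
  assumes P: "prob_space \<mu>" and sets: "sets \<mu> = sets borel" and A: "finite A"
    and AE: "AE \<omega> in \<mu>. \<forall>j<k. \<omega> j \<in> A"
  defines "F \<equiv> {w. length w = k \<and> set w \<subseteq> A}"
  shows "integrable \<mu> (\<lambda>\<omega>. g (prefix_word \<omega> k) :: real)"
    and "(\<integral>\<omega>. g (prefix_word \<omega> k) \<partial>\<mu>) = (\<Sum>w\<in>F. measure \<mu> (cylinder w) * g w)"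
    and "(\<Sum>w\<in>F. measure \<mu> (cylinder w)) = 1"
    and "\<And>w. length w = k \<Longrightarrow> w \<notin> F \<Longrightarrow> measure \<mu> (cylinder w) = 0"
    and "h \<in> borel_measurable borel \<Longrightarrow> (\<And>\<omega>. \<bar>h \<omega> - g (prefix_word \<omega> k)\<bar> \<le> V) \<Longrightarrow>
           integrable \<mu> h \<and> \<bar>(\<integral>\<omega>. h \<omega> \<partial>\<mu>) - (\<Sum>w\<in>F. measure \<mu> (cylinder w) * g w)\<bar> \<le> V"
proof -
  interpret prob_space \<mu> by fact
  note [measurable_cong] = sets
  have fin: "finite F" unfolding F_def using A by (rule finite_words)
  have ae: "AE \<omega> in \<mu>. prefix_word \<omega> k \<in> F"
    using AE by eventually_elim (auto simp: F_def in_set_conv_nth)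
  have ind: "g (prefix_word \<omega> k) = (\<Sum>w\<in>F. g w * indicator (cylinder w) \<omega>)" if "prefix_word \<omega> k \<in> F" for g :: "nat list \<Rightarrow> real" and \<omega>
  proof -
    have "(\<Sum>w\<in>F. g w * indicator (cylinder w) \<omega>) = (\<Sum>w\<in>F. if w = prefix_word \<omega> k then g w else 0)"
      by (intro sum.cong) (auto simp: F_def cylinder_def indicator_def)
    thus ?thesis using that fin by simp
  qed
  have m: "(\<lambda>\<omega>. g (prefix_word \<omega> k)) \<in> borel_measurable \<mu>" for g :: "nat list \<Rightarrow> real"
    by measurable
  have cyl: "cylinder w \<in> sets \<mu>" for w by (simp add: sets)
  have int: "integrable \<mu> (\<lambda>\<omega>. \<Sum>w\<in>F. g w * indicator (cylinder w) \<omega>)" for g :: "nat list \<Rightarrow> real"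
    using cyl by (intro Bochner_Integration.integrable_sum integrable_mult_right integrable_real_indicator) (auto simp: emeasure_eq_measure)
  have aeq: "AE \<omega> in \<mu>. g (prefix_word \<omega> k) = (\<Sum>w\<in>F. g w * indicator (cylinder w) \<omega>)" for g :: "nat list \<Rightarrow> real"
    using ae by eventually_elim (rule ind)
  have aeq': "AE \<omega> in \<mu>. (\<Sum>w\<in>F. g w * indicator (cylinder w) \<omega>) = g (prefix_word \<omega> k)" for g :: "nat list \<Rightarrow> real"
    using ae by eventually_elim (rule ind[symmetric])
  have gi: "integrable \<mu> (\<lambda>\<omega>. g (prefix_word \<omega> k))" for g :: "nat list \<Rightarrow> real"
    by (rule integrable_cong_AE_imp[OF int[of g] m aeq'])
  have gint: "(\<integral>\<omega>. g (prefix_word \<omega> k) \<partial>\<mu>) = (\<Sum>w\<in>F. measure \<mu> (cylinder w) * g w)" for g :: "nat list \<Rightarrow> real"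
  proof -
    have "(\<integral>\<omega>. g (prefix_word \<omega> k) \<partial>\<mu>) = (\<integral>\<omega>. (\<Sum>w\<in>F. g w * indicator (cylinder w) \<omega>) \<partial>\<mu>)"
      by (rule integral_cong_AE[OF m borel_measurable_integrable[OF int[of g]] aeq])
    also have "\<dots> = (\<Sum>w\<in>F. \<integral>\<omega>. g w * indicator (cylinder w) \<omega> \<partial>\<mu>)"
      using cyl by (intro Bochner_Integration.integral_sum integrable_mult_right integrable_real_indicator) (auto simp: emeasure_eq_measure)
    also have "\<dots> = (\<Sum>w\<in>F. measure \<mu> (cylinder w) * g w)"
      using cyl by (intro sum.cong) (auto simp: mult.commute)
    finally show ?thesis .
  qed
  show "integrable \<mu> (\<lambda>\<omega>. g (prefix_word \<omega> k) :: real)" by (rule gi)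
  show G: "(\<integral>\<omega>. g (prefix_word \<omega> k) \<partial>\<mu>) = (\<Sum>w\<in>F. measure \<mu> (cylinder w) * g w)" by (rule gint)
  show "(\<Sum>w\<in>F. measure \<mu> (cylinder w)) = 1" using gint[of "\<lambda>_. 1"] by (simp add: prob_space)
  show "measure \<mu> (cylinder w) = 0" if "length w = k" "w \<notin> F" for w
  proof -
    have "AE \<omega> in \<mu>. \<omega> \<notin> cylinder w" using ae by eventually_elim (use that in \<open>auto simp: cylinder_def\<close>)
    thus ?thesis using cyl[of w] by (simp add: prob_eq_0)
  qed
  { assume h: "h \<in> borel_measurable borel" and V: "\<And>\<omega>. \<bar>h \<omega> - g (prefix_word \<omega> k)\<bar> \<le> V"
    have [measurable]: "h \<in> borel_measurable \<mu>" using h by measurable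
    have d: "integrable \<mu> (\<lambda>\<omega>. h \<omega> - g (prefix_word \<omega> k))"
      using V m[of g] by (intro integrable_const_bound[of _ V]) auto
    hence "integrable \<mu> (\<lambda>\<omega>. (h \<omega> - g (prefix_word \<omega> k)) + g (prefix_word \<omega> k))"
      using gi[of g] by (rule Bochner_Integration.integrable_add)
    hence hi: "integrable \<mu> h" by simp
    have "\<bar>\<integral>\<omega>. (h \<omega> - g (prefix_word \<omega> k)) \<partial>\<mu>\<bar> \<le> (\<integral>\<omega>. \<bar>h \<omega> - g (prefix_word \<omega> k)\<bar> \<partial>\<mu>)"
      by (rule integral_abs_bound)
    also have "\<dots> \<le> (\<integral>\<omega>. V \<partial>\<mu>)" using d V by (intro integral_mono) auto
    also have "\<dots> = V" by (simp add: prob_space)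
    finally have "\<bar>(\<integral>\<omega>. h \<omega> \<partial>\<mu>) - (\<integral>\<omega>. g (prefix_word \<omega> k) \<partial>\<mu>)\<bar> \<le> V" using hi gi[of g] by simp
    thus "integrable \<mu> h \<and> \<bar>(\<integral>\<omega>. h \<omega> \<partial>\<mu>) - (\<Sum>w\<in>F. measure \<mu> (cylinder w) * g w)\<bar> \<le> V"
      using hi G by simp }
qed

section \<open>The dimension of a probability vector on words\<close>

context affine_family
begin

text \<open>Entropy plus the mean of \<open>ln \<phi>\<^sup>s\<close>; the symbolic dimension of a measure is the zero in \<open>s\<close> of the
  pressure of its marginal.\<close>
definition pressure :: "real \<Rightarrow> (nat list \<Rightarrow> real) \<Rightarrow> nat list set \<Rightarrow> real" where
  "pressure s p F = (\<Sum>w\<in>F. p w * ln (\<phi> s w / p w))"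

lemma pressure_add_le:
  assumes "\<And>w. w \<in> F \<Longrightarrow> length w = k" "\<And>w. w \<in> F \<Longrightarrow> 0 \<le> p w" "sum p F = 1" "0 \<le> s" "0 \<le> h"
  shows "pressure (s + h) p F \<le> pressure s p F - h * real k * ln 2"
proof -
  have "pressure (s + h) p F \<le> (\<Sum>w\<in>F. p w * ln (\<phi> s w / p w) - p w * (h * real k * ln 2))"
    unfolding pressure_def
  proof (rule sum_mono)
    fix w assume w: "w \<in> F"
    show "p w * ln (\<phi> (s + h) w / p w) \<le> p w * ln (\<phi> s w / p w) - p w * (h * real k * ln 2)"
    proof (cases "p w = 0")
      case False
      hence p: "0 < p w" using assms(2)[OF w] by simp
      have "\<phi> (s + h) w / p w \<le> \<phi> s w / p w * (1/2) powr (h * real k)"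
        using word_svf_add_le[of s h w] assms p w by (simp add: divide_right_mono)
      hence "ln (\<phi> (s + h) w / p w) \<le> ln (\<phi> s w / p w * (1/2) powr (h * real k))"
        using word_svf_pos[of "s + h" w] assms p by (intro ln_mono) auto
      also have "\<dots> = ln (\<phi> s w / p w) - h * real k * ln 2"
        using word_svf_pos[of s w] assms p by (simp add: ln_mult ln_powr ln_div)
      finally have "p w * ln (\<phi> (s + h) w / p w) \<le> p w * (ln (\<phi> s w / p w) - h * real k * ln 2)"
        using p by (intro mult_left_mono) auto
      thus ?thesis by (simp add: algebra_simps)
    qed simp
  qed
  also have "\<dots> = pressure s p F - h * real k * ln 2"
    using assms(3) by (simp add: sum_subtractf pressure_def flip: sum_distrib_right)
  finally show ?thesis .
qed

lemma pressure_add_ge: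
  assumes "finite F" "\<And>w. w \<in> F \<Longrightarrow> 0 \<le> p w"
  shows "\<exists>B\<ge>0. \<forall>s h. 0 \<le> s \<longrightarrow> 0 \<le> h \<longrightarrow> pressure s p F - h * B \<le> pressure (s + h) p F"
proof -
  obtain b where b: "\<And>w. 0 < b w" "\<And>w s h. 0 \<le> s \<Longrightarrow> 0 \<le> h \<Longrightarrow> \<phi> s w * b w powr h \<le> \<phi> (s + h) w"
    using word_svf_add_ge by metis
  define B where "B = (\<Sum>w\<in>F. p w * \<bar>ln (b w)\<bar>)"
  have "pressure s p F - h * B \<le> pressure (s + h) p F" if sh: "0 \<le> s" "0 \<le> h" for s h
  proof -
    have "pressure s p F - h * B = (\<Sum>w\<in>F. p w * (ln (\<phi> s w / p w) - h * \<bar>ln (b w)\<bar>))"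
      by (simp add: pressure_def B_def sum_distrib_left algebra_simps sum_subtractf)
    also have "\<dots> \<le> pressure (s + h) p F"
      unfolding pressure_def
    proof (rule sum_mono)
      fix w assume w: "w \<in> F"
      show "p w * (ln (\<phi> s w / p w) - h * \<bar>ln (b w)\<bar>) \<le> p w * ln (\<phi> (s + h) w / p w)"
      proof (cases "p w = 0")
        case False
        hence p: "0 < p w" using assms(2)[OF w] by simp
        have "ln (\<phi> s w / p w) - h * \<bar>ln (b w)\<bar> \<le> ln (\<phi> s w / p w) + h * ln (b w)"
          using sh mult_left_mono[of "- \<bar>ln (b w)\<bar>" "ln (b w)" h] by simp
        also have "\<dots> = ln (\<phi> s w * b w powr h / p w)"
          using word_svf_pos[of s w] sh p b(1)[of w] by (simp add: ln_mult ln_div ln_powr)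
        also have "\<dots> \<le> ln (\<phi> (s + h) w / p w)"
          using b(2)[OF sh, of w] word_svf_pos[of s w] sh p b(1)[of w]
          by (intro ln_mono divide_right_mono) auto
        finally show ?thesis using p by (intro mult_left_mono) auto
      qed simp
    qed
    finally show ?thesis .
  qed
  moreover have "0 \<le> B" unfolding B_def using assms(2) by (intro sum_nonneg) auto
  ultimately show ?thesis by blast
qed

lemma pressure_0_nonneg:
  assumes "finite F" "\<And>w. w \<in> F \<Longrightarrow> 0 \<le> p w" "sum p F = 1"
  shows "0 \<le> pressure 0 p F"
  unfolding pressure_def
proof (rule sum_nonneg)
  fix w assume w: "w \<in> F"
  have "p w \<le> 1" using member_le_sum[OF w, of p] assms by auto
  thus "0 \<le> p w * ln (\<phi> 0 w / p w)" using assms(2)[OF w] by (cases "p w = 0") (auto simp: word_svf_0)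
qed

text \<open>In \<open>s\<close> the pressure is Lipschitz, strictly decreasing with slope at most \<open>- k ln 2\<close> because all maps
  contract by \<open>1/2\<close>, and non-negative at 0, where it is the entropy.\<close>
lemma pressure_root_exists:
  assumes "finite F" "\<And>w. w \<in> F \<Longrightarrow> length w = k" "\<And>w. w \<in> F \<Longrightarrow> 0 \<le> p w" "sum p F = 1" "1 \<le> k"
  shows "\<exists>!s. 0 \<le> s \<and> pressure s p F = 0"
proof -
  let ?P = "\<lambda>s. pressure s p F"
  have dec: "?P (s + h) \<le> ?P s - h * real k * ln 2" if "0 \<le> s" "0 \<le> h" for s h
    using pressure_add_le[OF assms(2-4) that] .
  obtain B where B: "0 \<le> B" "\<And>s h. 0 \<le> s \<Longrightarrow> 0 \<le> h \<Longrightarrow> ?P s - h * B \<le> ?P (s + h)"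
    using pressure_add_ge[of F p] assms by blast
  have kl: "0 < real k * ln 2" using assms(5) by simp
  have lip: "\<bar>?P t - ?P s\<bar> \<le> B * \<bar>t - s\<bar>" if "0 \<le> s" "s \<le> t" for s t
  proof -
    have "0 \<le> (t - s) * (real k * ln 2)"
      by (intro mult_nonneg_nonneg less_imp_le[OF kl]) (use that in simp)
    moreover have "?P t \<le> ?P s - (t - s) * (real k * ln 2)"
      using dec[of s "t - s"] that by (simp add: mult.assoc)
    ultimately have "?P t \<le> ?P s" by linarith
    moreover have "?P s - (t - s) * B \<le> ?P t" using B(2)[of s "t - s"] that by simp
    ultimately show ?thesis using that by (simp add: mult.commute abs_if)
  qed
  have "B-lipschitz_on {0..} ?P"
  proof (rule lipschitz_onI[OF _ B(1)])
    fix s t :: real assume "s \<in> {0..}" "t \<in> {0..}"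
    thus "dist (?P s) (?P t) \<le> B * dist s t"
      using lip[of s t] lip[of t s] by (cases "s \<le> t") (auto simp: dist_real_def abs_minus_commute)
  qed
  hence cont: "continuous_on {0..} ?P" by (rule lipschitz_on_continuous_on)
  define S where "S = ?P 0 / (real k * ln 2)"
  have P0: "0 \<le> ?P 0" using pressure_0_nonneg[OF assms(1,3,4)] .
  have S: "0 \<le> S" using P0 kl by (simp add: S_def)
  have "S * (real k * ln 2) = ?P 0" using assms(5) by (simp add: S_def)
  hence "?P S \<le> 0" using dec[of 0 S] S by (simp add: mult.assoc)
  moreover have "continuous_on {0..S} ?P" by (rule continuous_on_subset[OF cont]) auto
  ultimately obtain s where s: "0 \<le> s" "?P s = 0" using IVT2'[of ?P S 0 0] P0 S by auto
  have strict: "?P t < ?P s" if "0 \<le> s" "s < t" for s t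
  proof -
    have "0 < (t - s) * (real k * ln 2)" by (intro mult_pos_pos kl) (use that in simp)
    moreover have "?P t \<le> ?P s - (t - s) * (real k * ln 2)"
      using dec[of s "t - s"] that by (simp add: mult.assoc)
    ultimately show ?thesis by linarith
  qed
  show ?thesis
  proof (rule ex1I[of _ s])
    fix t assume "0 \<le> t \<and> ?P t = 0"
    thus "t = s" using s strict[of s t] strict[of t s] by (cases s t rule: linorder_cases) auto
  qed (use s in simp)
qed

text \<open>By monotonicity of the pressure, comparing \<open>s\<close> with the symbolic dimension amounts to looking at the
  sign of the pressure at \<open>s\<close>; the last part quantifies how positive it is below the dimension.\<close>
lemma symbolic_dimension_pressure:
  assumes "prob_space \<mu>" "sets \<mu> = sets borel" "finite A" "AE \<omega> in \<mu>. \<forall>j<k. \<omega> j \<in> A" "1 \<le> k"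
  defines "F \<equiv> {w. length w = k \<and> set w \<subseteq> A}" and "p \<equiv> \<lambda>w. measure \<mu> (cylinder w)"
  shows "0 \<le> symbolic_dimension T k \<mu>" "pressure (symbolic_dimension T k \<mu>) p F = 0"
    and "0 \<le> s \<Longrightarrow> 0 \<le> pressure s p F \<Longrightarrow> s \<le> symbolic_dimension T k \<mu>"
    and "0 \<le> s \<Longrightarrow> s \<le> symbolic_dimension T k \<mu> \<Longrightarrow>
           (symbolic_dimension T k \<mu> - s) * real k * ln 2 \<le> pressure s p F"
proof -
  note mi = marginal_integral[OF assms(1-4)]
  have fin: "finite F" unfolding F_def using assms(3) by (rule finite_words)
  have p: "sum p F = 1" "\<And>w. 0 \<le> p w" using mi(3) by (auto simp: p_def F_def)
  have len: "\<And>w. w \<in> F \<Longrightarrow> length w = k" by (simp add: F_def)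
  have "(\<Sum>\<^sub>\<infinity>w\<in>{w. length w = k}. p w * ln (\<phi> s w / p w)) = pressure s p F" for s
  proof -
    have "(\<Sum>\<^sub>\<infinity>w\<in>{w. length w = k}. p w * ln (\<phi> s w / p w)) = (\<Sum>\<^sub>\<infinity>w\<in>F. p w * ln (\<phi> s w / p w))"
      using mi(4) by (intro infsum_cong_neutral) (auto simp: F_def p_def)
    thus ?thesis using fin by (simp add: pressure_def)
  qed
  hence D: "symbolic_dimension T k \<mu> = (THE s. 0 \<le> s \<and> pressure s p F = 0)"
    by (simp add: symbolic_dimension_def p_def)
  have "0 \<le> symbolic_dimension T k \<mu> \<and> pressure (symbolic_dimension T k \<mu>) p F = 0"
    unfolding D by (rule theI') (rule pressure_root_exists[OF fin len p(2) p(1) assms(5)])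
  thus D0: "0 \<le> symbolic_dimension T k \<mu>" and D1: "pressure (symbolic_dimension T k \<mu>) p F = 0" by auto
  have dec: "pressure (s + h) p F \<le> pressure s p F - h * real k * ln 2" if "0 \<le> s" "0 \<le> h" for s h
    using pressure_add_le[OF len p(2) p(1) that] by simp
  { assume "0 \<le> s" "s \<le> symbolic_dimension T k \<mu>"
    thus "(symbolic_dimension T k \<mu> - s) * real k * ln 2 \<le> pressure s p F"
      using dec[of s "symbolic_dimension T k \<mu> - s"] D1 by simp }
  { assume "0 \<le> s" "0 \<le> pressure s p F"
    show "s \<le> symbolic_dimension T k \<mu>"
    proof (rule ccontr)
      assume nle: "\<not> ?thesis"
      hence "0 < (s - symbolic_dimension T k \<mu>) * real k * ln 2" using assms(5) by (simp add: mult_pos_pos)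
      thus False using dec[of "symbolic_dimension T k \<mu>" "s - symbolic_dimension T k \<mu>"] D0 D1 nle \<open>0 \<le> pressure s p F\<close>
        by simp
    qed }
qed

end

section \<open>Typical sequences\<close>

definition words_over :: "'a set \<Rightarrow> nat \<Rightarrow> 'a list set" where
  "words_over F N = {xs. set xs \<subseteq> F \<and> length xs = N}"

abbreviation weight :: "('a \<Rightarrow> real) \<Rightarrow> 'a list \<Rightarrow> real" where
  "weight p xs \<equiv> prod_list (map p xs)"

lemma words_over_0 [simp]: "words_over F 0 = {[]}"
  by (auto simp: words_over_def)

lemma finite_words_over [simp]: "finite F \<Longrightarrow> finite (words_over F N)"
  unfolding words_over_def by (rule finite_lists_length_eq)

lemma sum_words_over_Suc:
  assumes "finite F"
  shows "sum h (words_over F (Suc N)) = (\<Sum>x\<in>F. \<Sum>xs\<in>words_over F N. h (x # xs))"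
proof -
  have "words_over F (Suc N) = (\<lambda>(x, xs). x # xs) ` (F \<times> words_over F N)"
    by (auto simp: words_over_def length_Suc_conv image_iff)
  moreover have "inj_on (\<lambda>(x, xs). x # xs) (F \<times> words_over F N)" by (auto simp: inj_on_def)
  ultimately have "sum h (words_over F (Suc N)) = (\<Sum>(x, xs)\<in>F \<times> words_over F N. h (x # xs))"
    by (simp add: sum.reindex case_prod_unfold)
  thus ?thesis by (simp add: sum.cartesian_product)
qed

lemma sum_weight:
  assumes "finite F" "sum p F = 1"
  shows "(\<Sum>xs\<in>words_over F N. weight p xs) = 1"
proof (induction N)
  case (Suc N)
  have "(\<Sum>xs\<in>words_over F (Suc N). weight p xs) = (\<Sum>x\<in>F. p x * (\<Sum>xs\<in>words_over F N. weight p xs))"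
    by (simp add: sum_words_over_Suc assms sum_distrib_left)
  thus ?case using Suc assms by simp
qed simp

text \<open>\<open>weight p\<close> is the product of \<open>N\<close> copies of the probability vector \<open>p\<close>. Under it, the sum of \<open>f\<close> along
  a sequence has mean and variance as for independent variables.\<close>
lemma sum_weight_mean:
  assumes "finite F" "sum p F = 1" "(\<Sum>x\<in>F. p x * f x) = 0"
  shows "(\<Sum>xs\<in>words_over F N. weight p xs * sum_list (map f xs)) = 0"
proof (induction N)
  case (Suc N)
  have "(\<Sum>xs\<in>words_over F (Suc N). weight p xs * sum_list (map f xs)) =
      (\<Sum>x\<in>F. p x * f x * (\<Sum>xs\<in>words_over F N. weight p xs) +
              p x * (\<Sum>xs\<in>words_over F N. weight p xs * sum_list (map f xs)))"
    by (simp add: sum_words_over_Suc assms sum_distrib_left sum.distrib algebra_simps)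
  thus ?case using Suc assms by (simp add: sum_weight)
qed simp

lemma sum_weight_variance:
  assumes "finite F" "sum p F = 1" "(\<Sum>x\<in>F. p x * f x) = 0"
  shows "(\<Sum>xs\<in>words_over F N. weight p xs * (sum_list (map f xs))\<^sup>2) = real N * (\<Sum>x\<in>F. p x * (f x)\<^sup>2)"
proof (induction N)
  case (Suc N)
  have "(\<Sum>xs\<in>words_over F (Suc N). weight p xs * (sum_list (map f xs))\<^sup>2) =
      (\<Sum>x\<in>F. p x * (f x)\<^sup>2 * (\<Sum>xs\<in>words_over F N. weight p xs) +
        2 * (p x * f x) * (\<Sum>xs\<in>words_over F N. weight p xs * sum_list (map f xs)) +
        p x * (\<Sum>xs\<in>words_over F N. weight p xs * (sum_list (map f xs))\<^sup>2))"
    by (simp add: sum_words_over_Suc assms(1) sum_distrib_left sum.distrib power2_eq_square algebra_simps)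
  also have "\<dots> = (\<Sum>x\<in>F. p x * (f x)\<^sup>2 + p x * (real N * (\<Sum>x\<in>F. p x * (f x)\<^sup>2)))"
    by (simp add: sum_weight[OF assms(1,2)] sum_weight_mean[OF assms] Suc)
  also have "\<dots> = (\<Sum>x\<in>F. p x * (f x)\<^sup>2) + (\<Sum>x\<in>F. p x) * (real N * (\<Sum>x\<in>F. p x * (f x)\<^sup>2))"
    by (simp only: sum.distrib sum_distrib_right)
  also have "\<dots> = real (Suc N) * (\<Sum>x\<in>F. p x * (f x)\<^sup>2)"
    by (simp add: assms(2) algebra_simps)
  finally show ?case .
qed simp

lemma weight_nonneg: "(\<And>x. x \<in> set xs \<Longrightarrow> 0 \<le> p x) \<Longrightarrow> 0 \<le> weight p xs"
  by (induction xs) auto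

lemma sum_weight_chebyshev:
  assumes F: "finite F" "sum p F = 1" "\<And>x. x \<in> F \<Longrightarrow> 0 \<le> p x" and e: "0 < e" and N: "0 < N"
    and m: "m = (\<Sum>x\<in>F. p x * f x)"
  shows "(\<Sum>xs\<in>{xs\<in>words_over F N. \<bar>sum_list (map f xs) - real N * m\<bar> > real N * e}. weight p xs)
           \<le> (\<Sum>x\<in>F. p x * (f x - m)\<^sup>2) / (real N * e\<^sup>2)"
proof -
  let ?B = "{xs\<in>words_over F N. \<bar>sum_list (map f xs) - real N * m\<bar> > real N * e}"
  let ?g = "\<lambda>x. f x - m"
  have z: "(\<Sum>x\<in>F. p x * ?g x) = 0"
    using F(2) by (simp add: m right_diff_distrib sum_subtractf flip: sum_distrib_right)
  have s: "sum_list (map ?g xs) = sum_list (map f xs) - real N * m" if "xs \<in> words_over F N" for xs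
    using that by (simp add: words_over_def sum_list_subtractf sum_list_triv)
  have w: "0 \<le> weight p xs" if "xs \<in> words_over F N" for xs
    using that F(3) by (intro weight_nonneg) (auto simp: words_over_def)
  have "(real N * e)\<^sup>2 * (\<Sum>xs\<in>?B. weight p xs) = (\<Sum>xs\<in>?B. weight p xs * (real N * e)\<^sup>2)"
    by (simp add: sum_distrib_left mult.commute)
  also have "\<dots> \<le> (\<Sum>xs\<in>?B. weight p xs * (sum_list (map ?g xs))\<^sup>2)"
  proof (rule sum_mono, rule mult_left_mono)
    fix xs assume xs: "xs \<in> ?B"
    hence "\<bar>real N * e\<bar> \<le> \<bar>sum_list (map ?g xs)\<bar>" using s[of xs] e by auto
    thus "(real N * e)\<^sup>2 \<le> (sum_list (map ?g xs))\<^sup>2" by (simp only: abs_le_square_iff)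
    show "0 \<le> weight p xs" using xs w by auto
  qed
  also have "\<dots> \<le> (\<Sum>xs\<in>words_over F N. weight p xs * (sum_list (map ?g xs))\<^sup>2)"
    using F(1) w by (intro sum_mono2) auto
  also have "\<dots> = real N * (\<Sum>x\<in>F. p x * (?g x)\<^sup>2)"
    by (rule sum_weight_variance[OF F(1,2) z])
  finally have "(real N * e)\<^sup>2 * (\<Sum>xs\<in>?B. weight p xs) \<le> real N * (\<Sum>x\<in>F. p x * (?g x)\<^sup>2)" .
  moreover have "(real N * e)\<^sup>2 * (\<Sum>xs\<in>?B. weight p xs) = real N * (real N * e\<^sup>2 * (\<Sum>xs\<in>?B. weight p xs))"
    by (simp add: power2_eq_square)
  ultimately have "real N * (real N * e\<^sup>2 * (\<Sum>xs\<in>?B. weight p xs)) \<le> real N * (\<Sum>x\<in>F. p x * (?g x)\<^sup>2)"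
    by simp
  hence "real N * e\<^sup>2 * (\<Sum>xs\<in>?B. weight p xs) \<le> (\<Sum>x\<in>F. p x * (?g x)\<^sup>2)"
    using N by (simp only: mult_le_cancel_left_pos of_nat_0_less_iff)
  thus ?thesis using N e by (simp add: pos_le_divide_eq mult.commute)
qed

lemma sum_UN_le:
  fixes g :: "'a \<Rightarrow> real"
  assumes "finite J" "\<And>j. j \<in> J \<Longrightarrow> finite (B j)" "\<And>j x. j \<in> J \<Longrightarrow> x \<in> B j \<Longrightarrow> 0 \<le> g x"
  shows "sum g (\<Union>j\<in>J. B j) \<le> (\<Sum>j\<in>J. sum g (B j))"
  using assms
proof (induction J rule: finite_induct)
  case (insert i J)
  have "sum g (B i \<union> (\<Union>j\<in>J. B j)) + sum g (B i \<inter> (\<Union>j\<in>J. B j)) = sum g (B i) + sum g (\<Union>j\<in>J. B j)"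
    using insert by (intro sum.union_inter) auto
  moreover have "0 \<le> sum g (B i \<inter> (\<Union>j\<in>J. B j))" using insert.prems(2)[of i] by (intro sum_nonneg) auto
  moreover have "sum g (\<Union>j\<in>J. B j) \<le> (\<Sum>j\<in>J. sum g (B j))"
    by (rule insert.IH) (use insert.prems in auto)
  ultimately show ?case using insert.hyps by simp
qed simp

text \<open>The weak law of large numbers, simultaneously for finitely many functions: by Chebyshev, the
  exceptional sequences have total weight at most \<open>1/2\<close> as soon as \<open>N\<close> is large.\<close>
lemma typical_sequences:
  fixes f :: "'i \<Rightarrow> 'a \<Rightarrow> real"
  assumes F: "finite F" "sum p F = 1" "\<And>x. x \<in> F \<Longrightarrow> 0 \<le> p x" and e: "0 < e" and J: "finite J"
  shows "\<exists>N0. \<forall>N\<ge>N0. \<exists>G\<subseteq>words_over F N. 1/2 \<le> (\<Sum>xs\<in>G. weight p xs) \<and>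
    (\<forall>xs\<in>G. \<forall>j\<in>J. \<bar>sum_list (map (f j) xs) - real N * (\<Sum>x\<in>F. p x * f j x)\<bar> \<le> real N * e)"
proof -
  define m where "m j = (\<Sum>x\<in>F. p x * f j x)" for j
  define v where "v j = (\<Sum>x\<in>F. p x * (f j x - m j)\<^sup>2)" for j
  obtain N0 :: nat where N0: "2 * (\<Sum>j\<in>J. v j) / e\<^sup>2 < real N0" using reals_Archimedean2 by blast
  have "\<exists>G\<subseteq>words_over F N. 1/2 \<le> (\<Sum>xs\<in>G. weight p xs) \<and>
    (\<forall>xs\<in>G. \<forall>j\<in>J. \<bar>sum_list (map (f j) xs) - real N * m j\<bar> \<le> real N * e)" if N: "N \<ge> Suc N0" for N
  proof -
    let ?B = "\<lambda>j. {xs\<in>words_over F N. \<bar>sum_list (map (f j) xs) - real N * m j\<bar> > real N * e}"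
    let ?G = "words_over F N - (\<Union>j\<in>J. ?B j)"
    have w: "0 \<le> weight p xs" if "xs \<in> words_over F N" for xs
      using that F(3) by (intro weight_nonneg) (auto simp: words_over_def)
    have "(\<Sum>xs\<in>(\<Union>j\<in>J. ?B j). weight p xs) \<le> (\<Sum>j\<in>J. \<Sum>xs\<in>?B j. weight p xs)"
      using F(1) J w by (intro sum_UN_le) auto
    also have "\<dots> \<le> (\<Sum>j\<in>J. v j / (real N * e\<^sup>2))"
      using N unfolding v_def by (intro sum_mono sum_weight_chebyshev F e) (auto simp: m_def)
    also have "\<dots> = (\<Sum>j\<in>J. v j) / e\<^sup>2 / real N" by (simp add: sum_divide_distrib mult.commute)
    also have "\<dots> \<le> 1/2"
    proof -
      have half: "a / real N \<le> 1/2" if "2 * a < real N" for a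
        using that N by (simp add: field_simps)
      show ?thesis by (rule half) (use N0 N in simp)
    qed
    finally have "(\<Sum>xs\<in>(\<Union>j\<in>J. ?B j). weight p xs) \<le> 1/2" .
    moreover have "(\<Sum>xs\<in>?G. weight p xs) = 1 - (\<Sum>xs\<in>(\<Union>j\<in>J. ?B j). weight p xs)"
      using F(1) sum_weight[OF F(1,2), of N] by (subst sum_diff) auto
    ultimately have "1/2 \<le> (\<Sum>xs\<in>?G. weight p xs)" by linarith
    moreover have "\<bar>sum_list (map (f j) xs) - real N * m j\<bar> \<le> real N * e" if "xs \<in> ?G" "j \<in> J" for xs j
      using that by (auto simp: not_less)
    ultimately show ?thesis by (intro exI[of _ ?G]) blast
  qed
  thus ?thesis unfolding m_def by blast
qed

section \<open>Gluing words with connecting words\<close>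

text \<open>The connecting word may depend on everything that precedes it, since quasi-multiplicativity offers no
  uniform choice.\<close>
fun glue :: "(nat list \<Rightarrow> nat list \<Rightarrow> nat list) \<Rightarrow> nat list \<Rightarrow> nat list list \<Rightarrow> nat list" where
  "glue \<kappa> x [] = x"
| "glue \<kappa> x (y # ys) = glue \<kappa> (x @ \<kappa> x y @ y) ys"

lemma glue_append: "glue \<kappa> x (ys @ zs) = glue \<kappa> (glue \<kappa> x ys) zs"
  by (induction ys arbitrary: x) auto

lemma glue_prefix: "\<exists>z. glue \<kappa> x ys = x @ z"
proof (induction ys arbitrary: x)
  case (Cons y ys)
  obtain z where "glue \<kappa> (x @ \<kappa> x y @ y) ys = (x @ \<kappa> x y @ y) @ z" using Cons by blast
  thus ?case by simp
qed simp

lemma cylinder_append: "\<omega> \<in> cylinder (u @ v) \<longleftrightarrow> \<omega> \<in> cylinder u \<and> (shift ^^ length u) \<omega> \<in> cylinder v"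
proof
  assume "\<omega> \<in> cylinder (u @ v)"
  hence h: "\<And>i. i < length u + length v \<Longrightarrow> \<omega> i = (u @ v) ! i" by (simp add: cylinder_iff)
  show "\<omega> \<in> cylinder u \<and> (shift ^^ length u) \<omega> \<in> cylinder v"
    using h by (simp add: cylinder_iff shift_funpow nth_append)
next
  assume h: "\<omega> \<in> cylinder u \<and> (shift ^^ length u) \<omega> \<in> cylinder v"
  show "\<omega> \<in> cylinder (u @ v)"
    unfolding cylinder_iff
  proof (intro allI impI)
    fix i assume i: "i < length (u @ v)"
    show "\<omega> i = (u @ v) ! i"
    proof (cases "i < length u")
      case True thus ?thesis using h by (simp add: cylinder_iff nth_append)
    next
      case False
      hence e: "i - length u + length u = i" by simp
      have "i - length u < length v" using i False by auto
      hence "\<omega> (i - length u + length u) = v ! (i - length u)"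
        using h unfolding cylinder_iff shift_funpow by blast
      hence "\<omega> i = v ! (i - length u)" by (simp only: e)
      thus ?thesis using False by (simp add: nth_append)
    qed
  qed
qed

lemma glue_cylinder: "\<omega> \<in> cylinder (glue \<kappa> x ys) \<Longrightarrow> \<omega> \<in> cylinder x"
  using glue_prefix[of \<kappa> x ys] by (auto simp: cylinder_append)

lemma length_glue:
  assumes "\<And>u v. length (\<kappa> u v) \<le> K"
  shows "length x + sum_list (map length ys) \<le> length (glue \<kappa> x ys)"
    and "length (glue \<kappa> x ys) \<le> length x + sum_list (map length ys) + length ys * K"
proof (induction ys arbitrary: x)
  case (Cons y ys)
  { case 1 show ?case using Cons(1)[of "x @ \<kappa> x y @ y"] by simp }
  { case 2 show ?case using Cons(2)[of "x @ \<kappa> x y @ y"] assms[of x y] by simp }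
qed simp_all

text \<open>Once the lengths of the blocks are fixed, the sequence of the connecting words determines the blocks
  that are read off from \<open>\<omega>\<close>; so there are at most \<open>card \<Gamma>\<close> choices per block.\<close>
lemma card_glue_fibre:
  assumes G: "finite \<Gamma>" "\<And>u v. \<kappa> u v \<in> \<Gamma>"
  shows "finite {ys. map length ys = ls \<and> \<omega> \<in> cylinder (glue \<kappa> x ys)} \<and>
    card {ys. map length ys = ls \<and> \<omega> \<in> cylinder (glue \<kappa> x ys)} \<le> card \<Gamma> ^ length ls"
proof (induction ls arbitrary: x)
  case Nil
  have sub: "{ys. map length ys = [] \<and> \<omega> \<in> cylinder (glue \<kappa> x ys)} \<subseteq> {[]}" by auto
  show ?case using finite_subset[OF sub] card_mono[OF _ sub] by simp
next
  case (Cons l ls)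
  let ?S = "\<lambda>x ls. {ys. map length ys = ls \<and> \<omega> \<in> cylinder (glue \<kappa> x ys)}"
  define Y where "Y g = map \<omega> [length x + length g..<length x + length g + l]" for g :: "nat list"
  let ?U = "\<Union>g\<in>\<Gamma>. (#) (Y g) ` ?S (x @ g @ Y g) ls"
  have sub: "?S x (l # ls) \<subseteq> ?U"
  proof
    fix zs assume "zs \<in> ?S x (l # ls)"
    then obtain y ys where z: "zs = y # ys" "length y = l" "map length ys = ls"
      "\<omega> \<in> cylinder (glue \<kappa> (x @ \<kappa> x y @ y) ys)" by (cases zs) auto
    have "\<omega> \<in> cylinder (x @ \<kappa> x y @ y)" using z(4) by (rule glue_cylinder)
    hence "(shift ^^ length (x @ \<kappa> x y)) \<omega> \<in> cylinder y"
      using cylinder_append[of \<omega> "x @ \<kappa> x y" y] by simp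
    hence "y = Y (\<kappa> x y)" using z(2)
      by (intro nth_equalityI) (auto simp: Y_def cylinder_iff shift_funpow ac_simps)
    thus "zs \<in> ?U" using z G(2)[of x y] by (intro UN_I[of "\<kappa> x y"]) auto
  qed
  have fin: "finite ?U" using G(1) Cons by auto
  have "card (?S x (l # ls)) \<le> card ?U" by (rule card_mono[OF fin sub])
  also have "\<dots> \<le> (\<Sum>g\<in>\<Gamma>. card ((#) (Y g) ` ?S (x @ g @ Y g) ls))" by (rule card_UN_le[OF G(1)])
  also have "\<dots> \<le> (\<Sum>g\<in>\<Gamma>. card \<Gamma> ^ length ls)"
    using Cons card_image_le le_trans by (intro sum_mono) blast
  finally show ?case using finite_subset[OF sub fin] by simp
qed

text \<open>Every block contributes its own sum up to the distortion \<open>V\<close>, every connecting word at most \<open>E\<close>.\<close>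
lemma birkhoff_sum_glue:
  assumes G: "\<And>u v. \<kappa> u v \<in> \<Gamma>" and E: "\<And>g \<tau>. g \<in> \<Gamma> \<Longrightarrow> \<tau> \<in> cylinder g \<Longrightarrow> \<bar>birkhoff_sum f (length g) \<tau>\<bar> \<le> E"
    and V: "\<And>y \<tau>. y \<in> set ys \<Longrightarrow> \<tau> \<in> cylinder y \<Longrightarrow> \<bar>birkhoff_sum f (length y) \<tau> - h y\<bar> \<le> V"
    and w: "\<omega> \<in> cylinder (glue \<kappa> x ys)"
  shows "\<bar>birkhoff_sum f (length (glue \<kappa> x ys)) \<omega> - birkhoff_sum f (length x) \<omega> - sum_list (map h ys)\<bar>
           \<le> real (length ys) * (V + E)"
  using V w
proof (induction ys arbitrary: x)
  case (Cons y ys)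
  let ?g = "\<kappa> x y"
  let ?x = "x @ ?g @ y"
  have IH: "\<bar>birkhoff_sum f (length (glue \<kappa> ?x ys)) \<omega> - birkhoff_sum f (length ?x) \<omega> - sum_list (map h ys)\<bar>
      \<le> real (length ys) * (V + E)"
    by (rule Cons.IH) (use Cons.prems in auto)
  have c: "\<omega> \<in> cylinder ?x" using Cons.prems(2) glue_cylinder by simp
  have c1: "(shift ^^ length x) \<omega> \<in> cylinder ?g" and c2: "(shift ^^ length (x @ ?g)) \<omega> \<in> cylinder y"
    using c cylinder_append[of \<omega> "x @ ?g" y] cylinder_append[of \<omega> x "?g"] by simp_all
  have "birkhoff_sum f (length ?x) \<omega> = birkhoff_sum f (length (x @ ?g)) \<omega> + birkhoff_sum f (length y) ((shift ^^ length (x @ ?g)) \<omega>)"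
    using birkhoff_sum_add[of f "length (x @ ?g)" "length y" \<omega>] by (simp add: add.assoc)
  also have "birkhoff_sum f (length (x @ ?g)) \<omega> = birkhoff_sum f (length x) \<omega> + birkhoff_sum f (length ?g) ((shift ^^ length x) \<omega>)"
    using birkhoff_sum_add[of f "length x" "length ?g" \<omega>] by simp
  finally have "birkhoff_sum f (length ?x) \<omega> = birkhoff_sum f (length x) \<omega> +
      birkhoff_sum f (length ?g) ((shift ^^ length x) \<omega>) + birkhoff_sum f (length y) ((shift ^^ length (x @ ?g)) \<omega>)" .
  moreover have "\<bar>birkhoff_sum f (length ?g) ((shift ^^ length x) \<omega>)\<bar> \<le> E" by (rule E[OF G c1])
  moreover have "\<bar>birkhoff_sum f (length y) ((shift ^^ length (x @ ?g)) \<omega>) - h y\<bar> \<le> V"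
    by (rule Cons.prems(1)[OF _ c2]) simp
  moreover have "real (length (y # ys)) * (V + E) = real (length ys) * (V + E) + V + E" by (simp add: algebra_simps)
  ultimately show ?case using IH unfolding glue.simps list.map sum_list.Cons by linarith
qed simp

definition zero_extension :: "nat list \<Rightarrow> nat \<Rightarrow> nat" where
  "zero_extension w i = (if i < length w then w ! i else 0)"

lemma zero_extension_cylinder: "zero_extension w \<in> cylinder w"
  by (simp add: cylinder_iff zero_extension_def)

lemma prefix_zero_extension:
  assumes "length w \<le> q"
  shows "prefix_word (zero_extension w) q = w @ replicate (q - length w) 0"
  using assms by (intro nth_equalityI) (auto simp: zero_extension_def nth_append)

text \<open>For a map at most \<open>B\<close> to one, passing to the image loses at most the factor \<open>B\<close>.\<close>
lemma sum_image_fibres: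
  fixes g :: "'b \<Rightarrow> real"
  assumes "finite G" "\<And>y. 0 \<le> g y" "\<And>y. card {x\<in>G. h x = y} \<le> B"
  shows "(\<Sum>x\<in>G. g (h x)) \<le> real B * (\<Sum>y\<in>h ` G. g y)"
proof -
  have "(\<Sum>x\<in>G. g (h x)) = (\<Sum>y\<in>h ` G. \<Sum>x\<in>{x\<in>G. h x = y}. g (h x))"
    by (rule sum.image_gen[OF assms(1)])
  also have "\<dots> = (\<Sum>y\<in>h ` G. real (card {x\<in>G. h x = y}) * g y)" by (intro sum.cong) auto
  also have "\<dots> \<le> (\<Sum>y\<in>h ` G. real B * g y)" using assms by (intro sum_mono mult_right_mono) auto
  finally show ?thesis by (simp add: sum_distrib_left)
qed

lemma birkhoff_sum_letters_bound:
  assumes "\<And>\<tau>. \<tau> 0 \<in> A \<Longrightarrow> \<bar>f \<tau>\<bar> \<le> E" "\<And>i. i < n \<Longrightarrow> \<omega> i \<in> A"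
  shows "\<bar>birkhoff_sum f n \<omega>\<bar> \<le> real n * E"
proof -
  have "\<bar>birkhoff_sum f n \<omega>\<bar> \<le> (\<Sum>j<n. \<bar>f ((shift ^^ j) \<omega>)\<bar>)" unfolding birkhoff_sum_def by (rule sum_abs)
  also have "\<dots> \<le> (\<Sum>j<n. E)" using assms by (intro sum_mono) (simp add: shift_funpow)
  finally show ?thesis by simp
qed

lemma letters_bound:
  assumes V: "\<And>n \<omega> \<tau>. (\<And>i. i < n \<Longrightarrow> \<omega> i = \<tau> i) \<Longrightarrow> \<bar>birkhoff_sum f n \<omega> - birkhoff_sum f n \<tau>\<bar> \<le> V" and A: "finite A"
  shows "\<exists>E\<ge>0. \<forall>\<tau>. \<tau> 0 \<in> A \<longrightarrow> \<bar>f \<tau>\<bar> \<le> E"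
proof -
  define E where "E = (\<Sum>a\<in>A. \<bar>f (\<lambda>i. a)\<bar> + \<bar>V\<bar>)"
  have "\<bar>f \<tau>\<bar> \<le> E" if "\<tau> 0 \<in> A" for \<tau>
  proof -
    have "\<bar>f \<tau> - f (\<lambda>i. \<tau> 0)\<bar> \<le> V" using V[of 1 \<tau> "\<lambda>i. \<tau> 0"] by (simp add: birkhoff_sum_def)
    hence "\<bar>f \<tau>\<bar> \<le> \<bar>f (\<lambda>i. \<tau> 0)\<bar> + \<bar>V\<bar>" by linarith
    also have "\<dots> \<le> E" unfolding E_def using that A by (intro member_le_sum) auto
    finally show ?thesis .
  qed
  moreover have "0 \<le> E" by (auto simp: E_def intro: sum_nonneg)
  ultimately show ?thesis by blast
qed

context affine_family
begin

text \<open>The connecting words of quasi-multiplicativity as a function of the words to be connected, so that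
  gluing is deterministic. The constants depend on \<open>s\<close>.\<close>
definition connector :: "real \<Rightarrow> real \<Rightarrow> nat list set \<Rightarrow> (nat list \<Rightarrow> nat list \<Rightarrow> nat list) \<Rightarrow> bool" where
  "connector s c \<Gamma> \<kappa> \<longleftrightarrow> 1 \<le> c \<and> finite \<Gamma> \<and> (\<forall>u v. \<kappa> u v \<in> \<Gamma>) \<and>
     (\<forall>u v. u \<noteq> [] \<longrightarrow> v \<noteq> [] \<longrightarrow> \<phi> s u * \<phi> s v \<le> c * \<phi> s (u @ \<kappa> u v @ v))"

lemma connector_exists: "0 \<le> s \<Longrightarrow> \<exists>c \<Gamma> \<kappa>. connector s c \<Gamma> \<kappa>"
proof -
  assume s: "0 \<le> s"
  from word_svf_quasi_multiplicative[OF s] obtain c \<Gamma> where c: "1 \<le> c" "finite \<Gamma>" "\<Gamma> \<noteq> {}"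
    and qm': "\<forall>u v. u \<noteq> [] \<longrightarrow> v \<noteq> [] \<longrightarrow> (\<exists>w\<in>\<Gamma>. \<phi> s u * \<phi> s v \<le> c * \<phi> s (u @ w @ v))"
    by (elim exE conjE)
  define P where "P u v w \<longleftrightarrow> w \<in> \<Gamma> \<and> (u \<noteq> [] \<longrightarrow> v \<noteq> [] \<longrightarrow> \<phi> s u * \<phi> s v \<le> c * \<phi> s (u @ w @ v))" for u v w
  have "\<exists>w. P u v w" for u v
  proof (cases "u = [] \<or> v = []")
    case True
    thus ?thesis using c(3) by (auto simp: P_def)
  next
    case False
    then obtain w where "w \<in> \<Gamma>" "\<phi> s u * \<phi> s v \<le> c * \<phi> s (u @ w @ v)" using qm' by blast
    thus ?thesis by (auto simp: P_def)
  qed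
  hence P: "P u v (SOME w. P u v w)" for u v by (rule someI_ex)
  define \<kappa> where "\<kappa> u v = (SOME w. P u v w)" for u v
  have "\<And>u v. P u v (\<kappa> u v)" unfolding \<kappa>_def by (rule P)
  hence "connector s c \<Gamma> \<kappa>" using c(1,2) by (auto simp: connector_def P_def)
  thus ?thesis by blast
qed

lemma word_svf_glue:
  assumes "connector s c \<Gamma> \<kappa>" "0 \<le> s" "x \<noteq> []" "[] \<notin> set ys"
  shows "\<phi> s x * weight (\<phi> s) ys \<le> c ^ length ys * \<phi> s (glue \<kappa> x ys)"
  using assms(3,4)
proof (induction ys arbitrary: x)
  case (Cons y ys)
  have c: "0 \<le> c" using assms(1) by (simp add: connector_def)
  have "\<phi> s x * \<phi> s y \<le> c * \<phi> s (x @ \<kappa> x y @ y)"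
    using assms(1) Cons.prems by (auto simp: connector_def)
  moreover have "0 \<le> weight (\<phi> s) ys" using word_svf_pos[OF assms(2)] by (intro weight_nonneg) (auto intro: less_imp_le)
  ultimately have "\<phi> s x * \<phi> s y * weight (\<phi> s) ys \<le> c * \<phi> s (x @ \<kappa> x y @ y) * weight (\<phi> s) ys"
    by (intro mult_right_mono)
  also have "\<dots> \<le> c * (c ^ length ys * \<phi> s (glue \<kappa> (x @ \<kappa> x y @ y) ys))"
    unfolding mult.assoc using Cons c by (intro mult_left_mono Cons.IH) auto
  finally show ?case by (simp add: mult.assoc)
qed simp

text \<open>Glue the entries of \<open>N\<close>-fold sequences that are typical for the probability vector \<open>p\<close>, and pad by zeros
  up to the length \<open>q\<close>; then \<open>N = (q - 1) div (k + K)\<close> blocks always fit. For a typical sequence, \<open>\<phi>\<^sup>s\<close> of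
  the result is about its weight times \<open>exp (N * pressure)\<close>, and the weights add up to at least \<open>1/2\<close>.
  Gluing, its ambiguity and the padding cost a constant factor per block, however long the blocks are;
  the constant \<open>P0\<close> is the logarithm of this factor plus one. Hence the sum of \<open>\<phi>\<^sup>s\<close> over the words obtained
  grows exponentially in \<open>N\<close> as soon as the pressure exceeds \<open>P0\<close>.\<close>
lemma typical_words:
  fixes f :: "nat \<Rightarrow> (nat \<Rightarrow> nat) \<Rightarrow> real"
  assumes s: "0 \<le> s"
    and distortion: "\<forall>i<m. \<forall>n \<omega> \<tau>. (\<forall>j<n. \<omega> j = \<tau> j) \<longrightarrow> \<bar>birkhoff_sum (f i) n \<omega> - birkhoff_sum (f i) n \<tau>\<bar> \<le> V"
  shows "\<exists>P0 K E. 0 \<le> E \<and> (\<forall>k F p. 1 \<le> k \<longrightarrow> finite F \<longrightarrow> (\<forall>w\<in>F. length w = k \<and> 0 < p w) \<longrightarrow> sum p F = 1 \<longrightarrow>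
     P0 < pressure s p F \<longrightarrow> (\<forall>\<epsilon>>0. \<forall>B. \<exists>q0. \<forall>q\<ge>q0. \<exists>W. finite W \<and> (\<forall>v\<in>W. length v = q) \<and> B \<le> sum (\<phi> s) W \<and>
       (\<forall>v\<in>W. \<forall>\<omega>\<in>cylinder v. \<forall>i<m.
          \<bar>birkhoff_sum (f i) q \<omega> - real ((q - 1) div (k + K)) * (\<Sum>w\<in>F. p w * birkhoff_sum (f i) k (zero_extension w))\<bar>
            \<le> real ((q - 1) div (k + K)) * (\<epsilon> + V) + (2 * real ((q - 1) div (k + K)) * real K + real k + real K) * E)))"
proof -
  have V: "\<bar>birkhoff_sum (f i) n \<omega> - birkhoff_sum (f i) n \<tau>\<bar> \<le> V" if "i < m" "\<And>j. j < n \<Longrightarrow> \<omega> j = \<tau> j" for i n \<omega> \<tau>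
    using distortion that by blast
  obtain c \<Gamma> \<kappa> where con: "connector s c \<Gamma> \<kappa>" using connector_exists[OF s] by blast
  have c: "1 \<le> c" and G: "finite \<Gamma>" and kG: "\<kappa> u v \<in> \<Gamma>" for u v using con by (auto simp: connector_def)
  define A where "A = insert 0 (\<Union>(set ` \<Gamma>))"
  have A: "finite A" using G by (auto simp: A_def)
  have "\<exists>E\<ge>0. \<forall>\<tau>. \<tau> 0 \<in> A \<longrightarrow> \<bar>f i \<tau>\<bar> \<le> E" if "i < m" for i
    by (rule letters_bound[OF V[OF that] A])
  hence "\<forall>i. \<exists>E. i < m \<longrightarrow> 0 \<le> E \<and> (\<forall>\<tau>. \<tau> 0 \<in> A \<longrightarrow> \<bar>f i \<tau>\<bar> \<le> E)" by blast
  from choice[OF this] obtain E' where E': "\<And>i. i < m \<Longrightarrow> 0 \<le> E' i" "\<And>i \<tau>. i < m \<Longrightarrow> \<tau> 0 \<in> A \<Longrightarrow> \<bar>f i \<tau>\<bar> \<le> E' i"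
    by blast
  define E where "E = (\<Sum>i<m. E' i)"
  have E0: "0 \<le> E" unfolding E_def by (intro sum_nonneg) (auto intro: E')
  have E: "\<bar>f i \<tau>\<bar> \<le> E" if "i < m" "\<tau> 0 \<in> A" for i \<tau>
  proof -
    have "E' i \<le> E" unfolding E_def using that(1) E'(1) by (intro member_le_sum) auto
    moreover have "\<bar>f i \<tau>\<bar> \<le> E' i" by (rule E'(2)) (use that in auto)
    ultimately show ?thesis by linarith
  qed
  define K where "K = (\<Sum>g\<in>\<Gamma>. length g)"
  have K: "length g \<le> K" if "g \<in> \<Gamma>" for g unfolding K_def using that G by (intro member_le_sum) auto
  obtain b where b: "0 < b" "b \<le> 1" "\<And>u v. set v \<subseteq> {0} \<Longrightarrow> \<phi> s u * b ^ length v \<le> \<phi> s (u @ v)"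
    using word_svf_append_ge[of "{0}", OF _ s] by blast
  have cG: "1 \<le> real (card \<Gamma>)" using kG[of "[]" "[]"] G card_gt_0_iff[of \<Gamma>] by fastforce
  define P0 where "P0 = ln c + ln (real (card \<Gamma>)) + real K * ln (1 / b) + 1"
  have Ebound: "\<bar>birkhoff_sum (f i) (length g) \<tau>\<bar> \<le> real K * E" if "i < m" "g \<in> \<Gamma>" "\<tau> \<in> cylinder g" for i g \<tau>
  proof -
    have "\<bar>birkhoff_sum (f i) (length g) \<tau>\<bar> \<le> real (length g) * E"
    proof (rule birkhoff_sum_letters_bound[where A = A])
      show "\<bar>f i \<tau>\<bar> \<le> E" if "\<tau> 0 \<in> A" for \<tau> using E \<open>i < m\<close> that by blast
      show "\<tau> j \<in> A" if "j < length g" for j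
        using that \<open>g \<in> \<Gamma>\<close> \<open>\<tau> \<in> cylinder g\<close> by (force simp: A_def cylinder_iff)
    qed
    also have "\<dots> \<le> real K * E" using K[OF that(2)] E0 by (intro mult_right_mono) auto
    finally show ?thesis .
  qed
  have main: "\<exists>q0. \<forall>q\<ge>q0. \<exists>W. finite W \<and> (\<forall>v\<in>W. length v = q) \<and> B \<le> sum (\<phi> s) W \<and>
       (\<forall>v\<in>W. \<forall>\<omega>\<in>cylinder v. \<forall>i<m.
          \<bar>birkhoff_sum (f i) q \<omega> - real ((q - 1) div (k + K)) * (\<Sum>w\<in>F. p w * birkhoff_sum (f i) k (zero_extension w))\<bar>
            \<le> real ((q - 1) div (k + K)) * (\<epsilon> + V) + (2 * real ((q - 1) div (k + K)) * real K + real k + real K) * E)"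
    if k: "1 \<le> k" and F: "finite F" and Fw: "\<forall>w\<in>F. length w = k \<and> 0 < p w" and p: "sum p F = 1"
      and P: "P0 < pressure s p F" and eps: "0 < \<epsilon>" for k F p \<epsilon> B
  proof -
    define g where "g w = ln (\<phi> s w / p w)" for w
    \<comment> \<open>Index \<open>m\<close> stands for the integrand of the pressure.\<close>
    define h where "h i w = (if i < m then birkhoff_sum (f i) k (zero_extension w) else g w)" for i w
    define e where "e = min \<epsilon> (1/2)"
    have e: "0 < e" "e \<le> \<epsilon>" "e \<le> 1/2" using eps by (auto simp: e_def)
    obtain N0 where N0: "\<And>N. N0 \<le> N \<Longrightarrow> \<exists>G\<subseteq>words_over F N. 1/2 \<le> (\<Sum>xs\<in>G. weight p xs) \<and>
       (\<forall>xs\<in>G. \<forall>j\<in>{..m}. \<bar>sum_list (map (h j) xs) - real N * (\<Sum>x\<in>F. p x * h j x)\<bar> \<le> real N * e)"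
      using typical_sequences[OF F p _ e(1), of "{..m}" h] Fw less_imp_le by blast
    \<comment> \<open>\<open>b ^ (k + K)\<close> pays for the part of the padding that does not grow with \<open>N\<close>; the factor 1/2 is the total weight of the typical sequences.\<close>
    define c0 where "c0 = \<phi> s [0] * b ^ (k + K) / 2"
    have c0: "0 < c0" using word_svf_pos[OF s] b by (simp add: c0_def)
    obtain N1 :: nat where N1: "B / c0 < real N1" using reals_Archimedean2 by blast
    define N2 where "N2 = max N0 (2 * N1)"
    have N2: "N0 \<le> N2" "2 * N1 \<le> N2" by (auto simp: N2_def)
    show ?thesis
    proof (intro exI[of _ "N2 * (k + K) + 1"] allI impI)
      fix q assume q: "N2 * (k + K) + 1 \<le> q"
      define N where "N = (q - 1) div (k + K)"
      have "N2 * (k + K) \<le> q - 1" using q by simp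
      hence N: "N2 \<le> N" unfolding N_def using k div_le_mono[of "N2 * (k + K)" "q - 1" "k + K"] by simp
      have Nq: "N * (k + K) \<le> q - 1" by (simp add: N_def)
      have q1: "1 \<le> q" using q by simp
      have "q - 1 < (N + 1) * (k + K)" unfolding N_def using k dividend_less_div_times[of "k + K" "q - 1"]
        by (simp add: algebra_simps)
      hence qN: "q \<le> N * k + N * K + k + K" by (simp add: algebra_simps)
      obtain G where Gs: "G \<subseteq> words_over F N" "1/2 \<le> (\<Sum>xs\<in>G. weight p xs)"
        and Gt: "\<And>xs j. xs \<in> G \<Longrightarrow> j \<le> m \<Longrightarrow> \<bar>sum_list (map (h j) xs) - real N * (\<Sum>x\<in>F. p x * h j x)\<bar> \<le> real N * e"
        using N0[of N] N N2 by auto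
      have finG: "finite G" using Gs(1) F finite_subset by (metis finite_words_over)
      \<comment> \<open>Gluing starts from \<open>[0]\<close>, as quasi-multiplicativity concerns non-empty words only.\<close>
      define ext where "ext xs = prefix_word (zero_extension (glue \<kappa> [0] xs)) q" for xs
      have xs: "set xs \<subseteq> F" "length xs = N" "map length xs = replicate N k" "[] \<notin> set xs" if "xs \<in> G" for xs
      proof -
        show 1: "set xs \<subseteq> F" "length xs = N" using that Gs(1) by (auto simp: words_over_def)
        show "map length xs = replicate N k" using 1 Fw by (intro replicate_eqI) auto
        show "[] \<notin> set xs" using 1 Fw k by force
      qed
      have len: "1 + N * k \<le> length (glue \<kappa> [0] xs)" "length (glue \<kappa> [0] xs) \<le> q" if "xs \<in> G" for xs
      proof -
        have sl: "sum_list (map length xs) = N * k" using xs(3)[OF that] by (simp add: sum_list_replicate)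
        have kl: "\<And>u v. length (\<kappa> u v) \<le> K" using K kG by blast
        show "1 + N * k \<le> length (glue \<kappa> [0] xs)" using length_glue(1)[of \<kappa> K "[0]" xs, OF kl] sl by simp
        have "length (glue \<kappa> [0] xs) \<le> 1 + N * k + N * K"
          using length_glue(2)[of \<kappa> K "[0]" xs, OF kl] sl xs(2)[OF that] by simp
        also have "\<dots> = 1 + N * (k + K)" by (simp add: distrib_left)
        also have "\<dots> \<le> q" using Nq q1 by linarith
        finally show "length (glue \<kappa> [0] xs) \<le> q" .
      qed
      have ext: "ext xs = glue \<kappa> [0] xs @ replicate (q - length (glue \<kappa> [0] xs)) 0" if "xs \<in> G" for xs
        unfolding ext_def by (rule prefix_zero_extension[OF len(2)[OF that]])
      have fib: "card {xs\<in>G. ext xs = v} \<le> card \<Gamma> ^ N" for v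
      proof -
        have "{xs\<in>G. ext xs = v} \<subseteq> {ys. map length ys = replicate N k \<and> zero_extension v \<in> cylinder (glue \<kappa> [0] ys)}"
        proof
          fix ys assume ys: "ys \<in> {xs\<in>G. ext xs = v}"
          have "zero_extension v \<in> cylinder v" by (rule zero_extension_cylinder)
          hence "zero_extension v \<in> cylinder (glue \<kappa> [0] ys)" using ys ext[of ys] by (auto simp: cylinder_append)
          thus "ys \<in> {ys. map length ys = replicate N k \<and> zero_extension v \<in> cylinder (glue \<kappa> [0] ys)}"
            using ys xs(3) by auto
        qed
        hence "card {xs\<in>G. ext xs = v} \<le> card {ys. map length ys = replicate N k \<and> zero_extension v \<in> cylinder (glue \<kappa> [0] ys)}"
          by (rule card_mono[OF conjunct1[OF card_glue_fibre[OF G kG]]])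
        also have "\<dots> \<le> card \<Gamma> ^ length (replicate N k)" by (rule conjunct2[OF card_glue_fibre[OF G kG]])
        finally show ?thesis by simp
      qed
      have hm: "h m = g" by (simp add: h_def fun_eq_iff)
      have Pm: "(\<Sum>x\<in>F. p x * h m x) = pressure s p F" by (simp add: hm g_def pressure_def)
      define D where "D = 2 * c0 * real (card \<Gamma>) ^ N * exp (real N / 2)"
      have each: "weight p xs * D \<le> \<phi> s (ext xs)" if xG: "xs \<in> G" for xs
      proof -
        let ?L = "length (glue \<kappa> [0] xs)"
        have wp: "weight (\<phi> s) xs = weight p xs * exp (sum_list (map g xs))"
          using xs(1)[OF xG]
        proof (induction xs)
          case (Cons w xs)
          have "0 < p w" "0 < \<phi> s w" using Cons Fw word_svf_pos[OF s] by auto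
          hence "p w * exp (g w) = \<phi> s w" by (simp add: g_def)
          thus ?case using Cons by (simp add: exp_add)
        qed simp
        have w0: "0 \<le> weight p xs" using xs(1)[OF xG] Fw by (intro weight_nonneg) (auto intro: less_imp_le)
        have "\<bar>sum_list (map g xs) - real N * pressure s p F\<bar> \<le> real N * e"
          using Gt[OF xG, of m] Pm by (simp add: hm)
        moreover have "real N * e \<le> real N * (1/2)" using e by (intro mult_left_mono) auto
        moreover have "real N * P0 \<le> real N * pressure s p F" using P by (intro mult_left_mono) auto
        ultimately have "real N * P0 - real N * (1/2) \<le> sum_list (map g xs)" by linarith
        hence "exp (real N * (P0 - 1/2)) \<le> exp (sum_list (map g xs))" by (simp add: right_diff_distrib)
        moreover have "exp (real N * (P0 - 1/2)) = (c * real (card \<Gamma>) * (1 / b) ^ K) ^ N * exp (real N / 2)"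
        proof -
          have "exp (real N * (P0 - 1/2)) = exp (real N * (ln c + ln (real (card \<Gamma>)) + real K * ln (1 / b)) + real N / 2)"
            by (simp add: P0_def algebra_simps)
          also have "\<dots> = exp (ln c + ln (real (card \<Gamma>)) + real K * ln (1 / b)) ^ N * exp (real N / 2)"
            by (simp add: exp_add exp_of_nat_mult)
          also have "exp (ln c + ln (real (card \<Gamma>)) + real K * ln (1 / b)) = c * real (card \<Gamma>) * (1 / b) ^ K"
            using c cG b by (simp add: exp_add exp_of_nat_mult)
          finally show ?thesis .
        qed
        ultimately have ex: "(c * real (card \<Gamma>) * (1 / b) ^ K) ^ N * exp (real N / 2) \<le> exp (sum_list (map g xs))" by simp
        have "\<phi> s [0] * weight (\<phi> s) xs \<le> c ^ N * \<phi> s (glue \<kappa> [0] xs)"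
          using word_svf_glue[OF con s _ xs(4)[OF xG], of "[0]"] xs(2)[OF xG] by simp
        moreover have "\<phi> s [0] * (weight p xs * ((c * real (card \<Gamma>) * (1 / b) ^ K) ^ N * exp (real N / 2)))
            \<le> \<phi> s [0] * (weight p xs * exp (sum_list (map g xs)))"
          by (intro mult_left_mono ex w0 less_imp_le[OF word_svf_pos[OF s]])
        ultimately have "\<phi> s [0] * (weight p xs * ((c * real (card \<Gamma>) * (1 / b) ^ K) ^ N * exp (real N / 2))) \<le> c ^ N * \<phi> s (glue \<kappa> [0] xs)"
          unfolding wp by linarith
        hence "c ^ N * (\<phi> s [0] * weight p xs * (real (card \<Gamma>) ^ N * (1 / b) ^ (K * N) * exp (real N / 2))) \<le> c ^ N * \<phi> s (glue \<kappa> [0] xs)"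
          by (simp add: power_mult_distrib power_mult mult_ac)
        hence gl: "\<phi> s [0] * weight p xs * (real (card \<Gamma>) ^ N * (1 / b) ^ (K * N) * exp (real N / 2)) \<le> \<phi> s (glue \<kappa> [0] xs)"
          using c by (subst (asm) mult_le_cancel_left_pos) auto
        have "weight p xs * D = \<phi> s [0] * weight p xs * (real (card \<Gamma>) ^ N * (1 / b) ^ (K * N) * exp (real N / 2)) * b ^ (K * N + k + K)"
          using b by (simp add: D_def c0_def power_add power_divide)
        also have "\<dots> \<le> \<phi> s (glue \<kappa> [0] xs) * b ^ (q - ?L)"
        proof (intro mult_mono gl power_decreasing)
          show "q - ?L \<le> K * N + k + K" using qN len(1)[OF xG] by (simp add: mult.commute)
        qed (use b word_svf_pos[OF s, of "glue \<kappa> [0] xs"] in auto)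
        also have "\<dots> \<le> \<phi> s (ext xs)"
          using b(3)[of "replicate (q - ?L) 0" "glue \<kappa> [0] xs"] ext[OF xG] by (simp add: set_replicate_conv_if)
        finally show ?thesis .
      qed
      have D0: "0 \<le> D" using c0 by (simp add: D_def)
      have "1/2 * D \<le> (\<Sum>xs\<in>G. weight p xs) * D" using Gs(2) D0 by (intro mult_right_mono)
      also have "\<dots> \<le> (\<Sum>xs\<in>G. \<phi> s (ext xs))" unfolding sum_distrib_right using each by (intro sum_mono)
      also have "\<dots> \<le> real (card \<Gamma> ^ N) * sum (\<phi> s) (ext ` G)"
        using fib by (intro sum_image_fibres finG) (auto intro: less_imp_le word_svf_pos[OF s])
      finally have "real (card \<Gamma>) ^ N * (c0 * exp (real N / 2)) \<le> real (card \<Gamma>) ^ N * sum (\<phi> s) (ext ` G)"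
        by (simp add: D_def mult_ac)
      hence sumW: "c0 * exp (real N / 2) \<le> sum (\<phi> s) (ext ` G)"
        using cG by (subst (asm) mult_le_cancel_left_pos) auto
      have "B \<le> c0 * real N1" using N1 c0 by (simp add: pos_divide_less_eq mult.commute)
      also have "real N1 \<le> exp (real N / 2)"
      proof -
        have "real (2 * N1) \<le> real N" using N N2 by (simp only: of_nat_le_iff)
        moreover have "1 + real N / 2 \<le> exp (real N / 2)" by (rule exp_ge_add_one_self)
        ultimately show ?thesis by linarith
      qed
      finally have "B \<le> sum (\<phi> s) (ext ` G)" using sumW c0 by simp
      moreover have "\<bar>birkhoff_sum (f i) q \<omega> - real N * (\<Sum>w\<in>F. p w * birkhoff_sum (f i) k (zero_extension w))\<bar>
            \<le> real N * (\<epsilon> + V) + (2 * real N * real K + real k + real K) * E"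
        if xG: "xs \<in> G" and w: "\<omega> \<in> cylinder (ext xs)" and i: "i < m" for xs \<omega> i
      proof -
        let ?L = "length (glue \<kappa> [0] xs)" and ?h = "\<lambda>w. birkhoff_sum (f i) k (zero_extension w)"
        have w1: "\<omega> \<in> cylinder (glue \<kappa> [0] xs)" and w2: "(shift ^^ ?L) \<omega> \<in> cylinder (replicate (q - ?L) 0)"
          using w unfolding ext[OF xG] cylinder_append by auto
        have w0: "\<omega> \<in> cylinder [0]" using w1 by (rule glue_cylinder)
        have 1: "\<bar>birkhoff_sum (f i) ?L \<omega> - birkhoff_sum (f i) (length [0::nat]) \<omega> - sum_list (map ?h xs)\<bar> \<le> real (length xs) * (V + real K * E)"
        proof (rule birkhoff_sum_glue[of \<kappa> \<Gamma>, OF kG _ _ w1])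
          show "\<bar>birkhoff_sum (f i) (length g) \<tau>\<bar> \<le> real K * E" if "g \<in> \<Gamma>" "\<tau> \<in> cylinder g" for g \<tau>
            using Ebound[OF i that] .
          show "\<bar>birkhoff_sum (f i) (length y) \<tau> - ?h y\<bar> \<le> V" if "y \<in> set xs" "\<tau> \<in> cylinder y" for y \<tau>
          proof -
            have "length y = k" using that xs(1)[OF xG] Fw by auto
            thus ?thesis using V[OF i, of k \<tau> "zero_extension y"] that(2) by (simp add: cylinder_iff zero_extension_def)
          qed
        qed
        have 2: "\<bar>birkhoff_sum (f i) (length [0::nat]) \<omega>\<bar> \<le> real 1 * E"
          using birkhoff_sum_letters_bound[of A "f i" E 1 \<omega>] E[OF i] w0 by (simp add: cylinder_iff A_def)
        have 3: "\<bar>birkhoff_sum (f i) (q - ?L) ((shift ^^ ?L) \<omega>)\<bar> \<le> real (q - ?L) * E"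
          using birkhoff_sum_letters_bound[of A "f i" E "q - ?L" "(shift ^^ ?L) \<omega>"] E[OF i] w2 by (simp add: cylinder_iff A_def)
        have 4: "birkhoff_sum (f i) q \<omega> = birkhoff_sum (f i) ?L \<omega> + birkhoff_sum (f i) (q - ?L) ((shift ^^ ?L) \<omega>)"
          using birkhoff_sum_add[of "f i" ?L "q - ?L" \<omega>] len(2)[OF xG] by simp
        have "\<bar>sum_list (map ?h xs) - real N * (\<Sum>x\<in>F. p x * ?h x)\<bar> \<le> real N * e"
        proof -
          have "h i = ?h" using i by (simp add: h_def fun_eq_iff)
          thus ?thesis using Gt[OF xG, of i] i by simp
        qed
        moreover have "real N * e \<le> real N * \<epsilon>" using e by (intro mult_left_mono) auto
        ultimately have 5: "\<bar>sum_list (map ?h xs) - real N * (\<Sum>x\<in>F. p x * ?h x)\<bar> \<le> real N * \<epsilon>" by linarith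
        have "1 + (q - ?L) \<le> N * K + k + K" using qN len[OF xG] by linarith
        hence "real (1 + (q - ?L)) * E \<le> real (N * K + k + K) * E" using E0 by (intro mult_right_mono) (simp_all only: of_nat_le_iff)
        moreover have "real (1 + (q - ?L)) * E = real 1 * E + real (q - ?L) * E" by (simp only: of_nat_add distrib_right)
        ultimately have 6: "real 1 * E + real (q - ?L) * E \<le> real (N * K + k + K) * E" by linarith
        have 7: "real (length xs) * (V + real K * E) = real N * V + real N * real K * E"
          using xs(2)[OF xG] by (simp add: algebra_simps)
        have 8: "real N * (\<epsilon> + V) + (2 * real N * real K + real k + real K) * E =
           real N * \<epsilon> + (real N * V + real N * real K * E) + real (N * K + k + K) * E"
          by (simp add: algebra_simps)
        show ?thesis unfolding 8 using 1 2 3 4 5 6 unfolding 7 by linarith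
      qed
      ultimately show "\<exists>W. finite W \<and> (\<forall>v\<in>W. length v = q) \<and> B \<le> sum (\<phi> s) W \<and>
       (\<forall>v\<in>W. \<forall>\<omega>\<in>cylinder v. \<forall>i<m.
          \<bar>birkhoff_sum (f i) q \<omega> - real ((q - 1) div (k + K)) * (\<Sum>w\<in>F. p w * birkhoff_sum (f i) k (zero_extension w))\<bar>
            \<le> real ((q - 1) div (k + K)) * (\<epsilon> + V) + (2 * real ((q - 1) div (k + K)) * real K + real k + real K) * E)"
        unfolding N_def[symmetric] using finG
        by (intro exI[of _ "ext ` G"]) (auto simp: ext_def)
    qed
  qed
  show ?thesis
    by (rule exI[of _ P0], rule exI[of _ K], rule exI[of _ E]) (intro conjI E0 allI impI main)
qed

end

section \<open>Neighbourhoods of the target values\<close>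

lemma open_target_nhd: "open (target_nhd n \<beta>)"
  unfolding target_nhd_def by (cases \<beta>) auto

lemma convex_target_nhd: "convex (target_nhd n \<beta>)"
  unfolding target_nhd_def by (cases \<beta>) auto

text \<open>Membership in the interior with a quantified distance to the boundary; for convex sets the distance
  survives mixing.\<close>
definition margin :: "real \<Rightarrow> real set \<Rightarrow> real \<Rightarrow> bool" where
  "margin r T x \<longleftrightarrow> (\<forall>u. \<bar>u\<bar> \<le> r \<longrightarrow> x + u \<in> T)"

lemma margin_exists:
  assumes "open T" "x \<in> T"
  shows "\<exists>r>0. margin r T x"
proof -
  obtain e where "0 < e" "cball x e \<subseteq> T" using open_contains_cball assms by blast
  moreover from this have "margin e T x" by (auto simp: margin_def subset_iff dist_real_def)
  ultimately show ?thesis by blast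
qed

lemma margin_mono: "margin r T x \<Longrightarrow> r' \<le> r \<Longrightarrow> margin r' T x"
  by (auto simp: margin_def)

lemma margin_mix:
  assumes "convex T" "x \<in> T" "margin r T y" "0 < e" "e \<le> 1"
  shows "margin (e * r) T ((1 - e) * x + e * y)"
  unfolding margin_def
proof (intro allI impI)
  fix u :: real assume u: "\<bar>u\<bar> \<le> e * r"
  have "\<bar>u / e\<bar> \<le> r" using u assms(4) by (simp add: abs_divide pos_divide_le_eq mult.commute)
  hence "y + u / e \<in> T" using assms(3) by (simp add: margin_def)
  hence "(1 - e) *\<^sub>R x + e *\<^sub>R (y + u / e) \<in> T" using assms by (intro convexD) auto
  moreover have "(1 - e) *\<^sub>R x + e *\<^sub>R (y + u / e) = (1 - e) * x + e * y + u"
    using assms(4) by (simp add: distrib_left)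
  ultimately show "(1 - e) * x + e * y + u \<in> T" by (simp add: add.assoc)
qed

lemma margin_convex:
  assumes "convex T" "margin r T x" "margin r T y" "0 \<le> a" "a \<le> 1"
  shows "margin r T (a * x + (1 - a) * y)"
  unfolding margin_def
proof (intro allI impI)
  fix u :: real assume "\<bar>u\<bar> \<le> r"
  hence "x + u \<in> T" "y + u \<in> T" using assms by (auto simp: margin_def)
  hence "a *\<^sub>R (x + u) + (1 - a) *\<^sub>R (y + u) \<in> T" using assms by (intro convexD) auto
  moreover have "a *\<^sub>R (x + u) + (1 - a) *\<^sub>R (y + u) = a * x + (1 - a) * y + u" by (simp add: algebra_simps)
  ultimately show "a * x + (1 - a) * y + u \<in> T" by simp
qed

section \<open>Averaging an invariant measure\<close>

lemma sum_periodic: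
  fixes a :: "nat \<Rightarrow> real"
  assumes "\<And>i. a (i + k) = a i"
  shows "(\<Sum>j<k. a (i + j)) = (\<Sum>j<k. a j)"
proof (induction i)
  case (Suc i)
  have "(\<Sum>j<k. a (Suc i + j)) + a i = (\<Sum>j<Suc k. a (i + j))"
    by (subst sum.lessThan_Suc_shift) simp
  also have "\<dots> = (\<Sum>j<k. a (i + j)) + a i" using assms[of i] by simp
  finally show ?case using Suc by simp
qed simp

text \<open>If a measure is invariant under \<open>\<sigma>\<^sup>k\<^sup>0\<close> only, then the mean of a potential along the first \<open>k\<close> letters
  depends on \<open>k\<close>. But \<open>(1/k0) \<Sum>j<k0. \<mu> \<circ> \<sigma>\<^sup>-\<^sup>j\<close> is shift-invariant; its marginals \<open>Q k\<close> give the potentials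
  the same mean for every \<open>k\<close>, up to the distortion, and they live on a fixed finite alphabet.\<close>
lemma averaged_marginal:
  assumes mu: "\<mu> \<in> compact_invariant_measures k0" and k0: "1 \<le> k0"
  shows "\<exists>A Q. finite A \<and> (\<forall>k\<ge>1. (\<forall>w. 0 \<le> Q k w) \<and> (\<forall>w. length w = k \<longrightarrow> \<not> set w \<subseteq> A \<longrightarrow> Q k w = 0) \<and>
     sum (Q k) {w. length w = k \<and> set w \<subseteq> A} = 1 \<and>
     (\<forall>f V. f \<in> borel_measurable borel \<longrightarrow>
        (\<forall>n \<omega> \<tau>. (\<forall>j<n. \<omega> j = \<tau> j) \<longrightarrow> \<bar>birkhoff_sum f n \<omega> - birkhoff_sum f n \<tau>\<bar> \<le> V) \<longrightarrow>
        \<bar>(\<Sum>w\<in>{w. length w = k \<and> set w \<subseteq> A}. Q k w * birkhoff_sum f k (zero_extension w))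
           - real k * (\<integral>\<omega>. birkhoff_average k0 f \<omega> \<partial>\<mu>)\<bar> \<le> V))"
proof -
  from mu obtain Kc where P: "prob_space \<mu>" and sets: "sets \<mu> = sets borel" and inv: "distr \<mu> \<mu> (shift ^^ k0) = \<mu>"
    and Kc: "compact Kc" "emeasure \<mu> (- Kc) = 0" unfolding compact_invariant_measures_def by blast
  interpret prob_space \<mu> by fact
  note [measurable_cong] = sets
  have shm [measurable]: "(shift ^^ j) \<in> \<mu> \<rightarrow>\<^sub>M borel" for j
    using shift_funpow_measurable[of j] by (simp add: measurable_cong_sets[OF sets refl])
  have shm' [measurable]: "(shift ^^ j) \<in> \<mu> \<rightarrow>\<^sub>M \<mu>" for j
    using shift_funpow_measurable[of j] by (simp add: measurable_cong_sets[OF sets sets])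
  obtain A where A: "finite A" "AE \<omega> in \<mu>. \<forall>j<k0. \<omega> j \<in> A"
    using compact_letters[OF P sets Kc, of k0] by blast
  have step: "AE \<omega> in \<mu>. \<forall>j<k0. ((shift ^^ (k0 * m)) \<omega>) j \<in> A" for m
  proof (induction m)
    case 0
    show ?case using A(2) by simp
  next
    case (Suc m)
    have "AE \<omega> in distr \<mu> \<mu> (shift ^^ k0). \<forall>j<k0. ((shift ^^ (k0 * m)) \<omega>) j \<in> A"
      unfolding inv by (rule Suc)
    hence "AE \<omega> in \<mu>. \<forall>j<k0. ((shift ^^ (k0 * m)) ((shift ^^ k0) \<omega>)) j \<in> A"
      by (rule AE_distrD[OF shm'])
    thus ?case by eventually_elim (simp add: shift_funpow ac_simps)
  qed
  have "AE \<omega> in \<mu>. \<forall>m. \<forall>j<k0. ((shift ^^ (k0 * m)) \<omega>) j \<in> A"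
    by (rule iffD2[OF AE_all_countable allI[OF step]])
  hence letters: "AE \<omega> in \<mu>. \<forall>i. \<omega> i \<in> A"
  proof eventually_elim
    case (elim \<omega>)
    show ?case
    proof
      fix i
      have "i mod k0 < k0" using k0 by simp
      hence "((shift ^^ (k0 * (i div k0))) \<omega>) (i mod k0) \<in> A" using elim by blast
      thus "\<omega> i \<in> A" by (simp add: shift_funpow)
    qed
  qed
  define \<nu> where "\<nu> j = distr \<mu> borel (shift ^^ j)" for j
  have \<nu>: "prob_space (\<nu> j)" "sets (\<nu> j) = sets borel" for j
    unfolding \<nu>_def by (auto intro: prob_space_distr)
  have pA: "Measurable.pred borel (\<lambda>\<omega>. \<forall>i<k. \<omega> i \<in> A)" for k :: nat by measurable
  have \<nu>A: "AE \<omega> in \<nu> j. \<forall>i<k. \<omega> i \<in> A" for j k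
    unfolding \<nu>_def using pA letters by (subst AE_distr_iff[OF shm]) (auto simp: shift_funpow elim: eventually_mono)
  define Q where "Q k w = (\<Sum>j<k0. measure (\<nu> j) (cylinder w)) / real k0" for k :: nat and w
  let ?F = "\<lambda>k. {w. length w = k \<and> set w \<subseteq> A}"
  have "(\<forall>w. 0 \<le> Q k w) \<and> (\<forall>w. length w = k \<longrightarrow> \<not> set w \<subseteq> A \<longrightarrow> Q k w = 0) \<and> sum (Q k) (?F k) = 1 \<and>
     (\<forall>f V. f \<in> borel_measurable borel \<longrightarrow>
        (\<forall>n \<omega> \<tau>. (\<forall>j<n. \<omega> j = \<tau> j) \<longrightarrow> \<bar>birkhoff_sum f n \<omega> - birkhoff_sum f n \<tau>\<bar> \<le> V) \<longrightarrow>
        \<bar>(\<Sum>w\<in>?F k. Q k w * birkhoff_sum f k (zero_extension w)) - real k * (\<integral>\<omega>. birkhoff_average k0 f \<omega> \<partial>\<mu>)\<bar> \<le> V)"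
    if k: "1 \<le> k" for k
  proof (intro conjI allI impI)
    note mi = marginal_integral[OF \<nu>(1) \<nu>(2) A(1) \<nu>A]
    show "0 \<le> Q k w" for w by (auto simp: Q_def intro!: divide_nonneg_nonneg sum_nonneg)
    show "Q k w = 0" if "length w = k" "\<not> set w \<subseteq> A" for w
      using mi(4)[of w k] that by (simp add: Q_def)
    have "sum (Q k) (?F k) = (\<Sum>j<k0. \<Sum>w\<in>?F k. measure (\<nu> j) (cylinder w)) / real k0"
      unfolding Q_def sum_divide_distrib[symmetric] by (subst sum.swap) simp
    also have "\<dots> = 1" using mi(3)[of _ k] k0 by simp
    finally show "sum (Q k) (?F k) = 1" .
    fix f V assume f [measurable]: "f \<in> borel_measurable borel"
      and V: "\<forall>n \<omega> \<tau>. (\<forall>j<n. \<omega> j = \<tau> j) \<longrightarrow> \<bar>birkhoff_sum f n \<omega> - birkhoff_sum f n \<tau>\<bar> \<le> V"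
    have close: "\<bar>birkhoff_sum f n \<omega> - birkhoff_sum f n (zero_extension (prefix_word \<omega> n))\<bar> \<le> V" for n \<omega>
      using V by (simp add: zero_extension_def)
    note mi5 = mi(5)[OF birkhoff_sum_measurable[OF f] close]
    have fi: "integrable (\<nu> j) f" for j
      using conjunct1[OF mi5[of j 1]] by (simp add: birkhoff_sum_def)
    have fj: "integrable \<mu> (\<lambda>\<omega>. f ((shift ^^ j) \<omega>))" for j
      using fi[of j] unfolding \<nu>_def by (subst (asm) integrable_distr_eq[OF shm]) auto
    define a where "a j = (\<integral>\<omega>. f ((shift ^^ j) \<omega>) \<partial>\<mu>)" for j
    have per: "a (i + k0) = a i" for i
    proof -
      have "a i = (\<integral>\<omega>. f ((shift ^^ i) \<omega>) \<partial>(distr \<mu> \<mu> (shift ^^ k0)))" by (simp add: a_def inv)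
      also have "\<dots> = (\<integral>\<omega>. f ((shift ^^ i) ((shift ^^ k0) \<omega>)) \<partial>\<mu>)"
        by (rule integral_distr[OF shm']) measurable
      finally show ?thesis by (simp add: a_def funpow_add)
    qed
    have I: "(\<integral>\<omega>. birkhoff_sum f k \<omega> \<partial>(\<nu> j)) = (\<Sum>i<k. a (i + j))" for j
    proof -
      have "(\<integral>\<omega>. birkhoff_sum f k \<omega> \<partial>(\<nu> j)) = (\<integral>\<omega>. birkhoff_sum f k ((shift ^^ j) \<omega>) \<partial>\<mu>)"
        unfolding \<nu>_def by (rule integral_distr[OF shm birkhoff_sum_measurable[OF f]])
      also have "\<dots> = (\<integral>\<omega>. (\<Sum>i<k. f ((shift ^^ (i + j)) \<omega>)) \<partial>\<mu>)"
        by (simp add: birkhoff_sum_def funpow_add)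
      also have "\<dots> = (\<Sum>i<k. a (i + j))"
        unfolding a_def by (rule Bochner_Integration.integral_sum) (rule fj)
      finally show ?thesis .
    qed
    have S: "(\<integral>\<omega>. birkhoff_average k0 f \<omega> \<partial>\<mu>) = (\<Sum>j<k0. a j) / real k0"
      unfolding birkhoff_average_eq birkhoff_sum_def a_def
      using fj by (simp add: Bochner_Integration.integral_sum)
    have "(\<Sum>j<k0. \<Sum>i<k. a (i + j)) = (\<Sum>i<k. \<Sum>j<k0. a (i + j))" by (rule sum.swap)
    also have "\<dots> = (\<Sum>i<k. \<Sum>j<k0. a j)" by (simp only: sum_periodic[of a, OF per])
    also have "\<dots> = real k * (\<Sum>j<k0. a j)" by simp
    finally have sw: "(\<Sum>j<k0. \<Sum>i<k. a (i + j)) = real k * (\<Sum>j<k0. a j)" .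
    let ?b = "\<lambda>w. birkhoff_sum f k (zero_extension w)"
    have each: "\<bar>(\<Sum>i<k. a (i + j)) - (\<Sum>w\<in>?F k. measure (\<nu> j) (cylinder w) * ?b w)\<bar> \<le> V" for j
      using conjunct2[OF mi5[of j k]] by (simp only: I)
    have QS: "(\<Sum>w\<in>?F k. Q k w * ?b w) = (\<Sum>j<k0. \<Sum>w\<in>?F k. measure (\<nu> j) (cylinder w) * ?b w) / real k0"
      unfolding Q_def times_divide_eq_left sum_divide_distrib[symmetric] sum_distrib_right by (subst sum.swap) simp
    have "(\<Sum>w\<in>?F k. Q k w * ?b w) - real k * (\<integral>\<omega>. birkhoff_average k0 f \<omega> \<partial>\<mu>) =
       (\<Sum>j<k0. (\<Sum>w\<in>?F k. measure (\<nu> j) (cylinder w) * ?b w) - (\<Sum>i<k. a (i + j))) / real k0"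
      unfolding QS S sum_subtractf sw by (simp add: diff_divide_distrib)
    also have "\<bar>\<dots>\<bar> \<le> (\<Sum>j<k0. V) / real k0"
    proof -
      have "\<bar>\<Sum>j<k0. (\<Sum>w\<in>?F k. measure (\<nu> j) (cylinder w) * ?b w) - (\<Sum>i<k. a (i + j))\<bar> \<le> (\<Sum>j<k0. V)"
        by (rule order_trans[OF sum_abs sum_mono]) (subst abs_minus_commute, rule each)
      thus ?thesis using k0 by (simp add: abs_divide pos_divide_le_eq mult.commute)
    qed
    also have "\<dots> = V" using k0 by simp
    finally show "\<bar>(\<Sum>w\<in>?F k. Q k w * ?b w) - real k * (\<integral>\<omega>. birkhoff_average k0 f \<omega> \<partial>\<mu>)\<bar> \<le> V" .
  qed
  thus ?thesis using A(1) by (intro exI[of _ A] exI[of _ Q]) blast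
qed

section \<open>Growth of sets of words with prescribed averages\<close>

locale birkhoff_family = affine_family T \<rho> for T :: "nat \<Rightarrow> real ^ 'n ^ 'n" and \<rho> +
  fixes \<Phi> :: "nat \<Rightarrow> (nat \<Rightarrow> nat) \<Rightarrow> real" and \<alpha> :: "nat \<Rightarrow> ereal"
  assumes var: "summable_variations (\<Phi> i)"
begin

definition feasible :: "nat \<Rightarrow> nat \<Rightarrow> (nat \<Rightarrow> nat) measure set" where
  "feasible n k = {\<mu> \<in> compact_invariant_measures k.
     \<forall>i<n. (\<integral>\<omega>. birkhoff_average k (\<Phi> i) \<omega> \<partial>\<mu>) \<in> target_nhd n (\<alpha> i)}"

lemma dimension_sup_eq: "dimension_sup T \<Phi> \<alpha> n k = (SUP \<mu>\<in>feasible n k. ennreal (symbolic_dimension T k \<mu>))"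
  by (simp add: dimension_sup_def feasible_def)

lemma uniform_distortion:
  "\<exists>V\<ge>0. \<forall>i<m. \<forall>n \<omega> \<tau>. (\<forall>j<n. \<omega> j = \<tau> j) \<longrightarrow> \<bar>birkhoff_sum (\<Phi> i) n \<omega> - birkhoff_sum (\<Phi> i) n \<tau>\<bar> \<le> V"
proof -
  have "\<forall>i. \<exists>V\<ge>0. \<forall>n \<omega> \<tau>. (\<forall>j<n. \<omega> j = \<tau> j) \<longrightarrow> \<bar>birkhoff_sum (\<Phi> i) n \<omega> - birkhoff_sum (\<Phi> i) n \<tau>\<bar> \<le> V"
    by (rule allI) (rule summable_variations_distortion[OF var])
  from choice[OF this] obtain V where V': "\<forall>i. 0 \<le> V i \<and>
    (\<forall>n \<omega> \<tau>. (\<forall>j<n. \<omega> j = \<tau> j) \<longrightarrow> \<bar>birkhoff_sum (\<Phi> i) n \<omega> - birkhoff_sum (\<Phi> i) n \<tau>\<bar> \<le> V i)" ..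
  have V: "0 \<le> V i" "(\<forall>j<n. \<omega> j = \<tau> j) \<Longrightarrow> \<bar>birkhoff_sum (\<Phi> i) n \<omega> - birkhoff_sum (\<Phi> i) n \<tau>\<bar> \<le> V i" for i n \<omega> \<tau>
    using V' by auto
  have "\<bar>birkhoff_sum (\<Phi> i) n \<omega> - birkhoff_sum (\<Phi> i) n \<tau>\<bar> \<le> (\<Sum>i<m. V i)"
    if "i < m" "\<forall>j<n. \<omega> j = \<tau> j" for i n \<omega> \<tau>
  proof -
    have "V i \<le> (\<Sum>i<m. V i)" using that(1) V(1) by (intro member_le_sum) auto
    thus ?thesis using V(2)[OF that(2), of i] by linarith
  qed
  thus ?thesis by (intro exI[of _ "\<Sum>i<m. V i"]) (auto intro: sum_nonneg V)
qed

lemma pressure_support: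
  assumes "finite F" "\<And>w. w \<in> F \<Longrightarrow> 0 \<le> p w"
  shows "pressure s p {w\<in>F. 0 < p w} = pressure s p F"
  unfolding pressure_def using assms by (intro sum.mono_neutral_left) (auto simp: order.order_iff_strict)

lemma pressure_neutral:
  assumes "finite F'" "F \<subseteq> F'" "\<And>w. w \<in> F' - F \<Longrightarrow> p w = 0"
  shows "pressure s p F' = pressure s p F"
  unfolding pressure_def using assms by (intro sum.mono_neutral_right) auto

text \<open>Concavity of the entropy, from \<open>ln x \<le> x - 1\<close>.\<close>
lemma pressure_mix:
  assumes F: "finite F" and p: "\<And>w. w \<in> F \<Longrightarrow> 0 \<le> p w" and q: "\<And>w. w \<in> F \<Longrightarrow> 0 \<le> q w"
    and e: "0 < e" "e < 1" and s: "0 \<le> s"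
  shows "(1 - e) * pressure s p F + e * pressure s q F \<le> pressure s (\<lambda>w. (1 - e) * p w + e * q w) F"
proof -
  have one: "a * ln (c / a) \<le> a * ln (c / x) + (x - a)" if "0 \<le> a" "0 < x" "0 < c" for a c x :: real
  proof (cases "a = 0")
    case False
    hence a: "0 < a" using that by simp
    have "ln (x / a) \<le> x / a - 1" using a that by (intro ln_le_minus_one) auto
    hence "a * ln (x / a) \<le> a * (x / a - 1)" using a by (intro mult_left_mono) auto
    hence "a * ln (x / a) \<le> x - a" using a by (simp add: right_diff_distrib)
    moreover have "ln (c / a) = ln (c / x) + ln (x / a)" using a that by (simp add: ln_div)
    ultimately show ?thesis by (simp add: distrib_left)
  qed (use that in simp)
  have "(1 - e) * (p w * ln (\<phi> s w / p w)) + e * (q w * ln (\<phi> s w / q w))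
      \<le> ((1 - e) * p w + e * q w) * ln (\<phi> s w / ((1 - e) * p w + e * q w))" if w: "w \<in> F" for w
  proof (cases "p w = 0 \<and> q w = 0")
    case False
    let ?x = "(1 - e) * p w + e * q w"
    have "0 \<le> (1 - e) * p w" "0 \<le> e * q w" using p[OF w] q[OF w] e by auto
    moreover have "0 < (1 - e) * p w \<or> 0 < e * q w" using False p[OF w] q[OF w] e by auto
    ultimately have x: "0 < ?x" by linarith
    have "(1 - e) * (p w * ln (\<phi> s w / p w)) \<le> (1 - e) * (p w * ln (\<phi> s w / ?x) + (?x - p w))"
      using e by (intro mult_left_mono one p w x word_svf_pos s) auto
    moreover have "e * (q w * ln (\<phi> s w / q w)) \<le> e * (q w * ln (\<phi> s w / ?x) + (?x - q w))"
      using e by (intro mult_left_mono one q w x word_svf_pos s) auto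
    moreover have "(1 - e) * (p w * ln (\<phi> s w / ?x) + (?x - p w)) + e * (q w * ln (\<phi> s w / ?x) + (?x - q w))
        = ?x * ln (\<phi> s w / ?x)" by (simp add: algebra_simps)
    ultimately show ?thesis by linarith
  qed simp
  thus ?thesis unfolding pressure_def sum_distrib_left sum.distrib[symmetric] by (intro sum_mono)
qed

text \<open>The block length \<open>k\<close> must be large in order that the pressure exceeds the price of gluing and that
  connecting words hardly disturb the averages. The means of a measure which nearly attains the
  dimension may however approach the boundary of the neighbourhoods as \<open>k\<close> grows. Therefore one feasible
  measure \<open>\<mu>0\<close> is fixed, whose means \<open>\<beta>\<close> have a positive distance \<open>\<delta>\<close> to the boundary, and a small portion
  \<open>e\<close> of its marginals \<open>Q k\<close> is mixed into the marginal of a measure of dimension at least \<open>s'\<close>. The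
  neighbourhoods being convex, the mixture stays \<open>e * \<delta>\<close> away from the boundary for every \<open>k\<close>; and its
  pressure at \<open>s < s'\<close> still grows linearly in \<open>k\<close>, since \<open>Q k\<close> lives on a fixed finite alphabet.\<close>
lemma growing_words:
  assumes s: "0 \<le> s" "s < s'" and freq: "\<exists>\<^sub>F k in sequentially. \<exists>\<mu>\<in>feasible n k. s' \<le> symbolic_dimension T k \<mu>"
  shows "\<exists>q0. \<forall>q\<ge>q0. \<exists>W. finite W \<and> (\<forall>v\<in>W. length v = q) \<and> B \<le> sum (\<phi> s) W \<and>
     (\<forall>v\<in>W. \<forall>\<omega>\<in>cylinder v. \<forall>i<n. birkhoff_average q (\<Phi> i) \<omega> \<in> target_nhd n (\<alpha> i))"
proof -
  let ?T = "\<lambda>i. target_nhd n (\<alpha> i)"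
  obtain V where V0: "0 \<le> V" and
    distortion: "\<forall>i<n. \<forall>l \<omega> \<tau>. (\<forall>j<l. \<omega> j = \<tau> j) \<longrightarrow> \<bar>birkhoff_sum (\<Phi> i) l \<omega> - birkhoff_sum (\<Phi> i) l \<tau>\<bar> \<le> V"
    using uniform_distortion[of n] by blast
  hence V: "\<And>i l \<omega> \<tau>. i < n \<Longrightarrow> (\<And>j. j < l \<Longrightarrow> \<omega> j = \<tau> j) \<Longrightarrow>
      \<bar>birkhoff_sum (\<Phi> i) l \<omega> - birkhoff_sum (\<Phi> i) l \<tau>\<bar> \<le> V"
    by blast
  note meas = summable_variations_measurable[OF var]
  from typical_words[OF s(1) distortion] obtain P0 K E where E0: "0 \<le> E" and
    tw: "\<forall>k F p. 1 \<le> k \<longrightarrow> finite F \<longrightarrow> (\<forall>w\<in>F. length w = k \<and> 0 < p w) \<longrightarrow> sum p F = 1 \<longrightarrow>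
     P0 < pressure s p F \<longrightarrow> (\<forall>\<epsilon>>0. \<forall>B. \<exists>q0. \<forall>q\<ge>q0. \<exists>W. finite W \<and> (\<forall>v\<in>W. length v = q) \<and> B \<le> sum (\<phi> s) W \<and>
       (\<forall>v\<in>W. \<forall>\<omega>\<in>cylinder v. \<forall>i<n.
          \<bar>birkhoff_sum (\<Phi> i) q \<omega> - real ((q - 1) div (k + K)) * (\<Sum>w\<in>F. p w * birkhoff_sum (\<Phi> i) k (zero_extension w))\<bar>
            \<le> real ((q - 1) div (k + K)) * (\<epsilon> + V) + (2 * real ((q - 1) div (k + K)) * real K + real k + real K) * E))"
    by (elim exE conjE)
  from frequently_eventually_frequently[OF freq eventually_ge_at_top[of 1]]
  obtain k0 \<mu>0 where k0: "1 \<le> k0" and mu0: "\<mu>0 \<in> feasible n k0" by (auto dest!: frequently_ex)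
  define \<beta> where "\<beta> i = (\<integral>\<omega>. birkhoff_average k0 (\<Phi> i) \<omega> \<partial>\<mu>0)" for i
  have "\<exists>r>0. i < n \<longrightarrow> margin r (?T i) (\<beta> i)" for i
  proof (cases "i < n")
    case True
    hence "\<beta> i \<in> ?T i" using mu0 by (simp add: feasible_def \<beta>_def)
    from margin_exists[OF open_target_nhd this] show ?thesis by blast
  qed (auto intro: exI[of _ 1])
  then obtain r where r: "\<And>i. 0 < r i" "\<And>i. i < n \<Longrightarrow> margin (r i) (?T i) (\<beta> i)" by metis
  define \<delta> where "\<delta> = Min (insert 1 (r ` {..<n}))"
  have \<delta>: "0 < \<delta>" using r(1) by (auto simp: \<delta>_def)
  have \<beta>\<delta>: "margin \<delta> (?T i) (\<beta> i)" if "i < n" for i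
    by (rule margin_mono[OF r(2)[OF that]]) (use that in \<open>auto simp: \<delta>_def intro!: Min_le\<close>)
  define b where "b = (\<Sum>i<n. \<bar>\<beta> i\<bar>)"
  have b: "\<bar>\<beta> i\<bar> \<le> b" if "i < n" for i unfolding b_def using that by (intro member_le_sum) auto
  have b0: "0 \<le> b" by (simp add: b_def sum_nonneg)
  from mu0 have mu0': "\<mu>0 \<in> compact_invariant_measures k0" by (simp add: feasible_def)
  from averaged_marginal[OF mu0' k0] obtain A Q where A: "finite A" and
    AQ: "\<forall>k\<ge>1. (\<forall>w. 0 \<le> Q k w) \<and> (\<forall>w. length w = k \<longrightarrow> \<not> set w \<subseteq> A \<longrightarrow> Q k w = 0) \<and>
     sum (Q k) {w. length w = k \<and> set w \<subseteq> A} = 1 \<and>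
     (\<forall>f V. f \<in> borel_measurable borel \<longrightarrow>
        (\<forall>n \<omega> \<tau>. (\<forall>j<n. \<omega> j = \<tau> j) \<longrightarrow> \<bar>birkhoff_sum f n \<omega> - birkhoff_sum f n \<tau>\<bar> \<le> V) \<longrightarrow>
        \<bar>(\<Sum>w\<in>{w. length w = k \<and> set w \<subseteq> A}. Q k w * birkhoff_sum f k (zero_extension w))
           - real k * (\<integral>\<omega>. birkhoff_average k0 f \<omega> \<partial>\<mu>0)\<bar> \<le> V)"
    by (elim exE conjE)
  note AQ' = mp[OF spec[OF AQ]]
  have Q: "0 \<le> Q k w" "length w = k \<Longrightarrow> \<not> set w \<subseteq> A \<Longrightarrow> Q k w = 0"
       "sum (Q k) {w. length w = k \<and> set w \<subseteq> A} = 1" if "1 \<le> k" for k w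
    using conjunct1[OF AQ'[OF that]] conjunct1[OF conjunct2[OF AQ'[OF that]]]
      conjunct1[OF conjunct2[OF conjunct2[OF AQ'[OF that]]]] by simp_all
  note Qm = mp[OF mp[OF spec[OF spec[OF conjunct2[OF conjunct2[OF conjunct2[OF AQ']]]]]]]
  obtain c where c: "0 < c" "c \<le> 1" "\<And>u v. set v \<subseteq> A \<Longrightarrow> \<phi> s u * c ^ length v \<le> \<phi> s (u @ v)"
    using word_svf_append_ge[OF A s(1)] by blast
  define C where "C = ln (1 / c)"
  have C: "0 \<le> C" using c by (simp add: C_def)
  have PQ: "- (real k * C) \<le> pressure s (Q k) {w. length w = k \<and> set w \<subseteq> A}" if k: "1 \<le> k" for k
  proof -
    let ?F = "{w. length w = k \<and> set w \<subseteq> A}"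
    have fin: "finite ?F" by (rule finite_words[OF A])
    have "- (real k * C) = (\<Sum>w\<in>?F. Q k w * - (real k * C))"
      by (simp only: sum_distrib_right[symmetric] Q(3)[OF k] mult_1_left)
    also have "\<dots> \<le> pressure s (Q k) ?F"
      unfolding pressure_def
    proof (rule sum_mono)
      fix w assume w: "w \<in> ?F"
      show "Q k w * - (real k * C) \<le> Q k w * ln (\<phi> s w / Q k w)"
      proof (cases "Q k w = 0")
        case False
        hence q: "0 < Q k w" using Q(1)[OF k, of w] by simp
        have q1: "Q k w \<le> 1" using member_le_sum[of w ?F "Q k"] w Q(1,3)[OF k] fin by auto
        have "- (real k * C) = ln (c ^ k)" using c by (simp add: C_def ln_div ln_realpow)
        also have "\<dots> \<le> ln (\<phi> s w)" using c(3)[of w "[]"] w c(1) by (intro ln_mono) (auto simp: word_svf_Nil[OF s(1)])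
        also have "\<dots> \<le> ln (\<phi> s w / Q k w)"
          using q q1 word_svf_pos[OF s(1), of w] by (intro ln_mono) (auto simp: pos_le_divide_eq)
        finally show ?thesis using q by (intro mult_left_mono) auto
      qed simp
    qed
    finally show ?thesis .
  qed
  define \<eta> where "\<eta> = (s' - s) * ln 2"
  have \<eta>: "0 < \<eta>" using s by (simp add: \<eta>_def)
  \<comment> \<open>So chosen that mixing costs half of the pressure \<open>\<eta>\<close> per letter, see \<open>ee\<close>.\<close>
  define e where "e = \<eta> / (2 * (\<eta> + C))"
  have e: "0 < e" "e < 1" using \<eta> C by (auto simp: e_def field_simps)
  have ee: "(1 - e) * \<eta> - e * C = \<eta> / 2"
  proof -
    have half: "\<eta> / (2 * X) * X = \<eta> / 2" if "X \<noteq> 0" for X using that by simp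
    have "e * (\<eta> + C) = \<eta> / 2" unfolding e_def by (rule half) (use \<eta> C in simp)
    thus ?thesis by (simp add: algebra_simps)
  qed
  define R where "R = e * \<delta>"
  have R: "0 < R" "R \<le> \<delta>" using e \<delta> by (auto simp: R_def)
  \<comment> \<open>\<open>H\<close> bounds the error per block, \<open>G\<close> below the error of the incomplete block at the end.\<close>
  define H where "H = 1 + 2 * V + 2 * K * E + K * b"
  obtain k2 :: nat where k2: "2 * P0 / \<eta> < real k2" using reals_Archimedean2 by blast
  obtain k3 :: nat where k3: "2 * H / R < real k3" using reals_Archimedean2 by blast
  from frequently_eventually_frequently[OF freq eventually_ge_at_top[of "1 + k2 + k3"]]
  obtain k \<mu> where k: "1 + k2 + k3 \<le> k" and mu: "\<mu> \<in> feasible n k" and D: "s' \<le> symbolic_dimension T k \<mu>"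
    by (auto dest!: frequently_ex)
  have k1: "1 \<le> k" and kP: "P0 < real k * (\<eta> / 2)" and kH: "H / real k \<le> R / 2"
  proof -
    show kk: "1 \<le> k" using k by simp
    have "2 * P0 / \<eta> < real k" using k k2 by linarith
    thus "P0 < real k * (\<eta> / 2)" using \<eta> by (simp add: field_simps)
    have "2 * H / R < real k" using k k3 by linarith
    thus "H / real k \<le> R / 2" using R kk by (simp add: field_simps)
  qed
  from mu obtain Kc where P: "prob_space \<mu>" and sets: "sets \<mu> = sets borel"
    and Kc: "compact Kc" "emeasure \<mu> (- Kc) = 0" unfolding feasible_def compact_invariant_measures_def by blast
  obtain A1 where A1: "finite A1" "AE \<omega> in \<mu>. \<forall>j<k. \<omega> j \<in> A1" using compact_letters[OF P sets Kc, of k] by blast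
  define p where "p w = measure \<mu> (cylinder w)" for w
  let ?F1 = "{w. length w = k \<and> set w \<subseteq> A1}" and ?F0 = "{w. length w = k \<and> set w \<subseteq> A}"
  define F' where "F' = {w. length w = k \<and> set w \<subseteq> A \<union> A1}"
  have finF': "finite F'" unfolding F'_def using A A1 by (intro finite_words) auto
  have sub: "?F1 \<subseteq> F'" "?F0 \<subseteq> F'" by (auto simp: F'_def)
  note mi = marginal_integral[OF P sets A1]
  have p0: "0 \<le> p w" for w by (simp add: p_def)
  have pn: "p w = 0" if "w \<in> F' - ?F1" for w using mi(4)[of w] that by (auto simp: p_def F'_def)
  have qn: "Q k w = 0" if "w \<in> F' - ?F0" for w using Q(2)[OF k1, of w] that by (auto simp: F'_def)
  have sump: "(\<Sum>w\<in>F'. p w * h w) = (\<Sum>w\<in>?F1. p w * h w)" for h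
    using finF' sub pn by (intro sum.mono_neutral_right) auto
  have sumq: "(\<Sum>w\<in>F'. Q k w * h w) = (\<Sum>w\<in>?F0. Q k w * h w)" for h
    using finF' sub qn by (intro sum.mono_neutral_right) auto
  have sp1: "sum p F' = 1" using sump[of "\<lambda>_. 1"] mi(3) by (simp add: p_def)
  have sq1: "sum (Q k) F' = 1" using sumq[of "\<lambda>_. 1"] Q(3)[OF k1] by simp
  define p' where "p' w = (1 - e) * p w + e * Q k w" for w
  have p'0: "0 \<le> p' w" for w using p0 Q(1)[OF k1] e by (simp add: p'_def)
  have sp': "sum p' F' = 1" using sp1 sq1 by (simp add: p'_def sum.distrib flip: sum_distrib_left)
  define F where "F = {w\<in>F'. 0 < p' w}"
  have finF: "finite F" and Fw: "\<forall>w\<in>F. length w = k \<and> 0 < p' w"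
    using finite_subset[of F F'] finF' by (auto simp: F_def) (auto simp: F'_def)
  have sumF: "(\<Sum>w\<in>F. p' w * h w) = (\<Sum>w\<in>F'. p' w * h w)" for h
    unfolding F_def using finF' p'0 by (intro sum.mono_neutral_left) (auto simp: order.order_iff_strict)
  have spF: "sum p' F = 1" using sumF[of "\<lambda>_. 1"] sp' by simp
  have "real k * \<eta> \<le> pressure s p ?F1"
  proof -
    have "(s' - s) * real k * ln 2 \<le> (symbolic_dimension T k \<mu> - s) * real k * ln 2"
      using D by (intro mult_right_mono) auto
    also have "\<dots> \<le> pressure s p ?F1"
      using symbolic_dimension_pressure(4)[OF P sets A1 k1 s(1)] D s(2) by (simp add: p_def[abs_def])
    finally show ?thesis by (simp add: \<eta>_def mult_ac)
  qed
  hence Pp: "real k * \<eta> \<le> pressure s p F'" using pressure_neutral[OF finF' sub(1) pn] by simp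
  have Pq: "- (real k * C) \<le> pressure s (Q k) F'"
    using PQ[OF k1] pressure_neutral[OF finF' sub(2) qn] by simp
  have "real k * (\<eta> / 2) = (1 - e) * (real k * \<eta>) + e * - (real k * C)"
    unfolding ee[symmetric] by (simp add: algebra_simps)
  also have "\<dots> \<le> (1 - e) * pressure s p F' + e * pressure s (Q k) F'"
    using Pp Pq e by (intro add_mono mult_left_mono) auto
  also have "\<dots> \<le> pressure s p' F'"
    unfolding p'_def by (rule pressure_mix[OF finF' p0 Q(1)[OF k1] e s(1)])
  also have "\<dots> = pressure s p' F" unfolding F_def using pressure_support[OF finF' p'0] by simp
  finally have PF: "P0 < pressure s p' F" using kP by linarith
  define M where "M i = (\<integral>\<omega>. birkhoff_average k (\<Phi> i) \<omega> \<partial>\<mu>)" for i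
  define z where "z i = (1 - e) * M i + e * \<beta> i" for i
  have zR: "margin R (?T i) (z i)" if "i < n" for i
    unfolding z_def R_def
  proof (rule margin_mix[OF convex_target_nhd _ \<beta>\<delta>[OF that] e(1)])
    show "M i \<in> ?T i" using mu that by (simp add: feasible_def M_def)
  qed (use e in simp)
  let ?b = "\<lambda>i w. birkhoff_sum (\<Phi> i) k (zero_extension w)"
  define mm where "mm i = (\<Sum>w\<in>F. p' w * ?b i w)" for i
  have mz: "\<bar>mm i - real k * z i\<bar> \<le> V" if i: "i < n" for i
  proof -
    have dist: "\<forall>l \<omega> \<tau>. (\<forall>j<l. \<omega> j = \<tau> j) \<longrightarrow> \<bar>birkhoff_sum (\<Phi> i) l \<omega> - birkhoff_sum (\<Phi> i) l \<tau>\<bar> \<le> V"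
      using V[OF i] by blast
    have close: "\<bar>birkhoff_sum (\<Phi> i) k \<omega> - ?b i (prefix_word \<omega> k)\<bar> \<le> V" for \<omega>
      using V[OF i, of k] by (simp add: zero_extension_def)
    have "(\<integral>\<omega>. birkhoff_sum (\<Phi> i) k \<omega> \<partial>\<mu>) = real k * M i"
      using k1 by (simp add: M_def birkhoff_average_eq)
    hence 1: "\<bar>real k * M i - (\<Sum>w\<in>?F1. p w * ?b i w)\<bar> \<le> V"
      using conjunct2[OF mi(5)[OF birkhoff_sum_measurable[OF meas] close]] by (simp add: p_def)
    have 2: "\<bar>(\<Sum>w\<in>?F0. Q k w * ?b i w) - real k * \<beta> i\<bar> \<le> V"
      unfolding \<beta>_def by (rule Qm[OF k1 meas dist])
    have "mm i = (1 - e) * (\<Sum>w\<in>?F1. p w * ?b i w) + e * (\<Sum>w\<in>?F0. Q k w * ?b i w)"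
      unfolding mm_def sumF sump[symmetric] sumq[symmetric]
      by (simp add: p'_def sum_distrib_left sum.distrib distrib_right mult.assoc)
    hence "mm i - real k * z i = (1 - e) * ((\<Sum>w\<in>?F1. p w * ?b i w) - real k * M i) + e * ((\<Sum>w\<in>?F0. Q k w * ?b i w) - real k * \<beta> i)"
      by (simp add: z_def algebra_simps)
    also have "\<bar>\<dots>\<bar> \<le> (1 - e) * V + e * V"
    proof (rule order_trans[OF abs_triangle_ineq add_mono])
      show "\<bar>(1 - e) * ((\<Sum>w\<in>?F1. p w * ?b i w) - real k * M i)\<bar> \<le> (1 - e) * V"
        using 1 e by (simp add: abs_mult mult_left_mono abs_minus_commute)
      show "\<bar>e * ((\<Sum>w\<in>?F0. Q k w * ?b i w) - real k * \<beta> i)\<bar> \<le> e * V"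
        using 2 e by (simp add: abs_mult mult_left_mono)
    qed
    also have "\<dots> = V" by (simp add: algebra_simps)
    finally show ?thesis .
  qed
  from tw[rule_format, OF k1 finF _ spF PF, of 1 B] Fw obtain q0 where
    q0: "\<And>q. q0 \<le> q \<Longrightarrow> \<exists>W. finite W \<and> (\<forall>v\<in>W. length v = q) \<and> B \<le> sum (\<phi> s) W \<and>
       (\<forall>v\<in>W. \<forall>\<omega>\<in>cylinder v. \<forall>i<n.
          \<bar>birkhoff_sum (\<Phi> i) q \<omega> - real ((q - 1) div (k + K)) * mm i\<bar>
            \<le> real ((q - 1) div (k + K)) * (1 + V) + (2 * real ((q - 1) div (k + K)) * real K + real k + real K) * E)"
    unfolding mm_def by auto
  define G where "G = (real k + real K) * (E + b)"
  obtain q1 :: nat where q1: "2 * G / R < real q1" using reals_Archimedean2 by blast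
  show ?thesis
  proof (intro exI[of _ "max q0 (max 1 q1)"] allI impI)
    fix q assume "max q0 (max 1 q1) \<le> q"
    hence q: "q0 \<le> q" "1 \<le> q" "q1 \<le> q" by auto
    define N where "N = (q - 1) div (k + K)"
    have Nq: "N * (k + K) \<le> q - 1" by (simp add: N_def)
    have "q - 1 < (N + 1) * (k + K)" unfolding N_def using k1 dividend_less_div_times[of "k + K" "q - 1"]
      by (simp add: algebra_simps)
    hence qN: "real q \<le> real N * real k + real N * real K + real k + real K"
      by (simp only: of_nat_add[symmetric] of_nat_mult[symmetric] of_nat_le_iff) (simp add: algebra_simps)
    have "N * k \<le> q" using Nq by (simp add: distrib_left)
    hence Nk: "real N * real k \<le> real q" by (simp only: of_nat_mult[symmetric] of_nat_le_iff)
    from q0[OF q(1)] obtain W where W: "finite W" "\<And>v. v \<in> W \<Longrightarrow> length v = q" "B \<le> sum (\<phi> s) W" and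
      Wa: "\<And>v \<omega> i. v \<in> W \<Longrightarrow> \<omega> \<in> cylinder v \<Longrightarrow> i < n \<Longrightarrow>
          \<bar>birkhoff_sum (\<Phi> i) q \<omega> - real N * mm i\<bar> \<le> real N * (1 + V) + (2 * real N * real K + real k + real K) * E"
      unfolding N_def[symmetric] by blast
    have "birkhoff_average q (\<Phi> i) \<omega> \<in> ?T i" if v: "v \<in> W" "\<omega> \<in> cylinder v" and i: "i < n" for v \<omega> i
    proof -
      \<comment> \<open>The part of the time not spent in blocks is attributed to the mean \<open>\<beta> i\<close> by convexity.\<close>
      define \<theta> where "\<theta> = real N * real k / real q"
      have \<theta>: "0 \<le> \<theta>" "\<theta> \<le> 1" using Nk q(2) by (auto simp: \<theta>_def)
      define u where "u = birkhoff_average q (\<Phi> i) \<omega> - (\<theta> * z i + (1 - \<theta>) * \<beta> i)"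
      have qu: "real q * u = (birkhoff_sum (\<Phi> i) q \<omega> - real N * mm i) + real N * (mm i - real k * z i) - (real q - real N * real k) * \<beta> i"
        using q(2) by (simp add: u_def \<theta>_def birkhoff_average_eq algebra_simps add_divide_distrib diff_divide_distrib)
      have a1: "\<bar>real N * (mm i - real k * z i)\<bar> \<le> real N * V"
        using mz[OF i] by (simp add: abs_mult mult_left_mono)
      have a2: "\<bar>(real q - real N * real k) * \<beta> i\<bar> \<le> (real N * real K + real k + real K) * b"
        unfolding abs_mult using qN Nk b[OF i] b0 by (intro mult_mono) auto
      have "real q * \<bar>u\<bar> = \<bar>real q * u\<bar>" by (simp add: abs_mult)
      also have "\<dots> \<le> real N * (1 + V) + (2 * real N * real K + real k + real K) * E + real N * V + (real N * real K + real k + real K) * b"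
        unfolding qu using Wa[OF v i] a1 a2 by linarith
      also have "\<dots> = real N * H + G" by (simp add: H_def G_def algebra_simps)
      also have "\<dots> \<le> real q * (R / 2) + real q * (R / 2)"
      proof (rule add_mono)
        have "real N * H = real N * real k * (H / real k)" using k1 by simp
        also have "\<dots> \<le> real q * (R / 2)"
        proof (rule mult_mono[OF Nk kH])
          show "0 \<le> H / real k" using V0 E0 b0 by (simp add: H_def)
        qed simp
        finally show "real N * H \<le> real q * (R / 2)" .
        have "2 * G / R < real q" using q1 q(3) by linarith
        thus "G \<le> real q * (R / 2)" using R by (simp add: field_simps)
      qed
      finally have "real q * \<bar>u\<bar> \<le> real q * R" by (simp add: mult.commute)
      hence "\<bar>u\<bar> \<le> R" using q(2) by simp
      moreover have "margin R (?T i) (\<theta> * z i + (1 - \<theta>) * \<beta> i)"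
        by (rule margin_convex[OF convex_target_nhd zR[OF i] margin_mono[OF \<beta>\<delta>[OF i] R(2)] \<theta>])
      ultimately have "\<theta> * z i + (1 - \<theta>) * \<beta> i + u \<in> ?T i" by (simp add: margin_def)
      thus ?thesis by (simp add: u_def)
    qed
    thus "\<exists>W. finite W \<and> (\<forall>v\<in>W. length v = q) \<and> B \<le> sum (\<phi> s) W \<and>
     (\<forall>v\<in>W. \<forall>\<omega>\<in>cylinder v. \<forall>i<n. birkhoff_average q (\<Phi> i) \<omega> \<in> ?T i)"
      using W by (intro exI[of _ W]) simp
  qed
qed

end

section \<open>Bernoulli measures\<close>

lemma compact_words:
  assumes "finite A"
  shows "compact {\<omega> :: nat \<Rightarrow> nat. \<forall>i. \<omega> i \<in> A}"
proof -
  have "compactin (product_topology (\<lambda>i::nat. euclidean :: nat topology) UNIV) (PiE UNIV (\<lambda>i. A))"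
    using assms by (simp add: compactin_PiE finite_imp_compact)
  moreover have "PiE UNIV (\<lambda>i. A) = {\<omega> :: nat \<Rightarrow> nat. \<forall>i. \<omega> i \<in> A}" by auto
  ultimately show ?thesis by (simp add: euclidean_product_topology)
qed

lemma measurable_words:
  assumes "\<And>i. (\<lambda>x. f x i) \<in> M \<rightarrow>\<^sub>M count_space UNIV"
  shows "f \<in> M \<rightarrow>\<^sub>M (borel :: (nat \<Rightarrow> nat) measure)"
proof (rule measurable_coordinatewise_then_product)
  fix i
  show "(\<lambda>x. f x i) \<in> borel_measurable M" by (rule measurable_compose[OF assms]) simp
qed

text \<open>The infinite word that consists of independent blocks with distribution \<open>P\<close>.\<close>
lemma bernoulli_measure:
  fixes P :: "nat list pmf"
  assumes q: "1 \<le> q" and W: "finite (set_pmf P)" "\<And>v. v \<in> set_pmf P \<Longrightarrow> length v = q"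
  shows "\<exists>\<mu>\<in>compact_invariant_measures q. (\<forall>v. length v = q \<longrightarrow> measure \<mu> (cylinder v) = pmf P v) \<and>
    (AE \<omega> in \<mu>. prefix_word \<omega> q \<in> set_pmf P)"
proof -
  define \<Omega> where "\<Omega> = PiM UNIV (\<lambda>_::nat. measure_pmf P)"
  interpret product_prob_space "\<lambda>_::nat. measure_pmf P" UNIV
    by (intro product_prob_spaceI measure_pmf.prob_space_axioms)
  interpret \<Omega>: prob_space \<Omega> unfolding \<Omega>_def by (rule prob_space_PiM) (rule measure_pmf.prob_space_axioms)
  define G where "G u i = (u (i div q)) ! (i mod q)" for u :: "nat \<Rightarrow> nat list" and i
  have comp [measurable]: "(\<lambda>u. u j) \<in> \<Omega> \<rightarrow>\<^sub>M measure_pmf P" for j :: nat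
    unfolding \<Omega>_def by (rule measurable_component_singleton) simp
  have comp' [measurable]: "(\<lambda>u. h (u j)) \<in> \<Omega> \<rightarrow>\<^sub>M count_space UNIV" for j :: nat and h :: "nat list \<Rightarrow> 'c"
    by (rule measurable_compose[OF comp]) simp
  have G [measurable]: "G \<in> \<Omega> \<rightarrow>\<^sub>M borel"
    unfolding G_def by (rule measurable_words) (rule comp')
  define \<mu> where "\<mu> = distr \<Omega> borel G"
  have sets: "sets \<mu> = sets borel" by (simp add: \<mu>_def)
  have prob: "prob_space \<mu>" unfolding \<mu>_def by (rule \<Omega>.prob_space_distr[OF G])
  have aeW: "AE u in \<Omega>. \<forall>j. u j \<in> set_pmf P"
    unfolding AE_all_countable \<Omega>_def
    by (intro allI AE_PiM_component measure_pmf.prob_space_axioms) (auto simp: AE_measure_pmf)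
  define tl' where "tl' u = (\<lambda>j. u (Suc j))" for u :: "nat \<Rightarrow> nat list"
  have tl: "distr \<Omega> \<Omega> tl' = \<Omega>"
    using distr_PiM_reindex[of UNIV "\<lambda>_::nat. measure_pmf P" Suc UNIV]
    by (simp add: \<Omega>_def tl'_def[abs_def] measure_pmf.prob_space_axioms restrict_def)
  have tlm [measurable]: "tl' \<in> \<Omega> \<rightarrow>\<^sub>M \<Omega>"
  proof -
    have "tl' \<in> \<Omega> \<rightarrow>\<^sub>M PiM UNIV (\<lambda>_::nat. measure_pmf P)"
      unfolding tl'_def by (rule measurable_PiM_single') (rule comp, simp)
    thus ?thesis by (simp add: \<Omega>_def)
  qed
  have shG: "(shift ^^ q) (G u) = G (tl' u)" for u
    using q by (auto simp: fun_eq_iff shift_funpow G_def tl'_def)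
  have inv: "distr \<mu> \<mu> (shift ^^ q) = \<mu>"
  proof -
    have "distr \<mu> \<mu> (shift ^^ q) = distr \<mu> borel (shift ^^ q)" by (rule distr_cong) (simp_all add: sets)
    also have "\<dots> = distr \<Omega> borel ((shift ^^ q) \<circ> G)" unfolding \<mu>_def by (rule distr_distr) measurable
    also have "(shift ^^ q) \<circ> G = G \<circ> tl'" by (simp add: fun_eq_iff shG)
    also have "distr \<Omega> borel (G \<circ> tl') = distr (distr \<Omega> \<Omega> tl') borel G" by (rule distr_distr[symmetric]) measurable
    finally show ?thesis by (simp add: tl \<mu>_def)
  qed
  define A where "A = (\<Union>v\<in>set_pmf P. set v)"
  define K where "K = {\<omega> :: nat \<Rightarrow> nat. \<forall>i. \<omega> i \<in> A}"
  have K: "compact K" unfolding K_def by (rule compact_words) (use W(1) in \<open>auto simp: A_def\<close>)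
  have [measurable]: "K \<in> sets borel" using compact_imp_closed_words[OF K] by (rule borel_closed)
  have Km: "- K \<in> sets borel" using compact_imp_closed_words[OF K] by (simp add: borel_open open_Compl)
  have "AE u in \<Omega>. G u \<in> K"
    using aeW
  proof eventually_elim
    case (elim u)
    have "G u i \<in> A" for i
    proof -
      have "length (u (i div q)) = q" "u (i div q) \<in> set_pmf P" using elim W(2) by auto
      moreover have "i mod q < q" using q by simp
      ultimately show ?thesis unfolding A_def G_def by (intro UN_I[of "u (i div q)"]) auto
    qed
    thus ?case by (simp add: K_def)
  qed
  hence "AE u in \<Omega>. G u \<notin> - K" by eventually_elim simp
  hence "AE \<omega> in \<mu>. \<omega> \<notin> - K" unfolding \<mu>_def using Km by (subst AE_distr_iff[OF G]) auto
  hence "emeasure \<mu> (- K) = 0" using Km sets sets_eq_imp_space_eq[OF sets] by (subst (asm) AE_iff_measurable[of "- K"]) auto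
  hence mem: "\<mu> \<in> compact_invariant_measures q"
    unfolding compact_invariant_measures_def using prob sets inv K by blast
  have pre: "prefix_word (G u) q = u 0" if "u 0 \<in> set_pmf P" for u
    using W(2)[OF that] q by (intro nth_equalityI) (auto simp: G_def)
  have cyl: "measure \<mu> (cylinder v) = pmf P v" if v: "length v = q" for v
  proof -
    have "measure \<mu> (cylinder v) = measure \<Omega> {u\<in>space \<Omega>. G u \<in> cylinder v}"
      unfolding \<mu>_def by (subst measure_distr[OF G]) (auto intro!: arg_cong[where f = "measure \<Omega>"])
    also have "\<dots> = measure \<Omega> {u\<in>space \<Omega>. u 0 = v}"
    proof (rule \<Omega>.finite_measure_eq_AE)
      show "AE u in \<Omega>. (u \<in> {u\<in>space \<Omega>. G u \<in> cylinder v}) = (u \<in> {u\<in>space \<Omega>. u 0 = v})"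
        using aeW by eventually_elim (use v pre in \<open>auto simp: cylinder_def\<close>)
      show "{u\<in>space \<Omega>. G u \<in> cylinder v} \<in> sets \<Omega>" using measurable_sets[OF G, of "cylinder v"] by (simp add: vimage_def Int_def conj_commute)
      show "{u\<in>space \<Omega>. u 0 = v} \<in> sets \<Omega>"
        using measurable_sets[OF comp'[of id 0], of "{v}"] by (simp add: vimage_def Int_def conj_commute)
    qed
    also have "\<dots> = measure (distr \<Omega> (measure_pmf P) (\<lambda>u. u 0)) {v}"
      by (subst measure_distr[OF comp]) (auto intro!: arg_cong[where f = "measure \<Omega>"])
    also have "distr \<Omega> (measure_pmf P) (\<lambda>u. u 0) = measure_pmf P"
      unfolding \<Omega>_def by (rule PiM_component) simp
    finally show ?thesis by (simp add: measure_pmf_single)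
  qed
  have "AE u in \<Omega>. prefix_word (G u) q \<in> set_pmf P" using aeW by eventually_elim (simp add: pre)
  moreover have "{\<omega> \<in> space borel. prefix_word \<omega> q \<in> set_pmf P} \<in> sets borel"
    using measurable_sets[OF prefix_word_measurable[of q], of "set_pmf P"] by (simp add: vimage_def)
  ultimately have "AE \<omega> in \<mu>. prefix_word \<omega> q \<in> set_pmf P"
    unfolding \<mu>_def using AE_distr_iff[OF G] by auto
  thus ?thesis using mem cyl by blast
qed

lemma (in prob_space) expectation_in_target_nhd:
  assumes "integrable M X" "AE x in M. X x \<in> target_nhd n \<beta>"
  shows "expectation X \<in> target_nhd n \<beta>"
proof (cases \<beta>)
  case (real r)
  have "AE x in M. r - 1 / real n < X x" "AE x in M. X x < r + 1 / real n"
    using assms(2) by (auto simp: real target_nhd_def elim: eventually_mono)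
  thus ?thesis using expectation_greater[OF assms(1)] expectation_less[OF assms(1)] by (auto simp: real target_nhd_def)
next
  case PInf
  have "AE x in M. real n < X x" using assms(2) by (auto simp: PInf target_nhd_def elim: eventually_mono)
  thus ?thesis using expectation_greater[OF assms(1)] by (auto simp: PInf target_nhd_def)
next
  case MInf
  have "AE x in M. X x < - real n" using assms(2) by (auto simp: MInf target_nhd_def elim: eventually_mono)
  thus ?thesis using expectation_less[OF assms(1)] by (auto simp: MInf target_nhd_def)
qed

context birkhoff_family
begin

definition gibbs_pmf :: "real \<Rightarrow> nat list set \<Rightarrow> nat list pmf" where
  "gibbs_pmf s W = embed_pmf (\<lambda>v. if v \<in> W then \<phi> s v / sum (\<phi> s) W else 0)"

lemma gibbs_pmf:
  assumes "finite W" "W \<noteq> {}" "0 \<le> s"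
  shows "pmf (gibbs_pmf s W) v = (if v \<in> W then \<phi> s v / sum (\<phi> s) W else 0)" "set_pmf (gibbs_pmf s W) = W"
proof -
  have pos: "0 < sum (\<phi> s) W" using assms word_svf_pos[OF assms(3)] by (intro sum_pos) auto
  have nn: "0 \<le> (if v \<in> W then \<phi> s v / sum (\<phi> s) W else 0)" for v
    using pos word_svf_pos[OF assms(3), of v] by auto
  have "(\<integral>\<^sup>+v. ennreal (if v \<in> W then \<phi> s v / sum (\<phi> s) W else 0) \<partial>count_space UNIV) =
      (\<Sum>v\<in>W. ennreal (if v \<in> W then \<phi> s v / sum (\<phi> s) W else 0))"
    using assms(1) by (intro nn_integral_count_space') auto
  also have "\<dots> = ennreal (\<Sum>v\<in>W. \<phi> s v / sum (\<phi> s) W)"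
    using nn by (subst sum_ennreal[symmetric]) (auto intro!: sum.cong less_imp_le divide_pos_pos pos word_svf_pos[OF assms(3)])
  also have "(\<Sum>v\<in>W. \<phi> s v / sum (\<phi> s) W) = 1" using pos by (simp flip: sum_divide_distrib)
  finally have one: "(\<integral>\<^sup>+v. ennreal (if v \<in> W then \<phi> s v / sum (\<phi> s) W else 0) \<partial>count_space UNIV) = 1" by simp
  show p: "pmf (gibbs_pmf s W) v = (if v \<in> W then \<phi> s v / sum (\<phi> s) W else 0)" for v
    unfolding gibbs_pmf_def by (rule pmf_embed_pmf[OF nn one])
  show "set_pmf (gibbs_pmf s W) = W"
    using pos word_svf_pos[OF assms(3)] by (auto simp: set_pmf_eq p less_imp_neq[THEN not_sym])
qed

text \<open>The Gibbs vector \<open>\<phi>\<^sup>s / Z\<close> on \<open>W\<close> has pressure \<open>ln Z\<close>, which is not negative; so its Bernoulli measure has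
  dimension at least \<open>s\<close>.\<close>
lemma gibbs_measure_feasible:
  assumes W: "finite W" "\<And>v. v \<in> W \<Longrightarrow> length v = q" and q: "1 \<le> q" and s: "0 \<le> s" and Z: "1 \<le> sum (\<phi> s) W"
    and av: "\<And>v \<omega> i. v \<in> W \<Longrightarrow> \<omega> \<in> cylinder v \<Longrightarrow> i < n \<Longrightarrow> birkhoff_average q (\<Phi> i) \<omega> \<in> target_nhd n (\<alpha> i)"
  shows "\<exists>\<mu>\<in>feasible n q. s \<le> symbolic_dimension T q \<mu>"
proof -
  have ne: "W \<noteq> {}" using Z by auto
  let ?P = "gibbs_pmf s W" and ?Z = "sum (\<phi> s) W"
  note gp = gibbs_pmf[OF W(1) ne s]
  obtain \<mu> where mu: "\<mu> \<in> compact_invariant_measures q"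
    and cyl: "\<And>v. length v = q \<Longrightarrow> measure \<mu> (cylinder v) = pmf ?P v"
    and ae: "AE \<omega> in \<mu>. prefix_word \<omega> q \<in> W"
    using bernoulli_measure[OF q, of ?P] W gp(2) by auto
  have P: "prob_space \<mu>" and sets: "sets \<mu> = sets borel" using mu by (auto simp: compact_invariant_measures_def)
  interpret prob_space \<mu> by fact
  define A where "A = (\<Union>v\<in>W. set v)"
  have A: "finite A" using W(1) by (auto simp: A_def)
  have aeA: "AE \<omega> in \<mu>. \<forall>j<q. \<omega> j \<in> A"
    using ae
  proof eventually_elim
    case (elim \<omega>)
    show ?case
    proof (intro allI impI)
      fix j assume "j < q"
      hence "\<omega> j \<in> set (prefix_word \<omega> q)" by (auto simp: prefix_word_def)
      thus "\<omega> j \<in> A" using elim by (auto simp: A_def)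
    qed
  qed
  let ?F = "{w. length w = q \<and> set w \<subseteq> A}"
  let ?p = "\<lambda>w. measure \<mu> (cylinder w)"
  have WF: "W \<subseteq> ?F" using W(2) by (auto simp: A_def)
  have "pressure s ?p ?F = pressure s ?p W"
    using WF finite_words[OF A, of q] cyl gp(1) by (intro pressure_neutral) auto
  also have "\<dots> = (\<Sum>w\<in>W. \<phi> s w / ?Z * ln ?Z)"
    unfolding pressure_def
  proof (rule sum.cong[OF refl])
    fix w assume w: "w \<in> W"
    have p: "?p w = \<phi> s w / ?Z" using cyl[of w] W(2) w gp(1) by simp
    show "?p w * ln (\<phi> s w / ?p w) = \<phi> s w / ?Z * ln ?Z"
      unfolding p using word_svf_pos[OF s, of w] Z by simp
  qed
  also have "\<dots> \<ge> 0" using Z word_svf_pos[OF s] by (intro sum_nonneg mult_nonneg_nonneg divide_nonneg_nonneg) (auto intro: less_imp_le)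
  finally have "0 \<le> pressure s ?p ?F" .
  hence "s \<le> symbolic_dimension T q \<mu>"
    using symbolic_dimension_pressure(3)[OF P sets A aeA q s] by simp
  moreover have "\<mu> \<in> feasible n q"
    unfolding feasible_def
  proof (intro CollectI conjI mu allI impI)
    fix i assume i: "i < n"
    obtain V where V: "\<And>l \<omega> \<tau>. (\<forall>j<l. \<omega> j = \<tau> j) \<Longrightarrow> \<bar>birkhoff_sum (\<Phi> i) l \<omega> - birkhoff_sum (\<Phi> i) l \<tau>\<bar> \<le> V"
      using summable_variations_distortion[OF var[of i]] by blast
    have "\<bar>birkhoff_sum (\<Phi> i) q \<omega> - birkhoff_sum (\<Phi> i) q (zero_extension (prefix_word \<omega> q))\<bar> \<le> V" for \<omega>
      by (rule V) (simp add: zero_extension_def)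
    from marginal_integral(5)[OF P sets A aeA birkhoff_sum_measurable[OF summable_variations_measurable[OF var]] this]
    have "integrable \<mu> (birkhoff_sum (\<Phi> i) q)" by simp
    hence "integrable \<mu> (\<lambda>\<omega>. birkhoff_average q (\<Phi> i) \<omega>)" by (simp add: birkhoff_average_eq)
    moreover have "AE \<omega> in \<mu>. birkhoff_average q (\<Phi> i) \<omega> \<in> target_nhd n (\<alpha> i)"
      using ae by eventually_elim (rule av[OF _ prefix_word_in_cylinder i])
    ultimately show "(\<integral>\<omega>. birkhoff_average q (\<Phi> i) \<omega> \<partial>\<mu>) \<in> target_nhd n (\<alpha> i)"
      by (rule expectation_in_target_nhd)
  qed
  ultimately show ?thesis by blast
qed

section \<open>Existence of the limits\<close>

text \<open>A large dimension at infinitely many levels \<open>k\<close> is inherited by all late levels, with an arbitrarily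
  small loss: in every large length there are words over which \<open>\<phi>\<^sup>s\<close> has a large sum, and their Gibbs
  vector is feasible.\<close>
lemma eventually_dimension_sup_ge:
  assumes s: "0 \<le> s" "s < s'" and freq: "\<exists>\<^sub>F k in sequentially. ennreal s' < dimension_sup T \<Phi> \<alpha> n k"
  shows "\<forall>\<^sub>F q in sequentially. ennreal s \<le> dimension_sup T \<Phi> \<alpha> n q"
    and "\<exists>q0. \<forall>q\<ge>q0. \<exists>W. finite W \<and> (\<forall>v\<in>W. length v = q) \<and> B \<le> sum (\<phi> s) W \<and>
     (\<forall>v\<in>W. \<forall>\<omega>\<in>cylinder v. \<forall>i<n. birkhoff_average q (\<Phi> i) \<omega> \<in> target_nhd n (\<alpha> i))"
proof -
  have "\<exists>\<^sub>F k in sequentially. \<exists>\<mu>\<in>feasible n k. s' \<le> symbolic_dimension T k \<mu>"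
    using freq
  proof (rule frequently_elim1)
    fix k assume "ennreal s' < dimension_sup T \<Phi> \<alpha> n k"
    then obtain \<mu> where m: "\<mu> \<in> feasible n k" "ennreal s' < ennreal (symbolic_dimension T k \<mu>)"
      unfolding dimension_sup_eq less_SUP_iff by blast
    hence "s' \<le> symbolic_dimension T k \<mu>" using s by (simp add: ennreal_less_iff)
    thus "\<exists>\<mu>\<in>feasible n k. s' \<le> symbolic_dimension T k \<mu>" using m(1) by blast
  qed
  note gw = growing_words[OF s this]
  show "\<exists>q0. \<forall>q\<ge>q0. \<exists>W. finite W \<and> (\<forall>v\<in>W. length v = q) \<and> B \<le> sum (\<phi> s) W \<and>
     (\<forall>v\<in>W. \<forall>\<omega>\<in>cylinder v. \<forall>i<n. birkhoff_average q (\<Phi> i) \<omega> \<in> target_nhd n (\<alpha> i))" by (rule gw)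
  obtain q0 where q0: "\<forall>q\<ge>q0. \<exists>W. finite W \<and> (\<forall>v\<in>W. length v = q) \<and> 1 \<le> sum (\<phi> s) W \<and>
     (\<forall>v\<in>W. \<forall>\<omega>\<in>cylinder v. \<forall>i<n. birkhoff_average q (\<Phi> i) \<omega> \<in> target_nhd n (\<alpha> i))"
    using gw[of 1] by (elim exE)
  show "\<forall>\<^sub>F q in sequentially. ennreal s \<le> dimension_sup T \<Phi> \<alpha> n q"
    unfolding eventually_sequentially
  proof (intro exI[of _ "max 1 q0"] allI impI)
    fix q assume q: "max 1 q0 \<le> q"
    have "q0 \<le> q" using q by simp
    from mp[OF spec[OF q0] this] obtain W where W: "finite W" "\<forall>v\<in>W. length v = q" "1 \<le> sum (\<phi> s) W"
      "\<forall>v\<in>W. \<forall>\<omega>\<in>cylinder v. \<forall>i<n. birkhoff_average q (\<Phi> i) \<omega> \<in> target_nhd n (\<alpha> i)"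
      by (elim exE conjE)
    have "\<exists>\<mu>\<in>feasible n q. s \<le> symbolic_dimension T q \<mu>"
      by (rule gibbs_measure_feasible[OF W(1)]) (use W q s in auto)
    then obtain \<mu> where mu: "\<mu> \<in> feasible n q" "s \<le> symbolic_dimension T q \<mu>" by blast
    show "ennreal s \<le> dimension_sup T \<Phi> \<alpha> n q"
      unfolding dimension_sup_eq by (rule SUP_upper2[OF mu(1)]) (simp add: mu(2) ennreal_leI)
  qed
qed

text \<open>The limit superior is a limit, as is shown next. The index 0, at which the neighbourhoods degenerate,
  repeats the value at 1.\<close>
definition level_limit :: "nat \<Rightarrow> ennreal" where
  "level_limit n = limsup (dimension_sup T \<Phi> \<alpha> (max 1 n))"

lemma dimension_sup_tendsto: "dimension_sup T \<Phi> \<alpha> n \<longlonglongrightarrow> limsup (dimension_sup T \<Phi> \<alpha> n)"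
proof (rule Liminf_eq_Limsup)
  let ?X = "dimension_sup T \<Phi> \<alpha> n"
  have "limsup ?X \<le> liminf ?X"
  proof (rule ccontr)
    assume "\<not> ?thesis"
    hence "liminf ?X < limsup ?X" by simp
    then obtain y where y: "liminf ?X < y" "y < limsup ?X" using dense by blast
    then obtain z where z: "y < z" "z < limsup ?X" using dense by blast
    have "y < \<infinity>" "z < \<infinity>" using y z by (auto intro: less_le_trans[of _ "limsup ?X"])
    then obtain s s' where ss: "y = ennreal s" "0 \<le> s" "z = ennreal s'" "0 \<le> s'"
      by (metis ennreal_cases infinity_ennreal_def order_less_irrefl)
    have lt: "s < s'" using z(1) ss by (simp add: ennreal_less_iff)
    have "\<exists>\<^sub>F k in sequentially. ennreal s' < ?X k"
    proof (rule ccontr)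
      assume "\<not> ?thesis"
      hence "\<forall>\<^sub>F k in sequentially. ?X k \<le> z" by (simp add: frequently_def ss not_less)
      hence "limsup ?X \<le> z" by (rule Limsup_bounded)
      thus False using z(2) by simp
    qed
    from eventually_dimension_sup_ge(1)[OF ss(2) lt this] have "y \<le> liminf ?X"
      unfolding ss(1) by (rule Liminf_bounded)
    thus False using y(1) by simp
  qed
  thus "liminf ?X = limsup ?X" using Liminf_le_Limsup[of sequentially ?X] by (simp add: antisym)
qed simp_all

lemma level_limit: "1 \<le> n \<Longrightarrow> dimension_sup T \<Phi> \<alpha> n \<longlonglongrightarrow> level_limit n"
  using dimension_sup_tendsto[of n] by (simp add: level_limit_def max_absorb2)

lemma target_nhd_antimono: "1 \<le> n \<Longrightarrow> n \<le> m \<Longrightarrow> target_nhd m \<beta> \<subseteq> target_nhd n \<beta>"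
proof -
  assume n: "1 \<le> n" "n \<le> m"
  hence "1 / real m \<le> 1 / real n" by (simp add: frac_le)
  thus ?thesis using n by (cases \<beta>) (auto simp: target_nhd_def)
qed

lemma level_limit_antimono: "n \<le> m \<Longrightarrow> level_limit m \<le> level_limit n"
proof -
  assume nm: "n \<le> m"
  have "feasible (max 1 m) k \<subseteq> feasible (max 1 n) k" for k
  proof
    fix \<mu> assume mu: "\<mu> \<in> feasible (max 1 m) k"
    show "\<mu> \<in> feasible (max 1 n) k"
      unfolding feasible_def
    proof (intro CollectI conjI allI impI)
      show "\<mu> \<in> compact_invariant_measures k" using mu by (simp add: feasible_def)
      fix i assume "i < max 1 n"
      hence "i < max 1 m" using nm by auto
      hence "(\<integral>\<omega>. birkhoff_average k (\<Phi> i) \<omega> \<partial>\<mu>) \<in> target_nhd (max 1 m) (\<alpha> i)"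
        using mu by (simp add: feasible_def)
      thus "(\<integral>\<omega>. birkhoff_average k (\<Phi> i) \<omega> \<partial>\<mu>) \<in> target_nhd (max 1 n) (\<alpha> i)"
        using target_nhd_antimono[OF _ max.mono[OF order_refl nm], of 1 "\<alpha> i"] by auto
    qed
  qed
  hence "dimension_sup T \<Phi> \<alpha> (max 1 m) k \<le> dimension_sup T \<Phi> \<alpha> (max 1 n) k" for k
    unfolding dimension_sup_eq by (intro SUP_subset_mono) auto
  thus ?thesis unfolding level_limit_def by (intro Limsup_mono) auto
qed

lemma level_limit_tendsto: "level_limit \<longlonglongrightarrow> (INF n. level_limit n)"
  by (rule LIMSEQ_INF) (auto simp: decseq_def level_limit_antimono)

end

section \<open>Null sets of Hausdorff measures\<close>

lemma nn_integral_count_space_countable: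
  fixes f :: "'a::countable \<Rightarrow> ennreal"
  shows "(\<integral>\<^sup>+x. f x \<partial>count_space UNIV) = (\<Sum>n. if n \<in> range (to_nat :: 'a \<Rightarrow> nat) then f (from_nat n) else 0)"
proof -
  have "(\<integral>\<^sup>+x. f x \<partial>count_space UNIV) = (\<integral>\<^sup>+x. f (from_nat (to_nat (x :: 'a))) \<partial>count_space UNIV)" by simp
  also have "\<dots> = (\<integral>\<^sup>+n. f (from_nat n) \<partial>count_space (range (to_nat :: 'a \<Rightarrow> nat)))"
    by (rule nn_integral_bij_count_space) (simp add: inj_on_imp_bij_betw)
  also have "\<dots> = (\<integral>\<^sup>+n. f (from_nat n) * indicator (range (to_nat :: 'a \<Rightarrow> nat)) n \<partial>count_space UNIV)"
    by (rule nn_integral_count_space_indicator) simp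
  also have "\<dots> = (\<Sum>n. f (from_nat n) * indicator (range (to_nat :: 'a \<Rightarrow> nat)) n)"
    by (rule nn_integral_count_space_nat)
  also have "\<dots> = (\<Sum>n. if n \<in> range (to_nat :: 'a \<Rightarrow> nat) then f (from_nat n) else 0)"
    by (intro arg_cong[where f = suminf] ext) (simp add: indicator_def)
  finally show ?thesis .
qed

lemma nn_integral_count_space_le:
  fixes f :: "'a::countable \<Rightarrow> ennreal"
  assumes "\<And>W. finite W \<Longrightarrow> sum f W \<le> c"
  shows "(\<integral>\<^sup>+x. f x \<partial>count_space UNIV) \<le> c"
proof -
  have "(\<Sum>n<N. if n \<in> range (to_nat :: 'a \<Rightarrow> nat) then f (from_nat n) else 0) \<le> c" for N
  proof -
    let ?J = "{n\<in>{..<N}. n \<in> range (to_nat :: 'a \<Rightarrow> nat)}"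
    have inj: "inj_on (from_nat :: nat \<Rightarrow> 'a) ?J" by (rule inj_onI) auto
    have "(\<Sum>n<N. if n \<in> range (to_nat :: 'a \<Rightarrow> nat) then f (from_nat n) else 0) = (\<Sum>n\<in>?J. f (from_nat n))"
      by (rule sum.mono_neutral_cong_right) auto
    also have "\<dots> = sum f (from_nat ` ?J)" by (subst sum.reindex[OF inj]) (simp add: o_def)
    also have "\<dots> \<le> c" by (rule assms) simp
    finally show ?thesis .
  qed
  thus ?thesis unfolding nn_integral_count_space_countable by (intro suminf_le_const) auto
qed

text \<open>Covers may be indexed by any countable type, which saves the enumeration of covers that are built from
  covers of countably many pieces.\<close>
lemma hausdorff_measure_nullI:
  fixes A :: "'a::metric_space set"
  assumes "\<And>e \<delta>. 0 < e \<Longrightarrow> 0 < \<delta> \<Longrightarrow> \<exists>U :: 'i::countable \<Rightarrow> 'a set. A \<subseteq> (\<Union>i. U i) \<and>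
     (\<forall>i. bounded (U i) \<and> diameter (U i) \<le> \<delta>) \<and> (\<integral>\<^sup>+i. hausdorff_gauge s (U i) \<partial>count_space UNIV) \<le> ennreal e"
  shows "hausdorff_measure s A = 0"
proof -
  have "hausdorff_premeasure s \<delta> A \<le> 0" if d: "0 < \<delta>" for \<delta>
  proof (rule ennreal_le_epsilon)
    fix e :: real assume e: "0 < e"
    obtain U :: "'i \<Rightarrow> 'a set" where U: "A \<subseteq> (\<Union>i. U i)" "\<And>i. bounded (U i)" "\<And>i. diameter (U i) \<le> \<delta>"
      "(\<integral>\<^sup>+i. hausdorff_gauge s (U i) \<partial>count_space UNIV) \<le> ennreal e"
      using assms[OF e d] by blast
    define U' where "U' n = (if n \<in> range (to_nat :: 'i \<Rightarrow> nat) then U (from_nat n) else {})" for n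
    have "A \<subseteq> (\<Union>n. U' n)"
    proof
      fix x assume "x \<in> A"
      then obtain i where "x \<in> U i" using U(1) by auto
      hence "x \<in> U' (to_nat i)" by (simp add: U'_def)
      thus "x \<in> (\<Union>n. U' n)" by blast
    qed
    moreover have "bounded (U' n) \<and> diameter (U' n) \<le> \<delta>" for n using U(2,3) d by (simp add: U'_def)
    ultimately have "hausdorff_premeasure s \<delta> A \<le> (\<Sum>n. hausdorff_gauge s (U' n))"
      unfolding hausdorff_premeasure_def by (intro INF_lower) auto
    also have "\<dots> = (\<integral>\<^sup>+i. hausdorff_gauge s (U i) \<partial>count_space UNIV)"
      unfolding nn_integral_count_space_countable
      by (intro arg_cong[where f = suminf] ext) (simp add: U'_def hausdorff_gauge_def)
    also have "\<dots> \<le> 0 + ennreal e" using U(4) by simp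
    finally show "hausdorff_premeasure s \<delta> A \<le> 0 + ennreal e" .
  qed
  hence "hausdorff_measure s A \<le> 0" unfolding hausdorff_measure_def by (intro SUP_least) auto
  thus ?thesis by simp
qed

lemma hausdorff_dim_le: "0 \<le> s \<Longrightarrow> hausdorff_measure s A = 0 \<Longrightarrow> hausdorff_dim A \<le> ennreal s"
  unfolding hausdorff_dim_def by (intro INF_lower) auto

lemma hausdorff_gauge_le:
  assumes "0 < s" "0 \<le> D" "diameter U \<le> D" "bounded U"
  shows "hausdorff_gauge s U \<le> ennreal (D powr s)"
  using assms diameter_ge_0[of U] by (auto simp: hausdorff_gauge_def intro!: ennreal_leI powr_mono2)

lemma diameter_le_norm:
  fixes U :: "'a::real_normed_vector set"
  assumes "\<And>x y. x \<in> U \<Longrightarrow> y \<in> U \<Longrightarrow> norm (x - y) \<le> D" "0 \<le> D"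
  shows "bounded U" "diameter U \<le> D"
proof -
  show "bounded U"
  proof (cases "U = {}")
    case False
    then obtain x where "x \<in> U" by blast
    thus ?thesis using assms(1) unfolding bounded_def by (intro exI[of _ x] exI[of _ D]) (auto simp: dist_norm)
  qed simp
  show "diameter U \<le> D" using assms by (intro diameter_le) auto
qed

text \<open>Cover by the cells of a grid of mesh \<open>r \<rightarrow> 0\<close>: the number of cells is of order \<open>r\<close> to the power minus
  the dimension.\<close>
lemma hausdorff_dim_bounded_le:
  fixes A :: "(real ^ 'n) set"
  assumes A: "A \<subseteq> cball 0 R" and R: "0 \<le> R"
  shows "hausdorff_dim A \<le> ennreal (real CARD('n))"
proof (rule ccontr)
  let ?d = "real CARD('n)"
  assume "\<not> ?thesis"
  hence "ennreal ?d < hausdorff_dim A" by (simp only: not_le)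
  from dense[OF this] obtain z where z: "ennreal ?d < z" "z < hausdorff_dim A" by (elim exE conjE)
  then obtain s where s: "z = ennreal s" "0 \<le> s" by (cases z rule: ennreal_cases) auto
  have sd: "?d < s" using z(1) s by (simp add: ennreal_less_iff)
  have s0: "0 < s" using sd by (meson of_nat_0_le_iff le_less_trans)
  define C where "C = (2 * R + 2) ^ CARD('n) * sqrt ?d powr s"
  have C: "0 < C" using R by (auto simp: C_def intro!: mult_pos_pos)
  have "hausdorff_measure s A = 0"
  proof (rule hausdorff_measure_nullI[where 'i = "int list"])
    fix e \<delta> :: real assume ed: "0 < e" "0 < \<delta>"
    define r where "r = min (min 1 (\<delta> / sqrt ?d)) ((e / C) powr (1 / (s - ?d)))"
    have r: "0 < r" "r \<le> 1" "r \<le> \<delta> / sqrt ?d" "r \<le> (e / C) powr (1 / (s - ?d))"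
      using ed C by (auto simp: r_def)
    obtain c :: "real ^ 'n \<Rightarrow> int list" where c: "finite (c ` cball 0 R)"
      "\<And>x y. c x = c y \<Longrightarrow> norm (x - y) \<le> sqrt ?d * r" "real (card (c ` cball 0 R)) \<le> ((2 * R + 2) / r) ^ CARD('n)"
      using bounded_set_cover[OF R r(1,2)] by blast
    define U where "U z = {x\<in>A. c x = z}" for z
    have D: "0 \<le> sqrt ?d * r" using r by simp
    have U: "bounded (U z)" "diameter (U z) \<le> sqrt ?d * r" for z
      using diameter_le_norm[of "U z" "sqrt ?d * r"] c(2) D by (auto simp: U_def)
    have "sqrt ?d * r \<le> \<delta>" using r(3) by (simp add: pos_le_divide_eq mult.commute)
    hence Ud: "diameter (U z) \<le> \<delta>" for z using U(2)[of z] by linarith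
    have "(\<integral>\<^sup>+z. hausdorff_gauge s (U z) \<partial>count_space UNIV) = (\<Sum>z\<in>c ` cball 0 R. hausdorff_gauge s (U z))"
    proof (rule nn_integral_count_space'[OF c(1)])
      fix z assume "z \<notin> c ` cball 0 R"
      hence "U z = {}" using A by (auto simp: U_def)
      thus "hausdorff_gauge s (U z) = 0" by (simp add: hausdorff_gauge_def)
    qed auto
    also have "\<dots> \<le> (\<Sum>z\<in>c ` cball 0 R. ennreal ((sqrt ?d * r) powr s))"
      using U D s0 by (intro sum_mono hausdorff_gauge_le) auto
    also have "\<dots> = ennreal (real (card (c ` cball 0 R)) * (sqrt ?d * r) powr s)"
      by (simp add: ennreal_mult ennreal_of_nat_eq_real_of_nat)
    also have "\<dots> \<le> ennreal e"
    proof (rule ennreal_leI)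
      have "real (card (c ` cball 0 R)) * (sqrt ?d * r) powr s \<le> ((2 * R + 2) / r) ^ CARD('n) * (sqrt ?d * r) powr s"
        using c(3) by (rule mult_right_mono) simp
      also have "\<dots> = C * (r powr s / r powr ?d)"
        using r by (simp add: C_def powr_mult power_divide powr_realpow)
      also have "r powr s / r powr ?d = r powr (s - ?d)" by (simp add: powr_diff)
      also have "C * r powr (s - ?d) \<le> C * ((e / C) powr (1 / (s - ?d))) powr (s - ?d)"
        using r sd C by (intro mult_left_mono powr_mono2) auto
      also have "\<dots> = e" using sd ed C by (simp add: powr_powr)
      finally show "real (card (c ` cball 0 R)) * (sqrt ?d * r) powr s \<le> e" .
    qed
    finally have "(\<integral>\<^sup>+z. hausdorff_gauge s (U z) \<partial>count_space UNIV) \<le> ennreal e" .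
    moreover have "A \<subseteq> (\<Union>z. U z)" by (auto simp: U_def)
    ultimately show "\<exists>U :: int list \<Rightarrow> (real ^ 'n) set. A \<subseteq> (\<Union>i. U i) \<and>
     (\<forall>i. bounded (U i) \<and> diameter (U i) \<le> \<delta>) \<and> (\<integral>\<^sup>+i. hausdorff_gauge s (U i) \<partial>count_space UNIV) \<le> ennreal e"
      using U(1) Ud by blast
  qed
  hence "hausdorff_dim A \<le> z" unfolding s(1) by (rule hausdorff_dim_le[OF s(2)])
  thus False using z(2) by simp
qed

section \<open>The projection\<close>

lemma cube_norm_le: "x \<in> cbox 0 1 \<Longrightarrow> norm (x :: real ^ 'n) \<le> real CARD('n)"
proof -
  assume x: "x \<in> cbox 0 1"
  have "norm x \<le> (\<Sum>k\<in>UNIV. \<bar>x $ k\<bar>)" by (rule norm_le_l1_cart)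
  also have "\<dots> \<le> (\<Sum>k\<in>(UNIV :: 'n set). 1)"
  proof (rule sum_mono)
    fix k
    have "0 \<le> x $ k \<and> x $ k \<le> 1" using x by (simp add: mem_box_cart)
    thus "\<bar>x $ k\<bar> \<le> 1" by simp
  qed
  finally show ?thesis by simp
qed

context affine_family
begin

definition bounded_translation :: "(nat \<Rightarrow> real ^ 'n) \<Rightarrow> bool" where
  "bounded_translation a \<longleftrightarrow> (\<forall>i. norm (a i) \<le> real CARD('n))"

lemma projection_term_le:
  assumes "bounded_translation a"
  shows "norm (M (prefix_word \<omega> j) *v a (\<omega> j)) \<le> real CARD('n) * \<rho> ^ j"
proof -
  have "norm (M (prefix_word \<omega> j) *v a (\<omega> j)) \<le> \<rho> ^ j * norm (a (\<omega> j))"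
    using word_matrix_contr[of "prefix_word \<omega> j"] by simp
  also have "\<dots> \<le> \<rho> ^ j * real CARD('n)" using assms rho by (intro mult_left_mono) (auto simp: bounded_translation_def)
  finally show ?thesis by (simp add: mult.commute)
qed

lemma projection_summable:
  assumes "bounded_translation a"
  shows "summable (\<lambda>j. M (prefix_word \<omega> j) *v a (\<omega> j))"
proof (rule summable_comparison_test'[where N = 0])
  show "summable (\<lambda>j. real CARD('n) * \<rho> ^ j)" using rho by (intro summable_mult summable_geometric) auto
  show "norm (M (prefix_word \<omega> j) *v a (\<omega> j)) \<le> real CARD('n) * \<rho> ^ j" for j by (rule projection_term_le[OF assms])
qed

lemma norm_projection_le:
  assumes "bounded_translation a"
  shows "norm (projection T a \<omega>) \<le> 2 * real CARD('n)"
proof -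
  have g: "(\<lambda>j. real CARD('n) * \<rho> ^ j) sums (real CARD('n) * (1 / (1 - \<rho>)))"
    using rho by (intro sums_mult geometric_sums) auto
  have "norm (projection T a \<omega>) \<le> (\<Sum>j. real CARD('n) * \<rho> ^ j)"
    unfolding projection_def using projection_term_le[OF assms] sums_summable[OF g]
    by (intro norm_suminf_le) auto
  also have "\<dots> = real CARD('n) * (1 / (1 - \<rho>))" using g by (simp add: sums_iff)
  also have "\<dots> \<le> real CARD('n) * 2" using rho by (intro mult_left_mono) (auto simp: field_simps)
  finally show ?thesis by simp
qed

lemma projection_split:
  assumes "bounded_translation a"
  shows "projection T a \<omega> = (\<Sum>j<n. M (prefix_word \<omega> j) *v a (\<omega> j)) + M (prefix_word \<omega> n) *v projection T a ((shift ^^ n) \<omega>)"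
proof -
  have bl: "bounded_linear ((*v) (M (prefix_word \<omega> n)))" by simp
  have "projection T a \<omega> = (\<Sum>j. M (prefix_word \<omega> (j + n)) *v a (\<omega> (j + n))) + (\<Sum>j<n. M (prefix_word \<omega> j) *v a (\<omega> j))"
    unfolding projection_def by (rule suminf_split_initial_segment[OF projection_summable[OF assms]])
  also have "(\<Sum>j. M (prefix_word \<omega> (j + n)) *v a (\<omega> (j + n))) =
      (\<Sum>j. M (prefix_word \<omega> n) *v (M (prefix_word ((shift ^^ n) \<omega>) j) *v a (((shift ^^ n) \<omega>) j)))"
    using prefix_word_add[of \<omega> n]
    by (simp add: word_matrix_append matrix_vector_mul_assoc add.commute[of _ n]) (simp add: shift_funpow add.commute)
  also have "\<dots> = M (prefix_word \<omega> n) *v projection T a ((shift ^^ n) \<omega>)"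
    unfolding projection_def by (rule bounded_linear.suminf[OF bl projection_summable[OF assms], symmetric])
  finally show ?thesis by (simp add: add.commute)
qed

lemma projection_diff:
  assumes "bounded_translation a" "prefix_word \<omega> n = w" "prefix_word \<tau> n = w"
  shows "projection T a \<omega> - projection T a \<tau> = M w *v (projection T a ((shift ^^ n) \<omega>) - projection T a ((shift ^^ n) \<tau>))"
proof -
  have e: "\<And>i. i < n \<Longrightarrow> \<omega> i = \<tau> i" using assms(2,3) prefix_word_eq_iff by metis
  have "(\<Sum>j<n. M (prefix_word \<omega> j) *v a (\<omega> j)) = (\<Sum>j<n. M (prefix_word \<tau> j) *v a (\<tau> j))"
  proof (rule sum.cong[OF refl])
    fix j assume "j \<in> {..<n}"
    hence "prefix_word \<omega> j = prefix_word \<tau> j" "\<omega> j = \<tau> j" using e by (auto simp: prefix_word_eq_iff)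
    thus "M (prefix_word \<omega> j) *v a (\<omega> j) = M (prefix_word \<tau> j) *v a (\<tau> j)" by simp
  qed
  thus ?thesis using projection_split[OF assms(1), of \<omega> n] projection_split[OF assms(1), of \<tau> n] assms(2,3)
    by (simp add: matrix_vector_mult_diff_distrib)
qed

lemma translation_bounded: "a \<in> space (translation_measure :: (nat \<Rightarrow> real ^ 'n) measure) \<Longrightarrow> bounded_translation a"
proof -
  assume "a \<in> space (translation_measure :: (nat \<Rightarrow> real ^ 'n) measure)"
  hence a: "a i \<in> cbox 0 1" for i by (auto simp: translation_measure_def space_PiM space_restrict_space PiE_iff)
  thus ?thesis by (simp add: bounded_translation_def cube_norm_le)
qed

text \<open>The projection of the cylinder of \<open>v\<close> is a translate of the image of a bounded set under \<open>M v\<close>, so the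
  covers of ellipsoids apply.\<close>
lemma cylinder_cover:
  assumes a: "bounded_translation a" and s: "0 < s" "s \<le> real CARD('n)"
  shows "\<exists>U :: int list \<Rightarrow> (real ^ 'n) set. projection T a ` cylinder v \<subseteq> (\<Union>z. U z) \<and>
     (\<forall>z. bounded (U z) \<and> diameter (U z) \<le> sqrt (real CARD('n)) * (1/2) ^ length v) \<and>
     (\<integral>\<^sup>+z. hausdorff_gauge s (U z) \<partial>count_space UNIV) \<le>
       ennreal (sqrt (real CARD('n)) powr s * (4 * real CARD('n) + 2) ^ CARD('n) * \<phi> s v)"
proof -
  let ?d = "real CARD('n)" and ?n = "length v" and ?R = "2 * real CARD('n)"
  let ?\<pi> = "\<lambda>\<omega>. projection T a ((shift ^^ length v) \<omega>)"
  obtain c :: "real ^ 'n \<Rightarrow> int list" and r where c: "0 < r" "r \<le> (1/2) ^ ?n" "finite (c ` cball 0 ?R)"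
    "\<And>x y. c x = c y \<Longrightarrow> norm (M v *v x - M v *v y) \<le> sqrt ?d * r"
    "real (card (c ` cball 0 ?R)) * r powr s \<le> (2 * ?R + 2) ^ CARD('n) * \<phi> s v"
  proof -
    have "norm (M v *v x) \<le> (1/2) ^ ?n * norm x" for x
      using word_matrix_contr[of v x] mult_right_mono[OF power_mono[of \<rho> "1/2" ?n], of "norm x"] rho by simp
    from singular_value_function_cover[OF word_matrix_invertible s, of ?R v, OF _ this] that
    show thesis unfolding word_svf_def by auto
  qed
  define U where "U z = projection T a ` {\<omega>\<in>cylinder v. c (?\<pi> \<omega>) = z}" for z
  have D: "0 \<le> sqrt ?d * r" using c(1) by simp
  have Un: "norm (x - y) \<le> sqrt ?d * r" if xy: "x \<in> U z" "y \<in> U z" for x y z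
  proof -
    obtain \<omega> \<tau> where w: "x = projection T a \<omega>" "\<omega> \<in> cylinder v" "c (?\<pi> \<omega>) = z"
      "y = projection T a \<tau>" "\<tau> \<in> cylinder v" "c (?\<pi> \<tau>) = z" using xy unfolding U_def by blast
    have "x - y = M v *v (?\<pi> \<omega> - ?\<pi> \<tau>)"
      unfolding w(1,4) using w(2,5) by (intro projection_diff[OF a]) (auto simp: cylinder_def)
    hence "x - y = M v *v ?\<pi> \<omega> - M v *v ?\<pi> \<tau>" by (simp add: matrix_vector_mult_diff_distrib)
    thus ?thesis using c(4)[of "?\<pi> \<omega>" "?\<pi> \<tau>"] w(3,6) by simp
  qed
  have U: "bounded (U z)" "diameter (U z) \<le> sqrt ?d * r" for z
    using diameter_le_norm[OF Un D] by auto
  have "sqrt ?d * r \<le> sqrt ?d * (1/2) ^ ?n" using c(2) by (intro mult_left_mono) auto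
  hence Ud: "diameter (U z) \<le> sqrt ?d * (1/2) ^ ?n" for z using U(2)[of z] by linarith
  have "(\<integral>\<^sup>+z. hausdorff_gauge s (U z) \<partial>count_space UNIV) = (\<Sum>z\<in>c ` cball 0 ?R. hausdorff_gauge s (U z))"
  proof (rule nn_integral_count_space'[OF c(3)])
    fix z assume "z \<notin> c ` cball 0 ?R"
    hence "U z = {}" using norm_projection_le[OF a] by (auto simp: U_def)
    thus "hausdorff_gauge s (U z) = 0" by (simp add: hausdorff_gauge_def)
  qed auto
  also have "\<dots> \<le> (\<Sum>z\<in>c ` cball 0 ?R. ennreal ((sqrt ?d * r) powr s))"
    using U D s by (intro sum_mono hausdorff_gauge_le) auto
  also have "\<dots> = ennreal (real (card (c ` cball 0 ?R)) * (sqrt ?d * r) powr s)"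
    by (simp add: ennreal_mult ennreal_of_nat_eq_real_of_nat)
  also have "\<dots> \<le> ennreal (sqrt ?d powr s * (4 * ?d + 2) ^ CARD('n) * \<phi> s v)"
  proof (rule ennreal_leI)
    have "real (card (c ` cball 0 ?R)) * (sqrt ?d * r) powr s = sqrt ?d powr s * (real (card (c ` cball 0 ?R)) * r powr s)"
      using c(1) by (simp add: powr_mult)
    also have "\<dots> \<le> sqrt ?d powr s * ((2 * ?R + 2) ^ CARD('n) * \<phi> s v)" by (intro mult_left_mono c(5)) simp
    finally show "real (card (c ` cball 0 ?R)) * (sqrt ?d * r) powr s \<le> sqrt ?d powr s * (4 * ?d + 2) ^ CARD('n) * \<phi> s v"
      by (simp add: mult.assoc)
  qed
  finally have "(\<integral>\<^sup>+z. hausdorff_gauge s (U z) \<partial>count_space UNIV) \<le> ennreal (sqrt ?d powr s * (4 * ?d + 2) ^ CARD('n) * \<phi> s v)" .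
  moreover have "projection T a ` cylinder v \<subseteq> (\<Union>z. U z)" by (auto simp: U_def)
  ultimately show ?thesis using U(1) Ud by (intro exI[of _ U]) blast
qed

end

section \<open>The upper bound\<close>

lemma target_nhd_widen:
  assumes "1 \<le> n" "x \<in> target_nhd (Suc n) \<beta>" "\<bar>y - x\<bar> \<le> 1 / real n - 1 / real (Suc n)"
  shows "y \<in> target_nhd n \<beta>"
proof (cases \<beta>)
  case (real r)
  thus ?thesis using assms by (simp add: target_nhd_def) linarith
next
  have "1 / real n - 1 / real (Suc n) \<le> 1"
  proof -
    have "1 / real n \<le> 1" using assms(1) by simp
    moreover have "0 \<le> 1 / real (Suc n)" by simp
    ultimately show ?thesis by linarith
  qed
  hence d: "\<bar>y - x\<bar> \<le> 1" using assms(3) by linarith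
  case PInf
  thus ?thesis using assms(2) d by (auto simp: target_nhd_def)
next
  have "1 / real n - 1 / real (Suc n) \<le> 1"
  proof -
    have "1 / real n \<le> 1" using assms(1) by simp
    moreover have "0 \<le> 1 / real (Suc n)" by simp
    ultimately show ?thesis by linarith
  qed
  hence d: "\<bar>y - x\<bar> \<le> 1" using assms(3) by linarith
  case MInf
  thus ?thesis using assms(2) d by (auto simp: target_nhd_def)
qed

lemma eventually_target_nhd:
  assumes "(\<lambda>q. ereal (f q)) \<longlonglongrightarrow> \<beta>" "1 \<le> n"
  shows "\<forall>\<^sub>F q in sequentially. f q \<in> target_nhd n \<beta>"
proof (cases \<beta>)
  case (real r)
  have p: "0 < 1 / real n" using assms(2) by simp
  have "f \<longlonglongrightarrow> r" using assms(1) by (simp add: real)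
  hence "\<forall>\<^sub>F q in sequentially. r - 1 / real n < f q" "\<forall>\<^sub>F q in sequentially. f q < r + 1 / real n"
    using p by (auto intro: order_tendstoD)
  thus ?thesis by eventually_elim (simp add: real target_nhd_def)
next
  case PInf
  have "\<forall>\<^sub>F q in sequentially. ereal (real n) < ereal (f q)"
    using order_tendstoD(1)[OF assms(1), of "ereal (real n)"] by (simp add: PInf)
  thus ?thesis by eventually_elim (simp add: PInf target_nhd_def)
next
  case MInf
  have "\<forall>\<^sub>F q in sequentially. ereal (f q) < ereal (- real n)"
    using order_tendstoD(2)[OF assms(1), of "ereal (- real n)"] by (simp add: MInf)
  thus ?thesis by eventually_elim (simp add: MInf target_nhd_def)
qed

context birkhoff_family
begin

text \<open>One point of the cylinder is asked to have averages close to the targets. By bounded distortion all of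
  its points then have averages in the slightly larger neighbourhoods of level \<open>n\<close>, once \<open>q\<close> is large.\<close>
definition good_words :: "nat \<Rightarrow> nat \<Rightarrow> nat list set" where
  "good_words n q = {v. length v = q \<and> (\<exists>\<omega>\<in>cylinder v. \<forall>i<n. birkhoff_average q (\<Phi> i) \<omega> \<in> target_nhd (Suc n) (\<alpha> i))}"

lemma level_set_good_words:
  assumes "\<omega> \<in> level_set \<Phi> \<alpha>"
  shows "\<forall>\<^sub>F q in sequentially. prefix_word \<omega> q \<in> good_words n q"
proof -
  have "\<forall>\<^sub>F q in sequentially. \<forall>i\<in>{..<n}. birkhoff_average q (\<Phi> i) \<omega> \<in> target_nhd (Suc n) (\<alpha> i)"
    using assms by (intro eventually_ball_finite ballI eventually_target_nhd) (auto simp: level_set_def)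
  thus ?thesis by eventually_elim (use prefix_word_in_cylinder in \<open>auto simp: good_words_def\<close>)
qed

text \<open>Otherwise the Bernoulli measure of the Gibbs vector on \<open>W\<close> would be feasible and of dimension at
  least \<open>s\<close>.\<close>
lemma good_words_sum_less:
  assumes n: "1 \<le> n" and s: "0 \<le> s" and lim: "level_limit n < ennreal s"
  shows "\<forall>\<^sub>F q in sequentially. \<forall>W. finite W \<longrightarrow> W \<subseteq> good_words n q \<longrightarrow> sum (\<phi> s) W < 1"
proof -
  obtain V where V: "\<And>i l \<omega> \<tau>. i < n \<Longrightarrow> (\<forall>j<l. \<omega> j = \<tau> j) \<Longrightarrow>
      \<bar>birkhoff_sum (\<Phi> i) l \<omega> - birkhoff_sum (\<Phi> i) l \<tau>\<bar> \<le> V"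
    using uniform_distortion[of n] by blast
  define g where "g = 1 / real n - 1 / real (Suc n)"
  have g: "0 < g" using n by (simp add: g_def field_simps add_pos_nonneg)
  obtain k :: nat where k: "V / g < real k" using reals_Archimedean2 by blast
  have "\<forall>\<^sub>F q in sequentially. dimension_sup T \<Phi> \<alpha> n q < ennreal s"
    by (rule order_tendstoD(2)[OF level_limit[OF n] lim])
  moreover have "\<forall>\<^sub>F q in sequentially. max 1 k \<le> q" by (rule eventually_ge_at_top)
  ultimately show ?thesis
  proof eventually_elim
    case (elim q)
    have q: "1 \<le> q" "k \<le> q" using elim(2) by auto
    have Vq: "V / real q \<le> g"
    proof -
      have "V / g < real q" using k q by linarith
      thus ?thesis using g q by (simp add: field_simps)
    qed
    show ?case
    proof (intro allI impI, rule ccontr)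
      fix W assume W: "finite W" "W \<subseteq> good_words n q" "\<not> sum (\<phi> s) W < 1"
      have "\<exists>\<mu>\<in>feasible n q. s \<le> symbolic_dimension T q \<mu>"
      proof (rule gibbs_measure_feasible[OF W(1) _ q(1) s])
        show "length v = q" if "v \<in> W" for v using that W(2) by (auto simp: good_words_def)
        show "1 \<le> sum (\<phi> s) W" using W(3) by simp
        fix v \<tau> i assume v: "v \<in> W" "\<tau> \<in> cylinder v" and i: "i < n"
        obtain \<omega> where w: "\<omega> \<in> cylinder v" "birkhoff_average q (\<Phi> i) \<omega> \<in> target_nhd (Suc n) (\<alpha> i)" and len: "length v = q"
          using v(1) W(2) i by (auto simp: good_words_def)
        have "\<bar>birkhoff_sum (\<Phi> i) q \<tau> - birkhoff_sum (\<Phi> i) q \<omega>\<bar> \<le> V"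
          using v(2) w(1) len by (intro V[OF i]) (auto simp: cylinder_iff)
        hence "\<bar>birkhoff_sum (\<Phi> i) q \<tau> - birkhoff_sum (\<Phi> i) q \<omega>\<bar> / real q \<le> V / real q" by (rule divide_right_mono) simp
        hence "\<bar>birkhoff_average q (\<Phi> i) \<tau> - birkhoff_average q (\<Phi> i) \<omega>\<bar> \<le> V / real q"
          using q by (simp add: birkhoff_average_eq flip: diff_divide_distrib)
        hence "\<bar>birkhoff_average q (\<Phi> i) \<tau> - birkhoff_average q (\<Phi> i) \<omega>\<bar> \<le> 1 / real n - 1 / real (Suc n)"
          using Vq unfolding g_def by linarith
        thus "birkhoff_average q (\<Phi> i) \<tau> \<in> target_nhd n (\<alpha> i)" by (rule target_nhd_widen[OF n w(2)])
      qed
      then obtain \<mu> where mu: "\<mu> \<in> feasible n q" "s \<le> symbolic_dimension T q \<mu>" by blast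
      have "ennreal s \<le> dimension_sup T \<Phi> \<alpha> n q"
        unfolding dimension_sup_eq by (rule SUP_upper2[OF mu(1)]) (simp add: mu(2) ennreal_leI)
      thus False using elim(1) by simp
    qed
  qed
qed

text \<open>A point of the level set has good prefixes in all late lengths, hence lies in the union over \<open>N\<close> of the
  cylinders of good words of length \<open>Q N\<close>, for any lengths \<open>Q N \<ge> N\<close>. The sum of \<open>\<phi>\<^sup>t\<close> over good words of
  length \<open>q\<close> is at most \<open>2\<^sup>(\<^sup>s\<^sup>-\<^sup>t\<^sup>)\<^sup>q\<close>, so if the lengths are large and grow fast, then the total cost of the covers is
  arbitrarily small.\<close>
lemma hausdorff_dim_projection_le_above_limit:
  assumes a: "bounded_translation a" and s: "0 \<le> s" "s < t" "t \<le> real CARD('n)" and lim: "(INF n. level_limit n) < ennreal s"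
  shows "hausdorff_dim (projected_level_set T \<Phi> \<alpha> a) \<le> ennreal t"
proof -
  obtain m where m: "level_limit m < ennreal s" using lim by (auto simp: INF_less_iff)
  define n where "n = max 1 m"
  have n: "1 \<le> n" "level_limit n < ennreal s"
    using m level_limit_antimono[of m n] by (auto simp: n_def intro: le_less_trans)
  have t: "0 < t" using s by simp
  let ?d = "real CARD('n)"
  define C where "C = sqrt ?d powr t * (4 * ?d + 2) ^ CARD('n)"
  have C: "0 \<le> C" by (simp add: C_def)
  have "hausdorff_measure t (projected_level_set T \<Phi> \<alpha> a) = 0"
  proof (rule hausdorff_measure_nullI[where 'i = "nat \<times> nat list \<times> int list"])
    fix e \<delta> :: real assume ed: "0 < e" "0 < \<delta>"
    have "\<exists>q\<ge>N. (\<forall>W. finite W \<longrightarrow> W \<subseteq> good_words n q \<longrightarrow> sum (\<phi> s) W < 1) \<and>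
        sqrt ?d * (1/2) ^ q \<le> \<delta> \<and> C * ((1/2) powr (t - s)) ^ q \<le> e * (1/2) ^ Suc N" for N
    proof -
      have h: "0 < e * (1/2) ^ Suc N" using ed by simp
      have "(\<lambda>q. sqrt ?d * (1/2) ^ q) \<longlonglongrightarrow> sqrt ?d * 0" by (intro tendsto_mult tendsto_const LIMSEQ_power_zero) auto
      hence "\<forall>\<^sub>F q in sequentially. sqrt ?d * (1/2) ^ q < \<delta>" using ed by (intro order_tendstoD(2)) auto
      moreover have "(1/2::real) powr (t - s) < (1/2) powr 0" using s by (intro powr_less_mono') auto
      hence "(1/2::real) powr (t - s) < 1" by simp
      hence "(\<lambda>q. C * ((1/2) powr (t - s)) ^ q) \<longlonglongrightarrow> C * 0" by (intro tendsto_mult tendsto_const LIMSEQ_power_zero) auto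
      hence "\<forall>\<^sub>F q in sequentially. C * ((1/2) powr (t - s)) ^ q < e * (1/2) ^ Suc N" using h by (intro order_tendstoD(2)) auto
      moreover note good_words_sum_less[OF n(1) s(1) n(2)]
      moreover have "\<forall>\<^sub>F q in sequentially. N \<le> q" by (rule eventually_ge_at_top)
      ultimately have "\<forall>\<^sub>F q in sequentially. N \<le> q \<and> (\<forall>W. finite W \<longrightarrow> W \<subseteq> good_words n q \<longrightarrow> sum (\<phi> s) W < 1) \<and>
        sqrt ?d * (1/2) ^ q \<le> \<delta> \<and> C * ((1/2) powr (t - s)) ^ q \<le> e * (1/2) ^ Suc N"
        by eventually_elim (simp add: less_imp_le)
      from eventually_happens[OF this] show ?thesis by auto
    qed
    then obtain Q where Q: "\<And>N. N \<le> Q N" "\<And>N W. finite W \<Longrightarrow> W \<subseteq> good_words n (Q N) \<Longrightarrow> sum (\<phi> s) W < 1"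
      "\<And>N. sqrt ?d * (1/2) ^ Q N \<le> \<delta>" "\<And>N. C * ((1/2) powr (t - s)) ^ Q N \<le> e * (1/2) ^ Suc N" by metis
    from choice[OF allI[OF cylinder_cover[OF a t s(3)]]]
    obtain U0 :: "nat list \<Rightarrow> int list \<Rightarrow> (real ^ 'n) set" where
      U0': "\<forall>v. projection T a ` cylinder v \<subseteq> (\<Union>z. U0 v z) \<and>
       (\<forall>z. bounded (U0 v z) \<and> diameter (U0 v z) \<le> sqrt ?d * (1/2) ^ length v) \<and>
       (\<integral>\<^sup>+z. hausdorff_gauge t (U0 v z) \<partial>count_space UNIV) \<le> ennreal (sqrt ?d powr t * (4 * ?d + 2) ^ CARD('n) * \<phi> t v)" ..
    have U0: "projection T a ` cylinder v \<subseteq> (\<Union>z. U0 v z)" "bounded (U0 v z)" "diameter (U0 v z) \<le> sqrt ?d * (1/2) ^ length v"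
      "(\<integral>\<^sup>+z. hausdorff_gauge t (U0 v z) \<partial>count_space UNIV) \<le> ennreal (C * \<phi> t v)" for v z
      using U0' by (simp_all add: C_def)
    define U where "U = (\<lambda>(N, v, z). if v \<in> good_words n (Q N) then U0 v z else {})"
    have cov: "projected_level_set T \<Phi> \<alpha> a \<subseteq> (\<Union>i. U i)"
    proof
      fix x assume "x \<in> projected_level_set T \<Phi> \<alpha> a"
      then obtain \<omega> where w: "\<omega> \<in> level_set \<Phi> \<alpha>" "x = projection T a \<omega>" by (auto simp: projected_level_set_def)
      obtain N where N: "\<And>q. N \<le> q \<Longrightarrow> prefix_word \<omega> q \<in> good_words n q"
        using level_set_good_words[OF w(1), of n] by (auto simp: eventually_sequentially)
      let ?v = "prefix_word \<omega> (Q N)"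
      have v: "?v \<in> good_words n (Q N)" by (rule N[OF Q(1)])
      have "x \<in> projection T a ` cylinder ?v" using w(2) prefix_word_in_cylinder by blast
      then obtain z where "x \<in> U0 ?v z" using U0(1)[of ?v] by blast
      hence "x \<in> U (N, ?v, z)" using v by (simp add: U_def)
      thus "x \<in> (\<Union>i. U i)" by blast
    qed
    have bd: "bounded (U i) \<and> diameter (U i) \<le> \<delta>" for i
    proof -
      obtain N v z where i: "i = (N, v, z)" by (metis prod_cases3)
      show ?thesis
      proof (cases "v \<in> good_words n (Q N)")
        case True
        hence "length v = Q N" by (simp add: good_words_def)
        thus ?thesis using True U0(2,3)[of v z] Q(3)[of N] by (simp add: i U_def)
      qed (use ed in \<open>simp add: i U_def\<close>)
    qed
    have perN: "(\<integral>\<^sup>+p. hausdorff_gauge t (U (N, p)) \<partial>count_space UNIV) \<le> ennreal (e * (1/2) ^ Suc N)" for N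
    proof -
      have "(\<integral>\<^sup>+p. hausdorff_gauge t (U (N, p)) \<partial>count_space UNIV) =
          (\<integral>\<^sup>+v. \<integral>\<^sup>+z. hausdorff_gauge t (U (N, v, z)) \<partial>count_space UNIV \<partial>count_space UNIV)"
        using nn_integral_fst_count_space[of "\<lambda>p. hausdorff_gauge t (U (N, p))"] by simp
      also have "\<dots> \<le> (\<integral>\<^sup>+v. (if v \<in> good_words n (Q N) then ennreal (C * \<phi> t v) else 0) \<partial>count_space UNIV)"
        using U0(4) by (intro nn_integral_mono) (auto simp: U_def hausdorff_gauge_def[of _ "{}"])
      also have "\<dots> \<le> ennreal (e * (1/2) ^ Suc N)"
      proof (rule nn_integral_count_space_le)
        fix W0 :: "nat list set" assume W0: "finite W0"
        define W where "W = {v\<in>W0. v \<in> good_words n (Q N)}"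
        have W: "finite W" "W \<subseteq> good_words n (Q N)" using W0 by (auto simp: W_def)
        have "(\<Sum>v\<in>W0. if v \<in> good_words n (Q N) then ennreal (C * \<phi> t v) else 0) = (\<Sum>v\<in>W. ennreal (C * \<phi> t v))"
          unfolding W_def using W0 by (intro sum.mono_neutral_cong_right) auto
        also have "\<dots> = ennreal (\<Sum>v\<in>W. C * \<phi> t v)"
          using C word_svf_pos[of t] t by (intro sum_ennreal) (simp add: less_imp_le)
        also have "\<dots> \<le> ennreal (e * (1/2) ^ Suc N)"
        proof (rule ennreal_leI)
          have "(\<Sum>v\<in>W. C * \<phi> t v) \<le> (\<Sum>v\<in>W. C * (\<phi> s v * ((1/2) powr (t - s)) ^ Q N))"
          proof (intro sum_mono mult_left_mono C)
            fix v assume "v \<in> W"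
            hence "length v = Q N" using W(2) by (auto simp: good_words_def)
            thus "\<phi> t v \<le> \<phi> s v * ((1/2) powr (t - s)) ^ Q N"
              using word_svf_add_le[of s "t - s" v] s by (simp add: powr_powr flip: powr_realpow)
          qed
          also have "\<dots> = (C * ((1/2) powr (t - s)) ^ Q N) * sum (\<phi> s) W"
            unfolding sum_distrib_left by (intro sum.cong refl) (simp add: mult_ac)
          also have "\<dots> \<le> (C * ((1/2) powr (t - s)) ^ Q N) * 1"
            using Q(2)[OF W] C by (intro mult_left_mono) auto
          also have "\<dots> \<le> e * (1/2) ^ Suc N" using Q(4) by simp
          finally show "(\<Sum>v\<in>W. C * \<phi> t v) \<le> e * (1/2) ^ Suc N" .
        qed
        finally show "(\<Sum>v\<in>W0. if v \<in> good_words n (Q N) then ennreal (C * \<phi> t v) else 0) \<le> ennreal (e * (1/2) ^ Suc N)" .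
      qed
      finally show ?thesis .
    qed
    have "(\<integral>\<^sup>+i. hausdorff_gauge t (U i) \<partial>count_space UNIV) =
        (\<integral>\<^sup>+N. \<integral>\<^sup>+p. hausdorff_gauge t (U (N, p)) \<partial>count_space UNIV \<partial>count_space UNIV)"
      using nn_integral_fst_count_space[of "\<lambda>i. hausdorff_gauge t (U i)"] by simp
    also have "\<dots> \<le> (\<integral>\<^sup>+N. ennreal (e * (1/2) ^ Suc N) \<partial>count_space UNIV)" by (intro nn_integral_mono perN)
    also have "\<dots> = (\<Sum>N. ennreal (e * (1/2) ^ Suc N))" by (rule nn_integral_count_space_nat)
    also have "\<dots> = ennreal (e * 1)"
      using ed by (intro suminf_ennreal_eq sums_mult power_half_series) auto
    finally have "(\<integral>\<^sup>+i. hausdorff_gauge t (U i) \<partial>count_space UNIV) \<le> ennreal e" by simp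
    thus "\<exists>U :: nat \<times> nat list \<times> int list \<Rightarrow> (real ^ 'n) set. projected_level_set T \<Phi> \<alpha> a \<subseteq> (\<Union>i. U i) \<and>
     (\<forall>i. bounded (U i) \<and> diameter (U i) \<le> \<delta>) \<and> (\<integral>\<^sup>+i. hausdorff_gauge t (U i) \<partial>count_space UNIV) \<le> ennreal e"
      using cov bd by blast
  qed
  thus ?thesis using t by (intro hausdorff_dim_le) auto
qed

lemma hausdorff_dim_projection_le:
  assumes a: "bounded_translation a"
  shows "hausdorff_dim (projected_level_set T \<Phi> \<alpha> a) \<le> min (of_nat CARD('n)) (INF n. level_limit n)"
proof -
  let ?J = "projected_level_set T \<Phi> \<alpha> a" and ?L = "INF n. level_limit n"
  have "?J \<subseteq> cball 0 (2 * real CARD('n))"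
    using norm_projection_le[OF a] by (auto simp: projected_level_set_def)
  hence d: "hausdorff_dim ?J \<le> ennreal (real CARD('n))" by (rule hausdorff_dim_bounded_le) simp
  have "hausdorff_dim ?J \<le> ?L"
  proof (rule ccontr)
    assume "\<not> ?thesis"
    hence "?L < hausdorff_dim ?J" by simp
    then obtain y where y: "?L < y" "y < hausdorff_dim ?J" using dense by blast
    then obtain z where z: "y < z" "z < hausdorff_dim ?J" using dense by blast
    have "y < \<infinity>" "z < \<infinity>" using y z d by (auto intro: less_le_trans[of _ "hausdorff_dim ?J"])
    then obtain s t where st: "y = ennreal s" "0 \<le> s" "z = ennreal t" "0 \<le> t"
      by (metis ennreal_cases infinity_ennreal_def order_less_irrefl)
    have 1: "s < t" using z(1) st by (simp add: ennreal_less_iff)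
    have "ennreal t < ennreal (real CARD('n))" using z(2) d st by simp
    hence 2: "t \<le> real CARD('n)" using st by (simp add: ennreal_less_iff)
    from hausdorff_dim_projection_le_above_limit[OF a st(2) 1 2] y(1) z(2) st show False by simp
  qed
  thus ?thesis using d by (simp add: ennreal_of_nat_eq_real_of_nat)
qed

end

section \<open>Energy and Hausdorff dimension\<close>

text \<open>The part \<open>E m\<close> where the potential of the image measure is at most \<open>m\<close> has positive mass for some \<open>m\<close>.
  A set of diameter \<open>D\<close> carries at most the mass \<open>m D\<^sup>t\<close> of that part; so covers of \<open>A\<close> cannot be cheap.\<close>
lemma hausdorff_dim_ge_of_energy:
  fixes G :: "'a \<Rightarrow> 'b::{real_normed_vector, second_countable_topology}"
  assumes P: "prob_space P" and G [measurable]: "G \<in> P \<rightarrow>\<^sub>M borel" and t: "0 < t"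
    and energy: "(\<integral>\<^sup>+u. \<integral>\<^sup>+u'. riesz t (G u - G u') \<partial>P \<partial>P) < \<infinity>" and A: "AE u in P. G u \<in> A"
  shows "ennreal t \<le> hausdorff_dim A"
proof -
  interpret prob_space P by fact
  define g where "g u = (\<integral>\<^sup>+u'. riesz t (G u - G u') \<partial>P)" for u
  have g [measurable]: "g \<in> borel_measurable P"
    unfolding g_def by measurable
  have fin: "AE u in P. g u \<noteq> \<infinity>"
    using energy by (intro nn_integral_PInf_AE g) (simp add: g_def)
  define E where "E m = {u\<in>space P. g u \<le> of_nat m}" for m :: nat
  have E [measurable]: "E m \<in> sets P" for m unfolding E_def by measurable
  have "\<exists>m. 0 < emeasure P (E m)"
  proof (rule ccontr)
    assume "\<not> ?thesis"
    hence "emeasure P (E m) = 0" for m by (simp add: zero_less_iff_neq_zero)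
    hence "AE u in P. u \<notin> E m" for m by (intro AE_not_in null_setsI) auto
    hence "AE u in P. \<forall>m. u \<notin> E m" by (rule iffD2[OF AE_all_countable allI])
    with fin have "AE u in P. False"
      using AE_space
    proof eventually_elim
      case (elim u)
      then obtain r where r: "g u = ennreal r" "0 \<le> r" by (cases "g u" rule: ennreal_cases) auto
      obtain m :: nat where "r \<le> real m" using real_arch_simple by blast
      hence "g u \<le> of_nat m" by (simp add: r ennreal_of_nat_eq_real_of_nat ennreal_leI)
      thus False using elim by (auto simp: E_def)
    qed
    thus False by simp
  qed
  then obtain m0 where "0 < emeasure P (E m0)" by blast
  define m where "m = Suc m0"
  have "E m0 \<subseteq> E m" by (auto simp: E_def m_def intro: order_trans)
  from less_le_trans[OF \<open>0 < emeasure P (E m0)\<close> emeasure_mono[OF this E]]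
  have Em: "0 < emeasure P (E m)" .
  have main: "t \<le> s" if s: "0 \<le> s" and null: "hausdorff_measure s A = 0" for s
  proof (rule ccontr)
    assume "\<not> t \<le> s"
    hence st: "s < t" by simp
    have cov: "emeasure P (E m) \<le> of_nat m * (\<Sum>n. hausdorff_gauge s (U n))"
      if U: "A \<subseteq> (\<Union>n. U n)" "\<And>n. bounded (U n)" "\<And>n. diameter (U n) \<le> 1" for U :: "nat \<Rightarrow> 'b set"
    proof -
      have "\<exists>B. B \<in> sets P \<and> emeasure P B \<le> of_nat m * hausdorff_gauge s (U n) \<and> {u\<in>E m. G u \<in> U n} \<subseteq> B" for n
      proof (cases "{u\<in>E m. G u \<in> U n} = {}")
        case True
        thus ?thesis by (intro exI[of _ "{}"]) simp
      next
        case False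
        then obtain u0 where u0: "u0 \<in> E m" "G u0 \<in> U n" by blast
        define D where "D = diameter (U n)"
        have D: "0 \<le> D" "D \<le> 1" using U(2,3) diameter_ge_0 by (auto simp: D_def)
        define B where "B = {u\<in>space P. norm (G u0 - G u) \<le> D}"
        have B: "B \<in> sets P" unfolding B_def by measurable
        have sub: "{u\<in>E m. G u \<in> U n} \<subseteq> B"
        proof
          fix u assume u: "u \<in> {u\<in>E m. G u \<in> U n}"
          hence "dist (G u0) (G u) \<le> D" unfolding D_def using u0(2) U(2) by (intro diameter_bounded_bound) auto
          thus "u \<in> B" using u by (auto simp: B_def E_def dist_norm)
        qed
        have le: "(\<integral>\<^sup>+u. x * indicator B u \<partial>P) \<le> of_nat m"
          if x: "\<And>u. u \<in> B \<Longrightarrow> x \<le> riesz t (G u0 - G u)" for x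
        proof -
          have "(\<integral>\<^sup>+u. x * indicator B u \<partial>P) \<le> g u0"
            unfolding g_def using x by (intro nn_integral_mono) (auto simp: indicator_def)
          also have "\<dots> \<le> of_nat m" using u0(1) by (simp add: E_def)
          finally show ?thesis .
        qed
        have "emeasure P B \<le> of_nat m * hausdorff_gauge s (U n)"
        proof (cases "D = 0")
          case True
          have "(\<integral>\<^sup>+u. \<infinity> * indicator B u \<partial>P) \<le> of_nat m"
            by (rule le) (auto simp: B_def True riesz_def)
          hence "\<infinity> * emeasure P B \<le> of_nat m" using B by (simp add: nn_integral_cmult)
          hence "emeasure P B = 0"
            using of_nat_less_top[of m] by (cases "emeasure P B = 0") (auto simp: ennreal_top_mult top_unique)
          thus ?thesis by simp
        next
          case False
          hence Dp: "0 < D" using D by simp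
          have "(\<integral>\<^sup>+u. ennreal (D powr - t) * indicator B u \<partial>P) \<le> of_nat m"
          proof (rule le)
            fix u assume "u \<in> B"
            hence "norm (G u0 - G u) \<le> D" by (simp add: B_def)
            thus "ennreal (D powr - t) \<le> riesz t (G u0 - G u)"
              using t Dp by (auto simp: riesz_def intro!: ennreal_leI powr_mono2')
          qed
          hence "ennreal (D powr - t) * emeasure P B \<le> of_nat m" using B by (simp add: nn_integral_cmult)
          hence "ennreal (D powr t) * (ennreal (D powr - t) * emeasure P B) \<le> ennreal (D powr t) * of_nat m"
            by (rule mult_left_mono) simp
          moreover have "ennreal (D powr t) * (ennreal (D powr - t) * emeasure P B) = emeasure P B"
            using Dp by (simp add: mult.assoc[symmetric] ennreal_mult[symmetric] powr_minus)
          ultimately have "emeasure P B \<le> of_nat m * ennreal (D powr t)" by (simp add: mult.commute)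
          also have "\<dots> \<le> of_nat m * hausdorff_gauge s (U n)"
          proof (rule mult_left_mono)
            have "D powr t \<le> D powr s" using st Dp D by (intro powr_mono') auto
            moreover have "D powr t \<le> 1" using Dp D t by (intro powr_le1) auto
            ultimately show "ennreal (D powr t) \<le> hausdorff_gauge s (U n)"
              using u0(2) by (auto simp: hausdorff_gauge_def D_def[symmetric] ennreal_leI simp flip: ennreal_1)
          qed simp
          finally show ?thesis .
        qed
        thus ?thesis using B sub by blast
      qed
      hence "\<forall>n. \<exists>B. B \<in> sets P \<and> emeasure P B \<le> of_nat m * hausdorff_gauge s (U n) \<and> {u\<in>E m. G u \<in> U n} \<subseteq> B" by blast
      from choice[OF this] obtain B where B: "\<forall>n. B n \<in> sets P \<and> emeasure P (B n) \<le> of_nat m * hausdorff_gauge s (U n) \<and> {u\<in>E m. G u \<in> U n} \<subseteq> B n" ..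
      have Bs: "(\<Union>n. B n) \<in> sets P" using B by auto
      have "emeasure P (E m) \<le> emeasure P (\<Union>n. B n)"
      proof (rule emeasure_mono_AE[OF _ Bs])
        show "AE u in P. u \<in> E m \<longrightarrow> u \<in> (\<Union>n. B n)"
          using A
        proof eventually_elim
          case (elim u)
          then obtain n where "G u \<in> U n" using U(1) by auto
          thus ?case using B by blast
        qed
      qed
      also have "\<dots> \<le> (\<Sum>n. emeasure P (B n))" using B by (intro emeasure_subadditive_countably) auto
      also have "\<dots> \<le> (\<Sum>n. of_nat m * hausdorff_gauge s (U n))" using B by (intro suminf_le) auto
      also have "\<dots> = of_nat m * (\<Sum>n. hausdorff_gauge s (U n))" by simp
      finally show ?thesis .
    qed
    have "hausdorff_premeasure s 1 A \<ge> emeasure P (E m) / of_nat m"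
      unfolding hausdorff_premeasure_def
    proof (rule INF_greatest)
      fix U :: "nat \<Rightarrow> 'b set" assume "U \<in> {U. A \<subseteq> (\<Union>n. U n) \<and> (\<forall>n. bounded (U n) \<and> diameter (U n) \<le> 1)}"
      hence "emeasure P (E m) \<le> of_nat m * (\<Sum>n. hausdorff_gauge s (U n))" by (intro cov) auto
      hence "emeasure P (E m) / of_nat m \<le> (of_nat m * (\<Sum>n. hausdorff_gauge s (U n))) / of_nat m"
        by (rule divide_right_mono_ennreal)
      also have "\<dots> = (\<Sum>n. hausdorff_gauge s (U n))"
        by (simp add: m_def ennreal_mult_divide_eq mult.commute[of "of_nat (Suc m0)"] del: of_nat_Suc)
      finally show "emeasure P (E m) / of_nat m \<le> (\<Sum>n. hausdorff_gauge s (U n))" .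
    qed
    moreover have "hausdorff_premeasure s 1 A \<le> hausdorff_measure s A"
      unfolding hausdorff_measure_def by (rule SUP_upper) simp
    ultimately have "emeasure P (E m) / of_nat m \<le> 0" using null by simp
    hence "emeasure P (E m) = 0" by (auto simp: ennreal_divide_eq_0_iff)
    thus False using Em by simp
  qed
  show ?thesis unfolding hausdorff_dim_def by (rule INF_greatest) (use main in \<open>auto intro: ennreal_leI\<close>)
qed

section \<open>Transversality\<close>

lemma riesz_minus: "riesz t (x - y) = riesz t (y - x)"
  by (auto simp: riesz_def norm_minus_commute)

abbreviation cube_measure :: "(real ^ 'n) measure" where
  "cube_measure \<equiv> restrict_space lborel (cbox 0 1)"

lemma prob_space_cube: "prob_space (cube_measure :: (real ^ 'n) measure)"
  by (rule prob_spaceI) (simp add: emeasure_restrict_space space_restrict_space emeasure_unit_cube)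

lemma translation_component_measurable [measurable]:
  "(\<lambda>a. a i) \<in> (translation_measure :: (nat \<Rightarrow> real ^ 'n) measure) \<rightarrow>\<^sub>M borel"
proof -
  have "(\<lambda>a. a i) \<in> (translation_measure :: (nat \<Rightarrow> real ^ 'n) measure) \<rightarrow>\<^sub>M cube_measure"
    unfolding translation_measure_def by (rule measurable_component_singleton) simp
  moreover have "(\<lambda>x. x) \<in> (cube_measure :: (real ^ 'n) measure) \<rightarrow>\<^sub>M borel"
    by (intro measurable_restrict_space1) simp
  ultimately show ?thesis by (rule measurable_compose)
qed

lemma prob_space_translation: "prob_space (translation_measure :: (nat \<Rightarrow> real ^ 'n) measure)"
  unfolding translation_measure_def by (intro prob_space_PiM prob_space_cube)

lemma matrix_vector_measurable [measurable (raw)]: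
  assumes "f \<in> borel_measurable N"
  shows "(\<lambda>x. (A :: real ^ 'n ^ 'm) *v f x) \<in> borel_measurable N"
  using borel_measurable_continuous_onI[of "(*v) A"] by (auto intro!: measurable_compose[OF assms] linear_continuous_on)

text \<open>Resampling the translation of one letter does not change the distribution.\<close>
lemma nn_integral_translation_split:
  fixes h :: "(nat \<Rightarrow> real ^ 'n) \<Rightarrow> ennreal"
  assumes h [measurable]: "h \<in> borel_measurable translation_measure"
  shows "(\<integral>\<^sup>+a. h a \<partial>translation_measure) = (\<integral>\<^sup>+a. \<integral>\<^sup>+x. h (a(i := x)) \<partial>cube_measure \<partial>translation_measure)"
proof -
  let ?Q = "cube_measure :: (real ^ 'n) measure" and ?T = "translation_measure :: (nat \<Rightarrow> real ^ 'n) measure"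
  interpret Q: prob_space ?Q by (rule prob_space_cube)
  interpret T: prob_space ?T by (rule prob_space_translation)
  interpret pair_sigma_finite ?Q ?T ..
  have d: "distr (?Q \<Otimes>\<^sub>M ?T) ?T (\<lambda>(x, X). X(i := x)) = ?T"
    using distr_pair_PiM_eq_PiM[of UNIV "\<lambda>_. ?Q" i] prob_space_cube by (simp add: translation_measure_def)
  have m [measurable]: "(\<lambda>(x, X). X(i := x)) \<in> ?Q \<Otimes>\<^sub>M ?T \<rightarrow>\<^sub>M ?T"
  proof -
    have "(\<lambda>p. (case p of (x, X) \<Rightarrow> X(i := x)) l) \<in> ?Q \<Otimes>\<^sub>M PiM UNIV (\<lambda>_. ?Q) \<rightarrow>\<^sub>M ?Q" for l
      by (cases "l = i") (simp_all add: case_prod_unfold)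
    thus ?thesis
      unfolding translation_measure_def
      by (intro measurable_PiM_single') (auto simp: space_pair_measure space_PiM space_restrict_space PiE_iff)
  qed
  have "(\<integral>\<^sup>+a. h a \<partial>?T) = (\<integral>\<^sup>+a. h a \<partial>distr (?Q \<Otimes>\<^sub>M ?T) ?T (\<lambda>(x, X). X(i := x)))" by (simp only: d)
  also have "\<dots> = (\<integral>\<^sup>+p. h ((\<lambda>(x, X). X(i := x)) p) \<partial>(?Q \<Otimes>\<^sub>M ?T))" by (rule nn_integral_distr[OF m]) (simp add: h)
  also have "\<dots> = (\<integral>\<^sup>+(x, X). h (X(i := x)) \<partial>(?Q \<Otimes>\<^sub>M ?T))" by (simp add: case_prod_unfold)
  also have "\<dots> = (\<integral>\<^sup>+X. \<integral>\<^sup>+x. h (X(i := x)) \<partial>?Q \<partial>?T)"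
    using nn_integral_snd[of "\<lambda>(x, X). h (X(i := x))"] measurable_compose[OF m h] by (simp add: case_prod_unfold)
  finally show ?thesis .
qed

context affine_family
begin

lemma projection_measurable [measurable]:
  "(\<lambda>a. projection T a \<omega>) \<in> borel_measurable translation_measure"
  unfolding projection_def by measurable

lemma projection_summable_of_bound:
  assumes "\<And>i. norm (a i) \<le> D"
  shows "summable (\<lambda>j. M (prefix_word \<omega> j) *v a (\<omega> j))"
proof (rule summable_comparison_test'[where N = 0])
  show "summable (\<lambda>j. \<rho> ^ j * D)" using rho by (intro summable_mult2 summable_geometric) auto
  show "norm (M (prefix_word \<omega> j) *v a (\<omega> j)) \<le> \<rho> ^ j * D" for j
  proof -
    have "norm (M (prefix_word \<omega> j) *v a (\<omega> j)) \<le> \<rho> ^ j * norm (a (\<omega> j))"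
      using word_matrix_contr[of "prefix_word \<omega> j"] by simp
    also have "\<dots> \<le> \<rho> ^ j * D" using assms rho by (intro mult_left_mono) auto
    finally show ?thesis .
  qed
qed

text \<open>A bound for the effect on the projection of \<open>\<omega>\<close> of a unit change in the translation of the letter \<open>i\<close>,
  the first position excluded.\<close>
definition letter_weight :: "nat \<Rightarrow> (nat \<Rightarrow> nat) \<Rightarrow> real" where
  "letter_weight i \<omega> = (\<Sum>j. if \<omega> (Suc j) = i then \<rho> ^ Suc j else 0)"

lemma letter_weight_summable: "summable (\<lambda>j. if \<omega> (Suc j) = i then \<rho> ^ Suc j else 0)"
proof (rule summable_comparison_test'[where N = 0])
  show "summable (\<lambda>j. \<rho> * \<rho> ^ j)" using rho by (intro summable_mult summable_geometric) auto
qed (use rho in auto)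

text \<open>A position is occupied by at most one of the two letters.\<close>
lemma letter_weight_sum:
  assumes "i \<noteq> k"
  shows "letter_weight i \<omega> + letter_weight k \<omega> \<le> \<rho> / (1 - \<rho>)"
proof -
  have g: "(\<lambda>j. \<rho> * \<rho> ^ j) sums (\<rho> * (1 / (1 - \<rho>)))" using rho by (intro sums_mult geometric_sums) auto
  have "letter_weight i \<omega> + letter_weight k \<omega> =
      (\<Sum>j. (if \<omega> (Suc j) = i then \<rho> ^ Suc j else 0) + (if \<omega> (Suc j) = k then \<rho> ^ Suc j else 0))"
    unfolding letter_weight_def by (rule suminf_add[OF letter_weight_summable letter_weight_summable])
  also have "\<dots> \<le> (\<Sum>j. \<rho> * \<rho> ^ j)"
    using assms rho g by (intro suminf_le summable_add letter_weight_summable sums_summable[OF g]) auto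
  also have "\<dots> = \<rho> / (1 - \<rho>)" using g by (simp add: sums_iff)
  finally show ?thesis .
qed

lemma norm_projection_single_tail:
  fixes z :: "real ^ 'n"
  shows "norm (projection T (\<lambda>l. if l = i then z else 0) \<omega> - (if \<omega> 0 = i then z else 0)) \<le> letter_weight i \<omega> * norm z"
proof -
  let ?a = "\<lambda>l. if l = i then z else 0"
  have sm: "summable (\<lambda>j. M (prefix_word \<omega> j) *v ?a (\<omega> j))"
    by (rule projection_summable_of_bound[of _ "norm z"]) auto
  have "projection T ?a \<omega> = (\<Sum>j. M (prefix_word \<omega> (Suc j)) *v ?a (\<omega> (Suc j))) + M (prefix_word \<omega> 0) *v ?a (\<omega> 0)"
    unfolding projection_def using suminf_split_head[OF sm] by simp
  hence "projection T ?a \<omega> - (if \<omega> 0 = i then z else 0) = (\<Sum>j. M (prefix_word \<omega> (Suc j)) *v ?a (\<omega> (Suc j)))"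
    by (simp add: prefix_word_def)
  also have "norm \<dots> \<le> (\<Sum>j. (if \<omega> (Suc j) = i then \<rho> ^ Suc j else 0) * norm z)"
  proof (rule norm_suminf_le)
    show "norm (M (prefix_word \<omega> (Suc j)) *v ?a (\<omega> (Suc j))) \<le> (if \<omega> (Suc j) = i then \<rho> ^ Suc j else 0) * norm z" for j
      using word_matrix_contr[of "prefix_word \<omega> (Suc j)" z] by simp
    show "summable (\<lambda>j. (if \<omega> (Suc j) = i then \<rho> ^ Suc j else 0) * norm z)"
      by (rule summable_mult2[OF letter_weight_summable])
  qed
  also have "\<dots> = letter_weight i \<omega> * norm z"
    unfolding letter_weight_def by (rule suminf_mult2[OF letter_weight_summable, symmetric])
  finally show ?thesis .
qed

lemma projection_update_diff:
  assumes "bounded_translation a"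
  shows "projection T (a(i := x)) \<omega> - projection T (a(i := y)) \<omega> = projection T (\<lambda>l. if l = i then x - y else 0) \<omega>"
proof -
  have "norm ((a(i := x)) l) \<le> max (real CARD('n)) (norm x)" for x l
    using assms by (auto simp: bounded_translation_def le_max_iff_disj)
  hence sm: "summable (\<lambda>j. M (prefix_word \<omega> j) *v (a(i := x)) (\<omega> j))" for x
    by (rule projection_summable_of_bound)
  have "projection T (a(i := x)) \<omega> - projection T (a(i := y)) \<omega> =
      (\<Sum>j. M (prefix_word \<omega> j) *v (a(i := x)) (\<omega> j) - M (prefix_word \<omega> j) *v (a(i := y)) (\<omega> j))"
    unfolding projection_def by (rule suminf_diff[OF sm sm])
  also have "\<dots> = projection T (\<lambda>l. if l = i then x - y else 0) \<omega>"
    unfolding projection_def by (intro arg_cong[where f = suminf] ext) (simp add: matrix_vector_mult_diff_distrib)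
  finally show ?thesis .
qed

text \<open>The words split after the common prefix \<open>w\<close> into the letters \<open>\<omega> m\<close> and \<open>\<tau> m\<close>. The later occurrences of
  these two letters in both words have total weight at most \<open>2 r\<close> with \<open>r = \<rho> / (1 - \<rho>)\<close>, and \<open>r < 1\<close> since
  \<open>\<rho> < 1/2\<close>; hence one of the letters has weight at most \<open>r\<close>. As a function of the translation of
  that letter alone, the difference of the projections is \<open>M w\<close> applied to a map \<open>f\<close> that differs from the
  identity, or its negative, by a contraction with factor \<open>r\<close> up to a constant vector. The integral over
  that translation is therefore bounded by the estimate for Riesz kernels.\<close>
lemma transversality:
  assumes t: "0 < t" "t < s" "s \<le> real CARD('n)"
  shows "\<exists>C\<ge>0. \<forall>\<omega> \<tau> m. (\<forall>i<m. \<omega> i = \<tau> i) \<longrightarrow> \<omega> m \<noteq> \<tau> m \<longrightarrow>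
    (\<integral>\<^sup>+a. riesz t (projection T a \<omega> - projection T a \<tau>) \<partial>translation_measure) \<le> ennreal (C / \<phi> s (prefix_word \<omega> m))"
proof -
  define r where "r = \<rho> / (1 - \<rho>)"
  have r: "r < 1" using rho by (simp add: r_def field_simps)
  have k: "0 < 1 - r" using r by simp
  have R: "1 \<le> 4 * real CARD('n)"
  proof -
    have "1 \<le> CARD('n)" by (simp add: Suc_le_eq)
    hence "1 \<le> real CARD('n)" using of_nat_mono[of 1 "CARD('n)", where 'a = real] by simp
    thus ?thesis by linarith
  qed
  obtain C where C: "0 \<le> C" and Cb: "\<And>(A :: real ^ 'n ^ 'n) (f :: real ^ 'n \<Rightarrow> real ^ 'n). invertible A \<Longrightarrow> singular_value_function s A \<le> 1 \<Longrightarrow>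
     f \<in> borel_measurable borel \<Longrightarrow> (\<forall>x y. norm (f x - f y) \<ge> (1 - r) * norm (x - y)) \<Longrightarrow>
     (\<forall>x\<in>cbox 0 1. norm (f x) \<le> 4 * real CARD('n)) \<Longrightarrow>
     (\<integral>\<^sup>+x\<in>cbox 0 1. riesz t (A *v f x) \<partial>lborel) \<le> ennreal (C / singular_value_function s A)"
    using riesz_integral_le[OF t R k] by auto
  have s0: "0 \<le> s" using t by simp
  let ?T = "translation_measure :: (nat \<Rightarrow> real ^ 'n) measure"
  interpret TT: prob_space ?T by (rule prob_space_translation)
  have one: "(\<integral>\<^sup>+a. riesz t (projection T a \<omega> - projection T a \<tau>) \<partial>translation_measure) \<le> ennreal (C / \<phi> s (prefix_word \<omega> m))"
    if eq: "\<And>i. i < m \<Longrightarrow> \<omega> i = \<tau> i" and ne: "\<omega> m \<noteq> \<tau> m"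
      and wt: "letter_weight (\<omega> m) ((shift ^^ m) \<omega>) + letter_weight (\<omega> m) ((shift ^^ m) \<tau>) \<le> r" for \<omega> \<tau> m
  proof -
    define i where "i = \<omega> m"
    define \<omega>' where "\<omega>' = (shift ^^ m) \<omega>"
    define \<tau>' where "\<tau>' = (shift ^^ m) \<tau>"
    have i0: "\<omega>' 0 = i" "\<tau>' 0 \<noteq> i" using ne by (auto simp: i_def \<omega>'_def \<tau>'_def shift_funpow)
    let ?w = "prefix_word \<omega> m"
    have pw: "prefix_word \<tau> m = ?w" using eq by (simp add: prefix_word_eq_iff)
    have hm: "(\<lambda>a. riesz t (projection T a \<omega> - projection T a \<tau>)) \<in> borel_measurable ?T" by measurable
    have inner: "(\<integral>\<^sup>+x. riesz t (projection T (a(i := x)) \<omega> - projection T (a(i := x)) \<tau>) \<partial>cube_measure) \<le> ennreal (C / \<phi> s ?w)"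
      if a: "a \<in> space ?T" for a
    proof -
      have ba: "bounded_translation a" by (rule translation_bounded[OF a])
      define f where "f x = projection T (a(i := x)) \<omega>' - projection T (a(i := x)) \<tau>'" for x
      have fm: "f \<in> borel_measurable borel"
      proof -
        have "(\<lambda>x. (a(i := x)) l) \<in> borel_measurable borel" for l by (cases "l = i") auto
        hence "(\<lambda>x. projection T (a(i := x)) \<omega>) \<in> borel_measurable borel" for \<omega>
          unfolding projection_def by (intro borel_measurable_suminf matrix_vector_measurable)
        thus ?thesis unfolding f_def[abs_def] by measurable
      qed
      have fe: "\<forall>x y. norm (f x - f y) \<ge> (1 - r) * norm (x - y)"
      proof (intro allI)
        fix x y
        let ?z = "x - y" and ?p = "\<lambda>\<omega>. projection T (\<lambda>l. if l = i then x - y else 0) \<omega>"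
        have fd: "f x - f y = ?p \<omega>' - ?p \<tau>'"
          using projection_update_diff[OF ba, of i x \<omega>' y] projection_update_diff[OF ba, of i x \<tau>' y]
          by (simp add: f_def algebra_simps)
        have 1: "norm (?p \<omega>' - ?z) \<le> letter_weight i \<omega>' * norm ?z"
          using norm_projection_single_tail[of i ?z \<omega>'] i0 by simp
        have 2: "norm (?p \<tau>') \<le> letter_weight i \<tau>' * norm ?z"
          using norm_projection_single_tail[of i ?z \<tau>'] i0 by simp
        have "(letter_weight i \<omega>' + letter_weight i \<tau>') * norm ?z \<le> r * norm ?z"
          using wt by (intro mult_right_mono) (auto simp: i_def \<omega>'_def \<tau>'_def)
        moreover have "norm ?z \<le> norm (?p \<omega>' - ?p \<tau>') + norm (?p \<omega>' - ?z) + norm (?p \<tau>')"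
        proof -
          have "(?p \<omega>' - ?p \<tau>') - (?p \<omega>' - ?z) + ?p \<tau>' = ?z" by simp
          with norm_triangle_ineq[of "(?p \<omega>' - ?p \<tau>') - (?p \<omega>' - ?z)" "?p \<tau>'"]
          have "norm ?z \<le> norm ((?p \<omega>' - ?p \<tau>') - (?p \<omega>' - ?z)) + norm (?p \<tau>')" by (simp only:)
          with norm_triangle_ineq4[of "?p \<omega>' - ?p \<tau>'" "?p \<omega>' - ?z"] show ?thesis by linarith
        qed
        ultimately show "norm (f x - f y) \<ge> (1 - r) * norm (x - y)"
          unfolding fd using 1 2 by (simp add: left_diff_distrib distrib_right)
      qed
      have bu: "bounded_translation (a(i := x))" if "x \<in> cbox 0 1" for x
        using ba cube_norm_le[OF that] by (simp add: bounded_translation_def)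
      have fb: "\<forall>x\<in>cbox 0 1. norm (f x) \<le> 4 * real CARD('n)"
      proof
        fix x :: "real ^ 'n" assume x: "x \<in> cbox 0 1"
        have "norm (f x) \<le> norm (projection T (a(i := x)) \<omega>') + norm (projection T (a(i := x)) \<tau>')"
          unfolding f_def by (rule norm_triangle_ineq4)
        thus "norm (f x) \<le> 4 * real CARD('n)"
          using norm_projection_le[OF bu[OF x], of \<omega>'] norm_projection_le[OF bu[OF x], of \<tau>'] by linarith
      qed
      have "(\<integral>\<^sup>+x. riesz t (projection T (a(i := x)) \<omega> - projection T (a(i := x)) \<tau>) \<partial>cube_measure) =
          (\<integral>\<^sup>+x\<in>cbox 0 1. riesz t (projection T (a(i := x)) \<omega> - projection T (a(i := x)) \<tau>) \<partial>lborel)"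
        by (rule nn_integral_restrict_space) simp
      also have "\<dots> = (\<integral>\<^sup>+x\<in>cbox 0 1. riesz t (M ?w *v f x) \<partial>lborel)"
      proof (rule nn_integral_cong)
        fix x :: "real ^ 'n"
        show "riesz t (projection T (a(i := x)) \<omega> - projection T (a(i := x)) \<tau>) * indicator (cbox 0 1) x =
            riesz t (M ?w *v f x) * indicator (cbox 0 1) x"
        proof (cases "x \<in> cbox 0 1")
          case True
          from projection_diff[OF bu[OF True] refl pw]
          show ?thesis by (simp add: f_def \<omega>'_def \<tau>'_def)
        qed simp
      qed
      also have "\<dots> \<le> ennreal (C / \<phi> s ?w)"
        unfolding word_svf_def
        by (rule Cb[OF word_matrix_invertible _ fm fe fb]) (use word_svf_le_1[OF s0, of ?w] in \<open>simp add: word_svf_def\<close>)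
      finally show ?thesis .
    qed
    have "(\<integral>\<^sup>+a. riesz t (projection T a \<omega> - projection T a \<tau>) \<partial>?T) =
        (\<integral>\<^sup>+a. \<integral>\<^sup>+x. riesz t (projection T (a(i := x)) \<omega> - projection T (a(i := x)) \<tau>) \<partial>cube_measure \<partial>?T)"
      by (rule nn_integral_translation_split[OF hm])
    also have "\<dots> \<le> (\<integral>\<^sup>+a. ennreal (C / \<phi> s ?w) \<partial>?T)" by (intro nn_integral_mono inner)
    also have "\<dots> = ennreal (C / \<phi> s ?w)" by (simp add: TT.emeasure_space_1)
    finally show ?thesis .
  qed
  show ?thesis
  proof (intro exI[of _ C] conjI C allI impI)
    fix \<omega> \<tau> :: "nat \<Rightarrow> nat" and m :: nat assume eq: "\<forall>i<m. \<omega> i = \<tau> i" and ne: "\<omega> m \<noteq> \<tau> m"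
    let ?o = "(shift ^^ m) \<omega>" and ?t = "(shift ^^ m) \<tau>"
    have "letter_weight (\<omega> m) ?o + letter_weight (\<tau> m) ?o \<le> r" "letter_weight (\<omega> m) ?t + letter_weight (\<tau> m) ?t \<le> r"
      unfolding r_def by (rule letter_weight_sum[OF ne])+
    hence "letter_weight (\<omega> m) ?o + letter_weight (\<omega> m) ?t \<le> r \<or> letter_weight (\<tau> m) ?t + letter_weight (\<tau> m) ?o \<le> r"
      by linarith
    thus "(\<integral>\<^sup>+a. riesz t (projection T a \<omega> - projection T a \<tau>) \<partial>translation_measure) \<le> ennreal (C / \<phi> s (prefix_word \<omega> m))"
    proof
      assume "letter_weight (\<omega> m) ?o + letter_weight (\<omega> m) ?t \<le> r"
      thus ?thesis using eq ne by (intro one) auto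
    next
      assume w: "letter_weight (\<tau> m) ?t + letter_weight (\<tau> m) ?o \<le> r"
      have "prefix_word \<tau> m = prefix_word \<omega> m" using eq by (simp add: prefix_word_eq_iff)
      moreover have "(\<integral>\<^sup>+a. riesz t (projection T a \<tau> - projection T a \<omega>) \<partial>translation_measure) \<le> ennreal (C / \<phi> s (prefix_word \<tau> m))"
        by (rule one) (use eq ne w in auto)
      ultimately show ?thesis by (subst riesz_minus) simp
    qed
  qed
qed

end

section \<open>Slow schedules and weighted averages\<close>

text \<open>Let \<open>N\<close> take a value \<open>n \<ge> 2\<close> only when \<open>j\<close> is so large that \<open>|Q m| * m \<le> j\<close> for all \<open>m \<le> n\<close>.\<close>
lemma slow_schedule:
  fixes Q :: "nat \<Rightarrow> real"
  shows "\<exists>N. (\<forall>j. 1 \<le> N j) \<and> filterlim N at_top sequentially \<and> (\<lambda>j. Q (N j) / real (Suc j)) \<longlonglongrightarrow> 0"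
proof -
  define A where "A j = {n. n \<le> j \<and> (\<forall>m\<le>n. \<bar>Q m\<bar> * real m \<le> real j)}" for j
  define N where "N j = max 1 (Max (A j))" for j
  have fin: "finite (A j)" and ne: "A j \<noteq> {}" for j
  proof -
    show "finite (A j)" by (rule finite_subset[of _ "{..j}"]) (auto simp: A_def)
    have "0 \<in> A j" by (simp add: A_def)
    thus "A j \<noteq> {}" by blast
  qed
  define J where "J n = max n (nat \<lceil>\<Sum>m\<le>n. \<bar>Q m\<bar> * real m\<rceil>)" for n
  have mem: "n \<in> A j" if "J n \<le> j" for n j
  proof -
    have n: "n \<le> j" "nat \<lceil>\<Sum>m\<le>n. \<bar>Q m\<bar> * real m\<rceil> \<le> j" using that by (auto simp: J_def)
    hence "(\<Sum>m\<le>n. \<bar>Q m\<bar> * real m) \<le> real j" by (simp add: nat_le_iff ceiling_le_iff)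
    moreover have "\<bar>Q m\<bar> * real m \<le> (\<Sum>m\<le>n. \<bar>Q m\<bar> * real m)" if "m \<le> n" for m
      using that by (intro member_le_sum) auto
    ultimately show ?thesis using n(1) by (force simp: A_def)
  qed
  have ge: "n \<le> N j" if "J n \<le> j" for n j
    using Max_ge[OF fin mem[OF that]] by (simp add: N_def)
  have "filterlim N at_top sequentially"
    unfolding filterlim_at_top eventually_sequentially using ge by blast
  moreover have "(\<lambda>j. Q (N j) / real (Suc j)) \<longlonglongrightarrow> 0"
  proof (rule LIMSEQ_I)
    fix e :: real assume e: "0 < e"
    obtain n0 :: nat where n0: "1 / e < real n0" using reals_Archimedean2 by blast
    show "\<exists>no. \<forall>j\<ge>no. norm (Q (N j) / real (Suc j) - 0) < e"
    proof (intro exI[of _ "J (max 2 n0)"] allI impI)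
      fix j assume j: "J (max 2 n0) \<le> j"
      have N: "max 2 n0 \<le> N j" by (rule ge[OF j])
      hence "N j = Max (A j)" by (auto simp: N_def max_def split: if_splits)
      hence "N j \<in> A j" using Max_in[OF fin ne] by simp
      hence "\<bar>Q (N j)\<bar> * real (N j) \<le> real j" by (simp add: A_def)
      hence "\<bar>Q (N j)\<bar> * real (N j) < real (Suc j)" by simp
      moreover have "1 < e * real (N j)"
      proof -
        have "1 / e < real (N j)" using n0 N by simp
        thus ?thesis using e by (simp add: pos_divide_less_eq mult.commute)
      qed
      hence "real (Suc j) * 1 < real (Suc j) * (e * real (N j))" by (intro mult_strict_left_mono) auto
      hence "real (Suc j) < (e * real (Suc j)) * real (N j)" by (simp only: mult_1_left mult_1_right mult_ac)
      ultimately have "\<bar>Q (N j)\<bar> * real (N j) < (e * real (Suc j)) * real (N j)" by linarith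
      hence "\<bar>Q (N j)\<bar> < e * real (Suc j)" using N by (simp add: mult_less_cancel_right)
      thus "norm (Q (N j) / real (Suc j) - 0) < e" by (simp add: abs_divide pos_divide_less_eq)
    qed
  qed
  ultimately show ?thesis by (intro exI[of _ N]) (simp add: N_def)
qed

text \<open>One half of a Cesaro theorem for blocks of lengths \<open>q\<^sub>b \<rightarrow> \<infinity>\<close>. The errors allowed are linear in the
  number \<open>j\<close> of blocks; this is negligible, as the blocks together are much longer than \<open>j\<close>.\<close>
lemma weighted_average_lower:
  fixes h B s :: "nat \<Rightarrow> real" and q t :: "nat \<Rightarrow> nat"
  assumes t: "\<And>j. t j + q j \<le> t (Suc j)" and q: "filterlim q at_top sequentially"
    and err: "\<And>j l. t j \<le> l \<Longrightarrow> l < t (Suc j) \<Longrightarrow>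
       \<bar>s l - (\<Sum>b<j. h b)\<bar> \<le> a + c * real j + B j \<and> \<bar>real l - (\<Sum>b<j. real (q b))\<bar> \<le> a + c * real j + B j"
    and B: "(\<lambda>j. B j / real (Suc j)) \<longlonglongrightarrow> 0"
    and low: "\<forall>\<^sub>F b in sequentially. x * real (q b) \<le> h b" and e: "0 < e"
  shows "\<forall>\<^sub>F l in sequentially. (x - e) * real l \<le> s l"
proof -
  have tmono: "t i \<le> t j" if "i \<le> j" for i j
    by (rule lift_Suc_mono_le[OF _ that]) (use t add_leD1 in blast)
  obtain b0 where b0: "\<And>b. b0 \<le> b \<Longrightarrow> x * real (q b) \<le> h b" using low by (auto simp: eventually_sequentially)
  \<comment> \<open>The blocks before \<open>b0\<close> do not obey the lower bound; they cost a constant.\<close>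
  define D where "D = (\<Sum>b<b0. \<bar>h b\<bar> + \<bar>x\<bar> * real (q b))"
  have D: "x * (\<Sum>b<j. real (q b)) - D \<le> (\<Sum>b<j. h b)" for j
  proof -
    have "(\<Sum>b<j. x * real (q b) - h b) \<le> (\<Sum>b<j. if b < b0 then \<bar>h b\<bar> + \<bar>x\<bar> * real (q b) else 0)"
    proof (rule sum_mono)
      fix b
      have "x * real (q b) \<le> \<bar>x\<bar> * real (q b)" by (intro mult_right_mono) auto
      thus "x * real (q b) - h b \<le> (if b < b0 then \<bar>h b\<bar> + \<bar>x\<bar> * real (q b) else 0)"
        using b0[of b] by auto
    qed
    also have "\<dots> = (\<Sum>b\<in>{..<j} \<inter> {..<b0}. \<bar>h b\<bar> + \<bar>x\<bar> * real (q b))"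
      by (rule sum.mono_neutral_cong_right) auto
    also have "\<dots> \<le> D" unfolding D_def by (intro sum_mono2) auto
    finally show ?thesis by (simp add: sum_subtractf sum_distrib_left)
  qed
  define G where "G j = D + (1 + \<bar>x\<bar>) * (a + c * real j + B j)" for j
  define L where "L = \<bar>D\<bar> + (1 + \<bar>x\<bar>) * (\<bar>a\<bar> + \<bar>c\<bar> + 1)"
  have L: "0 < L"
  proof -
    have "0 < 1 + \<bar>x\<bar>" "0 < \<bar>a\<bar> + \<bar>c\<bar> + 1" by linarith+
    from add_nonneg_pos[OF abs_ge_zero mult_pos_pos[OF this]] show ?thesis by (simp only: L_def)
  qed
  have "\<forall>\<^sub>F j in sequentially. B j / real (Suc j) < 1" using order_tendstoD(2)[OF B, of 1] by simp
  hence G: "\<forall>\<^sub>F j in sequentially. G j \<le> L * real (Suc j)"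
  proof eventually_elim
    case (elim j)
    have 1: "B j \<le> 1 * real (Suc j)" using elim by (simp add: pos_divide_less_eq)
    have 2: "a \<le> \<bar>a\<bar> * real (Suc j)"
    proof -
      have "\<bar>a\<bar> * 1 \<le> \<bar>a\<bar> * real (Suc j)" by (intro mult_left_mono) auto
      thus ?thesis by linarith
    qed
    have "c * real j \<le> \<bar>c\<bar> * real (Suc j)" by (intro mult_mono) auto
    with 1 2 have "a + c * real j + B j \<le> (\<bar>a\<bar> + \<bar>c\<bar> + 1) * real (Suc j)" unfolding distrib_right by linarith
    hence "(1 + \<bar>x\<bar>) * (a + c * real j + B j) \<le> (1 + \<bar>x\<bar>) * ((\<bar>a\<bar> + \<bar>c\<bar> + 1) * real (Suc j))" by (intro mult_left_mono) auto
    moreover have "D \<le> \<bar>D\<bar> * real (Suc j)"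
    proof -
      have "\<bar>D\<bar> * 1 \<le> \<bar>D\<bar> * real (Suc j)" by (intro mult_left_mono) auto
      thus ?thesis by linarith
    qed
    ultimately show ?case unfolding G_def L_def distrib_right[of "\<bar>D\<bar>"] by (simp add: mult.assoc)
  qed
  obtain \<Lambda> :: nat where \<Lambda>: "2 * L / e < real \<Lambda>" using reals_Archimedean2 by blast
  have "\<forall>\<^sub>F b in sequentially. \<Lambda> \<le> q b" using q by (simp add: filterlim_at_top)
  then obtain b1 where b1: "\<And>b. b1 \<le> b \<Longrightarrow> \<Lambda> \<le> q b" by (auto simp: eventually_sequentially)
  have tb: "\<Lambda> * k \<le> t (b1 + k)" for k
  proof (induction k)
    case (Suc k)
    have "\<Lambda> * Suc k \<le> t (b1 + k) + q (b1 + k)" using Suc b1[of "b1 + k"] by simp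
    thus ?case using t[of "b1 + k"] by simp
  qed simp
  have "\<forall>\<^sub>F j in sequentially. 2 * b1 + 1 \<le> j" by (rule eventually_ge_at_top)
  with G have "\<forall>\<^sub>F j in sequentially. G j \<le> e * real (t j)"
  proof eventually_elim
    case (elim j)
    have j: "j = b1 + (j - b1)" using elim(2) by simp
    have "real \<Lambda> * real (j - b1) \<le> real (t j)" using tb[of "j - b1"] j by (metis of_nat_le_iff of_nat_mult)
    moreover have "real (Suc j) \<le> 2 * real (j - b1)" using elim(2) by linarith
    hence "real \<Lambda> * real (Suc j) \<le> real \<Lambda> * (2 * real (j - b1))" by (intro mult_left_mono) auto
    ultimately have a1: "real \<Lambda> * real (Suc j) \<le> 2 * real (t j)" by linarith
    have "2 * L < e * real \<Lambda>" using \<Lambda> e by (simp add: pos_divide_less_eq mult.commute)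
    hence "2 * L * real (Suc j) \<le> e * real \<Lambda> * real (Suc j)" by (intro mult_right_mono) auto
    also have "\<dots> \<le> e * (2 * real (t j))" unfolding mult.assoc using a1 e by (intro mult_left_mono) auto
    finally have "L * real (Suc j) \<le> e * real (t j)" by simp
    with elim(1) show ?case by linarith
  qed
  then obtain j0 where j0: "\<And>j. j0 \<le> j \<Longrightarrow> G j \<le> e * real (t j)"
    by (auto simp: eventually_sequentially)
  show ?thesis
    unfolding eventually_sequentially
  proof (intro exI[of _ "t j0"] allI impI)
    fix l assume l: "t j0 \<le> l"
    define k where "k = (LEAST k. l < t k)"
    have L1: "1 \<le> \<Lambda>"
    proof -
      have "0 < 2 * L / e" using L e by simp
      hence "0 < real \<Lambda>" using \<Lambda> by linarith
      thus ?thesis by simp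
    qed
    have "1 * Suc l \<le> \<Lambda> * Suc l" by (rule mult_right_mono[OF L1]) simp
    from order_trans[OF this tb[of "Suc l"]] have ex: "l < t (b1 + Suc l)" by simp
    have k: "l < t k" unfolding k_def by (rule LeastI[of "\<lambda>k. l < t k", OF ex])
    have "j0 < k"
    proof (rule ccontr)
      assume "\<not> j0 < k"
      hence "t k \<le> t j0" by (intro tmono) simp
      thus False using k l by simp
    qed
    then obtain j where j: "k = Suc j" "j0 \<le> j" by (cases k) auto
    have tj: "t j \<le> l" using not_less_Least[of j "\<lambda>k. l < t k"] j(1) by (simp add: k_def[symmetric])
    define E where "E = a + c * real j + B j"
    from err[OF tj k[unfolded j(1)]] have 1: "\<bar>s l - (\<Sum>b<j. h b)\<bar> \<le> E" and 2: "\<bar>real l - (\<Sum>b<j. real (q b))\<bar> \<le> E"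
      by (auto simp: E_def)
    have "\<bar>x * (real l - (\<Sum>b<j. real (q b)))\<bar> \<le> \<bar>x\<bar> * E"
      unfolding abs_mult using 2 by (intro mult_left_mono) auto
    hence "x * real l - x * (\<Sum>b<j. real (q b)) \<le> \<bar>x\<bar> * E" unfolding right_diff_distrib by linarith
    moreover have "G j = D + E + \<bar>x\<bar> * E" by (simp add: G_def E_def distrib_right)
    ultimately have "x * real l - G j \<le> s l" using D[of j] 1 by linarith
    moreover have "e * real (t j) \<le> e * real l" using tj e by (intro mult_left_mono) auto
    ultimately show "(x - e) * real l \<le> s l" using j0[OF j(2)] unfolding left_diff_distrib by linarith
  qed
qed

section \<open>Averages along glued sequences\<close>

context birkhoff_family
begin

text \<open>Each block \<open>u j\<close> has averages in the neighbourhoods of level \<open>N j \<rightarrow> \<infinity>\<close>. Between the ends of two blocks the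
  sums change by at most \<open>Bd (N j)\<close>, which is \<open>o(j)\<close>, so that convergence at the ends of blocks suffices.\<close>
lemma glued_level_set:
  assumes kG: "\<And>u v. \<kappa> u v \<in> \<Gamma>" and G: "finite \<Gamma>"
    and W0: "\<And>n v. 1 \<le> n \<Longrightarrow> v \<in> W0 n \<Longrightarrow> length v = q0 n"
    and q0: "\<And>n. 1 \<le> n \<Longrightarrow> n \<le> q0 n"
    and av: "\<And>n v \<omega> i. 1 \<le> n \<Longrightarrow> v \<in> W0 n \<Longrightarrow> \<omega> \<in> cylinder v \<Longrightarrow> i < n \<Longrightarrow> birkhoff_average (q0 n) (\<Phi> i) \<omega> \<in> target_nhd n (\<alpha> i)"
    and Bd: "\<And>n i v g \<tau> l. 1 \<le> n \<Longrightarrow> i < n \<Longrightarrow> v \<in> W0 n \<Longrightarrow> g \<in> \<Gamma> \<Longrightarrow> \<tau> \<in> cylinder (g @ v) \<Longrightarrow> l \<le> length (g @ v) \<Longrightarrow>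
         \<bar>birkhoff_sum (\<Phi> i) l \<tau>\<bar> \<le> Bd n \<and> real (length (g @ v)) \<le> Bd n"
    and N: "\<And>j. 1 \<le> N j" "filterlim N at_top sequentially" "(\<lambda>j. Bd (N j) / real (Suc j)) \<longlonglongrightarrow> 0"
    and u: "\<And>j. u j \<in> W0 (N j)"
    and w: "\<And>j. \<omega> \<in> cylinder (glue \<kappa> [0] (map u [0..<j]))"
  shows "\<omega> \<in> level_set \<Phi> \<alpha>"
  unfolding level_set_def
proof (intro CollectI allI)
  fix i
  obtain V where V: "\<And>l \<omega> \<tau>. (\<And>j. j < l \<Longrightarrow> \<omega> j = \<tau> j) \<Longrightarrow> \<bar>birkhoff_sum (\<Phi> i) l \<omega> - birkhoff_sum (\<Phi> i) l \<tau>\<bar> \<le> V"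
    using summable_variations_distortion[OF var[of i]] by blast
  define K where "K = (\<Sum>g\<in>\<Gamma>. length g)"
  have K: "length g \<le> K" if "g \<in> \<Gamma>" for g unfolding K_def using that G by (intro member_le_sum) auto
  define A where "A = (\<Union>(set ` \<Gamma>))"
  have "finite A" using G by (auto simp: A_def)
  from letters_bound[OF V this] obtain E1 where E1: "0 \<le> E1" "\<And>\<tau>. \<tau> 0 \<in> A \<Longrightarrow> \<bar>\<Phi> i \<tau>\<bar> \<le> E1" by blast
  define E where "E = real K * E1"
  have E: "\<bar>birkhoff_sum (\<Phi> i) (length g) \<tau>\<bar> \<le> E" if "g \<in> \<Gamma>" "\<tau> \<in> cylinder g" for g \<tau>
  proof -
    have "\<tau> j \<in> A" if "j < length g" for j
      unfolding A_def using that \<open>g \<in> \<Gamma>\<close> \<open>\<tau> \<in> cylinder g\<close> by (intro UN_I[of g]) (auto simp: cylinder_iff)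
    hence "\<bar>birkhoff_sum (\<Phi> i) (length g) \<tau>\<bar> \<le> real (length g) * E1"
      by (intro birkhoff_sum_letters_bound[where A = A] E1(2)) auto
    also have "\<dots> \<le> E" unfolding E_def using K[OF that(1)] E1 by (intro mult_right_mono) auto
    finally show ?thesis .
  qed
  define X where "X j = glue \<kappa> [0] (map u [0..<j])" for j
  define t where "t j = length (X j)" for j
  define q where "q j = q0 (N j)" for j
  have XS: "X (Suc j) = X j @ \<kappa> (X j) (u j) @ u j" for j by (simp add: X_def glue_append)
  have lu: "length (u j) = q j" for j using W0[OF N(1) u] by (simp add: q_def)
  have tS: "t (Suc j) = t j + (length (\<kappa> (X j) (u j)) + q j)" for j by (simp add: t_def XS lu)
  have qlim: "filterlim q at_top sequentially"
    unfolding q_def by (rule filterlim_at_top_mono[OF N(2)]) (use q0[OF N(1)] in simp)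
  define s where "s l = birkhoff_sum (\<Phi> i) l \<omega>" for l
  define h where "h b = birkhoff_sum (\<Phi> i) (q b) (zero_extension (u b))" for b
  have wX: "\<omega> \<in> cylinder (X j)" for j using w by (simp add: X_def)
  have glue_err: "\<bar>s (t j) - s 1 - (\<Sum>b<j. h b)\<bar> \<le> real j * (V + E)" for j
  proof -
    let ?h = "\<lambda>y. birkhoff_sum (\<Phi> i) (length y) (zero_extension y)"
    have "\<bar>birkhoff_sum (\<Phi> i) (length (glue \<kappa> [0] (map u [0..<j]))) \<omega> - birkhoff_sum (\<Phi> i) (length [0::nat]) \<omega> - sum_list (map ?h (map u [0..<j]))\<bar>
        \<le> real (length (map u [0..<j])) * (V + E)"
    proof (rule birkhoff_sum_glue[of \<kappa> \<Gamma>, OF kG E _ w])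
      show "\<bar>birkhoff_sum (\<Phi> i) (length y) \<tau> - ?h y\<bar> \<le> V" if "\<tau> \<in> cylinder y" for y \<tau>
        using that by (intro V) (simp add: cylinder_iff zero_extension_def)
    qed
    moreover have "sum_list (map ?h (map u [0..<j])) = (\<Sum>b<j. h b)"
      by (simp add: h_def lu[symmetric] sum_list_sum_nth comp_def interv_sum_list_conv_sum_set_nat atLeast0LessThan)
    ultimately show ?thesis by (simp add: s_def t_def X_def)
  qed
  \<comment> \<open>The potential \<open>i\<close> is controlled by \<open>Bd\<close> only if \<open>i < N j\<close>; this fails for finitely many \<open>j\<close>, where any bound will do.\<close>
  define B where "B j = Bd (N j) + (if i < N j then 0 else \<Sum>l<t (Suc j). \<bar>s l - s (t j)\<bar>)" for j
  have block: "\<kappa> (X j) (u j) \<in> \<Gamma>" "(shift ^^ t j) \<omega> \<in> cylinder (\<kappa> (X j) (u j) @ u j)" for j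
    using kG wX[of "Suc j"] unfolding XS t_def by (auto simp: cylinder_append)
  have Bd0: "0 \<le> Bd (N j) \<and> real (length (\<kappa> (X j) (u j) @ u j)) \<le> Bd (N j)" for j
  proof -
    have "0 < N j" using N(1)[of j] by simp
    from Bd[OF N(1) this u block(1) block(2), of 0] show ?thesis by auto
  qed
  have err: "\<bar>s l - (\<Sum>b<j. h b)\<bar> \<le> (1 + \<bar>s 1\<bar>) + (V + E + real K) * real j + B j \<and>
      \<bar>real l - (\<Sum>b<j. real (q b))\<bar> \<le> (1 + \<bar>s 1\<bar>) + (V + E + real K) * real j + B j"
    if l: "t j \<le> l" "l < t (Suc j)" for j l
  proof -
    have V0: "0 \<le> V" using V[of 0 \<omega> \<omega>] by simp
    have E0: "0 \<le> E" using E1 by (simp add: E_def)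
    have ext: "0 \<le> (\<Sum>l<t (Suc j). \<bar>s l - s (t j)\<bar>)" by (intro sum_nonneg) auto
    have BB: "Bd (N j) \<le> B j" using ext by (simp add: B_def)
    have p: "\<bar>s l - s (t j)\<bar> \<le> B j"
    proof (cases "i < N j")
      case True
      have "s l = s (t j) + birkhoff_sum (\<Phi> i) (l - t j) ((shift ^^ t j) \<omega>)"
        unfolding s_def using birkhoff_sum_add[of "\<Phi> i" "t j" "l - t j" \<omega>] l(1) by simp
      moreover have "\<bar>birkhoff_sum (\<Phi> i) (l - t j) ((shift ^^ t j) \<omega>)\<bar> \<le> Bd (N j)"
        using Bd[OF N(1) True u block(1) block(2), of "l - t j"] l tS[of j] lu[of j] by simp
      ultimately show ?thesis using BB by linarith
    next
      case False
      have "\<bar>s l - s (t j)\<bar> \<le> (\<Sum>l<t (Suc j). \<bar>s l - s (t j)\<bar>)" using l by (intro member_le_sum) auto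
      thus ?thesis using False Bd0[of j] by (simp add: B_def)
    qed
    have tj: "1 + (\<Sum>b<j. q b) \<le> t j \<and> t j \<le> 1 + (\<Sum>b<j. q b) + j * K" for j
    proof (induction j)
      case 0
      show ?case by (simp add: t_def X_def)
    next
      case (Suc j)
      have "length (\<kappa> (X j) (u j)) \<le> K" by (rule K[OF block(1)])
      thus ?case using Suc unfolding tS by simp
    qed
    have "real (l - t j) \<le> Bd (N j)"
    proof -
      have "l - t j \<le> length (\<kappa> (X j) (u j) @ u j)" using l tS[of j] lu[of j] by simp
      hence "real (l - t j) \<le> real (length (\<kappa> (X j) (u j) @ u j))" by (simp only: of_nat_le_iff)
      thus ?thesis using Bd0[of j] by linarith
    qed
    hence lt: "real l \<le> real (t j) + Bd (N j)" using l(1) by (simp add: of_nat_diff)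
    have t1: "1 + (\<Sum>b<j. real (q b)) \<le> real (t j)" "real (t j) \<le> 1 + (\<Sum>b<j. real (q b)) + real j * real K"
      using tj[of j] by (simp_all flip: of_nat_sum of_nat_add of_nat_mult of_nat_Suc)
    have e1: "(V + E + real K) * real j = real j * (V + E) + real j * real K" by (simp add: algebra_simps)
    have nn: "0 \<le> real j * (V + E)" "0 \<le> real j * real K" using V0 E0 by auto
    have l1: "real (t j) \<le> real l" using l(1) by simp
    show ?thesis unfolding e1
    proof (intro conjI)
      show "\<bar>s l - (\<Sum>b<j. h b)\<bar> \<le> 1 + \<bar>s 1\<bar> + (real j * (V + E) + real j * real K) + B j"
        using p glue_err[of j] nn by linarith
      show "\<bar>real l - (\<Sum>b<j. real (q b))\<bar> \<le> 1 + \<bar>s 1\<bar> + (real j * (V + E) + real j * real K) + B j"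
        using lt t1 l1 BB nn by linarith
    qed
  qed
  have evN: "\<forall>\<^sub>F j in sequentially. n \<le> N j" for n using N(2) by (simp add: filterlim_at_top)
  have B: "(\<lambda>j. B j / real (Suc j)) \<longlonglongrightarrow> 0"
  proof (rule Lim_transform_eventually[OF N(3)])
    show "\<forall>\<^sub>F j in sequentially. Bd (N j) / real (Suc j) = B j / real (Suc j)"
      using evN[of "Suc i"] by eventually_elim (simp add: B_def)
  qed
  have tq: "t j + q j \<le> t (Suc j)" for j by (simp add: tS)
  have lower: "\<forall>\<^sub>F l in sequentially. (x - e) * real l \<le> s l"
    if "\<forall>\<^sub>F b in sequentially. x * real (q b) \<le> h b" "0 < e" for x e
    by (rule weighted_average_lower[OF tq qlim err B that])
  have upper: "\<forall>\<^sub>F l in sequentially. s l \<le> (x + e) * real l"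
    if low: "\<forall>\<^sub>F b in sequentially. h b \<le> x * real (q b)" and e: "0 < e" for x e
  proof -
    have low': "\<forall>\<^sub>F b in sequentially. - x * real (q b) \<le> - h b" using low by eventually_elim simp
    have err': "\<bar>- s l - (\<Sum>b<j. - h b)\<bar> \<le> (1 + \<bar>s 1\<bar>) + (V + E + real K) * real j + B j \<and>
      \<bar>real l - (\<Sum>b<j. real (q b))\<bar> \<le> (1 + \<bar>s 1\<bar>) + (V + E + real K) * real j + B j"
      if l: "t j \<le> l" "l < t (Suc j)" for j l using err[OF l] by (simp add: sum_negf abs_minus_commute)
    have "\<forall>\<^sub>F l in sequentially. (- x - e) * real l \<le> - s l"
      by (rule weighted_average_lower[OF tq qlim err' B low' e])
    thus ?thesis by eventually_elim (simp add: algebra_simps)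
  qed
  have hq: "h b / real (q b) \<in> target_nhd (N b) (\<alpha> i)" "0 < real (q b)" if "i < N b" for b
  proof -
    have "0 < q b" using q0[OF N(1), of b] N(1)[of b] by (simp add: q_def)
    thus "0 < real (q b)" by simp
    show "h b / real (q b) \<in> target_nhd (N b) (\<alpha> i)"
      using av[OF N(1) u zero_extension_cylinder that] by (simp add: birkhoff_average_eq h_def q_def)
  qed
  have pos: "\<forall>\<^sub>F l in sequentially. 0 < real l" using eventually_gt_at_top[of 0] by eventually_elim simp
  have avg: "birkhoff_average l (\<Phi> i) \<omega> = s l / real l" for l by (simp add: s_def birkhoff_average_eq)
  show "(\<lambda>n. ereal (birkhoff_average n (\<Phi> i) \<omega>)) \<longlonglongrightarrow> \<alpha> i"
  proof (cases "\<alpha> i")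
    case (real r)
    have "(\<lambda>l. s l / real l) \<longlonglongrightarrow> r"
    proof (rule tendstoI)
      fix e :: real assume e: "0 < e"
      obtain n :: nat where n: "3 / e < real n" using reals_Archimedean2 by blast
      have n1: "1 / real m < e / 3" if "n \<le> m" for m
      proof -
        have "3 / e < real m" using n that by linarith
        moreover from this have "0 < real m" using e by (meson divide_pos_pos less_trans zero_less_numeral)
        ultimately show ?thesis using e by (simp add: field_simps)
      qed
      have b: "\<forall>\<^sub>F b in sequentially. (r - e/3) * real (q b) \<le> h b \<and> h b \<le> (r + e/3) * real (q b)"
        using evN[of "max n (Suc i)"]
      proof eventually_elim
        case (elim b)
        hence i: "i < N b" "n \<le> N b" by auto
        have "r - e/3 < h b / real (q b)" "h b / real (q b) < r + e/3"
          using hq(1)[OF i(1)] n1[OF i(2)] by (auto simp: real target_nhd_def)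
        thus ?case using hq(2)[OF i(1)] by (simp add: pos_less_divide_eq pos_divide_less_eq)
      qed
      have e3: "0 < e / 3" using e by simp
      have "\<forall>\<^sub>F l in sequentially. (r - e/3 - e/3) * real l \<le> s l"
        by (rule lower[OF _ e3]) (use b in eventually_elim, simp)
      moreover have "\<forall>\<^sub>F l in sequentially. s l \<le> (r + e/3 + e/3) * real l"
        by (rule upper[OF _ e3]) (use b in eventually_elim, simp)
      ultimately show "\<forall>\<^sub>F l in sequentially. dist (s l / real l) r < e"
        using pos
      proof eventually_elim
        case (elim l)
        have "r - e/3 - e/3 \<le> s l / real l" "s l / real l \<le> r + e/3 + e/3"
          using elim by (simp_all add: pos_le_divide_eq pos_divide_le_eq)
        thus ?case using e by (simp add: dist_real_def abs_less_iff)
      qed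
    qed
    thus ?thesis by (simp add: real avg)
  next
    case PInf
    show ?thesis unfolding PInf tendsto_PInfty avg
    proof
      fix x :: real
      have b: "\<forall>\<^sub>F b in sequentially. (x + 2) * real (q b) \<le> h b"
        using evN[of "max (nat \<lceil>x + 2\<rceil>) (Suc i)"]
      proof eventually_elim
        case (elim b)
        hence i: "i < N b" "nat \<lceil>x + 2\<rceil> \<le> N b" by auto
        have "x + 2 \<le> real (N b)" using i(2) by linarith
        moreover have "real (N b) < h b / real (q b)" using hq(1)[OF i(1)] by (simp add: PInf target_nhd_def)
        ultimately have "x + 2 < h b / real (q b)" by linarith
        thus ?case using hq(2)[OF i(1)] by (simp add: pos_less_divide_eq)
      qed
      have "\<forall>\<^sub>F l in sequentially. (x + 2 - 1) * real l \<le> s l" by (rule lower[OF b]) simp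
      thus "\<forall>\<^sub>F l in sequentially. ereal x < ereal (s l / real l)"
        using pos
      proof eventually_elim
        case (elim l)
        have "x + 2 - 1 \<le> s l / real l" using elim by (simp add: pos_le_divide_eq)
        thus ?case by simp
      qed
    qed
  next
    case MInf
    show ?thesis unfolding MInf tendsto_MInfty avg
    proof
      fix x :: real
      have b: "\<forall>\<^sub>F b in sequentially. h b \<le> (x - 2) * real (q b)"
        using evN[of "max (nat \<lceil>- (x - 2)\<rceil>) (Suc i)"]
      proof eventually_elim
        case (elim b)
        hence i: "i < N b" "nat \<lceil>- (x - 2)\<rceil> \<le> N b" by auto
        have "- (x - 2) \<le> real (N b)" using i(2) by linarith
        moreover have "h b / real (q b) < - real (N b)" using hq(1)[OF i(1)] by (simp add: MInf target_nhd_def)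
        ultimately have "h b / real (q b) < x - 2" by linarith
        thus ?case using hq(2)[OF i(1)] by (simp add: pos_divide_less_eq)
      qed
      have "\<forall>\<^sub>F l in sequentially. s l \<le> (x - 2 + 1) * real l" by (rule upper[OF b]) simp
      thus "\<forall>\<^sub>F l in sequentially. ereal (s l / real l) < ereal x"
        using pos
      proof eventually_elim
        case (elim l)
        have "s l / real l \<le> x - 2 + 1" using elim by (simp add: pos_divide_le_eq)
        thus ?case by simp
      qed
    qed
  qed
qed

end

section \<open>A Frostman measure on the level set\<close>

lemma cylinder_prefix:
  assumes "\<omega> \<in> cylinder u" "\<omega> \<in> cylinder w" "length u \<le> length w"
  shows "\<exists>z. w = u @ z"
proof -
  have "w = prefix_word \<omega> (length u + (length w - length u))" using assms by (simp add: cylinder_def)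
  also have "\<dots> = u @ prefix_word ((shift ^^ length u) \<omega>) (length w - length u)"
    unfolding prefix_word_add using assms(1) by (simp add: cylinder_def)
  finally show ?thesis by blast
qed

context birkhoff_family
begin

text \<open>Independent blocks, the \<open>j\<close>-th one drawn from the Gibbs vector on \<open>W\<^sub>j\<close>, are glued together.
  A cylinder \<open>[w]\<close> is met only by block sequences whose glued word \<open>x\<close> is, up to one incomplete
  block, a prefix of \<open>w\<close>.  There are at most \<open>card \<Gamma>\<^sup>j\<close> of these with \<open>j\<close> blocks, each has probability
  at most \<open>\<phi>\<^sup>s(x) / card \<Gamma>\<^sup>j\<close> up to a constant since the partition sums exceed \<open>c card \<Gamma>\<close>, and the
  incomplete block costs the factor \<open>exp Q\<^sub>j\<close>.\<close>
lemma glued_measure: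
  assumes con: "connector s c \<Gamma> \<kappa>" and s: "0 \<le> s"
    and W: "\<And>j. finite (W j)" "\<And>j. W j \<noteq> {}" "\<And>j v. v \<in> W j \<Longrightarrow> length v = q j" "\<And>j. 1 \<le> q j"
    and Z: "\<And>j. c * real (card \<Gamma>) \<le> sum (\<phi> s) (W j)"
    and Q: "\<And>j x g v v' z. g \<in> \<Gamma> \<Longrightarrow> v \<in> W j \<Longrightarrow> g @ v = v' @ z \<Longrightarrow> \<phi> s x * exp (- Q j) \<le> \<phi> s (x @ v')"
  shows "\<exists>(P :: (nat \<Rightarrow> nat list) measure) F. prob_space P \<and> F \<in> P \<rightarrow>\<^sub>M borel \<and>
    (AE u in P. \<forall>j. u j \<in> W j \<and> F u \<in> cylinder (glue \<kappa> [0] (map u [0..<j]))) \<and>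
    (\<forall>w. w \<noteq> [] \<longrightarrow> emeasure P {u\<in>space P. F u \<in> cylinder w} \<le> ennreal ((\<Sum>j<length w. exp (Q j)) * \<phi> s w / \<phi> s [0]))"
proof -
  have c: "1 \<le> c" and G: "finite \<Gamma>" and kG: "\<And>u v. \<kappa> u v \<in> \<Gamma>" using con by (auto simp: connector_def)
  have cG: "0 < card \<Gamma>" using kG G by (auto simp: card_gt_0_iff)
  let ?p = "\<lambda>j. gibbs_pmf s (W j)"
  note gp = gibbs_pmf[OF W(1,2) s]
  define P where "P = PiM UNIV (\<lambda>j. measure_pmf (?p j))"
  interpret product_prob_space "\<lambda>j. measure_pmf (?p j)" UNIV
    by (intro product_prob_spaceI measure_pmf.prob_space_axioms)
  interpret Om: prob_space P unfolding P_def by (rule prob_space_PiM) (rule measure_pmf.prob_space_axioms)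
  have comp: "(\<lambda>u. u j) \<in> P \<rightarrow>\<^sub>M measure_pmf (?p j)" for j :: nat
    unfolding P_def by (rule measurable_component_singleton) simp
  have comp': "(\<lambda>u. h (u j)) \<in> P \<rightarrow>\<^sub>M count_space UNIV" for j :: nat and h :: "nat list \<Rightarrow> 'c"
    by (rule measurable_compose[OF comp]) simp
  have blocks: "(\<lambda>u. map u [0..<j]) \<in> P \<rightarrow>\<^sub>M count_space UNIV" for j
  proof (induction j)
    case (Suc j)
    have "(\<lambda>u. (\<lambda>xs u. xs @ [u j]) (map u [0..<j]) u) \<in> P \<rightarrow>\<^sub>M count_space UNIV"
      by (rule measurable_compose_countable[OF comp' Suc])
    thus ?case by simp
  qed simp
  have blocks': "(\<lambda>u. h (map u [0..<j])) \<in> P \<rightarrow>\<^sub>M count_space UNIV" for j :: nat and h :: "nat list list \<Rightarrow> 'c"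
    by (rule measurable_compose[OF blocks]) simp
  define X where "X u j = glue \<kappa> [0] (map u [0..<j])" for u j
  define F where "F u i = X u i ! i" for u i
  have F: "F \<in> P \<rightarrow>\<^sub>M borel"
    unfolding F_def X_def by (rule measurable_words) (rule blocks')
  have XS: "X u (Suc j) = X u j @ \<kappa> (X u j) (u j) @ u j" for u j by (simp add: X_def glue_append)
  have aeW: "AE u in P. \<forall>j. u j \<in> W j"
    unfolding AE_all_countable P_def
    by (intro allI AE_PiM_component measure_pmf.prob_space_axioms) (auto simp: AE_measure_pmf_iff gp(2))
  have len: "Suc j \<le> length (X u j)" if "\<forall>j. u j \<in> W j" for u j
  proof (induction j)
    case 0
    show ?case by (simp add: X_def)
  next
    case (Suc j)
    have "1 \<le> length (u j)" using that W(3,4) by (metis)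
    with Suc show ?case by (simp add: XS)
  qed
  have Xpre: "X u j ! i = X u k ! i" if "j \<le> k" "i < length (X u j)" for u i j k
  proof -
    have "[0..<k] = [0..<j] @ [j..<k]" using that(1) upt_add_eq_append[of 0 j "k - j"] by simp
    hence "X u k = glue \<kappa> (X u j) (map u [j..<k])" by (simp add: X_def glue_append)
    then obtain z where "X u k = X u j @ z" using glue_prefix by metis
    thus ?thesis using that(2) by (simp add: nth_append)
  qed
  have Fcyl: "F u \<in> cylinder (X u j)" if u: "\<forall>j. u j \<in> W j" for u j
    unfolding cylinder_iff F_def
  proof (intro allI impI)
    fix i assume i: "i < length (X u j)"
    have "i < length (X u i)" using len[OF u, of i] by simp
    show "X u i ! i = X u j ! i"
    proof (cases "i \<le> j")
      case True
      thus ?thesis by (rule Xpre) fact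
    next
      case False
      thus ?thesis using Xpre[of j i i u] i by simp
    qed
  qed
  have ae: "AE u in P. \<forall>j. u j \<in> W j \<and> F u \<in> cylinder (glue \<kappa> [0] (map u [0..<j]))"
    using aeW by eventually_elim (use Fcyl in \<open>simp add: X_def\<close>)
  have block_prob: "emeasure P {u\<in>space P. map u [0..<j] = ys} \<le> ennreal (\<phi> s (glue \<kappa> [0] ys) / (\<phi> s [0] * real (card \<Gamma>) ^ j))"
    if ys: "length ys = j" "\<And>i. i < j \<Longrightarrow> ys ! i \<in> W i" for ys j
  proof -
    have "{u\<in>space P. map u [0..<j] = ys} = {u\<in>space P. \<forall>i\<in>{..<j}. u i \<in> {ys ! i}}"
      using ys(1) by (auto simp: list_eq_iff_nth_eq)
    hence "emeasure P {u\<in>space P. map u [0..<j] = ys} = (\<Prod>i<j. emeasure (measure_pmf (?p i)) {ys ! i})"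
      unfolding P_def by (simp only:) (rule emeasure_PiM_Collect, auto)
    also have "\<dots> = (\<Prod>i<j. ennreal (\<phi> s (ys ! i) / sum (\<phi> s) (W i)))"
      using ys(2) by (intro prod.cong) (auto simp: emeasure_pmf_single gp(1))
    also have "\<dots> = ennreal (\<Prod>i<j. \<phi> s (ys ! i) / sum (\<phi> s) (W i))"
      by (intro prod_ennreal divide_nonneg_nonneg sum_nonneg less_imp_le[OF word_svf_pos[OF s]])
    also have "(\<Prod>i<j. \<phi> s (ys ! i) / sum (\<phi> s) (W i)) \<le> (\<Prod>i<j. \<phi> s (ys ! i) / (c * real (card \<Gamma>)))"
    proof (intro prod_mono conjI)
      fix i
      have "0 < c * real (card \<Gamma>)" using c cG by simp
      moreover from this have "0 < sum (\<phi> s) (W i)" using Z[of i] by linarith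
      ultimately show "\<phi> s (ys ! i) / sum (\<phi> s) (W i) \<le> \<phi> s (ys ! i) / (c * real (card \<Gamma>))" "0 \<le> \<phi> s (ys ! i) / sum (\<phi> s) (W i)"
        using Z[of i] word_svf_pos[OF s, of "ys ! i"] by (auto intro!: divide_left_mono mult_pos_pos)
    qed
    also have "(\<Prod>i<j. \<phi> s (ys ! i) / (c * real (card \<Gamma>))) = weight (\<phi> s) ys / (c * real (card \<Gamma>)) ^ j"
      using ys(1) by (simp add: prod_dividef prod.list_conv_set_nth atLeast0LessThan)
    also have "weight (\<phi> s) ys / (c * real (card \<Gamma>)) ^ j \<le> \<phi> s (glue \<kappa> [0] ys) / (\<phi> s [0] * real (card \<Gamma>) ^ j)"
    proof -
      have "[] \<notin> set ys"
      proof
        assume "[] \<in> set ys"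
        then obtain i where "i < j" "ys ! i = []" using ys(1) by (auto simp: in_set_conv_nth)
        thus False using ys(2)[of i] W(3)[of "[]" i] W(4)[of i] by simp
      qed
      from word_svf_glue[OF con s _ this, of "[0]"] ys(1)
      have "\<phi> s [0] * weight (\<phi> s) ys \<le> c ^ j * \<phi> s (glue \<kappa> [0] ys)" by simp
      thus ?thesis using c cG word_svf_pos[OF s, of "[0]"] by (simp add: power_mult_distrib field_simps)
    qed
    finally show ?thesis by (simp add: ennreal_leI)
  qed
  have "emeasure P {u\<in>space P. F u \<in> cylinder w} \<le> ennreal ((\<Sum>j<length w. exp (Q j)) * \<phi> s w / \<phi> s [0])"
    if w: "w \<noteq> []" for w
  proof -
    define Y where "Y j = {ys. map length ys = map q [0..<j] \<and> zero_extension w \<in> cylinder (glue \<kappa> [0] ys)} \<inter>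
      {ys. (\<forall>i<j. ys ! i \<in> W i) \<and> \<phi> s (glue \<kappa> [0] ys) \<le> exp (Q j) * \<phi> s w}" for j
    note fib = card_glue_fibre[where \<kappa> = \<kappa> and \<omega> = "zero_extension w" and x = "[0]", OF G kG]
    have Y: "finite (Y j)" "card (Y j) \<le> card \<Gamma> ^ j" for j
    proof -
      note f = fib[of "map q [0..<j]"]
      show "finite (Y j)" unfolding Y_def using f by blast
      have "card (Y j) \<le> card {ys. map length ys = map q [0..<j] \<and> zero_extension w \<in> cylinder (glue \<kappa> [0] ys)}"
        unfolding Y_def using f by (intro card_mono) auto
      also have "\<dots> \<le> card \<Gamma> ^ j" using f by simp
      finally show "card (Y j) \<le> card \<Gamma> ^ j" .
    qed
    define E where "E ys = {u\<in>space P. map u [0..<length ys] = ys}" for ys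
    have E: "E ys \<in> sets P" for ys
      using measurable_sets[OF blocks[of "length ys"], of "{ys}"] by (simp add: E_def vimage_def Int_def conj_commute)
    have sub: "F u \<in> cylinder w \<Longrightarrow> u \<in> (\<Union>j<length w. \<Union>ys\<in>Y j. E ys)" if u: "\<forall>j. u j \<in> W j" "u \<in> space P" for u
    proof -
      assume Fw: "F u \<in> cylinder w"
      define J where "J = {j. length (X u j) \<le> length w}"
      have Jsub: "J \<subseteq> {..<length w}" unfolding J_def using len[OF u(1)] by (auto dest: order_trans intro: Suc_le_lessD order_trans)
      have J: "finite J" using Jsub by (rule finite_subset) simp
      have "0 \<in> J" using w by (cases w) (auto simp: J_def X_def)
      hence ne: "J \<noteq> {}" by blast
      define j where "j = Max J"
      have j: "length (X u j) \<le> length w" "j < length w" using Max_in[OF J ne] Jsub by (auto simp: j_def J_def)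
      have Sj: "length w \<le> length (X u (Suc j))"
      proof (rule ccontr)
        assume "\<not> ?thesis"
        hence "Suc j \<in> J" by (simp add: J_def)
        from Max_ge[OF J this] show False by (simp add: j_def)
      qed
      obtain v' where v': "w = X u j @ v'" using cylinder_prefix[OF Fcyl[OF u(1)] Fw j(1)] by blast
      obtain z where z: "X u (Suc j) = w @ z" using cylinder_prefix[OF Fw Fcyl[OF u(1)] Sj] by blast
      have "\<kappa> (X u j) (u j) @ u j = v' @ z" using z unfolding XS v' by simp
      from Q[OF kG _ this, of j "X u j"] u(1) have "\<phi> s (X u j) * exp (- Q j) \<le> \<phi> s w" by (simp add: v')
      hence 1: "\<phi> s (X u j) \<le> exp (Q j) * \<phi> s w" by (simp add: exp_minus field_simps)
      have 2: "zero_extension w \<in> cylinder (X u j)"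
        using zero_extension_cylinder[of w] unfolding v' cylinder_append by simp
      have "map u [0..<j] \<in> Y j" using 1 2 u(1) W(3) by (simp add: Y_def X_def)
      moreover have "u \<in> E (map u [0..<j])" using u(2) by (simp add: E_def)
      ultimately show ?thesis using j(2) by blast
    qed
    have "emeasure P {u\<in>space P. F u \<in> cylinder w} \<le> emeasure P (\<Union>j<length w. \<Union>ys\<in>Y j. E ys)"
    proof (rule emeasure_mono_AE)
      show "AE u in P. u \<in> {u\<in>space P. F u \<in> cylinder w} \<longrightarrow> u \<in> (\<Union>j<length w. \<Union>ys\<in>Y j. E ys)"
        using aeW by eventually_elim (use sub in blast)
      show "(\<Union>j<length w. \<Union>ys\<in>Y j. E ys) \<in> sets P" using Y(1) E by (intro sets.finite_UN) auto
    qed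
    also have "\<dots> \<le> (\<Sum>j<length w. emeasure P (\<Union>ys\<in>Y j. E ys))"
      using Y(1) E by (intro emeasure_subadditive_finite) (auto intro!: sets.finite_UN)
    also have "\<dots> \<le> (\<Sum>j<length w. ennreal (exp (Q j) * \<phi> s w / \<phi> s [0]))"
    proof (rule sum_mono)
      fix j
      have pos: "0 < \<phi> s w" "0 < \<phi> s [0]" using word_svf_pos[OF s] by auto
      have "emeasure P (\<Union>ys\<in>Y j. E ys) \<le> (\<Sum>ys\<in>Y j. emeasure P (E ys))"
        using Y(1) E by (intro emeasure_subadditive_finite) auto
      also have "\<dots> \<le> (\<Sum>ys\<in>Y j. ennreal (exp (Q j) * \<phi> s w / (\<phi> s [0] * real (card \<Gamma>) ^ j)))"
      proof (rule sum_mono)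
        fix ys assume ys: "ys \<in> Y j"
        hence "map length ys = map q [0..<j]" by (simp add: Y_def)
        from arg_cong[where f = length, OF this] have l: "length ys = j" by simp
        have "emeasure P (E ys) \<le> ennreal (\<phi> s (glue \<kappa> [0] ys) / (\<phi> s [0] * real (card \<Gamma>) ^ j))"
          unfolding E_def l using ys by (intro block_prob l) (auto simp: Y_def)
        also have "\<dots> \<le> ennreal (exp (Q j) * \<phi> s w / (\<phi> s [0] * real (card \<Gamma>) ^ j))"
          using ys pos by (intro ennreal_leI divide_right_mono) (auto simp: Y_def)
        finally show "emeasure P (E ys) \<le> ennreal (exp (Q j) * \<phi> s w / (\<phi> s [0] * real (card \<Gamma>) ^ j))" .
      qed
      also have "\<dots> = ennreal (real (card (Y j)) * (exp (Q j) * \<phi> s w / (\<phi> s [0] * real (card \<Gamma>) ^ j)))"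
        by (simp add: ennreal_of_nat_eq_real_of_nat flip: ennreal_mult')
      also have "\<dots> \<le> ennreal (real (card \<Gamma>) ^ j * (exp (Q j) * \<phi> s w / (\<phi> s [0] * real (card \<Gamma>) ^ j)))"
      proof (intro ennreal_leI mult_right_mono)
        show "real (card (Y j)) \<le> real (card \<Gamma>) ^ j" using Y(2)[of j] by (simp flip: of_nat_power)
      qed (use pos in auto)
      also have "real (card \<Gamma>) ^ j * (exp (Q j) * \<phi> s w / (\<phi> s [0] * real (card \<Gamma>) ^ j)) = exp (Q j) * \<phi> s w / \<phi> s [0]"
        using cG by simp
      finally show "emeasure P (\<Union>ys\<in>Y j. E ys) \<le> ennreal (exp (Q j) * \<phi> s w / \<phi> s [0])" .
    qed
    also have "\<dots> = ennreal (\<Sum>j<length w. exp (Q j) * \<phi> s w / \<phi> s [0])"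
      using word_svf_pos[OF s] by (intro sum_ennreal) (auto intro!: divide_nonneg_nonneg mult_nonneg_nonneg less_imp_le)
    finally show ?thesis by (simp add: sum_distrib_right sum_divide_distrib)
  qed
  with Om.prob_space_axioms F ae show ?thesis by blast
qed

text \<open>For every level \<open>n\<close> there are words of some length \<open>q0 n\<close> with averages in the neighbourhoods of level
  \<open>n\<close> and a large sum of \<open>\<phi>\<^sup>s\<close>. Blocks of level \<open>n\<close> are used so long before passing to the next level that
  the costs of an incomplete block are of size \<open>o(j)\<close>; they are absorbed by the exponential gain in passing
  from \<open>\<phi>\<^sup>s\<close> to \<open>\<phi>\<^sup>s\<^sup>1\<close>.\<close>
lemma frostman_measure:
  assumes s: "0 \<le> s1" "s1 < s" "s < s'" and lim: "ennreal s' < (INF n. level_limit n)"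
  shows "\<exists>(P :: (nat \<Rightarrow> nat list) measure) F K r. prob_space P \<and> F \<in> P \<rightarrow>\<^sub>M borel \<and>
    (AE u in P. F u \<in> level_set \<Phi> \<alpha>) \<and> 0 \<le> K \<and> 0 < r \<and> r < (1::real) \<and>
    (\<forall>w. emeasure P {u\<in>space P. F u \<in> cylinder w} \<le> ennreal (K * r ^ length w * \<phi> s1 w))"
proof -
  have s0: "0 \<le> s" using s by simp
  obtain c \<Gamma> \<kappa> where con: "connector s c \<Gamma> \<kappa>" using connector_exists[OF s0] by blast
  have c: "1 \<le> c" and G: "finite \<Gamma>" and kG: "\<And>u v. \<kappa> u v \<in> \<Gamma>" using con by (auto simp: connector_def)
  define K0 where "K0 = (\<Sum>g\<in>\<Gamma>. length g)"
  have K0: "length g \<le> K0" if "g \<in> \<Gamma>" for g unfolding K0_def using that G by (intro member_le_sum) auto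
  define good where "good n p \<longleftrightarrow> (1 \<le> n \<longrightarrow> (n \<le> fst p \<and> finite (snd p) \<and> (\<forall>v\<in>snd p. length v = fst p) \<and> c * real (card \<Gamma>) \<le> sum (\<phi> s) (snd p) \<and>
     (\<forall>v\<in>snd p. \<forall>\<omega>\<in>cylinder v. \<forall>i<n. birkhoff_average (fst p) (\<Phi> i) \<omega> \<in> target_nhd n (\<alpha> i))))" for n :: nat and p :: "nat \<times> nat list set"
  have "\<exists>p. good n p" for n
  proof (cases "1 \<le> n")
    case True
    have "ennreal s' < level_limit n" using lim by (rule less_le_trans) (rule INF_lower, simp)
    hence "\<forall>\<^sub>F k in sequentially. ennreal s' < dimension_sup T \<Phi> \<alpha> n k" using order_tendstoD(1)[OF level_limit[OF True]] by blast
    hence fr: "\<exists>\<^sub>F k in sequentially. ennreal s' < dimension_sup T \<Phi> \<alpha> n k" by (rule eventually_frequently[OF sequentially_bot])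
    obtain q0 where q0: "\<forall>q\<ge>q0. \<exists>W. finite W \<and> (\<forall>v\<in>W. length v = q) \<and> c * real (card \<Gamma>) \<le> sum (\<phi> s) W \<and>
     (\<forall>v\<in>W. \<forall>\<omega>\<in>cylinder v. \<forall>i<n. birkhoff_average q (\<Phi> i) \<omega> \<in> target_nhd n (\<alpha> i))"
      using eventually_dimension_sup_ge(2)[OF s0 s(3) fr, of "c * real (card \<Gamma>)"] by (elim exE)
    have "q0 \<le> max n q0" by simp
    from mp[OF spec[OF q0] this] obtain W where "finite W \<and> (\<forall>v\<in>W. length v = max n q0) \<and> c * real (card \<Gamma>) \<le> sum (\<phi> s) W \<and>
     (\<forall>v\<in>W. \<forall>\<omega>\<in>cylinder v. \<forall>i<n. birkhoff_average (max n q0) (\<Phi> i) \<omega> \<in> target_nhd n (\<alpha> i))" by (elim exE)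
    thus ?thesis by (intro exI[of _ "(max n q0, W)"]) (simp add: good_def)
  qed (simp add: good_def)
  hence "\<forall>n. \<exists>p. good n p" by blast
  from choice[OF this] obtain p where p: "\<forall>n. good n (p n)" by (elim exE)
  define q0 where "q0 n = fst (p n)" for n
  define W0 where "W0 n = snd (p n)" for n
  have W0: "n \<le> q0 n" "finite (W0 n)" "\<And>v. v \<in> W0 n \<Longrightarrow> length v = q0 n" "c * real (card \<Gamma>) \<le> sum (\<phi> s) (W0 n)"
    "\<And>v \<omega> i. v \<in> W0 n \<Longrightarrow> \<omega> \<in> cylinder v \<Longrightarrow> i < n \<Longrightarrow> birkhoff_average (q0 n) (\<Phi> i) \<omega> \<in> target_nhd n (\<alpha> i)"
    if "1 \<le> n" for n
    using mp[OF spec[OF p, unfolded good_def] that] by (auto simp: q0_def W0_def)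
  define cost where "cost n b \<longleftrightarrow> 0 \<le> b \<and> (1 \<le> n \<longrightarrow> (\<forall>g\<in>\<Gamma>. \<forall>v\<in>W0 n. real (length (g @ v)) \<le> b \<and>
      (\<forall>i<n. \<forall>\<tau>\<in>cylinder (g @ v). \<forall>l\<le>length (g @ v). \<bar>birkhoff_sum (\<Phi> i) l \<tau>\<bar> \<le> b) \<and>
      (\<forall>x v' z. g @ v = v' @ z \<longrightarrow> \<phi> s x * exp (- b) \<le> \<phi> s (x @ v'))))" for n b
  have "\<exists>b. cost n b" for n
  proof (cases "1 \<le> n")
    case True
    define A where "A = (\<Union>(set ` (\<Gamma> \<union> W0 n)))"
    have A: "finite A" using G W0(2)[OF True] by (auto simp: A_def)
    have gA: "set (g @ v) \<subseteq> A" if "g \<in> \<Gamma>" "v \<in> W0 n" for g v using that by (auto simp: A_def)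
    have "\<exists>E\<ge>0. \<forall>\<tau>. \<tau> 0 \<in> A \<longrightarrow> \<bar>\<Phi> i \<tau>\<bar> \<le> E" for i
    proof -
      obtain V where V: "\<And>l \<omega> \<tau>. (\<And>j. j < l \<Longrightarrow> \<omega> j = \<tau> j) \<Longrightarrow> \<bar>birkhoff_sum (\<Phi> i) l \<omega> - birkhoff_sum (\<Phi> i) l \<tau>\<bar> \<le> V"
        using summable_variations_distortion[OF var[of i]] by blast
      show ?thesis by (rule letters_bound[OF V A])
    qed
    hence "\<forall>i. \<exists>E\<ge>0. \<forall>\<tau>. \<tau> 0 \<in> A \<longrightarrow> \<bar>\<Phi> i \<tau>\<bar> \<le> E" by blast
    from choice[OF this] obtain E where E: "\<forall>i. 0 \<le> E i \<and> (\<forall>\<tau>. \<tau> 0 \<in> A \<longrightarrow> \<bar>\<Phi> i \<tau>\<bar> \<le> E i)" by (elim exE)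
    obtain e where e: "0 < e" "e \<le> 1" "\<And>u v. set v \<subseteq> A \<Longrightarrow> \<phi> s u * e ^ length v \<le> \<phi> s (u @ v)"
      using word_svf_append_ge[OF A s0] by blast
    let ?L = "real (K0 + q0 n)"
    \<comment> \<open>One bound for the length of a block, for the partial Birkhoff sums and for the loss in truncating the block.\<close>
    define b where "b = ?L * (1 + (\<Sum>i<n. E i) + - ln e)"
    have ln: "0 \<le> - ln e" using e by simp
    have Es: "0 \<le> (\<Sum>i<n. E i)" using E by (simp add: sum_nonneg)
    have b0: "0 \<le> b" unfolding b_def using ln Es by (intro mult_nonneg_nonneg) auto
    have bb: "?L * y \<le> b" if "y \<le> 1 + (\<Sum>i<n. E i) + - ln e" for y
      unfolding b_def using that by (intro mult_left_mono) auto
    have lenL: "real (length (g @ v)) \<le> ?L" if "g \<in> \<Gamma>" "v \<in> W0 n" for g v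
      using K0[OF that(1)] W0(3)[OF True that(2)] by simp
    show ?thesis
      unfolding cost_def
    proof (intro exI[of _ b] conjI b0 impI ballI allI)
      fix g v assume gv: "g \<in> \<Gamma>" "v \<in> W0 n"
      show "real (length (g @ v)) \<le> b" using lenL[OF gv] bb[of 1] ln Es by simp
      show "\<bar>birkhoff_sum (\<Phi> i) l \<tau>\<bar> \<le> b" if i: "i < n" "\<tau> \<in> cylinder (g @ v)" "l \<le> length (g @ v)" for i \<tau> l
      proof -
        have "\<tau> j \<in> A" if "j < l" for j
        proof -
          have j: "j < length (g @ v)" using that i(3) by simp
          have "\<tau> j = (g @ v) ! j" using i(2) j by (simp add: cylinder_iff)
          hence "\<tau> j \<in> set (g @ v)" using nth_mem[OF j] by simp
          thus ?thesis using gA[OF gv] by blast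
        qed
        hence "\<bar>birkhoff_sum (\<Phi> i) l \<tau>\<bar> \<le> real l * E i"
          using E by (intro birkhoff_sum_letters_bound[where A = A]) auto
        also have "\<dots> \<le> ?L * E i" using i(3) lenL[OF gv] E by (intro mult_right_mono) auto
        also have "\<dots> \<le> b"
        proof (rule bb)
          have "E i \<le> (\<Sum>i<n. E i)" using i(1) E by (intro member_le_sum) auto
          thus "E i \<le> 1 + (\<Sum>i<n. E i) + - ln e" using ln by linarith
        qed
        finally show ?thesis .
      qed
      show "\<phi> s x * exp (- b) \<le> \<phi> s (x @ v')" if v': "g @ v = v' @ z" for x v' z
      proof -
        have l: "real (length v') \<le> ?L" using lenL[OF gv] unfolding v' by simp
        have sA: "set v' \<subseteq> A" using gA[OF gv] unfolding v' by simp
        have "exp (- b) \<le> exp (real (length v') * ln e)"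
        proof -
          have "real (length v') * - ln e \<le> ?L * - ln e" using l ln by (intro mult_right_mono) auto
          also have "\<dots> \<le> b" by (rule bb) (use Es in linarith)
          finally show ?thesis by simp
        qed
        also have "\<dots> = e ^ length v'" using e(1) by (simp add: exp_of_nat_mult)
        finally have "\<phi> s x * exp (- b) \<le> \<phi> s x * e ^ length v'"
          using word_svf_pos[OF s0, of x] by (intro mult_left_mono) auto
        also have "\<dots> \<le> \<phi> s (x @ v')" by (rule e(3)[OF sA])
        finally show ?thesis .
      qed
    qed
  qed (auto simp: cost_def)
  hence "\<forall>n. \<exists>b. cost n b" by blast
  from choice[OF this] obtain b where "\<forall>n. cost n (b n)" by (elim exE)
  note b = this[unfolded cost_def]
  have b0: "0 \<le> b n" for n using b by simp
  have b1: "\<bar>birkhoff_sum (\<Phi> i) l \<tau>\<bar> \<le> b n \<and> real (length (g @ v)) \<le> b n"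
    if "1 \<le> n" "i < n" "v \<in> W0 n" "g \<in> \<Gamma>" "\<tau> \<in> cylinder (g @ v)" "l \<le> length (g @ v)" for n i v g \<tau> l
    using mp[OF conjunct2[OF spec[OF b]] that(1)] that by blast
  have b2: "\<phi> s x * exp (- b n) \<le> \<phi> s (x @ v')" if "1 \<le> n" "g \<in> \<Gamma>" "v \<in> W0 n" "g @ v = v' @ z" for n g v v' z x
    using mp[OF conjunct2[OF spec[OF b]] that(1)] that by blast
  obtain N where N: "\<And>j. 1 \<le> N j" "filterlim N at_top sequentially" "(\<lambda>j. b (N j) / real (Suc j)) \<longlonglongrightarrow> 0"
    using slow_schedule[of b] by blast
  have Wne: "W0 (N j) \<noteq> {}" for j
  proof
    assume "W0 (N j) = {}"
    with W0(4)[OF N(1)[of j]] have "c * real (card \<Gamma>) \<le> 0" by simp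
    moreover have "0 < card \<Gamma>" using kG G by (auto simp: card_gt_0_iff)
    ultimately show False using c by (simp add: mult_le_0_iff)
  qed
  have q1: "1 \<le> q0 (N j)" for j using N(1)[of j] W0(1)[OF N(1)[of j]] by simp
  have "\<exists>(P :: (nat \<Rightarrow> nat list) measure) F. prob_space P \<and> F \<in> P \<rightarrow>\<^sub>M borel \<and>
    (AE u in P. \<forall>j. u j \<in> W0 (N j) \<and> F u \<in> cylinder (glue \<kappa> [0] (map u [0..<j]))) \<and>
    (\<forall>w. w \<noteq> [] \<longrightarrow> emeasure P {u\<in>space P. F u \<in> cylinder w} \<le> ennreal ((\<Sum>j<length w. exp (b (N j))) * \<phi> s w / \<phi> s [0]))"
  proof (rule glued_measure[OF con s0, where q = "\<lambda>j. q0 (N j)"])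
    show "\<phi> s x * exp (- b (N j)) \<le> \<phi> s (x @ v')" if "g \<in> \<Gamma>" "v \<in> W0 (N j)" "g @ v = v' @ z" for j x g v v' z
      by (rule b2[OF N(1) that])
  qed (fact W0(2)[OF N(1)] Wne W0(3)[OF N(1)] q1 W0(4)[OF N(1)])+
  then obtain P :: "(nat \<Rightarrow> nat list) measure" and F where P: "prob_space P" and F: "F \<in> P \<rightarrow>\<^sub>M borel"
    and ae: "AE u in P. \<forall>j. u j \<in> W0 (N j) \<and> F u \<in> cylinder (glue \<kappa> [0] (map u [0..<j]))"
    and cyl0: "\<forall>w. w \<noteq> [] \<longrightarrow> emeasure P {u\<in>space P. F u \<in> cylinder w} \<le> ennreal ((\<Sum>j<length w. exp (b (N j))) * \<phi> s w / \<phi> s [0])"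
    by (elim exE conjE)
  note cyl = mp[OF spec[OF cyl0]]
  have lev: "AE u in P. F u \<in> level_set \<Phi> \<alpha>"
    using ae
  proof eventually_elim
    case (elim u)
    show ?case
      by (rule glued_level_set[OF kG G W0(3) W0(1) W0(5) b1 N, where u = u]) (use elim in auto)
  qed
  \<comment> \<open>Of the gain \<open>exp (- 2 * \<eta>)\<close> per letter, one half pays for the costs \<open>b (N j)\<close>, a quarter for the number of summands, and \<open>r\<close> remains.\<close>
  define \<eta> where "\<eta> = (s - s1) * ln 2 / 2"
  have eta: "0 < \<eta>" using s by (simp add: \<eta>_def)
  have "\<forall>\<^sub>F j in sequentially. b (N j) / real (Suc j) < \<eta>" by (rule order_tendstoD(2)[OF N(3) eta])
  then obtain j0 where j0: "\<And>j. j0 \<le> j \<Longrightarrow> b (N j) / real (Suc j) < \<eta>" by (auto simp: eventually_sequentially)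
  define D where "D = (\<Sum>j<j0. b (N j))"
  have D: "b (N j) \<le> D + \<eta> * real (Suc j)" for j
  proof (cases "j < j0")
    case True
    hence "b (N j) \<le> D" unfolding D_def using b0 by (intro member_le_sum) auto
    moreover have "0 \<le> \<eta> * real (Suc j)" using eta by (intro mult_nonneg_nonneg) auto
    ultimately show ?thesis by linarith
  next
    case False
    hence "b (N j) < \<eta> * real (Suc j)" using j0[of j] by (simp add: pos_divide_less_eq)
    moreover have "0 \<le> D" unfolding D_def using b0 by (intro sum_nonneg) auto
    ultimately show ?thesis by linarith
  qed
  define r where "r = exp (- (\<eta> / 2))"
  define K where "K = 1 + exp D * (2 / \<eta>) / \<phi> s [0]"
  have K1: "0 \<le> exp D * (2 / \<eta>) / \<phi> s [0]" using eta word_svf_pos[OF s0, of "[0]"] by (intro divide_nonneg_nonneg mult_nonneg_nonneg) auto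
  have bound: "emeasure P {u\<in>space P. F u \<in> cylinder w} \<le> ennreal (K * r ^ length w * \<phi> s1 w)" for w
  proof (cases "w = []")
    case True
    have "emeasure P {u\<in>space P. F u \<in> cylinder w} \<le> 1" by (rule prob_space.emeasure_le_1[OF P])
    also have "1 \<le> ennreal (K * r ^ length w * \<phi> s1 w)"
    proof -
      have "1 \<le> K" using K1 by (simp add: K_def)
      thus ?thesis using word_svf_Nil[OF s(1)] by (simp add: True ennreal_leI flip: ennreal_1)
    qed
    finally show ?thesis .
  next
    case False
    define m where "m = length w"
    have pos: "0 < \<phi> s w" "0 < \<phi> s [0]" "0 < \<phi> s1 w" using word_svf_pos s0 s(1) by auto
    have "(\<Sum>j<m. exp (b (N j))) \<le> (\<Sum>j<m. exp (D + \<eta> * real m))"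
    proof (rule sum_mono)
      fix j assume "j \<in> {..<m}"
      hence "real (Suc j) \<le> real m" by simp
      hence "\<eta> * real (Suc j) \<le> \<eta> * real m" using eta by (intro mult_left_mono) auto
      thus "exp (b (N j)) \<le> exp (D + \<eta> * real m)" using D[of j] by simp
    qed
    also have "\<dots> = exp D * (real m * exp (\<eta> * real m))" by (simp add: exp_add)
    finally have S: "(\<Sum>j<m. exp (b (N j))) \<le> exp D * (real m * exp (\<eta> * real m))" .
    have "\<phi> s w \<le> \<phi> s1 w * (1/2) powr ((s - s1) * real m)"
      using word_svf_add_le[of s1 "s - s1" w] s by (simp add: m_def)
    also have "(1/2::real) powr ((s - s1) * real m) = exp (- 2 * (\<eta> * real m))"
      by (simp add: powr_def \<eta>_def ln_div)
    finally have w: "\<phi> s w \<le> \<phi> s1 w * exp (- 2 * (\<eta> * real m))" .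
    have "(\<Sum>j<m. exp (b (N j))) * \<phi> s w \<le> (exp D * (real m * exp (\<eta> * real m))) * (\<phi> s1 w * exp (- 2 * (\<eta> * real m)))"
      by (rule mult_mono[OF S w]) (use pos in auto)
    also have "\<dots> = exp D * real m * \<phi> s1 w * (exp (\<eta> * real m) * exp (- 2 * (\<eta> * real m)))" by (simp only: mult_ac)
    also have "exp (\<eta> * real m) * exp (- 2 * (\<eta> * real m)) = exp (- (\<eta> / 2 * real m)) * exp (- (\<eta> / 2 * real m))"
      by (simp flip: exp_add)
    also have "exp D * real m * \<phi> s1 w * (exp (- (\<eta> / 2 * real m)) * exp (- (\<eta> / 2 * real m)))
        = exp D * \<phi> s1 w * exp (- (\<eta> / 2 * real m)) * (real m * exp (- (\<eta> / 2 * real m)))" by (simp only: mult_ac)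
    also have "\<dots> \<le> exp D * \<phi> s1 w * exp (- (\<eta> / 2 * real m)) * (2 / \<eta>)"
    proof (rule mult_left_mono)
      have "\<eta> / 2 * real m \<le> exp (\<eta> / 2 * real m)" using exp_ge_add_one_self[of "\<eta> / 2 * real m"] by linarith
      thus "real m * exp (- (\<eta> / 2 * real m)) \<le> 2 / \<eta>" using eta by (simp add: exp_minus field_simps)
    qed (use pos in auto)
    also have "exp (- (\<eta> / 2 * real m)) = r ^ m" by (simp add: r_def mult.commute flip: exp_of_nat_mult)
    finally have "(\<Sum>j<m. exp (b (N j))) * \<phi> s w / \<phi> s [0] \<le> exp D * \<phi> s1 w * r ^ m * (2 / \<eta>) / \<phi> s [0]"
      using pos by (intro divide_right_mono) auto
    also have "\<dots> = (exp D * (2 / \<eta>) / \<phi> s [0]) * (r ^ m * \<phi> s1 w)" by (simp add: mult_ac)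
    also have "\<dots> \<le> K * (r ^ m * \<phi> s1 w)" using pos by (intro mult_right_mono) (auto simp: K_def r_def)
    finally have "(\<Sum>j<m. exp (b (N j))) * \<phi> s w / \<phi> s [0] \<le> K * r ^ m * \<phi> s1 w" by (simp only: mult.assoc)
    with cyl[OF False] show ?thesis unfolding m_def by (meson ennreal_leI order_trans)
  qed
  have "0 \<le> K" "0 < r" "r < 1" using K1 eta by (auto simp: K_def r_def)
  with P F lev bound show ?thesis by (intro exI[of _ P] exI[of _ F] exI[of _ K] exI[of _ r]) simp
qed

end

section \<open>The lower bound\<close>

context affine_family
begin

text \<open>The \<open>j\<close>-th term of the projection depends on the word only through its first \<open>j + 1\<close> letters, hence
  through countably many cases.\<close>
lemma projection_measurable_pair:
  assumes F [measurable]: "F \<in> P \<rightarrow>\<^sub>M borel"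
  shows "(\<lambda>p. projection T (fst p) (F (snd p))) \<in> borel_measurable (translation_measure \<Otimes>\<^sub>M P)"
proof -
  have "(\<lambda>p. M (prefix_word (F (snd p)) j) *v fst p (F (snd p) j)) \<in> borel_measurable (translation_measure \<Otimes>\<^sub>M P)" for j
  proof -
    let ?g = "\<lambda>w p. M (butlast w) *v fst p (last w)"
    have w: "(\<lambda>p. prefix_word (F (snd p)) (Suc j)) \<in> translation_measure \<Otimes>\<^sub>M P \<rightarrow>\<^sub>M count_space UNIV" by measurable
    have "?g w \<in> borel_measurable (translation_measure \<Otimes>\<^sub>M P)" for w by measurable
    hence "(\<lambda>p. ?g (prefix_word (F (snd p)) (Suc j)) p) \<in> borel_measurable (translation_measure \<Otimes>\<^sub>M P)"
      by (rule measurable_compose_countable[OF _ w])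
    thus ?thesis by (simp add: prefix_word_def)
  qed
  thus ?thesis unfolding projection_def by measurable
qed

text \<open>For fixed \<open>\<omega>\<close>, split the second point according to the length \<open>m\<close> of its common prefix with \<open>\<omega>\<close>.
  Transversality contributes \<open>1 / \<phi>\<^sup>s(\<omega>|m)\<close>, the mass of the cylinder \<open>r\<^sup>m \<phi>\<^sup>s(\<omega>|m)\<close>; the product is
  summable over \<open>m\<close>.\<close>
lemma frostman_energy_finite:
  assumes P: "prob_space P" and F [measurable]: "F \<in> P \<rightarrow>\<^sub>M borel" and K: "0 \<le> K" and r: "0 < r" "r < 1"
    and cyl: "\<And>w. emeasure P {u\<in>space P. F u \<in> cylinder w} \<le> ennreal (K * r ^ length w * \<phi> s w)"
    and t: "0 < t" "t < s" "s \<le> real CARD('n)"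
  shows "AE a in translation_measure.
    (\<integral>\<^sup>+u. \<integral>\<^sup>+u'. riesz t (projection T a (F u) - projection T a (F u')) \<partial>P \<partial>P) < \<infinity>"
proof -
  let ?TM = "translation_measure :: (nat \<Rightarrow> real ^ 'n) measure"
  interpret P: prob_space P by fact
  interpret TM: prob_space ?TM by (rule prob_space_translation)
  interpret PP: pair_prob_space P P ..
  interpret TP: pair_sigma_finite ?TM "P \<Otimes>\<^sub>M P" ..
  have s: "0 \<le> s" using t by simp
  obtain C where C: "0 \<le> C" "\<And>\<omega> \<tau> m. (\<forall>i<m. \<omega> i = \<tau> i) \<Longrightarrow> \<omega> m \<noteq> \<tau> m \<Longrightarrow>
      (\<integral>\<^sup>+a. riesz t (projection T a \<omega> - projection T a \<tau>) \<partial>?TM) \<le> ennreal (C / \<phi> s (prefix_word \<omega> m))"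
    using transversality[OF t] by blast
  note pm = projection_measurable_pair[OF F]
  let ?h = "\<lambda>a p. riesz t (projection T a (F (fst p)) - projection T a (F (snd p)))"
  have h: "case_prod ?h \<in> borel_measurable (?TM \<Otimes>\<^sub>M (P \<Otimes>\<^sub>M P))"
  proof -
    have "(\<lambda>q. (fst q, fst (snd q))) \<in> ?TM \<Otimes>\<^sub>M (P \<Otimes>\<^sub>M P) \<rightarrow>\<^sub>M ?TM \<Otimes>\<^sub>M P" "(\<lambda>q. (fst q, snd (snd q))) \<in> ?TM \<Otimes>\<^sub>M (P \<Otimes>\<^sub>M P) \<rightarrow>\<^sub>M ?TM \<Otimes>\<^sub>M P" by measurable
    note m = this[THEN measurable_compose[OF _ pm]]
    have [measurable]: "(\<lambda>q. projection T (fst q) (F (fst (snd q)))) \<in> borel_measurable (?TM \<Otimes>\<^sub>M (P \<Otimes>\<^sub>M P))"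
      "(\<lambda>q. projection T (fst q) (F (snd (snd q)))) \<in> borel_measurable (?TM \<Otimes>\<^sub>M (P \<Otimes>\<^sub>M P))" using m by simp_all
    show ?thesis unfolding case_prod_beta by measurable
  qed
  have inner: "(\<integral>\<^sup>+u'. \<integral>\<^sup>+a. riesz t (projection T a \<omega> - projection T a (F u')) \<partial>?TM \<partial>P) \<le> ennreal (C * K / (1 - r))" for \<omega>
  proof -
    let ?E = "\<lambda>m. {u'\<in>space P. F u' \<in> cylinder (prefix_word \<omega> m)}"
    have E [measurable]: "?E m \<in> sets P" for m by measurable
    have null: "AE u' in P. \<exists>m. F u' \<notin> cylinder (prefix_word \<omega> m)"
    proof (rule AE_I)
      show "(\<Inter>m. ?E m) \<in> sets P" using E by (intro sets.countable_INT) auto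
      have "emeasure P (\<Inter>m. ?E m) \<le> ennreal (K * r ^ m)" for m
      proof -
        have "emeasure P (\<Inter>m. ?E m) \<le> emeasure P (?E m)" by (intro emeasure_mono E) auto
        also have "\<dots> \<le> ennreal (K * r ^ m * \<phi> s (prefix_word \<omega> m))" using cyl[of "prefix_word \<omega> m"] by simp
        also have "\<dots> \<le> ennreal (K * r ^ m * 1)" using K r s by (intro ennreal_leI mult_left_mono word_svf_le_1) auto
        finally show ?thesis by simp
      qed
      moreover have "(\<lambda>m. ennreal (K * r ^ m)) \<longlonglongrightarrow> ennreal (K * 0)"
        using r by (intro tendsto_ennrealI tendsto_mult tendsto_const LIMSEQ_realpow_zero) auto
      ultimately have "emeasure P (\<Inter>m. ?E m) \<le> ennreal (K * 0)" by (intro LIMSEQ_le_const) auto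
      thus "emeasure P (\<Inter>m. ?E m) = 0" by simp
    qed auto
    have "(\<integral>\<^sup>+u'. \<integral>\<^sup>+a. riesz t (projection T a \<omega> - projection T a (F u')) \<partial>?TM \<partial>P)
       \<le> (\<integral>\<^sup>+u'. (\<Sum>m. ennreal (C / \<phi> s (prefix_word \<omega> m)) * indicator (?E m) u') \<partial>P)"
    proof (rule nn_integral_mono_AE)
      show "AE u' in P. (\<integral>\<^sup>+a. riesz t (projection T a \<omega> - projection T a (F u')) \<partial>?TM) \<le> (\<Sum>m. ennreal (C / \<phi> s (prefix_word \<omega> m)) * indicator (?E m) u')"
        using null AE_space
      proof eventually_elim
        case (elim u')
        hence "\<exists>i. \<omega> i \<noteq> F u' i" unfolding cylinder_iff by (metis prefix_word_nth length_prefix_word)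
        define m where "m = (LEAST i. \<omega> i \<noteq> F u' i)"
        have m: "\<omega> m \<noteq> F u' m" unfolding m_def using \<open>\<exists>i. \<omega> i \<noteq> F u' i\<close> by (rule LeastI_ex)
        have pre: "\<forall>i<m. \<omega> i = F u' i" unfolding m_def using not_less_Least by blast
        have "u' \<in> ?E m" using elim(2) pre by (simp add: cylinder_iff)
        hence "ennreal (C / \<phi> s (prefix_word \<omega> m)) * indicator (?E m) u' = ennreal (C / \<phi> s (prefix_word \<omega> m))" by simp
        hence "ennreal (C / \<phi> s (prefix_word \<omega> m)) \<le> (\<Sum>m. ennreal (C / \<phi> s (prefix_word \<omega> m)) * indicator (?E m) u')"
          using term_le_suminf_ennreal[of "\<lambda>m. ennreal (C / \<phi> s (prefix_word \<omega> m)) * indicator (?E m) u'" m] by (simp only:)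
        thus ?case using C(2)[OF pre m] by (rule order_trans[rotated])
      qed
    qed
    also have "\<dots> = (\<Sum>m. ennreal (C / \<phi> s (prefix_word \<omega> m)) * emeasure P (?E m))"
      by (subst nn_integral_suminf) (auto simp: nn_integral_cmult_indicator)
    also have "\<dots> \<le> (\<Sum>m. ennreal (C * K * r ^ m))"
    proof (intro suminf_le summableI)
      fix m
      have pos: "0 < \<phi> s (prefix_word \<omega> m)" by (rule word_svf_pos[OF s])
      have "ennreal (C / \<phi> s (prefix_word \<omega> m)) * emeasure P (?E m) \<le> ennreal (C / \<phi> s (prefix_word \<omega> m)) * ennreal (K * r ^ m * \<phi> s (prefix_word \<omega> m))"
        using cyl[of "prefix_word \<omega> m"] by (intro mult_left_mono) auto
      also have "\<dots> = ennreal (C / \<phi> s (prefix_word \<omega> m) * (K * r ^ m * \<phi> s (prefix_word \<omega> m)))"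
        using C(1) pos by (intro ennreal_mult'[symmetric] divide_nonneg_nonneg) auto
      also have "C / \<phi> s (prefix_word \<omega> m) * (K * r ^ m * \<phi> s (prefix_word \<omega> m)) = C * K * r ^ m" using pos by simp
      finally show "ennreal (C / \<phi> s (prefix_word \<omega> m)) * emeasure P (?E m) \<le> ennreal (C * K * r ^ m)" .
    qed
    also have "\<dots> = ennreal (C * K / (1 - r))"
    proof (rule suminf_ennreal_eq)
      show "(\<lambda>m. C * K * r ^ m) sums (C * K / (1 - r))"
        using sums_mult[OF geometric_sums[of r], of "C * K"] r by simp
    qed (use C(1) K r in auto)
    finally show ?thesis .
  qed
  have "(\<integral>\<^sup>+a. (\<integral>\<^sup>+p. ?h a p \<partial>(P \<Otimes>\<^sub>M P)) \<partial>?TM) = (\<integral>\<^sup>+p. (\<integral>\<^sup>+a. ?h a p \<partial>?TM) \<partial>(P \<Otimes>\<^sub>M P))"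
    using TP.Fubini'[OF h] by simp
  also have "\<dots> = (\<integral>\<^sup>+u. \<integral>\<^sup>+u'. (\<integral>\<^sup>+a. riesz t (projection T a (F u) - projection T a (F u')) \<partial>?TM) \<partial>P \<partial>P)"
  proof -
    have "(\<lambda>p. \<integral>\<^sup>+a. ?h a p \<partial>?TM) \<in> borel_measurable (P \<Otimes>\<^sub>M P)"
    proof (rule TM.borel_measurable_nn_integral)
      have "(\<lambda>q. (snd q, fst q)) \<in> (P \<Otimes>\<^sub>M P) \<Otimes>\<^sub>M ?TM \<rightarrow>\<^sub>M ?TM \<Otimes>\<^sub>M (P \<Otimes>\<^sub>M P)" by measurable
      from measurable_compose[OF this h] show "(\<lambda>(p, a). ?h a p) \<in> borel_measurable ((P \<Otimes>\<^sub>M P) \<Otimes>\<^sub>M ?TM)" by (simp add: case_prod_beta)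
    qed
    from P.nn_integral_fst[OF this] show ?thesis by simp
  qed
  also have "\<dots> \<le> (\<integral>\<^sup>+u. ennreal (C * K / (1 - r)) \<partial>P)" by (intro nn_integral_mono inner)
  also have "\<dots> < \<infinity>" by (simp add: P.emeasure_space_1)
  finally have fin: "(\<integral>\<^sup>+a. (\<integral>\<^sup>+p. ?h a p \<partial>(P \<Otimes>\<^sub>M P)) \<partial>?TM) \<noteq> \<infinity>" by simp
  have "AE a in ?TM. (\<integral>\<^sup>+p. ?h a p \<partial>(P \<Otimes>\<^sub>M P)) \<noteq> \<infinity>"
  proof (rule nn_integral_PInf_AE[OF _ fin])
    show "(\<lambda>a. \<integral>\<^sup>+p. ?h a p \<partial>(P \<Otimes>\<^sub>M P)) \<in> borel_measurable ?TM"
      by (rule PP.borel_measurable_nn_integral[OF h])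
  qed
  thus ?thesis
    using AE_space
  proof eventually_elim
    case (elim a)
    have "?h a \<in> borel_measurable (P \<Otimes>\<^sub>M P)"
      using measurable_compose[OF measurable_Pair1'[OF elim(2)] h] by simp
    from P.nn_integral_fst[OF this] elim(1) show ?case by (simp add: less_top)
  qed
qed

end

context birkhoff_family
begin

lemma hausdorff_dim_projection_ge:
  assumes t: "0 < t" "t < s1" "s1 \<le> real CARD('n)" and s': "s1 < s'" "ennreal s' < (INF n. level_limit n)"
  shows "AE a in translation_measure. ennreal t \<le> hausdorff_dim (projected_level_set T \<Phi> \<alpha> a)"
proof -
  obtain s where s: "s1 < s" "s < s'" using dense[OF s'(1)] by blast
  have "0 \<le> s1" using t by simp
  from frostman_measure[OF this s s'(2)] obtain P :: "(nat \<Rightarrow> nat list) measure" and F K and r :: real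
    where P: "prob_space P" and F [measurable]: "F \<in> P \<rightarrow>\<^sub>M borel" and lev: "AE u in P. F u \<in> level_set \<Phi> \<alpha>"
    and K: "0 \<le> K" and r: "0 < r" "r < 1"
    and cyl: "\<forall>w. emeasure P {u\<in>space P. F u \<in> cylinder w} \<le> ennreal (K * r ^ length w * \<phi> s1 w)" by (elim exE conjE)
  have "AE a in translation_measure. (\<integral>\<^sup>+u. \<integral>\<^sup>+u'. riesz t (projection T a (F u) - projection T a (F u')) \<partial>P \<partial>P) < \<infinity>"
    by (rule frostman_energy_finite[OF P F K r spec[OF cyl] t])
  thus ?thesis
    using AE_space
  proof eventually_elim
    case (elim a)
    have m: "(\<lambda>u. projection T a (F u)) \<in> borel_measurable P"
      using measurable_compose[OF measurable_Pair1'[OF elim(2)] projection_measurable_pair[OF F]] by simp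
    have A: "AE u in P. projection T a (F u) \<in> projected_level_set T \<Phi> \<alpha> a"
      using lev by eventually_elim (simp add: projected_level_set_def)
    show ?case by (rule hausdorff_dim_ge_of_energy[OF P m t(1) elim(1) A])
  qed
qed

text \<open>The exceptional set of translations in the lower bound depends on \<open>t\<close>; rational \<open>t\<close> suffice.\<close>
lemma hausdorff_dim_projection_eq:
  "AE a in translation_measure. hausdorff_dim (projected_level_set T \<Phi> \<alpha> a) = min (of_nat CARD('n)) (INF n. level_limit n)"
proof -
  let ?m = "min (of_nat CARD('n)) (INF n. level_limit n) :: ennreal"
  have "AE a in translation_measure. 0 < r \<longrightarrow> ennreal (real_of_rat r) < ?m \<longrightarrow> ennreal (real_of_rat r) \<le> hausdorff_dim (projected_level_set T \<Phi> \<alpha> a)" for r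
  proof (cases "0 < r \<and> ennreal (real_of_rat r) < ?m")
    case True
    hence pos: "0 < real_of_rat r" and lt: "ennreal (real_of_rat r) < ?m" by simp_all
    obtain y where y: "ennreal (real_of_rat r) < y" "y < ?m" using dense[OF lt] by blast
    obtain z where z: "y < z" "z < ?m" using dense[OF y(2)] by blast
    have "y < top" "z < top" using y(2) z(2) by (auto dest: less_le_trans[OF _ top_greatest])
    then obtain y' z' where yz: "y = ennreal y'" "0 \<le> y'" "z = ennreal z'" "0 \<le> z'"
      by (metis ennreal_cases order_less_irrefl)
    have 1: "real_of_rat r < y'" using y(1) pos by (simp add: yz ennreal_less_iff)
    have "ennreal y' < ennreal (real CARD('n))" using y(2) by (simp add: yz ennreal_of_nat_eq_real_of_nat)
    hence 2: "y' \<le> real CARD('n)" using yz by (simp add: ennreal_less_iff)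
    have 3: "y' < z'" using z(1) yz by (simp add: ennreal_less_iff)
    have 4: "ennreal z' < (INF n. level_limit n)" using z(2) yz by simp
    have "AE a in translation_measure. ennreal (real_of_rat r) \<le> hausdorff_dim (projected_level_set T \<Phi> \<alpha> a)"
      by (rule hausdorff_dim_projection_ge[OF pos 1 2 3 4])
    thus ?thesis by eventually_elim simp
  qed auto
  hence "AE a in translation_measure. \<forall>r. 0 < r \<longrightarrow> ennreal (real_of_rat r) < ?m \<longrightarrow> ennreal (real_of_rat r) \<le> hausdorff_dim (projected_level_set T \<Phi> \<alpha> a)"
    by (simp only: AE_all_countable) blast
  thus ?thesis
    using AE_space
  proof eventually_elim
    case (elim a)
    let ?d = "hausdorff_dim (projected_level_set T \<Phi> \<alpha> a)"
    have "?m \<le> ?d"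
    proof (rule ccontr)
      assume "\<not> ?m \<le> ?d"
      hence "?d < ?m" by (simp only: not_le)
      then obtain y where y: "?d < y" "y < ?m" using dense by blast
      obtain z where z: "y < z" "z < ?m" using dense[OF y(2)] by blast
      have "y < top" "z < top" using y(2) z(2) by (auto dest: less_le_trans[OF _ top_greatest])
      then obtain y' z' where yz: "y = ennreal y'" "0 \<le> y'" "z = ennreal z'" "0 \<le> z'"
        by (metis ennreal_cases order_less_irrefl)
      have "y' < z'" using z(1) yz by (simp add: ennreal_less_iff)
      then obtain r where r: "y' < real_of_rat r" "real_of_rat r < z'" using of_rat_dense by blast
      have "0 < real_of_rat r" using r yz by linarith
      hence "0 < r" by simp
      moreover have "ennreal (real_of_rat r) < ?m" using r yz z(2) by (meson ennreal_leI less_imp_le order_le_less_trans)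
      ultimately have "ennreal (real_of_rat r) \<le> ?d" using elim(1) by blast
      moreover have "?d < ennreal (real_of_rat r)" using y(1) r(1) yz by (meson ennreal_leI less_imp_le order_less_le_trans)
      ultimately show False by simp
    qed
    moreover have "?d \<le> ?m" by (rule hausdorff_dim_projection_le[OF translation_bounded[OF elim(2)]])
    ultimately show ?case by (rule antisym[rotated])
  qed
qed

end

theorem theorem3:
  fixes T :: "nat \<Rightarrow> real ^ 'n ^ 'n"
    and \<Phi> :: "nat \<Rightarrow> (nat \<Rightarrow> nat) \<Rightarrow> real"
    and \<alpha> :: "nat \<Rightarrow> ereal"
  assumes "\<forall>i. invertible (T i)"
    and "(SUP i. ereal (onorm (\<lambda>v. T i *v v))) < ereal (1 / 2)"
    and "\<forall>s. 0 \<le> s \<and> s \<le> real CARD('n) \<longrightarrow> quasi_multiplicative (word_svf T s)"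
    and "\<forall>i. summable_variations (\<Phi> i)"
  shows "\<exists>l L. (\<forall>n\<ge>1. (\<lambda>k. dimension_sup T \<Phi> \<alpha> n k) \<longlonglongrightarrow> l n) \<and> l \<longlonglongrightarrow> L \<and>
           (AE a in translation_measure.
              hausdorff_dim (projected_level_set T \<Phi> \<alpha> a) = min (of_nat CARD('n)) L)"
proof -
  let ?S = "SUP i. ereal (onorm (\<lambda>v. T i *v v))"
  have "max 0 ?S < ereal (1 / 2)" using assms(2) by simp
  from ereal_dense2[OF this] obtain \<rho> where "max 0 ?S < ereal \<rho>" "ereal \<rho> < ereal (1 / 2)" by blast
  hence rho: "0 < \<rho>" "\<rho> < 1 / 2" "?S < ereal \<rho>" by simp_all
  have contr: "norm (T i *v x) \<le> \<rho> * norm x" for i x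
  proof -
    have "ereal (onorm (\<lambda>v. T i *v v)) \<le> ?S" by (rule SUP_upper) simp
    from le_less_trans[OF this rho(3)] have "onorm (\<lambda>v. T i *v v) \<le> \<rho>" by simp
    hence "onorm (\<lambda>v. T i *v v) * norm x \<le> \<rho> * norm x" by (rule mult_right_mono) simp
    moreover have "norm (T i *v x) \<le> onorm (\<lambda>v. T i *v v) * norm x"
      by (rule onorm[OF matrix_vector_mul_bounded_linear])
    ultimately show ?thesis by linarith
  qed
  interpret birkhoff_family T \<rho> \<Phi> \<alpha>
  proof
    show "0 < \<rho>" "\<rho> < 1 / 2" by (rule rho)+
  qed (use assms(1,3,4) contr in \<open>simp_all only: simp_thms\<close>)
  show ?thesis
    using level_limit level_limit_tendsto hausdorff_dim_projection_eq
    by (intro exI[of _ level_limit] exI[of _ "INF n. level_limit n"]) simp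
qed

end
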